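(* Let $(S,\Omega)$ be a relative Sierpiński carpet and let $u:S\to\mathbb R$ be a (normalized) carpet-harmonic function. Assume that $u$ attains a maximum or a minimum (over $S$) at a point $x_0\in S$. Then $u$ is constant.
   Context: Relative Sierpiński carpets. Let $\Omega\subset\mathbb C$ be a connected open set and $\{Q_i\}_{i\in\mathbb N}$ open Jordan regions compactly contained in $\Omega$, with pairwise disjoint closures, such that $S:=\Omega\setminus\bigcup_iQ_i$ has empty interior and is locally connected. Then $(S,\Omega)$ is a relative Sierpiński carpet with peripheral disks $Q_i$. Standing assumptions on every relative Sierpiński carpet: (i) $\mathcal H^2(S)=0$; (ii) there is $K_0\ge1$ such that for each $i$ there are concentric balls $B(x,r)\subset Q_i\subset B(x,R)$ with $R/r\le K_0$; (iii) there is $K_1>0$ such that $\mathcal H^2(B(x,r)\cap Q_i)\ge K_1r^2$ for all $i$, $x\in Q_i$, $0<r<\operatorname{diam}(Q_i)$. $\mathcal H^m$ is Hausdorff measure normalized to agree with Lebesgue measure. Notation. $\widehat{\mathbb R}=\mathbb R\cup\{\pm\infty\}$. $V\subset\subset\Omega$: $\overline V$ is compact and contained in $\Omega$. $I_V=\{i:Q_i\cap V\ne\emptyset\}$. $S^\circ$: points of $S$ on no $\partial Q_i$. A path is a continuous map from a bounded interval to $\mathbb C$ with a continuous extension to the closed interval (also its image); it is open if the interval is open; subpaths are restrictions to subintervals. For $g:S\to\widehat{\mathbb R}$: $M_{Q_i}(g)=\sup_{\partial Q_i}g$, $m_{Q_i}(g)=\inf_{\partial Q_i}g$, $\operatorname{osc}_{Q_i}(g)=M_{Q_i}(g)-m_{Q_i}(g)$.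 Moduli of a path family $\Gamma$ in $\Omega$. $\mathrm{mod}_2(\Gamma)=\inf\int\lambda^2d\mathcal H^2$ over Borel $\lambda\ge0$ with $\int_\gamma\lambda\,ds\ge1$ for all $\gamma\in\Gamma$ (with $\int_\gamma\lambda\,ds:=\infty$ if $\gamma$ is not locally rectifiable). Weak modulus $\mathrm{mod}_w(\Gamma)=\inf\sum_i\rho(Q_i)^2$ over non-negative sequences for which there is $\Gamma_0\subset\Gamma$ with $\mathrm{mod}_2(\Gamma_0)=0$ and $\sum_{i:Q_i\cap\gamma\ne\emptyset}\rho(Q_i)\ge1$ for $\gamma\in\Gamma\setminus\Gamma_0$. Strong modulus $\mathrm{mod}_s(\Gamma)$: the same infimum over sequences satisfying this inequality for all $\gamma\in\Gamma$ with $\mathcal H^1(\gamma\cap S)=0$. Sobolev spaces. $\{\rho(Q_i)\}$ is a weak (strong) upper gradient of $g:S\to\widehat{\mathbb R}$ if there is $\Gamma_0$ with $\mathrm{mod}_w(\Gamma_0)=0$ ($\mathrm{mod}_s(\Gamma_0)=0$) such that for all paths $\gamma\subset\Omega$, $\gamma\notin\Gamma_0$, and $x,y\in\gamma\cap S$: $g(x),g(y)\neq\pm\infty$ and $|g(x)-g(y)|\le\sum_{i:Q_i\cap\gamma\ne\emptyset}\rho(Q_i)$. $g\in\mathcal W^{1,2}_{\mathrm{loc}}(S)$ if $M_{Q_i}(g),m_{Q_i}(g)$ are finite for all $i$, $\sum_{i\in I_B}M_{Q_i}(g)^2\operatorname{diam}(Q_i)^2<\infty$ and $\sum_{i\in I_B}\operatorname{osc}_{Q_i}(g)^2<\infty$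 for every ball $B\subset\subset\Omega$, and $\{\operatorname{osc}_{Q_i}(g)\}$ is an upper gradient of $g$; $g\in\mathcal W^{1,2}(S)$ if moreover the sums over all $i\in\mathbb N$ are finite. There is a weak and a strong version; the statement holds for each, with one version fixed throughout. Dirichlet energy: $D_V(g)=\sum_{i\in I_V}\operatorname{osc}_{Q_i}(g)^2$. $u\in\mathcal W^{1,2}_{\mathrm{loc}}(S)$ is carpet-harmonic if $D_V(u)\le D_V(u+\zeta)$ for every open $V\subset\subset\Omega$ and $\zeta\in\mathcal W^{1,2}(S)$ with $\zeta|_{S\setminus V}\equiv0$. Normalized functions. For $g\in\mathcal W^{1,2}_{\mathrm{loc}}(S)$ let $\hat g(Q_i)=M_{Q_i}(g)$. Let $\mathcal G_{\hat g}$ be the family of non-constant paths $\gamma\subset\Omega$ with: $\mathcal H^1(\gamma\cap S)=0$; for every subpath $\gamma'$ of $\gamma$ and $Q_{i_1},Q_{i_2}$ meeting $\gamma'$, $|\hat g(Q_{i_1})-\hat g(Q_{i_2})|\le\sum_{i:Q_i\cap\gamma'\neq\emptyset}\operatorname{osc}_{Q_i}(g)$; $\sum_{i:Q_i\cap\gamma'\ne\emptyset}\operatorname{osc}_{Q_i}(g)<\infty$ for subpaths $\gamma'\subset\subset\Omega$; and, if $\sum_{i\in\mathbb N}\operatorname{osc}_{Q_i}(g)^2<\infty$, also $\sum_{i:Q_i\cap\gamma\ne\emptyset}\operatorname{osc}_{Q_i}(g)<\infty$. A point $x\in S$ is accessible by $\gamma_0$ if $x\in\gamma_0\cap S^\circ$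 (put $\gamma=\gamma_0$), or there is an open subpath $\gamma$ of $\gamma_0$ with $x\in\overline\gamma\setminus\gamma$ and $\gamma\cap Q_{i_0}=\emptyset$ whenever $x\in\partial Q_{i_0}$. The normalized version $\tilde g$ of $g$ is: $\tilde g(x)=\liminf_{Q_i\to x,\,Q_i\cap\gamma\ne\emptyset}\hat g(Q_i)$ if $x$ is accessible by a path $\gamma_0\in\mathcal G_{\hat g}$, where $\gamma=\gamma_0$ if $x\in\gamma_0\cap S^\circ$, and otherwise $\gamma$ is an open subpath of $\gamma_0$ with $x\in\overline\gamma\setminus\gamma$ and $\gamma\cap Q_{i_0}=\emptyset$ whenever $x\in\partial Q_{i_0}$ (the value is independent of $\gamma$); for non-accessible $x\in\partial Q_{i_0}$, $\tilde g(x)=\liminf\tilde g(y)$ as $y\to x$ through accessible $y\in\partial Q_{i_0}$; for all other $x$, $\tilde g(x)=\liminf\tilde g(y)$ as $y\to x$ through accessible $y$. A function is normalized if it equals the normalized version of some function in the Sobolev space. Standing convention: carpet-harmonic functions are normalized. *)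

theory Defs
  imports "HOL-Analysis.Analysis"
begin

subsection \<open>Hausdorff measure\<close>

text \<open>
  The weight of a covering set is the volume of an m-dimensional ball of the same diameter, so that
  the m-dimensional Hausdorff measure agrees with Lebesgue measure on m-dimensional space.
  This is meant for \<open>m > 0\<close>: for \<open>m = 0\<close> the empty set would get weight 1.
\<close>

definition hausdorff_weight :: "nat \<Rightarrow> 'a::metric_space set \<Rightarrow> ennreal" where
  "hausdorff_weight m E = ennreal (unit_ball_vol (real m) * (diameter E / 2) ^ m)"

definition hausdorff_content :: "nat \<Rightarrow> real \<Rightarrow> 'a::metric_space set \<Rightarrow> ennreal" where
  "hausdorff_content m \<delta> A =
     Inf {(\<Sum>j. hausdorff_weight m (E j)) | E :: nat \<Rightarrow> 'a set.
            A \<subseteq> (\<Union>j. E j) \<and> (\<forall>j. bounded (E j) \<and> diameter (E j) \<le> \<delta>)}"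

definition hausdorff :: "nat \<Rightarrow> 'a::metric_space set \<Rightarrow> ennreal" where
  "hausdorff m A = (SUP \<delta>\<in>{0<..}. hausdorff_content m \<delta> A)"

definition hausdorff_measure :: "nat \<Rightarrow> 'a::metric_space measure" where
  "hausdorff_measure m = measure_of UNIV (sets borel) (hausdorff m)"

text \<open>
  The Hausdorff measure is a metric outer measure, hence a measure on the Borel sets, and
  \<open>hausdorff_measure\<close> is not the null measure that \<open>measure_of\<close> returns in degenerate cases.
\<close>

lemma hausdorff_weight_empty: "0 < m \<Longrightarrow> hausdorff_weight m {} = 0"
  by (simp add: hausdorff_weight_def)

lemma hausdorff_content_le:
  assumes "A \<subseteq> (\<Union>j. E j)" "\<And>j. bounded (E j)" "\<And>j. diameter (E j) \<le> \<delta>"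
  shows "hausdorff_content m \<delta> A \<le> (\<Sum>j::nat. hausdorff_weight m (E j))"
  unfolding hausdorff_content_def using assms by (intro Inf_lower) auto

lemma hausdorff_content_greatest:
  assumes "\<And>E :: nat \<Rightarrow> 'a::metric_space set. \<lbrakk>A \<subseteq> (\<Union>j. E j); \<And>j. bounded (E j); \<And>j. diameter (E j) \<le> \<delta>\<rbrakk>
             \<Longrightarrow> c \<le> (\<Sum>j. hausdorff_weight m (E j))"
  shows "c \<le> hausdorff_content m \<delta> A"
  unfolding hausdorff_content_def using assms by (intro Inf_greatest) auto

lemma hausdorff_content_mono: "A \<subseteq> B \<Longrightarrow> hausdorff_content m \<delta> A \<le> hausdorff_content m \<delta> B"
  by (rule hausdorff_content_greatest, rule hausdorff_content_le) auto

lemma hausdorff_content_antimono: "\<delta> \<le> \<epsilon> \<Longrightarrow> hausdorff_content m \<epsilon> A \<le> hausdorff_content m \<delta> A"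
  by (rule hausdorff_content_greatest, rule hausdorff_content_le) (auto intro: order_trans)

lemma hausdorff_content_empty:
  assumes "0 < m" "0 < \<delta>"
  shows "hausdorff_content m \<delta> {} = 0"
  using hausdorff_content_le[of "{}" "\<lambda>_. {}" \<delta> m] assms
  by (simp add: hausdorff_weight_empty)

lemma hausdorff_content_subadditive:
  fixes A :: "nat \<Rightarrow> 'a::metric_space set"
  shows "hausdorff_content m \<delta> (\<Union>i. A i) \<le> (\<Sum>i. hausdorff_content m \<delta> (A i))"
proof (rule ennreal_le_epsilon)
  fix e :: real
  assume e: "0 < e" "(\<Sum>i. hausdorff_content m \<delta> (A i)) < top"
  then have *: "hausdorff_content m \<delta> (A n) < hausdorff_content m \<delta> (A n) + e * (1/2)^Suc n" for n
    by (auto simp add: less_top dest!: ennreal_suminf_lessD)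
  have "\<exists>E. A n \<subseteq> (\<Union>j. E j) \<and> (\<forall>j. bounded (E j) \<and> diameter (E j) \<le> \<delta>) \<and>
            (\<Sum>j::nat. hausdorff_weight m (E j)) < hausdorff_content m \<delta> (A n) + e * (1/2)^Suc n" for n
    using *[of n, unfolded hausdorff_content_def[of m \<delta> "A n"] Inf_less_iff]
    unfolding hausdorff_content_def[symmetric] by auto
  then obtain E where E: "\<And>n. A n \<subseteq> (\<Union>j. E n j)" "\<And>n j. bounded (E n j)"
      "\<And>n j. diameter (E n j) \<le> \<delta>"
      "\<And>n. (\<Sum>j. hausdorff_weight m (E n j)) < hausdorff_content m \<delta> (A n) + e * (1/2)^Suc n"
    by metis
  define C where "C = case_prod E \<circ> prod_decode"
  have cov: "(\<Union>i. A i) \<subseteq> (\<Union>k. C k)"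
  proof
    fix x assume "x \<in> (\<Union>i. A i)"
    then obtain i j where "x \<in> E i j" using E(1) by blast
    then have "x \<in> C (prod_encode (i, j))" by (simp add: C_def)
    then show "x \<in> (\<Union>k. C k)" by blast
  qed
  have "hausdorff_content m \<delta> (\<Union>i. A i) \<le> (\<Sum>k. hausdorff_weight m (C k))"
    using cov E(2,3) by (intro hausdorff_content_le) (auto simp: C_def split: prod.split)
  also have "\<dots> = (\<Sum>n. \<Sum>j. hausdorff_weight m (E n j))"
    using suminf_ennreal_2dimen[of "\<lambda>n. \<Sum>j. hausdorff_weight m (E n j)" "\<lambda>(n, j). hausdorff_weight m (E n j)"]
    by (simp add: C_def comp_def case_prod_unfold)
  also have "\<dots> \<le> (\<Sum>n. hausdorff_content m \<delta> (A n) + e * (1/2) ^ Suc n)"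
    by (intro suminf_le allI less_imp_le[OF E(4)]) auto
  also have "\<dots> = (\<Sum>n. hausdorff_content m \<delta> (A n)) + (\<Sum>n. ennreal e * ennreal ((1/2) ^ Suc n))"
    using \<open>0 < e\<close> by (subst suminf_add[symmetric])
      (auto simp del: ennreal_suminf_cmult simp add: ennreal_mult[symmetric])
  also have "\<dots> = (\<Sum>n. hausdorff_content m \<delta> (A n)) + e"
    unfolding ennreal_suminf_cmult
    by (subst suminf_ennreal_eq[OF zero_le_power power_half_series]) auto
  finally show "hausdorff_content m \<delta> (\<Union>i. A i) \<le> (\<Sum>i. hausdorff_content m \<delta> (A i)) + e" .
qed

lemma hausdorff_empty: "0 < m \<Longrightarrow> hausdorff m {} = 0"
  unfolding hausdorff_def by (auto simp: hausdorff_content_empty intro!: SUP_eq_const exI[of _ 1])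

lemma hausdorff_mono: "A \<subseteq> B \<Longrightarrow> hausdorff m A \<le> hausdorff m B"
  unfolding hausdorff_def by (intro SUP_mono' hausdorff_content_mono)

lemma hausdorff_content_le_hausdorff: "0 < \<delta> \<Longrightarrow> hausdorff_content m \<delta> A \<le> hausdorff m A"
  unfolding hausdorff_def by (intro SUP_upper) auto

lemma hausdorff_subadditive: "hausdorff m (\<Union>i. A i) \<le> (\<Sum>i::nat. hausdorff m (A i))"
  unfolding hausdorff_def[of m "\<Union>i. A i"]
proof (rule SUP_least)
  fix \<delta> :: real assume "\<delta> \<in> {0<..}"
  then have "(\<Sum>i. hausdorff_content m \<delta> (A i)) \<le> (\<Sum>i. hausdorff m (A i))"
    by (intro suminf_le allI hausdorff_content_le_hausdorff) auto
  with hausdorff_content_subadditive[of m \<delta> A]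
  show "hausdorff_content m \<delta> (\<Union>i. A i) \<le> (\<Sum>i. hausdorff m (A i))" by (rule order_trans)
qed

lemma outer_measure_space_hausdorff: "0 < m \<Longrightarrow> outer_measure_space (Pow UNIV) (hausdorff m)"
  unfolding outer_measure_space_def positive_def increasing_def countably_subadditive_def
  by (auto simp: hausdorff_empty hausdorff_mono hausdorff_subadditive)

lemma hausdorff_Un_le:
  assumes "0 < m"
  shows "hausdorff m (A \<union> B) \<le> hausdorff m A + hausdorff m B"
proof -
  have "hausdorff m (\<Union>i. binaryset A B i) \<le> (\<Sum>i. hausdorff m (binaryset A B i))"
    by (rule hausdorff_subadditive)
  also have "\<dots> = hausdorff m A + hausdorff m B"
    using assms by (intro suminf_binaryset_eq) (simp add: hausdorff_empty)
  finally show ?thesis by (simp add: UN_binaryset_eq)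
qed

lemma hausdorff_content_separated:
  fixes A B :: "'a::metric_space set"
  assumes "0 < m" "0 < \<delta>" "\<delta> < d" and sep: "\<And>a b. a \<in> A \<Longrightarrow> b \<in> B \<Longrightarrow> d \<le> dist a b"
  shows "hausdorff_content m \<delta> A + hausdorff_content m \<delta> B \<le> hausdorff_content m \<delta> (A \<union> B)"
proof (rule hausdorff_content_greatest)
  fix E :: "nat \<Rightarrow> 'a set"
  assume E: "A \<union> B \<subseteq> (\<Union>j. E j)" "\<And>j. bounded (E j)" "\<And>j. diameter (E j) \<le> \<delta>"
  define EA where "EA j = (if E j \<inter> A = {} then {} else E j)" for j
  define EB where "EB j = (if E j \<inter> B = {} then {} else E j)" for j
  have "E j \<inter> A = {} \<or> E j \<inter> B = {}" for j
  proof (rule ccontr)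
    assume "\<not> ?thesis"
    then obtain a b where "a \<in> E j" "b \<in> E j" "a \<in> A" "b \<in> B" by blast
    then have "d \<le> dist a b" "dist a b \<le> diameter (E j)"
      using sep diameter_bounded_bound[OF E(2)] by auto
    then show False using E(3)[of j] \<open>\<delta> < d\<close> by linarith
  qed
  then have w: "hausdorff_weight m (EA j) + hausdorff_weight m (EB j) \<le> hausdorff_weight m (E j)" for j
    using assms(1) by (auto simp: EA_def EB_def hausdorff_weight_empty)
  have "hausdorff_content m \<delta> A \<le> (\<Sum>j. hausdorff_weight m (EA j))"
    using E \<open>0 < \<delta>\<close> by (intro hausdorff_content_le) (fastforce simp: EA_def)+
  moreover have "hausdorff_content m \<delta> B \<le> (\<Sum>j. hausdorff_weight m (EB j))"
    using E \<open>0 < \<delta>\<close> by (intro hausdorff_content_le) (fastforce simp: EB_def)+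
  ultimately have "hausdorff_content m \<delta> A + hausdorff_content m \<delta> B \<le>
      (\<Sum>j. hausdorff_weight m (EA j)) + (\<Sum>j. hausdorff_weight m (EB j))"
    by (rule add_mono)
  also have "\<dots> = (\<Sum>j. hausdorff_weight m (EA j) + hausdorff_weight m (EB j))"
    by (intro suminf_add) auto
  also have "\<dots> \<le> (\<Sum>j. hausdorff_weight m (E j))"
    by (intro suminf_le w) auto
  finally show "hausdorff_content m \<delta> A + hausdorff_content m \<delta> B \<le> (\<Sum>j. hausdorff_weight m (E j))" .
qed

lemma hausdorff_separated:
  fixes A B :: "'a::metric_space set"
  assumes "0 < m" "0 < d" and sep: "\<And>a b. a \<in> A \<Longrightarrow> b \<in> B \<Longrightarrow> d \<le> dist a b"
  shows "hausdorff m A + hausdorff m B \<le> hausdorff m (A \<union> B)"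
proof -
  have le: "hausdorff_content m r A + hausdorff_content m s B \<le> hausdorff m (A \<union> B)"
    if "0 < r" "0 < s" for r s
  proof -
    define \<delta> where "\<delta> = min (min r s) (d / 2)"
    have \<delta>: "0 < \<delta>" "\<delta> < d" "\<delta> \<le> r" "\<delta> \<le> s" using that \<open>0 < d\<close> by (auto simp: \<delta>_def)
    have "hausdorff_content m r A + hausdorff_content m s B
        \<le> hausdorff_content m \<delta> A + hausdorff_content m \<delta> B"
      using \<delta> by (intro add_mono hausdorff_content_antimono)
    also have "\<dots> \<le> hausdorff_content m \<delta> (A \<union> B)"
      using \<delta> assms by (intro hausdorff_content_separated) auto
    also have "\<dots> \<le> hausdorff m (A \<union> B)"
      using \<delta> by (intro hausdorff_content_le_hausdorff)
    finally show ?thesis .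
  qed
  have "hausdorff_content m r A + hausdorff m B \<le> hausdorff m (A \<union> B)" if "0 < r" for r
  proof -
    have "hausdorff_content m r A + hausdorff m B
        = (SUP s\<in>{0<..}. hausdorff_content m r A + hausdorff_content m s B)"
      unfolding hausdorff_def[of m B] by (subst ennreal_SUP_add_right) auto
    also have "\<dots> \<le> hausdorff m (A \<union> B)" using le[OF that] by (intro SUP_least) auto
    finally show ?thesis .
  qed
  moreover have "hausdorff m A + hausdorff m B
      = (SUP r\<in>{0<..}. hausdorff_content m r A + hausdorff m B)"
    unfolding hausdorff_def[of m A] by (subst ennreal_SUP_add_left) auto
  ultimately show ?thesis by (auto intro: SUP_least)
qed

lemma hausdorff_closed_split:
  fixes A C :: "'a::metric_space set"
  assumes m: "0 < m" and C: "closed C" "C \<noteq> {}" and fin: "hausdorff m A < top"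
  shows "hausdorff m (A \<inter> C) + hausdorff m (A - C) \<le> hausdorff m A"
proof -
  define F where "F n = {x \<in> A - C. 1 / real (Suc n) \<le> infdist x C}" for n
  define R where "R n = F (Suc n) - F n" for n
  have F_mono: "F i \<subseteq> F j" if "i \<le> j" for i j
  proof
    fix x assume "x \<in> F i"
    moreover have "1 / real (Suc j) \<le> 1 / real (Suc i)" using that by (simp add: frac_le)
    ultimately show "x \<in> F j" unfolding F_def by (auto intro: order_trans)
  qed
  have dist_le: "infdist x C \<le> dist x y + infdist y C" for x y
    using infdist_triangle[of x C y] by (simp add: add.commute)
  have F_sep: "hausdorff m (A \<inter> C) + hausdorff m (F n) \<le> hausdorff m A" for n
  proof -
    have "hausdorff m (A \<inter> C) + hausdorff m (F n) \<le> hausdorff m ((A \<inter> C) \<union> F n)"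
    proof (rule hausdorff_separated[OF m])
      show "0 < 1 / real (Suc n)" by simp
      fix a b assume "a \<in> A \<inter> C" "b \<in> F n"
      then show "1 / real (Suc n) \<le> dist a b"
        using infdist_le[of a C b] by (auto simp: F_def dist_commute intro: order_trans)
    qed
    also have "\<dots> \<le> hausdorff m A" by (rule hausdorff_mono) (auto simp: F_def)
    finally show ?thesis .
  qed
  have R_sep: "hausdorff m (F k) + hausdorff m (R (Suc k)) \<le> hausdorff m (F (Suc (Suc k)))" for k
  proof -
    have "hausdorff m (F k) + hausdorff m (R (Suc k)) \<le> hausdorff m (F k \<union> R (Suc k))"
    proof (rule hausdorff_separated[OF m])
      show "0 < 1 / real (Suc k) - 1 / real (Suc (Suc k))"
        by (simp add: frac_less2)
      fix a b assume "a \<in> F k" "b \<in> R (Suc k)"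
      then have "1 / real (Suc k) \<le> infdist a C" "infdist b C < 1 / real (Suc (Suc k))"
        by (auto simp: F_def R_def not_le)
      then show "1 / real (Suc k) - 1 / real (Suc (Suc k)) \<le> dist a b"
        using dist_le[of a b] by linarith
    qed
    also have "\<dots> \<le> hausdorff m (F (Suc (Suc k)))"
      using F_mono[of k "Suc (Suc k)"] by (intro hausdorff_mono) (auto simp: R_def)
    finally show ?thesis .
  qed
  have R_sum: "(\<Sum>k<Suc n. hausdorff m (R k)) \<le> hausdorff m (F n) + hausdorff m (F (Suc n))" for n
  proof (induction n)
    case 0
    have "hausdorff m (R 0) \<le> hausdorff m (F (Suc 0))" by (intro hausdorff_mono) (auto simp: R_def)
    then show ?case by (simp add: add_increasing)
  next
    case (Suc n)
    have "(\<Sum>k<Suc (Suc n). hausdorff m (R k))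
        \<le> (hausdorff m (F n) + hausdorff m (F (Suc n))) + hausdorff m (R (Suc n))"
      using Suc by (simp add: add_mono)
    also have "\<dots> = hausdorff m (F (Suc n)) + (hausdorff m (F n) + hausdorff m (R (Suc n)))"
      by (simp add: ac_simps)
    also have "\<dots> \<le> hausdorff m (F (Suc n)) + hausdorff m (F (Suc (Suc n)))"
      by (intro add_left_mono R_sep)
    finally show ?case .
  qed
  have F_le: "hausdorff m (F n) \<le> hausdorff m A" for n
    by (intro hausdorff_mono) (auto simp: F_def)
  define T where "T = (\<Sum>k. hausdorff m (R k))"
  have "T \<le> hausdorff m A + hausdorff m A"
    unfolding T_def
  proof (rule suminf_le_const)
    fix n
    have "(\<Sum>k<n. hausdorff m (R k)) \<le> (\<Sum>k<Suc n. hausdorff m (R k))" by (simp add: add_increasing2)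
    also have "\<dots> \<le> hausdorff m (F n) + hausdorff m (F (Suc n))" by (rule R_sum)
    also have "\<dots> \<le> hausdorff m A + hausdorff m A" by (intro add_mono F_le)
    finally show "(\<Sum>k<n. hausdorff m (R k)) \<le> hausdorff m A + hausdorff m A" .
  qed auto
  then have T_fin: "T < top" by (rule le_less_trans) (use fin in simp)
  have cov: "A - C \<subseteq> F n \<union> (\<Union>k. R (k + n))" for n
  proof
    fix x assume x: "x \<in> A - C"
    then have "0 < infdist x C"
      using C infdist_nonneg[of x C] in_closed_iff_infdist_zero[of C x] by fastforce
    then obtain N where "inverse (real (Suc N)) < infdist x C" using reals_Archimedean by blast
    then have "x \<in> F N" using x by (auto simp: F_def inverse_eq_divide)
    define k where "k = (LEAST k. x \<in> F k)"
    have k: "x \<in> F k" unfolding k_def using \<open>x \<in> F N\<close> by (rule LeastI[of "\<lambda>k. x \<in> F k"])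
    show "x \<in> F n \<union> (\<Union>k. R (k + n))"
    proof (cases "k \<le> n")
      case True
      then show ?thesis using F_mono k by blast
    next
      case False
      then obtain j where j: "k = Suc (j + n)" by (metis less_imp_Suc_add add.commute not_le)
      then have "x \<notin> F (j + n)" using not_less_Least[of "j + n" "\<lambda>k. x \<in> F k"] by (simp add: k_def)
      then have "x \<in> R (j + n)" using k j by (simp add: R_def)
      then show ?thesis by blast
    qed
  qed
  let ?X = "hausdorff m (A \<inter> C) + hausdorff m (A - C)"
  have bound: "?X + (\<Sum>k<n. hausdorff m (R k)) \<le> hausdorff m A + T" for n
  proof -
    have "hausdorff m (A - C) \<le> hausdorff m (F n) + hausdorff m (\<Union>k. R (k + n))"
      using hausdorff_mono[OF cov[of n], of m] hausdorff_Un_le[OF m] by (rule order_trans)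
    also have "\<dots> \<le> hausdorff m (F n) + (\<Sum>k. hausdorff m (R (k + n)))"
      by (intro add_left_mono hausdorff_subadditive)
    finally have "?X + (\<Sum>k<n. hausdorff m (R k))
        \<le> hausdorff m (A \<inter> C) + (hausdorff m (F n) + (\<Sum>k. hausdorff m (R (k + n))))
            + (\<Sum>k<n. hausdorff m (R k))"
      by (intro add_right_mono add_left_mono)
    also have "\<dots> = (hausdorff m (A \<inter> C) + hausdorff m (F n)) + T"
      unfolding T_def by (subst suminf_offset[of _ n]) (auto simp: ac_simps)
    also have "\<dots> \<le> hausdorff m A + T" by (intro add_right_mono F_sep)
    finally show ?thesis .
  qed
  have "?X + T = (SUP n. ?X + (\<Sum>k<n. hausdorff m (R k)))"
    unfolding T_def suminf_eq_SUP by (subst ennreal_SUP_add_right) auto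
  also have "\<dots> \<le> hausdorff m A + T" by (intro SUP_least bound)
  finally show ?thesis using T_fin by (auto simp: add.commute[of _ T] ennreal_add_left_cancel_le)
qed

lemma borel_subset_lambda_system_hausdorff:
  assumes m: "0 < m"
  shows "sets (borel :: 'a::metric_space measure) \<subseteq> lambda_system UNIV (Pow UNIV) (hausdorff m)"
proof -
  have "measure_space UNIV (lambda_system UNIV (Pow UNIV) (hausdorff m)) (hausdorff m)"
    using sigma_algebra.caratheodory_lemma[OF sigma_algebra_Pow outer_measure_space_hausdorff[OF m]] .
  then have sa: "sigma_algebra UNIV (lambda_system UNIV (Pow UNIV) (hausdorff m))"
    unfolding measure_space_def by blast
  have "C \<in> lambda_system UNIV (Pow UNIV) (hausdorff m)" if "closed C" for C :: "'a set"
  proof -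
    have "hausdorff m (A \<inter> C) + hausdorff m (A - C) = hausdorff m A" for A
    proof (rule antisym)
      show "hausdorff m (A \<inter> C) + hausdorff m (A - C) \<le> hausdorff m A"
      proof (cases "C = {} \<or> hausdorff m A = top")
        case True
        then show ?thesis using m by (auto simp: hausdorff_empty)
      next
        case False
        then show ?thesis using hausdorff_closed_split[OF m that] by (simp add: less_top)
      qed
      show "hausdorff m A \<le> hausdorff m (A \<inter> C) + hausdorff m (A - C)"
        using hausdorff_Un_le[OF m, of "A \<inter> C" "A - C"] by (simp add: Int_Diff_Un)
    qed
    then show ?thesis unfolding algebra.lambda_system_eq[OF algebra_Pow] by auto
  qed
  then show ?thesis
    unfolding borel_eq_closed using sigma_algebra.sigma_sets_subset[OF sa, of "Collect closed"] by auto
qed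

lemma space_hausdorff_measure [simp]: "space (hausdorff_measure m) = UNIV"
  by (simp add: hausdorff_measure_def space_measure_of_conv)

lemma sets_hausdorff_measure [simp]: "sets (hausdorff_measure m) = sets borel"
  unfolding hausdorff_measure_def by (metis sets.sets_measure_of_eq space_borel)

lemma emeasure_hausdorff_measure:
  fixes A :: "'a::metric_space set"
  assumes m: "0 < m" and A: "A \<in> sets borel"
  shows "emeasure (hausdorff_measure m) A = hausdorff m A"
  unfolding hausdorff_measure_def
proof (rule emeasure_measure_of_sigma)
  show "sigma_algebra UNIV (sets (borel :: 'a measure))" by (metis sets.sigma_algebra_axioms space_borel)
  show "positive (sets borel) (hausdorff m)" by (simp add: positive_def hausdorff_empty m)
  have "measure_space UNIV (lambda_system UNIV (Pow UNIV) (hausdorff m)) (hausdorff m)"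
    using sigma_algebra.caratheodory_lemma[OF sigma_algebra_Pow outer_measure_space_hausdorff[OF m]] .
  then show "countably_additive (sets (borel :: 'a measure)) (hausdorff m)"
    using borel_subset_lambda_system_hausdorff[OF m]
    unfolding measure_space_def countably_additive_def by blast
qed (rule A)

subsection \<open>Relative carpets\<close>

definition compactly_contained :: "complex set \<Rightarrow> complex set \<Rightarrow> bool" where
  "compactly_contained V \<Omega> \<longleftrightarrow> compact (closure V) \<and> closure V \<subseteq> \<Omega>"

definition jordan_region :: "complex set \<Rightarrow> bool" where
  "jordan_region U \<longleftrightarrow>
     (\<exists>c. simple_path c \<and> pathfinish c = pathstart c \<and> U = inside (path_image c))"

definition carpet :: "complex set \<Rightarrow> (nat \<Rightarrow> complex set) \<Rightarrow> complex set" where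
  "carpet \<Omega> Q = \<Omega> - (\<Union>i. Q i)"

definition relative_sierpinski_carpet :: "complex set \<Rightarrow> (nat \<Rightarrow> complex set) \<Rightarrow> bool" where
  "relative_sierpinski_carpet \<Omega> Q \<longleftrightarrow>
     open \<Omega> \<and> connected \<Omega> \<and>
     (\<forall>i. jordan_region (Q i) \<and> compactly_contained (Q i) \<Omega>) \<and>
     (\<forall>i j. i \<noteq> j \<longrightarrow> closure (Q i) \<inter> closure (Q j) = {}) \<and>
     interior (carpet \<Omega> Q) = {} \<and>
     locally connected (carpet \<Omega> Q) \<and>
     hausdorff 2 (carpet \<Omega> Q) = 0 \<and>
     (\<exists>K0\<ge>1. \<forall>i. \<exists>x r R. 0 < r \<and> ball x r \<subseteq> Q i \<and> Q i \<subseteq> ball x R \<and> R / r \<le> K0) \<and>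
     (\<exists>K1>0. \<forall>i. \<forall>x\<in>Q i. \<forall>r. 0 < r \<and> r < diameter (Q i) \<longrightarrow>
        hausdorff 2 (ball x r \<inter> Q i) \<ge> ennreal (K1 * r\<^sup>2))"

definition carpet_interior :: "complex set \<Rightarrow> (nat \<Rightarrow> complex set) \<Rightarrow> complex set" where
  "carpet_interior \<Omega> Q = carpet \<Omega> Q - (\<Union>i. frontier (Q i))"

definition meeting :: "(nat \<Rightarrow> complex set) \<Rightarrow> complex set \<Rightarrow> nat set" where
  "meeting Q V = {i. Q i \<inter> V \<noteq> {}}"

subsection \<open>Paths\<close>

text \<open>
  A path is a pair of a nonempty bounded interval \<open>I\<close> and a function whose restriction to the closure
  of \<open>I\<close> is the continuous extension of the path; the image of the path is the image of \<open>I\<close> only.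
\<close>

type_synonym plane_path = "real set \<times> (real \<Rightarrow> complex)"

definition is_path :: "plane_path \<Rightarrow> bool" where
  "is_path \<gamma> \<longleftrightarrow> fst \<gamma> \<noteq> {} \<and> is_interval (fst \<gamma>) \<and> bounded (fst \<gamma>) \<and>
                  continuous_on (closure (fst \<gamma>)) (snd \<gamma>)"

definition path_trace :: "plane_path \<Rightarrow> complex set" where
  "path_trace \<gamma> = snd \<gamma> ` fst \<gamma>"

definition paths_in :: "complex set \<Rightarrow> plane_path set" where
  "paths_in \<Omega> = {\<gamma>. is_path \<gamma> \<and> path_trace \<gamma> \<subseteq> \<Omega>}"

definition subpath_of :: "plane_path \<Rightarrow> plane_path \<Rightarrow> bool" where
  "subpath_of \<gamma>' \<gamma> \<longleftrightarrow>
     fst \<gamma>' \<noteq> {} \<and> is_interval (fst \<gamma>') \<and> fst \<gamma>' \<subseteq> fst \<gamma> \<and> snd \<gamma>' = snd \<gamma>"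

definition open_path :: "plane_path \<Rightarrow> bool" where
  "open_path \<gamma> \<longleftrightarrow> open (fst \<gamma>)"

definition arc_length :: "(real \<Rightarrow> complex) \<Rightarrow> real \<Rightarrow> real \<Rightarrow> ennreal" where
  "arc_length f a b =
     (SUP ts\<in>{ts. sorted ts \<and> set ts \<subseteq> {a..b}}.
        \<Sum>k<length ts - 1. ennreal (dist (f (ts ! k)) (f (ts ! Suc k))))"

definition locally_rectifiable :: "plane_path \<Rightarrow> bool" where
  "locally_rectifiable \<gamma> \<longleftrightarrow>
     (\<forall>a\<in>fst \<gamma>. \<forall>b\<in>fst \<gamma>. a \<le> b \<longrightarrow> arc_length (snd \<gamma>) a b < \<infinity>)"

text \<open>
  The parametrization by arc length of \<open>f\<close> on \<open>{a..b}\<close>. The choice of the parameter is immaterial,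
  since \<open>f\<close> is constant on every set where the length function is.
\<close>

definition arc_length_param :: "(real \<Rightarrow> complex) \<Rightarrow> real \<Rightarrow> real \<Rightarrow> real \<Rightarrow> complex" where
  "arc_length_param f a b s = f (SOME t. t \<in> {a..b} \<and> arc_length f a t = ennreal s)"

definition path_integral :: "(complex \<Rightarrow> ennreal) \<Rightarrow> plane_path \<Rightarrow> ennreal" where
  "path_integral l \<gamma> =
     (if locally_rectifiable \<gamma>
      then SUP (a, b)\<in>{(a, b). a \<in> fst \<gamma> \<and> b \<in> fst \<gamma> \<and> a \<le> b}.
             \<integral>\<^sup>+s\<in>{0..enn2real (arc_length (snd \<gamma>) a b)}.
                l (arc_length_param (snd \<gamma>) a b s) \<partial>lborel
      else \<infinity>)"

subsection \<open>Moduli\<close>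

definition mod2 :: "plane_path set \<Rightarrow> ennreal" where
  "mod2 \<Gamma> =
     (INF l\<in>{l \<in> borel_measurable borel. \<forall>\<gamma>\<in>\<Gamma>. path_integral l \<gamma> \<ge> 1}.
        \<integral>\<^sup>+z. (l z)\<^sup>2 \<partial>hausdorff_measure 2)"

definition sum_along :: "(nat \<Rightarrow> complex set) \<Rightarrow> (nat \<Rightarrow> real) \<Rightarrow> plane_path \<Rightarrow> ennreal" where
  "sum_along Q \<rho> \<gamma> = (\<Sum>\<^sub>\<infinity>i\<in>meeting Q (path_trace \<gamma>). ennreal (\<rho> i))"

definition weak_admissible ::
    "(nat \<Rightarrow> complex set) \<Rightarrow> plane_path set \<Rightarrow> (nat \<Rightarrow> real) set" where
  "weak_admissible Q \<Gamma> =
     {\<rho>. (\<forall>i. 0 \<le> \<rho> i) \<and>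
         (\<exists>\<Gamma>0\<subseteq>\<Gamma>. mod2 \<Gamma>0 = 0 \<and> (\<forall>\<gamma>\<in>\<Gamma> - \<Gamma>0. sum_along Q \<rho> \<gamma> \<ge> 1))}"

definition strong_admissible ::
    "complex set \<Rightarrow> (nat \<Rightarrow> complex set) \<Rightarrow> plane_path set \<Rightarrow> (nat \<Rightarrow> real) set" where
  "strong_admissible \<Omega> Q \<Gamma> =
     {\<rho>. (\<forall>i. 0 \<le> \<rho> i) \<and>
         (\<forall>\<gamma>\<in>\<Gamma>. hausdorff 1 (path_trace \<gamma> \<inter> carpet \<Omega> Q) = 0 \<longrightarrow> sum_along Q \<rho> \<gamma> \<ge> 1)}"

definition mod_w :: "(nat \<Rightarrow> complex set) \<Rightarrow> plane_path set \<Rightarrow> ennreal" where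
  "mod_w Q \<Gamma> = (INF \<rho>\<in>weak_admissible Q \<Gamma>. \<Sum>\<^sub>\<infinity>i\<in>UNIV. ennreal ((\<rho> i)\<^sup>2))"

definition mod_s :: "complex set \<Rightarrow> (nat \<Rightarrow> complex set) \<Rightarrow> plane_path set \<Rightarrow> ennreal" where
  "mod_s \<Omega> Q \<Gamma> = (INF \<rho>\<in>strong_admissible \<Omega> Q \<Gamma>. \<Sum>\<^sub>\<infinity>i\<in>UNIV. ennreal ((\<rho> i)\<^sup>2))"

datatype modulus_version = Weak | Strong

fun carpet_modulus ::
    "modulus_version \<Rightarrow> complex set \<Rightarrow> (nat \<Rightarrow> complex set) \<Rightarrow> plane_path set \<Rightarrow> ennreal" where
  "carpet_modulus Weak \<Omega> Q = mod_w Q"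
| "carpet_modulus Strong \<Omega> Q = mod_s \<Omega> Q"

subsection \<open>Sobolev spaces\<close>

text \<open>
  Functions on the carpet with values in the extended reals are total functions on the plane, whose
  values off the carpet are never used. The boundaries of the peripheral disks lie in the carpet.
\<close>

definition disk_max :: "complex set \<Rightarrow> (complex \<Rightarrow> ereal) \<Rightarrow> ereal" where
  "disk_max U g = (SUP x\<in>frontier U. g x)"

definition disk_min :: "complex set \<Rightarrow> (complex \<Rightarrow> ereal) \<Rightarrow> ereal" where
  "disk_min U g = (INF x\<in>frontier U. g x)"

definition disk_osc :: "complex set \<Rightarrow> (complex \<Rightarrow> ereal) \<Rightarrow> ereal" where
  "disk_osc U g = disk_max U g - disk_min U g"

definition upper_gradient ::
    "modulus_version \<Rightarrow> complex set \<Rightarrow> (nat \<Rightarrow> complex set) \<Rightarrow> (nat \<Rightarrow> real) \<Rightarrow>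
     (complex \<Rightarrow> ereal) \<Rightarrow> bool" where
  "upper_gradient v \<Omega> Q \<rho> g \<longleftrightarrow>
     (\<exists>\<Gamma>0\<subseteq>paths_in \<Omega>. carpet_modulus v \<Omega> Q \<Gamma>0 = 0 \<and>
        (\<forall>\<gamma>\<in>paths_in \<Omega> - \<Gamma>0. \<forall>x\<in>path_trace \<gamma> \<inter> carpet \<Omega> Q. \<forall>y\<in>path_trace \<gamma> \<inter> carpet \<Omega> Q.
           \<bar>g x\<bar> \<noteq> \<infinity> \<and> \<bar>g y\<bar> \<noteq> \<infinity> \<and> \<bar>g x - g y\<bar> \<le> enn2ereal (sum_along Q \<rho> \<gamma>)))"

definition mass_on :: "(nat \<Rightarrow> complex set) \<Rightarrow> nat set \<Rightarrow> (complex \<Rightarrow> ereal) \<Rightarrow> ennreal" where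
  "mass_on Q J g = (\<Sum>\<^sub>\<infinity>i\<in>J. e2ennreal ((disk_max (Q i) g)\<^sup>2 * ereal ((diameter (Q i))\<^sup>2)))"

definition energy_on :: "(nat \<Rightarrow> complex set) \<Rightarrow> nat set \<Rightarrow> (complex \<Rightarrow> ereal) \<Rightarrow> ennreal" where
  "energy_on Q J g = (\<Sum>\<^sub>\<infinity>i\<in>J. e2ennreal ((disk_osc (Q i) g)\<^sup>2))"

definition sobolev_loc ::
    "modulus_version \<Rightarrow> complex set \<Rightarrow> (nat \<Rightarrow> complex set) \<Rightarrow> (complex \<Rightarrow> ereal) set" where
  "sobolev_loc v \<Omega> Q =
     {g. (\<forall>i. \<bar>disk_max (Q i) g\<bar> \<noteq> \<infinity> \<and> \<bar>disk_min (Q i) g\<bar> \<noteq> \<infinity>) \<and>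
         (\<forall>x r. compactly_contained (ball x r) \<Omega> \<longrightarrow>
            mass_on Q (meeting Q (ball x r)) g < \<infinity> \<and>
            energy_on Q (meeting Q (ball x r)) g < \<infinity>) \<and>
         upper_gradient v \<Omega> Q (\<lambda>i. real_of_ereal (disk_osc (Q i) g)) g}"

definition sobolev ::
    "modulus_version \<Rightarrow> complex set \<Rightarrow> (nat \<Rightarrow> complex set) \<Rightarrow> (complex \<Rightarrow> ereal) set" where
  "sobolev v \<Omega> Q =
     {g \<in> sobolev_loc v \<Omega> Q. mass_on Q UNIV g < \<infinity> \<and> energy_on Q UNIV g < \<infinity>}"

subsection \<open>Carpet-harmonic functions\<close>

definition dirichlet_energy ::
    "(nat \<Rightarrow> complex set) \<Rightarrow> complex set \<Rightarrow> (complex \<Rightarrow> ereal) \<Rightarrow> ennreal" where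
  "dirichlet_energy Q V g = energy_on Q (meeting Q V) g"

definition carpet_harmonic ::
    "modulus_version \<Rightarrow> complex set \<Rightarrow> (nat \<Rightarrow> complex set) \<Rightarrow> (complex \<Rightarrow> ereal) \<Rightarrow> bool" where
  "carpet_harmonic v \<Omega> Q u \<longleftrightarrow>
     u \<in> sobolev_loc v \<Omega> Q \<and>
     (\<forall>V \<zeta>. open V \<and> compactly_contained V \<Omega> \<and> \<zeta> \<in> sobolev v \<Omega> Q \<and>
            (\<forall>x\<in>carpet \<Omega> Q - V. \<zeta> x = 0) \<longrightarrow>
        dirichlet_energy Q V u \<le> dirichlet_energy Q V (\<lambda>x. u x + \<zeta> x))"

subsection \<open>Normalized functions\<close>

definition good_paths ::
    "complex set \<Rightarrow> (nat \<Rightarrow> complex set) \<Rightarrow> (complex \<Rightarrow> ereal) \<Rightarrow> plane_path set" where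
  "good_paths \<Omega> Q g =
     (let osc_sum = sum_along Q (\<lambda>i. real_of_ereal (disk_osc (Q i) g))
      in {\<gamma> \<in> paths_in \<Omega>.
            \<not> snd \<gamma> constant_on fst \<gamma> \<and>
            hausdorff 1 (path_trace \<gamma> \<inter> carpet \<Omega> Q) = 0 \<and>
            (\<forall>\<gamma>'. subpath_of \<gamma>' \<gamma> \<longrightarrow>
               (\<forall>i\<in>meeting Q (path_trace \<gamma>'). \<forall>j\<in>meeting Q (path_trace \<gamma>').
                  \<bar>disk_max (Q i) g - disk_max (Q j) g\<bar> \<le> enn2ereal (osc_sum \<gamma>')) \<and>
               (compactly_contained (path_trace \<gamma>') \<Omega> \<longrightarrow> osc_sum \<gamma>' < \<infinity>)) \<and>
            (energy_on Q UNIV g < \<infinity> \<longrightarrow> osc_sum \<gamma> < \<infinity>)})"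

text \<open>\<open>\<gamma>\<close> is the path along which \<open>x\<close> is approached when it is accessible by \<open>\<gamma>0\<close>.\<close>

definition access_path ::
    "complex set \<Rightarrow> (nat \<Rightarrow> complex set) \<Rightarrow> complex \<Rightarrow> plane_path \<Rightarrow> plane_path \<Rightarrow> bool" where
  "access_path \<Omega> Q x \<gamma>0 \<gamma> \<longleftrightarrow>
     (if x \<in> path_trace \<gamma>0 \<inter> carpet_interior \<Omega> Q then \<gamma> = \<gamma>0
      else subpath_of \<gamma> \<gamma>0 \<and> open_path \<gamma> \<and> x \<in> closure (path_trace \<gamma>) - path_trace \<gamma> \<and>
           (\<forall>i. x \<in> frontier (Q i) \<longrightarrow> path_trace \<gamma> \<inter> Q i = {}))"

definition accessible_points ::
    "complex set \<Rightarrow> (nat \<Rightarrow> complex set) \<Rightarrow> (complex \<Rightarrow> ereal) \<Rightarrow> complex set" where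
  "accessible_points \<Omega> Q g =
     {x \<in> carpet \<Omega> Q. \<exists>\<gamma>0\<in>good_paths \<Omega> Q g. \<exists>\<gamma>. access_path \<Omega> Q x \<gamma>0 \<gamma>}"

text \<open>The lower limit over the disks meeting \<open>\<gamma>\<close> that shrink to \<open>x\<close>.\<close>

definition liminf_along ::
    "(nat \<Rightarrow> complex set) \<Rightarrow> (nat \<Rightarrow> ereal) \<Rightarrow> complex \<Rightarrow> plane_path \<Rightarrow> ereal" where
  "liminf_along Q h x \<gamma> =
     (SUP \<epsilon>\<in>{0<..}. INF i\<in>{i \<in> meeting Q (path_trace \<gamma>). Q i \<subseteq> ball x \<epsilon>}. h i)"

text \<open>The value at an accessible point does not depend on the path that is chosen here.\<close>

definition accessible_value ::
    "complex set \<Rightarrow> (nat \<Rightarrow> complex set) \<Rightarrow> (complex \<Rightarrow> ereal) \<Rightarrow> complex \<Rightarrow> ereal" where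
  "accessible_value \<Omega> Q g x =
     liminf_along Q (\<lambda>i. disk_max (Q i) g) x
       (SOME \<gamma>. \<exists>\<gamma>0\<in>good_paths \<Omega> Q g. access_path \<Omega> Q x \<gamma>0 \<gamma>)"

definition normalized_version ::
    "complex set \<Rightarrow> (nat \<Rightarrow> complex set) \<Rightarrow> (complex \<Rightarrow> ereal) \<Rightarrow> complex \<Rightarrow> ereal" where
  "normalized_version \<Omega> Q g x =
     (if x \<in> accessible_points \<Omega> Q g then accessible_value \<Omega> Q g x
      else if \<exists>i. x \<in> frontier (Q i)
      then Liminf (at x within
             accessible_points \<Omega> Q g \<inter> (\<Union>i\<in>{i. x \<in> frontier (Q i)}. frontier (Q i)))
             (accessible_value \<Omega> Q g)
      else Liminf (at x within accessible_points \<Omega> Q g) (accessible_value \<Omega> Q g))"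

definition normalized ::
    "modulus_version \<Rightarrow> complex set \<Rightarrow> (nat \<Rightarrow> complex set) \<Rightarrow> (complex \<Rightarrow> ereal) \<Rightarrow> bool" where
  "normalized v \<Omega> Q u \<longleftrightarrow>
     (\<exists>g\<in>sobolev_loc v \<Omega> Q. \<forall>x\<in>carpet \<Omega> Q. u x = normalized_version \<Omega> Q g x)"

end

theory Submission
  imports Defs
begin

text \<open>
  Up to sign and an additive constant, \<open>u\<close> is a non-negative carpet-harmonic function \<open>w\<close> with \<open>w x0 = 0\<close>.
  Testing minimality with \<open>w + s * \<eta>\<^sup>2 / (w + \<delta>)\<close> for a cutoff \<open>\<eta>\<close> bounds the energy of
  \<open>ln (w + \<delta>)\<close> on compact sets uniformly in \<open>\<delta>\<close>. By Fubini, on almost every line the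
  oscillations of \<open>ln (w + \<delta>)\<close> over the disks met have a sum that stays bounded for a sequence
  \<open>\<delta> \<rightarrow> 0\<close>, which is a Harnack inequality on that line. So if \<open>w\<close> vanishes at one boundary point of
  a disk, it vanishes on the boundaries of all disks met by almost every line through this disk, and, by
  connectedness of \<open>\<Omega>\<close>, on the boundaries of all disks.

  A point of the carpet on no boundary is invisible to curves in general position, and only here the
  normalization enters: at such a point, \<open>u\<close> is approximated by values on the boundaries of nearby disks.
  If \<open>x0\<close> is such a point, then by the minimum principle \<open>w\<close> takes arbitrarily small values on the boundary
  of a fixed rectangle around \<open>x0\<close> whose sides satisfy the Harnack inequality, so it vanishes there.
\<close>

text \<open>Squared oscillations do not depend differentiably on the function, so minimality gives
  no Euler-Lagrange equation and is exploited through explicit competitors, disk by disk. In the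
  logarithmic estimate the gain on a disk meeting the compact set and the loss caused by the cutoff
  are both proportional to \<open>s\<close>; dividing by \<open>s\<close> makes the bound
  independent of \<delta>. A competitor is built by quotients, cutoffs or truncation and comes with
  some locally square summable gradient, while the Sobolev space asks that its own oscillations form
  an upper gradient. \<open>curve_bound_osc\<close> closes this gap; it also controls the logarithm
  by its own oscillations. Path inequalities may fail on a family of modulus zero and say nothing
  about a prescribed curve. Values of \<open>w\<close> are therefore compared on axis-parallel
  segments, where modulus zero leaves almost every line unaffected, for both moduli. Relating a
  normalized function to nearby boundary values involves a given access path; a small rectangle with
  generic sides is made to cross both that path and a generic line.\<close>

section \<open>Suprema of real families and one-dimensional Hausdorff null sets\<close>

lemma SUP_ereal_eq:
  fixes f :: "'a \<Rightarrow> real"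
  assumes "A \<noteq> {}" "bounded (f ` A)"
  shows "(SUP x\<in>A. ereal (f x)) = ereal (Sup (f ` A))"
proof (rule antisym)
  have bdd: "bdd_above (f ` A)" using assms(2) by (rule bounded_imp_bdd_above)
  show "(SUP x\<in>A. ereal (f x)) \<le> ereal (Sup (f ` A))"
    using bdd by (intro SUP_least) (auto intro: cSup_upper)
  show "ereal (Sup (f ` A)) \<le> (SUP x\<in>A. ereal (f x))"
  proof (rule ereal_le_epsilon2)
    fix e :: real assume "0 < e"
    then have "\<exists>y\<in>f ` A. Sup (f ` A) - e < y" using assms(1) bdd by (subst less_cSup_iff[symmetric]) auto
    then obtain x where x: "x \<in> A" "Sup (f ` A) < f x + e" by (auto simp: algebra_simps)
    have "ereal (Sup (f ` A)) \<le> ereal (f x) + ereal e" using x(2) by simp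
    also have "\<dots> \<le> (SUP x\<in>A. ereal (f x)) + ereal e" using x(1) by (intro add_right_mono SUP_upper)
    finally show "ereal (Sup (f ` A)) \<le> (SUP x\<in>A. ereal (f x)) + ereal e" .
  qed
qed

lemma INF_ereal_eq:
  fixes f :: "'a \<Rightarrow> real"
  assumes "A \<noteq> {}" "bounded (f ` A)"
  shows "(INF x\<in>A. ereal (f x)) = ereal (Inf (f ` A))"
proof -
  have b: "bounded ((\<lambda>x. - f x) ` A)" using bounded_uminus[of "f ` A"] assms(2) by (simp add: image_image)
  have "(INF x\<in>A. ereal (f x)) = - (SUP x\<in>A. ereal (- f x))"
    using ereal_INF_uminus_eq[of "\<lambda>x. ereal (- f x)" A] by simp
  also have "\<dots> = ereal (Inf (f ` A))"
    unfolding SUP_ereal_eq[OF assms(1) b] by (simp add: Inf_real_def image_image)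
  finally show ?thesis .
qed

lemma ereal_le_enn2ereal_iff: "0 \<le> r \<Longrightarrow> ereal r \<le> enn2ereal X \<longleftrightarrow> ennreal r \<le> X"
  by (simp add: less_eq_ennreal.rep_eq enn2ereal_ennreal)

text \<open>\<open>P\<close> may be non-measurable, as the image of a disk under a Lipschitz
  function is treated as an arbitrary set; the interval from its infimum to its supremum is the
  Borel cover.\<close>

lemma pairwise_close_subset_interval:
  fixes P :: "real set"
  assumes "\<And>c c'. c \<in> P \<Longrightarrow> c' \<in> P \<Longrightarrow> \<bar>c - c'\<bar> \<le> d" "0 \<le> d"
  obtains I where "I \<in> sets borel" "P \<subseteq> I" "emeasure lborel I \<le> ennreal d"
proof (cases "P = {}")
  case True
  then show ?thesis using that[of "{}"] by simp
next
  case False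
  then obtain c0 where c0: "c0 \<in> P" by blast
  have bdd: "bdd_above P" "bdd_below P"
  proof -
    show "bdd_above P" by (rule bdd_aboveI[of _ "c0 + d"]) (use assms(1)[OF _ c0] in \<open>force simp: abs_le_iff\<close>)
    show "bdd_below P" by (rule bdd_belowI[of _ "c0 - d"]) (use assms(1)[OF c0] in \<open>force simp: abs_le_iff\<close>)
  qed
  have "Sup P \<le> Inf P + d"
  proof (rule cSup_least[OF False])
    fix c assume c: "c \<in> P"
    have "c - d \<le> Inf P"
      by (rule cInf_greatest[OF False]) (use assms(1)[OF c] in \<open>force simp: abs_le_iff\<close>)
    then show "c \<le> Inf P + d" by simp
  qed
  then have "emeasure lborel {Inf P..Sup P} \<le> ennreal d"
    using cInf_le_cSup[OF False bdd] by (simp add: ennreal_leI)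
  moreover have "P \<subseteq> {Inf P..Sup P}" using bdd by (auto intro: cInf_lower cSup_upper)
  ultimately show ?thesis using that[of "{Inf P..Sup P}"] by simp
qed

text \<open>Unordered sums over index sets become series with an indicator, to which monotone
  convergence, measurability and exchange of sums apply.\<close>

lemma infsum_ennreal_eq_suminf:
  fixes f :: "nat \<Rightarrow> ennreal"
  shows "(\<Sum>\<^sub>\<infinity>i\<in>J. f i) = (\<Sum>i. f i * indicator J i)"
proof -
  have "(\<Sum>\<^sub>\<infinity>i\<in>J. f i) = (\<Sum>\<^sub>\<infinity>i\<in>UNIV. f i * indicator J i)"
    by (rule infsum_cong_neutral) auto
  also have "\<dots> = (\<Sum>i. f i * indicator J i)"
    by (intro sums_unique has_sum_imp_sums has_sum_infsum nonneg_summable_on_complete) simp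
  finally show ?thesis .
qed

lemma hausdorff_eq_zeroI:
  fixes A :: "'a::metric_space set"
  assumes "\<And>\<delta> e. 0 < \<delta> \<Longrightarrow> 0 < e \<Longrightarrow> \<exists>E. A \<subseteq> (\<Union>j::nat. E j) \<and> (\<forall>j. bounded (E j) \<and> diameter (E j) \<le> \<delta>) \<and>
     (\<Sum>j. hausdorff_weight m (E j)) \<le> ennreal e"
  shows "hausdorff m A = 0"
proof -
  have "hausdorff_content m \<delta> A \<le> 0" if "0 < \<delta>" for \<delta>
  proof (rule ennreal_le_epsilon)
    fix e :: real assume "0 < e"
    obtain E where E: "A \<subseteq> (\<Union>j::nat. E j)" "\<forall>j. bounded (E j) \<and> diameter (E j) \<le> \<delta>"
        "(\<Sum>j. hausdorff_weight m (E j)) \<le> ennreal e"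
      using assms[OF \<open>0 < \<delta>\<close> \<open>0 < e\<close>] by blast
    have "hausdorff_content m \<delta> A \<le> (\<Sum>j. hausdorff_weight m (E j))"
      using E by (intro hausdorff_content_le) auto
    then show "hausdorff_content m \<delta> A \<le> 0 + ennreal e" using E(3) by simp
  qed
  then have "hausdorff m A \<le> 0" unfolding hausdorff_def by (intro SUP_least) simp
  then show ?thesis by simp
qed

lemma diameter_lipschitz_image_le:
  fixes f :: "real \<Rightarrow> 'a::real_normed_vector"
  assumes lip: "\<And>s t. s \<in> N \<Longrightarrow> t \<in> N \<Longrightarrow> dist (f s) (f t) \<le> \<bar>s - t\<bar>"
    and C: "is_interval C" "C \<in> sets borel" and fin: "emeasure lborel C < top"
  shows "bounded (f ` (N \<inter> C))" "ennreal (diameter (f ` (N \<inter> C))) \<le> emeasure lborel C"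
proof -
  define d where "d = measure lborel C"
  have d: "emeasure lborel C = ennreal d" using fin by (simp add: d_def emeasure_eq_ennreal_measure)
  have *: "\<bar>s - t\<bar> \<le> d" if "s \<in> C" "t \<in> C" for s t
  proof -
    have "{min s t..max s t} \<subseteq> C"
    proof
      fix x assume "x \<in> {min s t..max s t}"
      then show "x \<in> C"
        using mem_is_interval_1_I[OF C(1) that, of x] mem_is_interval_1_I[OF C(1) that(2,1), of x]
        by (cases "s \<le> t") auto
    qed
    then have "emeasure lborel {min s t..max s t} \<le> emeasure lborel C"
      using C(2) by (intro emeasure_mono) auto
    then show ?thesis unfolding d by (simp add: d_def split: split_min split_max)
  qed
  then have b: "dist x y \<le> d" if "x \<in> f ` (N \<inter> C)" "y \<in> f ` (N \<inter> C)" for x y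
    using that lip by force
  then show bd: "bounded (f ` (N \<inter> C))" unfolding bounded_two_points by blast
  show "ennreal (diameter (f ` (N \<inter> C))) \<le> emeasure lborel C"
  proof -
    have "diameter (f ` (N \<inter> C)) \<le> d"
      using b by (intro diameter_le) (auto simp: d_def dist_norm)
    then show ?thesis unfolding d by (rule ennreal_leI)
  qed
qed

text \<open>Outer regularity encloses \<open>N\<close> in an open set of small measure. Its
  components are countably many disjoint intervals, and the images of their traces on
  \<open>N\<close> have diameters at most the lengths, so these images are an efficient
  covering.\<close>

lemma hausdorff_1_lipschitz_image_null:
  fixes f :: "real \<Rightarrow> 'a::real_normed_vector"
  assumes N: "N \<in> null_sets lborel"
    and lip: "\<And>s t. s \<in> N \<Longrightarrow> t \<in> N \<Longrightarrow> dist (f s) (f t) \<le> \<bar>s - t\<bar>"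
  shows "hausdorff 1 (f ` N) = 0"
proof (rule hausdorff_eq_zeroI)
  fix \<delta> e :: real assume "0 < \<delta>" "0 < e"
  \<comment> \<open>One bound on the measure of the open set serves twice: each component is shorter
    than \<delta>, and the lengths sum to less than \<open>e\<close>.\<close>
  define r where "r = min \<delta> e"
  have r: "0 < r" "r \<le> \<delta>" "r \<le> e" using \<open>0 < \<delta>\<close> \<open>0 < e\<close> by (auto simp: r_def)
  have Nb: "N \<in> sets borel" and N0: "emeasure lborel N = 0" using N by (auto simp: null_sets_def)
  obtain U where U: "open U" "N \<subseteq> U" "emeasure lborel (U - N) < r"
    using outer_regular_lborel[OF Nb \<open>0 < r\<close>] by blast
  have "emeasure lborel U \<le> emeasure lborel (U - N) + emeasure lborel N"
    using emeasure_subadditive[of "U - N" lborel N] U Nb by (auto simp: Un_absorb1 intro!: order_trans[OF emeasure_mono[of U "U - N \<union> N"]])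
  then have Ur: "emeasure lborel U < r" using U(3) N0 by simp
  define \<C> where "\<C> = components U"
  have opn: "open C" if "C \<in> \<C>" for C using U(1) that by (auto simp: \<C>_def open_components)
  have dj: "disjoint \<C>" unfolding \<C>_def using pairwise_disjoint_components by (auto simp: pairwise_def disjnt_def)
  have cnt: "countable \<C>"
    using countable_disjoint_open_subsets[of \<C>] opn dj by auto
  have Un: "\<Union>\<C> = U" unfolding \<C>_def by (rule Union_components)
  \<comment> \<open>Indices that encode no component get the empty set: \<open>from_nat_into\<close>
    alone would repeat components and destroy disjointness.\<close>
  define C where "C j = (if j \<in> to_nat_on \<C> ` \<C> then from_nat_into \<C> j else {})" for j
  have C: "C j \<in> \<C> \<or> C j = {}" for j
    using cnt unfolding C_def by auto
  have C_UN: "(\<Union>j. C j) = U"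
  proof -
    have "c \<in> range C" if "c \<in> \<C>" for c
      using that cnt by (intro image_eqI[of _ _ "to_nat_on \<C> c"]) (auto simp: C_def)
    then show ?thesis using C Un by blast
  qed
  have dC: "disjoint_family C"
  proof (unfold disjoint_family_on_def, intro ballI impI)
    fix i j :: nat assume "i \<noteq> j"
    show "C i \<inter> C j = {}"
    proof (cases "i \<in> to_nat_on \<C> ` \<C> \<and> j \<in> to_nat_on \<C> ` \<C>")
      case True
      then obtain a b where ab: "a \<in> \<C>" "b \<in> \<C>" "i = to_nat_on \<C> a" "j = to_nat_on \<C> b" by blast
      then have "C i = a" "C j = b" using cnt by (auto simp: C_def)
      moreover have "a \<noteq> b" using ab \<open>i \<noteq> j\<close> by blast
      ultimately show ?thesis using ab dj by (auto simp: pairwise_def disjnt_def)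
    qed (auto simp: C_def)
  qed
  have Cb: "open (C j)" for j using C[of j] opn by auto
  have Ci: "is_interval (C j)" for j
    using C[of j] by (auto simp: \<C>_def is_interval_connected_1 in_components_connected)
  have sumC: "(\<Sum>j. emeasure lborel (C j)) = emeasure lborel U"
    using Cb dC C_UN by (subst suminf_emeasure) auto
  have Cle: "emeasure lborel (C j) < r" for j
    using emeasure_mono[of "C j" U lborel] C_UN U(1) Ur by (auto intro: le_less_trans)
  define E where "E j = f ` (N \<inter> C j)" for j
  have "emeasure lborel (C j) < top" for j using Cle[of j] by (metis ennreal_less_top less_trans)
  note dl = diameter_lipschitz_image_le[OF lip Ci _ this]
  have Eb: "bounded (E j)" for j unfolding E_def using Cb dl by auto
  have Ed: "ennreal (diameter (E j)) \<le> emeasure lborel (C j)" for j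
    unfolding E_def using Cb by (intro dl) auto
  have "ennreal (diameter (E j)) \<le> r" for j using Ed[of j] Cle[of j] by (meson le_less_trans less_imp_le)
  then have Ed': "diameter (E j) \<le> \<delta>" for j using r by (meson ennreal_le_iff less_imp_le order_trans)
  have "f ` N \<subseteq> (\<Union>j. E j)" unfolding E_def using U(2) C_UN by blast
  moreover have "(\<Sum>j. hausdorff_weight 1 (E j)) \<le> (\<Sum>j. emeasure lborel (C j))"
    using Ed by (intro suminf_le) (auto simp: hausdorff_weight_def)
  then have "(\<Sum>j. hausdorff_weight 1 (E j)) \<le> ennreal e"
    unfolding sumC using Ur r(3) by (meson ennreal_leI less_imp_le order_trans)
  ultimately show "\<exists>E. f ` N \<subseteq> (\<Union>j::nat. E j) \<and> (\<forall>j. bounded (E j) \<and> diameter (E j) \<le> \<delta>) \<and>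
     (\<Sum>j. hausdorff_weight 1 (E j)) \<le> ennreal e" using Eb Ed' by blast
qed

lemma hausdorff_null_cover:
  fixes A :: "'a::metric_space set"
  assumes "hausdorff m A = 0" "0 < e"
  obtains E where "A \<subseteq> (\<Union>j::nat. E j)" "\<And>j. bounded (E j)" "(\<Sum>j. hausdorff_weight m (E j)) < ennreal e"
proof -
  have "hausdorff_content m 1 A < ennreal e"
    using hausdorff_content_le_hausdorff[of 1 m A] assms by simp
  then show ?thesis using that unfolding hausdorff_content_def Inf_less_iff by blast
qed

text \<open>A covering set of diameter \<open>d\<close> is sent into an interval of length
  \<open>2 * d\<close>, so a covering of \<open>A\<close> of small total weight gives a covering of
  the image of small total length.\<close>

lemma hausdorff_1_null_lipschitz_image:
  fixes f :: "'a::metric_space \<Rightarrow> real"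
  assumes A: "hausdorff 1 A = 0" and lip: "\<And>x y. \<bar>f x - f y\<bar> \<le> dist x y"
  shows "negligible (f ` A)"
proof (rule negligible_outer_le[THEN iffD2], intro allI impI)
  fix e :: real assume "0 < e"
  then obtain E where E: "A \<subseteq> (\<Union>j::nat. E j)" "\<And>j. bounded (E j)" "(\<Sum>j. hausdorff_weight 1 (E j)) < ennreal (e/2)"
    using hausdorff_null_cover[OF A, of "e/2"] by auto
  \<comment> \<open>Centering at the image of an arbitrary point of \<open>E j\<close> costs a
    factor 2 over the weight \<open>diameter (E j)\<close>, hence the bound \<open>e/2\<close>
    chosen above.\<close>
  define I where "I j = (if E j = {} then {} else cball (f (SOME x. x \<in> E j)) (diameter (E j)))" for j
  have EI: "f ` E j \<subseteq> I j" for j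
  proof
    fix y assume "y \<in> f ` E j"
    then obtain x where x: "x \<in> E j" "y = f x" by blast
    then have "(SOME x. x \<in> E j) \<in> E j" by (metis someI_ex)
    then have "dist (SOME x. x \<in> E j) x \<le> diameter (E j)"
      using diameter_bounded_bound[OF E(2)] x by auto
    then show "y \<in> I j" using x lip[of "SOME x. x \<in> E j" x] by (auto simp: I_def dist_real_def)
  qed
  have Im: "emeasure lborel (I j) \<le> 2 * hausdorff_weight 1 (E j)" for j
  proof (cases "E j = {}")
    case False
    have "I j = {f (SOME x. x \<in> E j) - diameter (E j) .. f (SOME x. x \<in> E j) + diameter (E j)}"
      using False by (simp add: I_def cball_eq_atLeastAtMost)
    then have "emeasure lborel (I j) = ennreal (2 * diameter (E j))"
      using diameter_ge_0[OF E(2)] by simp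
    then show ?thesis using diameter_ge_0[OF E(2), of j] by (simp add: hausdorff_weight_def ennreal_mult)
  qed (simp add: I_def)
  have Ib: "I j \<in> sets lborel" for j by (simp add: I_def)
  have "emeasure lborel (\<Union>j. I j) \<le> (\<Sum>j. emeasure lborel (I j))"
    by (rule emeasure_subadditive_countably) (use Ib in auto)
  also have "\<dots> \<le> (\<Sum>j. 2 * hausdorff_weight 1 (E j))" by (intro suminf_le Im) auto
  also have "\<dots> = 2 * (\<Sum>j. hausdorff_weight 1 (E j))" by simp
  also have "\<dots> \<le> 2 * ennreal (e/2)" using E(3) by (intro mult_left_mono) auto
  also have "\<dots> = ennreal e" using \<open>0 < e\<close> by (subst ennreal_numeral[symmetric], subst ennreal_mult[symmetric]) auto
  finally have em: "emeasure lborel (\<Union>j. I j) \<le> ennreal e" .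
  have s: "(\<Union>j. I j) \<in> sets lborel" using Ib by auto
  then have "(\<Union>j. I j) \<in> lmeasurable"
    using em by (auto simp: fmeasurable_def emeasure_completion intro: le_less_trans)
  moreover have "measure lebesgue (\<Union>j. I j) \<le> e"
    using em s \<open>0 < e\<close> by (simp add: measure_def emeasure_completion enn2real_leI)
  moreover have "f ` A \<subseteq> (\<Union>j. f ` E j)" using E(1) by blast
  then have "f ` A \<subseteq> (\<Union>j. I j)" using EI by (meson SUP_mono' order_trans)
  ultimately show "\<exists>T. f ` A \<subseteq> T \<and> T \<in> lmeasurable \<and> measure lebesgue T \<le> e"
    by blast
qed

lemma negligible_AE_lborel:
  fixes A :: "'a::euclidean_space set"
  assumes "negligible A"
  shows "AE x in lborel. x \<notin> A"
proof -
  obtain N where "N \<in> null_sets lborel" "A \<subseteq> N"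
    using assms by (auto simp: negligible_iff_null_sets null_sets_completion_iff2)
  then show ?thesis by (intro AE_I'[of N]) auto
qed

section \<open>Coordinate lines and planar Hausdorff measure\<close>

text \<open>The boolean selects the direction, so that horizontal lines (\<open>True\<close>, height
  \<open>c\<close>) and vertical lines (\<open>False\<close>, abscissa \<open>c\<close>) share all
  proofs; \<open>cross_coord h\<close> is the coordinate that stays constant on them.\<close>

definition plane_line :: "bool \<Rightarrow> real \<Rightarrow> real \<Rightarrow> complex" where
  "plane_line h c t = (if h then Complex t c else Complex c t)"

definition cross_coord :: "bool \<Rightarrow> complex \<Rightarrow> real" where
  "cross_coord h z = (if h then Im z else Re z)"

lemma plane_line_simps [simp]:
  "cross_coord h (plane_line h c t) = c"
  "cross_coord (\<not> h) (plane_line h c t) = t"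
  "plane_line h (cross_coord h z) (cross_coord (\<not> h) z) = z"
  by (auto simp: plane_line_def cross_coord_def)

lemma cross_coord_lipschitz: "\<bar>cross_coord h x - cross_coord h y\<bar> \<le> dist x y"
  using abs_Re_le_cmod[of "x - y"] abs_Im_le_cmod[of "x - y"] by (simp add: cross_coord_def dist_norm)

lemma dist_plane_line [simp]: "dist (plane_line h c s) (plane_line h c t) = \<bar>s - t\<bar>"
  by (auto simp: plane_line_def dist_norm cmod_def)

lemma continuous_plane_line [continuous_intros]:
  "continuous_on A f \<Longrightarrow> continuous_on A g \<Longrightarrow> continuous_on A (\<lambda>x. plane_line h (f x) (g x))"
  unfolding plane_line_def Complex_eq by (cases h) (auto intro!: continuous_intros)

lemma continuous_cross_coord [continuous_intros]:
  "continuous_on A f \<Longrightarrow> continuous_on A (\<lambda>x. cross_coord h (f x))"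
  unfolding cross_coord_def by (cases h) (auto intro!: continuous_intros)

lemma plane_line_measurable [measurable]:
  "(\<lambda>p. plane_line h (fst p) (snd p)) \<in> borel_measurable (borel \<Otimes>\<^sub>M borel)"
  unfolding borel_prod by (intro borel_measurable_continuous_onI continuous_intros)

text \<open>The circumscribed square is cut into \<open>n * n\<close> squares of side
  \<open>l = 2 * r / n\<close>. Each has diameter at most \<open>sqrt 2 * l\<close> and weight at
  most \<open>pi * l^2 / 2\<close>, which sums to \<open>2 * pi * r^2\<close> whatever the
  mesh.\<close>

lemma hausdorff_2_ball_le: "hausdorff 2 (ball y r) \<le> ennreal (2 * pi * r\<^sup>2)"
  for y :: complex
proof (cases "r \<le> 0")
  case True
  then show ?thesis by (simp add: hausdorff_empty ball_empty)
next
  case False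
  then have r: "0 < r" by simp
  have "hausdorff_content 2 \<delta> (ball y r) \<le> ennreal (2 * pi * r\<^sup>2)" if "0 < \<delta>" for \<delta>
  proof -
    obtain n :: nat where n: "4 * r / \<delta> < real n" using reals_Archimedean2 by blast
    have "0 < 4 * r / \<delta>" using r that by simp
    then have n0: "0 < n" using n by (cases n) auto
    define l where "l = 2 * r / n"
    have l: "0 < l" "l * n = 2 * r" using r n0 by (auto simp: l_def)
    have ld: "2 * l \<le> \<delta>" using n n0 that by (simp add: l_def field_simps)
    define F where "F i j = cbox (Complex (Re y - r + i * l) (Im y - r + j * l))
        (Complex (Re y - r + (i + 1) * l) (Im y - r + (j + 1) * l))" for i j :: nat
    define E where "E k = (if k < n * n then F (k div n) (k mod n) else {})" for k
    have dF: "dist z w \<le> sqrt 2 * l" if "z \<in> F i j" "w \<in> F i j" for z w i j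
    proof -
      have "\<bar>Re z - Re w\<bar> \<le> l" "\<bar>Im z - Im w\<bar> \<le> l"
        using that by (auto simp: F_def in_cbox_complex_iff algebra_simps)
      then have "(Re z - Re w)\<^sup>2 \<le> l\<^sup>2" "(Im z - Im w)\<^sup>2 \<le> l\<^sup>2" using l(1)
        by (metis abs_le_square_iff abs_of_pos)+
      then have "(cmod (z - w))\<^sup>2 \<le> (sqrt 2 * l)\<^sup>2" by (simp add: cmod_power2 power_mult_distrib)
      then show ?thesis using l(1) by (simp add: dist_norm power2_le_iff_abs_le)
    qed
    have bE: "bounded (E k)" for k by (simp add: E_def F_def)
    have dE: "diameter (E k) \<le> sqrt 2 * l" for k
      using dF l(1) by (intro diameter_le) (auto simp: E_def dist_norm split: if_splits)
    have cov: "ball y r \<subseteq> (\<Union>k. E k)"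
    proof
      fix z assume z: "z \<in> ball y r"
      define p where "p = (Re z - Re y + r) / l"
      define q where "q = (Im z - Im y + r) / l"
      have "\<bar>Re z - Re y\<bar> < r" "\<bar>Im z - Im y\<bar> < r"
        using z abs_Re_le_cmod[of "z - y"] abs_Im_le_cmod[of "z - y"] by (auto simp: dist_norm norm_minus_commute)
      then have pq: "0 \<le> p" "p < n" "0 \<le> q" "q < n" using l
        by (auto simp: p_def q_def field_simps mult.commute)
      define i where "i = nat \<lfloor>p\<rfloor>"
      define j where "j = nat \<lfloor>q\<rfloor>"
      have ij: "real i \<le> p" "p < real i + 1" "real j \<le> q" "q < real j + 1"
        using pq by (auto simp: i_def j_def)
      have ijn: "i < n" "j < n" using pq ij by linarith+
      have "z \<in> F i j" using ij l(1)
        by (auto simp: F_def in_cbox_complex_iff p_def q_def field_simps)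
      moreover have "(i * n + j) div n = i" "(i * n + j) mod n = j" using ijn by auto
      moreover have "i * n + j < n * n"
      proof -
        have "i * n + j < (i + 1) * n" using ijn by simp
        also have "\<dots> \<le> n * n" using ijn by (intro mult_right_mono) auto
        finally show ?thesis .
      qed
      ultimately show "z \<in> (\<Union>k. E k)" by (auto simp: E_def intro!: exI[of _ "i * n + j"])
    qed
    have "sqrt 2 \<le> 2" by (rule real_le_lsqrt) auto
    then have "sqrt 2 * l \<le> \<delta>" using ld l(1) by (meson mult_right_mono less_imp_le order_trans)
    then have "hausdorff_content 2 \<delta> (ball y r) \<le> (\<Sum>k. hausdorff_weight 2 (E k))"
      using cov bE dE by (intro hausdorff_content_le) (auto intro: order_trans)
    also have "\<dots> = (\<Sum>k<n*n. hausdorff_weight 2 (E k))"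
      by (rule suminf_finite) (auto simp: E_def hausdorff_weight_empty)
    also have "\<dots> \<le> (\<Sum>k<n*n. ennreal (pi * (l\<^sup>2 / 2)))"
    proof (intro sum_mono)
      fix k
      have "(diameter (E k) / 2)\<^sup>2 \<le> (sqrt 2 * l / 2)\<^sup>2"
        using dE[of k] diameter_ge_0[OF bE, of k] by (intro power_mono divide_right_mono) auto
      also have "\<dots> = l\<^sup>2 / 2" by (simp add: power_divide power_mult_distrib)
      finally show "hausdorff_weight 2 (E k) \<le> ennreal (pi * (l\<^sup>2 / 2))"
        by (auto simp: hausdorff_weight_def unit_ball_vol_2 intro!: ennreal_leI mult_left_mono)
    qed
    also have "\<dots> = ennreal (real (n * n) * (pi * (l\<^sup>2 / 2)))"
      unfolding sum_constant by (subst ennreal_mult) (auto simp: ennreal_of_nat_eq_real_of_nat)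
    also have "real (n * n) * (pi * (l\<^sup>2 / 2)) = 2 * pi * r\<^sup>2"
      using n0 by (simp add: l_def power2_eq_square)
    finally show ?thesis .
  qed
  then show ?thesis unfolding hausdorff_def by (intro SUP_least) auto
qed

text \<open>A set of diameter \<open>d\<close> lies in a square of side \<open>2 * d\<close>, of
  area \<open>4 * d^2\<close>, while its weight is \<open>pi * d^2 / 4\<close>. The factor 6 comes
  from \<open>4 \<le> 6 * pi / 4\<close>.\<close>

lemma emeasure_plane_line_le:
  fixes A :: "complex set"
  assumes A: "A \<in> sets borel"
  shows "emeasure (lborel \<Otimes>\<^sub>M lborel) {p. plane_line h (fst p) (snd p) \<in> A} \<le> 6 * hausdorff 2 A"
proof -
  let ?M = "lborel \<Otimes>\<^sub>M lborel :: (real \<times> real) measure"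
  define T where "T B = {p. plane_line h (fst p) (snd p) \<in> B}" for B
  have T: "T B \<in> sets ?M" if "B \<in> sets borel" for B
  proof -
    have "T B = (\<lambda>p. plane_line h (fst p) (snd p)) -` B \<inter> space (borel \<Otimes>\<^sub>M borel)"
      by (auto simp: T_def space_pair_measure)
    also have "\<dots> \<in> sets (borel \<Otimes>\<^sub>M borel)" using that by measurable
    also have "sets (borel \<Otimes>\<^sub>M borel) = sets ?M" by (rule sets_pair_measure_cong) auto
    finally show ?thesis .
  qed
  have "emeasure ?M (T A) / 6 \<le> hausdorff_content 2 1 A"
  proof (rule hausdorff_content_greatest)
    fix E :: "nat \<Rightarrow> complex set"
    assume E: "A \<subseteq> (\<Union>j. E j)" "\<And>j. bounded (E j)" "\<And>j. diameter (E j) \<le> 1"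
    define x where "x j = (SOME x. x \<in> E j)" for j
    define I where "I b j = {cross_coord b (x j) - diameter (E j)..cross_coord b (x j) + diameter (E j)}" for b j
    define R where "R j = (if E j = {} then {} else I h j \<times> I (\<not> h) j)" for j
    have R: "R j \<in> sets ?M" for j by (auto simp: R_def I_def)
    have ER: "T (E j) \<subseteq> R j" for j
    proof
      fix p assume p: "p \<in> T (E j)"
      define z where "z = plane_line h (fst p) (snd p)"
      have z: "z \<in> E j" using p by (simp add: T_def z_def)
      have "x j \<in> E j" unfolding x_def using z by (metis someI_ex)
      then have d: "dist z (x j) \<le> diameter (E j)" using diameter_bounded_bound[OF E(2)] z by auto
      have pz: "fst p = cross_coord h z" "snd p = cross_coord (\<not> h) z" by (simp_all add: z_def)
      have "cross_coord b z \<in> I b j" for b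
        using cross_coord_lipschitz[of b z "x j"] d by (auto simp: I_def)
      then show "p \<in> R j" using z pz by (cases p) (auto simp: R_def)
    qed
    have Rm: "emeasure ?M (R j) \<le> 6 * hausdorff_weight 2 (E j)" for j
    proof (cases "E j = {}")
      case False
      let ?d = "diameter (E j)"
      have d0: "0 \<le> ?d" using diameter_ge_0[OF E(2)] .
      have "emeasure ?M (R j) = ennreal (2 * ?d) * ennreal (2 * ?d)"
        using False d0 by (simp add: R_def I_def lborel.emeasure_pair_measure_Times)
      also have "\<dots> = ennreal (4 * ?d\<^sup>2)" using d0 by (simp add: ennreal_mult[symmetric] power2_eq_square)
      also have "\<dots> \<le> ennreal (6 * (pi * (?d/2)\<^sup>2))"
      proof (rule ennreal_leI)
        have "4 * ?d\<^sup>2 \<le> (6 * 3) / 4 * ?d\<^sup>2" by simp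
        also have "\<dots> \<le> (6 * pi) / 4 * ?d\<^sup>2" using pi_gt3 by (intro mult_right_mono divide_right_mono) auto
        finally show "4 * ?d\<^sup>2 \<le> 6 * (pi * (?d/2)\<^sup>2)" by (simp add: power_divide)
      qed
      also have "\<dots> = 6 * hausdorff_weight 2 (E j)"
        by (simp add: hausdorff_weight_def unit_ball_vol_2 ennreal_mult)
      finally show ?thesis .
    qed (simp add: R_def)
    have "T A \<subseteq> (\<Union>j. R j)" using E(1) ER unfolding T_def by blast
    then have "emeasure ?M (T A) \<le> emeasure ?M (\<Union>j. R j)" using R by (intro emeasure_mono) auto
    also have "\<dots> \<le> (\<Sum>j. emeasure ?M (R j))" by (rule emeasure_subadditive_countably) (use R in auto)
    also have "\<dots> \<le> (\<Sum>j. 6 * hausdorff_weight 2 (E j))" by (intro suminf_le Rm) auto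
    also have "\<dots> = 6 * (\<Sum>j. hausdorff_weight 2 (E j))" by simp
    finally show "emeasure ?M (T A) / 6 \<le> (\<Sum>j. hausdorff_weight 2 (E j))"
      by (intro divide_le_posI_ennreal) auto
  qed
  also have "\<dots> \<le> hausdorff 2 A" by (rule hausdorff_content_le_hausdorff) simp
  finally have "emeasure ?M (T A) / 6 * 6 \<le> hausdorff 2 A * 6" by (rule mult_right_mono) simp
  moreover have "emeasure ?M (T A) / 6 * 6 = emeasure ?M (T A)"
    by (subst ennreal_divide_times) (simp add: ennreal_divide_self)
  ultimately show ?thesis by (simp add: T_def mult.commute)
qed

text \<open>The estimate for Borel sets is an inequality between measures, the image of planar
  Lebesgue measure and six times Hausdorff measure; integrals inherit it and Tonelli's theorem
  rewrites the left side.\<close>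

lemma nn_integral_plane_line_le:
  fixes f :: "complex \<Rightarrow> ennreal"
  assumes f [measurable]: "f \<in> borel_measurable borel"
  shows "(\<integral>\<^sup>+c. \<integral>\<^sup>+t. f (plane_line h c t) \<partial>lborel \<partial>lborel) \<le> 6 * (\<integral>\<^sup>+z. f z \<partial>hausdorff_measure 2)"
proof -
  let ?M = "lborel \<Otimes>\<^sub>M lborel :: (real \<times> real) measure"
  let ?T = "\<lambda>p::real \<times> real. plane_line h (fst p) (snd p)"
  have T [measurable]: "?T \<in> ?M \<rightarrow>\<^sub>M borel"
    using plane_line_measurable[of h] by (simp cong: measurable_cong_sets)
  let ?H = "scale_measure 6 (hausdorff_measure 2 :: complex measure)"
  have le: "distr ?M borel ?T \<le> ?H"
  proof (rule le_measure[THEN iffD2])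
    show "sets (distr ?M borel ?T) = sets ?H" by simp
    show "\<forall>A\<in>sets (distr ?M borel ?T). emeasure (distr ?M borel ?T) A \<le> emeasure ?H A"
    proof
      fix A assume "A \<in> sets (distr ?M borel ?T)"
      then have A: "A \<in> sets borel" by simp
      have "emeasure (distr ?M borel ?T) A = emeasure ?M {p. ?T p \<in> A}"
        using A T by (subst emeasure_distr) (auto simp: vimage_def space_pair_measure)
      then show "emeasure (distr ?M borel ?T) A \<le> emeasure ?H A"
        using emeasure_plane_line_le[OF A, of h] A by (simp add: emeasure_hausdorff_measure)
    qed
  qed
  have "(\<integral>\<^sup>+c. \<integral>\<^sup>+t. f (plane_line h c t) \<partial>lborel \<partial>lborel) = (\<integral>\<^sup>+p. f (?T p) \<partial>?M)"
    by (subst lborel.nn_integral_fst[symmetric]) auto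
  also have "\<dots> = (\<integral>\<^sup>+z. f z \<partial>distr ?M borel ?T)" by (simp add: nn_integral_distr)
  also have "\<dots> \<le> (\<integral>\<^sup>+z. f z \<partial>?H)" using le by (intro nn_integral_mono_measure) auto
  also have "\<dots> = 6 * (\<integral>\<^sup>+z. f z \<partial>hausdorff_measure 2)"
    by (subst nn_integral_scale_measure) (simp_all cong: measurable_cong_sets)
  finally show ?thesis .
qed

section \<open>Sums over sets of disks\<close>

text \<open>Common form of sums along a path and of energies over the disks meeting a set.
  Divergence is the value \<infinity>, and negative terms count as 0 because of
  \<open>ennreal\<close>.\<close>

definition disk_sum :: "(nat \<Rightarrow> real) \<Rightarrow> nat set \<Rightarrow> ennreal" where
  "disk_sum \<rho> J = (\<Sum>i. ennreal (\<rho> i) * indicator J i)"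

lemma sum_along_eq_disk_sum: "sum_along Q \<rho> \<gamma> = disk_sum \<rho> (meeting Q (path_trace \<gamma>))"
  by (simp add: sum_along_def disk_sum_def infsum_ennreal_eq_suminf)

lemma infsum_UNIV_eq_suminf: "(\<Sum>\<^sub>\<infinity>i\<in>UNIV. f i) = (\<Sum>i. f i)" for f :: "nat \<Rightarrow> ennreal"
  by (simp add: infsum_ennreal_eq_suminf)

lemma disk_sum_mono:
  assumes "\<And>i. i \<in> J \<Longrightarrow> \<rho> i \<le> \<tau> i" "J \<subseteq> K"
  shows "disk_sum \<rho> J \<le> disk_sum \<tau> K"
  unfolding disk_sum_def using assms
  by (intro suminf_le) (auto intro: ennreal_leI simp: indicator_def)

lemma disk_sum_subset: "J \<subseteq> K \<Longrightarrow> disk_sum \<rho> J \<le> disk_sum \<rho> K"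
  by (rule disk_sum_mono) auto

lemma disk_sum_cmult: "0 \<le> c \<Longrightarrow> disk_sum (\<lambda>i. c * \<rho> i) J = ennreal c * disk_sum \<rho> J"
  unfolding disk_sum_def by (subst ennreal_suminf_cmult[symmetric]) (simp add: ennreal_mult' mult.assoc)

lemma disk_sum_add:
  assumes "\<And>i. i \<in> J \<Longrightarrow> 0 \<le> \<rho> i" "\<And>i. i \<in> J \<Longrightarrow> 0 \<le> \<tau> i"
  shows "disk_sum (\<lambda>i. \<rho> i + \<tau> i) J = disk_sum \<rho> J + disk_sum \<tau> J"
  unfolding disk_sum_def using assms
  by (subst suminf_add) (auto intro!: suminf_cong simp: indicator_def)

lemma disk_sum_Un_disjoint: "J \<inter> K = {} \<Longrightarrow> disk_sum \<rho> (J \<union> K) = disk_sum \<rho> J + disk_sum \<rho> K"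
  unfolding disk_sum_def
  by (subst suminf_add) (auto intro!: suminf_cong simp: indicator_def)

lemma disk_sum_Un_le: "disk_sum \<rho> (J \<union> K) \<le> disk_sum \<rho> J + disk_sum \<rho> K"
proof -
  have "disk_sum \<rho> (J \<union> K) = disk_sum \<rho> J + disk_sum \<rho> (K - J)"
    using disk_sum_Un_disjoint[of J "K - J" \<rho>] by simp
  then show ?thesis using disk_sum_subset[of "K - J" K \<rho>] by (simp add: add_left_mono)
qed

lemma disk_sum_finite: "finite F \<Longrightarrow> disk_sum \<rho> F = (\<Sum>i\<in>F. ennreal (\<rho> i))"
  unfolding disk_sum_def by (subst suminf_finite[of F]) auto

lemma disk_sum_empty [simp]: "disk_sum \<rho> {} = 0"
  by (simp add: disk_sum_def)

lemma disk_sum_upper: "i \<in> J \<Longrightarrow> ennreal (\<rho> i) \<le> disk_sum \<rho> J"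
  using disk_sum_subset[of "{i}" J \<rho>] by (simp add: disk_sum_finite)

lemma disk_sum_insert: "i \<notin> J \<Longrightarrow> disk_sum \<rho> (insert i J) = ennreal (\<rho> i) + disk_sum \<rho> J"
  using disk_sum_Un_disjoint[of "{i}" J \<rho>] by (simp add: disk_sum_finite)

lemma disk_sum_infinite:
  assumes "infinite J" "0 < c" "\<And>i. i \<in> J \<Longrightarrow> c \<le> \<rho> i"
  shows "disk_sum \<rho> J = \<infinity>"
proof -
  have "(\<Sum>\<^sub>\<infinity>i\<in>J. ennreal (\<rho> i)) = \<infinity>"
    using assms by (intro infsum_superconst_infinite_ennreal[of _ "ennreal c"]) (auto intro: ennreal_leI)
  then show ?thesis by (simp add: disk_sum_def infsum_ennreal_eq_suminf)
qed

lemma disk_sum_tail: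
  assumes "disk_sum \<rho> J < \<infinity>" "0 < (e::real)"
  obtains n where "disk_sum \<rho> (J - {..<n}) < ennreal e"
proof -
  let ?f = "\<lambda>i. ennreal (\<rho> i) * indicator J i"
  have fin: "suminf ?f < top" using assms(1) by (simp add: disk_sum_def)
  have "(\<lambda>n. \<Sum>k<n. ?f k) \<longlonglongrightarrow> suminf ?f" by (intro summable_LIMSEQ) auto
  then have "(\<lambda>n. suminf ?f - (\<Sum>k<n. ?f k)) \<longlonglongrightarrow> suminf ?f - suminf ?f"
    using fin by (intro tendsto_diff_ennreal tendsto_const) (auto simp: less_top)
  then have "eventually (\<lambda>n. suminf ?f - (\<Sum>k<n. ?f k) < ennreal e) sequentially"
    using assms(2) fin by (intro order_tendstoD(2)) (auto simp: less_top)
  then obtain n where n: "suminf ?f - (\<Sum>k<n. ?f k) < ennreal e"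
    by (auto simp: eventually_sequentially)
  have 1: "suminf ?f = disk_sum \<rho> (J \<inter> {..<n}) + disk_sum \<rho> (J - {..<n})"
    using disk_sum_Un_disjoint[of "J \<inter> {..<n}" "J - {..<n}" \<rho>] by (simp add: disk_sum_def Int_Diff_Un Int_Diff_disjoint)
  have "disk_sum \<rho> (J \<inter> {..<n}) = (\<Sum>k<n. ?f k)"
    unfolding disk_sum_def by (subst suminf_finite[of "{..<n}"]) (auto simp: indicator_def intro!: sum.cong)
  moreover have "(\<Sum>k<n. ?f k) \<noteq> top"
    using fin sum_le_suminf[of ?f "{..<n}"] by (auto simp: top_unique less_top[symmetric])
  ultimately have "suminf ?f - (\<Sum>k<n. ?f k) = disk_sum \<rho> (J - {..<n})"
    unfolding 1 by (simp add: less_top)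
  then show ?thesis using n that by simp
qed

text \<open>Serves the countable subadditivity of \<open>mod2\<close>: the pointwise supremum of
  functions admissible for the single families is admissible for their union, and its energy is at
  most the sum of the energies. The supremum avoids square roots in \<open>ennreal\<close>.\<close>

lemma square_SUP_le_suminf:
  fixes f :: "nat \<Rightarrow> ennreal"
  shows "(SUP n. f n)\<^sup>2 \<le> (\<Sum>n. (f n)\<^sup>2)"
proof -
  have le: "(f n)\<^sup>2 \<le> (\<Sum>n. (f n)\<^sup>2)" for n
    using sum_le_suminf[of "\<lambda>n. (f n)\<^sup>2" "{n}"] by simp
  have "f n * f m \<le> (\<Sum>n. (f n)\<^sup>2)" for n m
  proof (cases "f n \<le> f m")
    case True
    then have "f n * f m \<le> (f m)\<^sup>2" unfolding power2_eq_square by (intro mult_right_mono) auto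
    then show ?thesis using le order_trans by blast
  next
    case False
    then have "f n * f m \<le> (f n)\<^sup>2" unfolding power2_eq_square by (intro mult_left_mono) auto
    then show ?thesis using le order_trans by blast
  qed
  then show ?thesis
    by (auto simp: power2_eq_square SUP_mult_left_ennreal SUP_mult_right_ennreal intro!: SUP_least)
qed

lemma suminf_swap_ennreal:
  fixes f :: "nat \<Rightarrow> nat \<Rightarrow> ennreal"
  shows "(\<Sum>i. \<Sum>n. f n i) = (\<Sum>n. \<Sum>i. f n i)"
  using nn_integral_suminf[of f "count_space UNIV"] by (simp add: nn_integral_count_space_nat)

lemma suminf_half_power: "(\<Sum>n. ennreal (e * (1/2) ^ Suc n)) = ennreal e" if "0 \<le> e" for e :: real
  using that power_half_series sums_mult[OF power_half_series, of e]
  by (intro suminf_ennreal_eq) auto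

subsection \<open>Exceptional path families\<close>

text \<open>The paths that admissible sequences may ignore, for both versions of the modulus.\<close>

definition negl_paths ::
    "modulus_version \<Rightarrow> complex set \<Rightarrow> (nat \<Rightarrow> complex set) \<Rightarrow> plane_path set \<Rightarrow> bool" where
  "negl_paths v \<Omega> Q \<Gamma> \<longleftrightarrow>
     (case v of Weak \<Rightarrow> mod2 \<Gamma> = 0
      | Strong \<Rightarrow> (\<forall>\<gamma>\<in>\<Gamma>. hausdorff 1 (path_trace \<gamma> \<inter> carpet \<Omega> Q) \<noteq> 0))"

definition exceptional ::
    "modulus_version \<Rightarrow> complex set \<Rightarrow> (nat \<Rightarrow> complex set) \<Rightarrow> plane_path set \<Rightarrow> bool" where
  "exceptional v \<Omega> Q \<Gamma> \<longleftrightarrow> carpet_modulus v \<Omega> Q \<Gamma> = 0"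

lemma INF_ennreal_zero_iff:
  fixes f :: "'a \<Rightarrow> ennreal"
  shows "(INF x\<in>A. f x) = 0 \<longleftrightarrow> (\<forall>e>0. \<exists>x\<in>A. f x < ennreal e)"
proof
  assume "(INF x\<in>A. f x) = 0"
  then show "\<forall>e>0. \<exists>x\<in>A. f x < ennreal e" by (auto simp flip: INF_less_iff)
next
  assume *: "\<forall>e>0. \<exists>x\<in>A. f x < ennreal e"
  have "(INF x\<in>A. f x) \<le> 0"
  proof (rule ennreal_le_epsilon)
    fix e :: real assume "0 < e"
    then show "(INF x\<in>A. f x) \<le> 0 + ennreal e"
      using * by (auto intro: INF_lower2 less_imp_le)
  qed
  then show "(INF x\<in>A. f x) = 0" by simp
qed

lemma mod2_zero_iff:
  "mod2 \<Gamma> = 0 \<longleftrightarrow> (\<forall>e>0. \<exists>l\<in>borel_measurable borel. (\<forall>\<gamma>\<in>\<Gamma>. 1 \<le> path_integral l \<gamma>) \<and>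
     (\<integral>\<^sup>+z. (l z)\<^sup>2 \<partial>hausdorff_measure 2) < ennreal e)"
  unfolding mod2_def INF_ennreal_zero_iff by auto

text \<open>Both moduli vanish under the same condition up to the class of paths that may be
  ignored. For the strong modulus the ignored family can be taken to be all paths of the family
  whose part in the carpet has positive length.\<close>

lemma exceptional_iff:
  "exceptional v \<Omega> Q \<Gamma> \<longleftrightarrow>
     (\<forall>e>0. \<exists>\<tau>. (\<forall>i. 0 \<le> \<tau> i) \<and> (\<Sum>i. ennreal ((\<tau> i)\<^sup>2)) < ennreal e \<and>
        (\<exists>\<Gamma>0\<subseteq>\<Gamma>. negl_paths v \<Omega> Q \<Gamma>0 \<and> (\<forall>\<gamma>\<in>\<Gamma> - \<Gamma>0. 1 \<le> sum_along Q \<tau> \<gamma>)))"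
proof (cases v)
  case Weak
  show ?thesis
    unfolding exceptional_def Weak carpet_modulus.simps mod_w_def INF_ennreal_zero_iff weak_admissible_def
      negl_paths_def modulus_version.case infsum_UNIV_eq_suminf Bex_def mem_Collect_eq
    by (intro all_cong1 imp_cong refl ex_cong1 iffI; elim conjE; intro conjI; assumption)
next
  case Strong
  have *: "(\<exists>\<Gamma>0\<subseteq>\<Gamma>. (\<forall>\<gamma>\<in>\<Gamma>0. hausdorff 1 (path_trace \<gamma> \<inter> carpet \<Omega> Q) \<noteq> 0) \<and> (\<forall>\<gamma>\<in>\<Gamma> - \<Gamma>0. 1 \<le> sum_along Q \<tau> \<gamma>)) \<longleftrightarrow>
    (\<forall>\<gamma>\<in>\<Gamma>. hausdorff 1 (path_trace \<gamma> \<inter> carpet \<Omega> Q) = 0 \<longrightarrow> 1 \<le> sum_along Q \<tau> \<gamma>)" for \<tau>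
  proof
    assume R: "\<forall>\<gamma>\<in>\<Gamma>. hausdorff 1 (path_trace \<gamma> \<inter> carpet \<Omega> Q) = 0 \<longrightarrow> 1 \<le> sum_along Q \<tau> \<gamma>"
    show "\<exists>\<Gamma>0\<subseteq>\<Gamma>. (\<forall>\<gamma>\<in>\<Gamma>0. hausdorff 1 (path_trace \<gamma> \<inter> carpet \<Omega> Q) \<noteq> 0) \<and> (\<forall>\<gamma>\<in>\<Gamma> - \<Gamma>0. 1 \<le> sum_along Q \<tau> \<gamma>)"
      using R by (intro exI[of _ "{\<gamma>\<in>\<Gamma>. hausdorff 1 (path_trace \<gamma> \<inter> carpet \<Omega> Q) \<noteq> 0}"]) auto
  qed blast
  show ?thesis
    unfolding exceptional_def Strong negl_paths_def modulus_version.case * carpet_modulus.simps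
      mod_s_def INF_ennreal_zero_iff strong_admissible_def infsum_UNIV_eq_suminf Bex_def mem_Collect_eq
    by (intro all_cong1 imp_cong refl ex_cong1 iffI; elim conjE; intro conjI; assumption)
qed

lemma path_integral_mono: "(\<And>z. l z \<le> l' z) \<Longrightarrow> path_integral l \<gamma> \<le> path_integral l' \<gamma>"
  unfolding path_integral_def by (auto intro!: SUP_mono' nn_integral_mono mult_right_mono)

lemma path_integral_subpath: "subpath_of \<gamma>' \<gamma> \<Longrightarrow> path_integral l \<gamma>' \<le> path_integral l \<gamma>"
  unfolding path_integral_def subpath_of_def locally_rectifiable_def
  by (auto intro!: SUP_subset_mono)

lemma path_trace_subpath: "subpath_of \<gamma>' \<gamma> \<Longrightarrow> path_trace \<gamma>' \<subseteq> path_trace \<gamma>"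
  by (auto simp: subpath_of_def path_trace_def)

lemma meeting_mono: "A \<subseteq> B \<Longrightarrow> meeting Q A \<subseteq> meeting Q B"
  by (auto simp: meeting_def)

lemma negl_paths_subset:
  assumes "negl_paths v \<Omega> Q \<Gamma>'" "\<Gamma> \<subseteq> \<Gamma>'"
  shows "negl_paths v \<Omega> Q \<Gamma>"
proof (cases v)
  case Weak
  have "mod2 \<Gamma>' = 0" using assms Weak by (simp add: negl_paths_def)
  then have "mod2 \<Gamma> = 0" unfolding mod2_zero_iff using assms(2) by (meson subsetD)
  then show ?thesis by (simp add: negl_paths_def Weak)
next
  case Strong
  then show ?thesis using assms by (auto simp: negl_paths_def)
qed

lemma negl_paths_UN:
  assumes "\<And>n::nat. negl_paths v \<Omega> Q (\<Gamma> n)"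
  shows "negl_paths v \<Omega> Q (\<Union>n. \<Gamma> n)"
proof (cases v)
  case Weak
  have "mod2 (\<Union>n. \<Gamma> n) = 0"
    unfolding mod2_zero_iff
  proof (intro allI impI)
    fix e :: real assume e: "0 < e"
    \<comment> \<open>The additional factor 1/2 makes the bounds sum to \<open>e / 2\<close>, which
      keeps the final inequality strict.\<close>
    have "\<exists>l\<in>borel_measurable borel. (\<forall>\<gamma>\<in>\<Gamma> n. 1 \<le> path_integral l \<gamma>) \<and>
        (\<integral>\<^sup>+z. (l z)\<^sup>2 \<partial>hausdorff_measure 2) < ennreal (e / 2 * (1/2) ^ Suc n)" for n
    proof -
      have "mod2 (\<Gamma> n) = 0" "0 < e / 2 * (1/2) ^ Suc n"
        using assms[of n] e by (auto simp: negl_paths_def Weak)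
      then show ?thesis unfolding mod2_zero_iff by blast
    qed
    then obtain l where l: "\<And>n. l n \<in> borel_measurable borel" "\<And>n \<gamma>. \<gamma> \<in> \<Gamma> n \<Longrightarrow> 1 \<le> path_integral (l n) \<gamma>"
        "\<And>n. (\<integral>\<^sup>+z. (l n z)\<^sup>2 \<partial>hausdorff_measure 2) < ennreal (e / 2 * (1/2) ^ Suc n)"
      by metis
    note l(1)[measurable]
    have lH: "(\<lambda>z. (l n z)\<^sup>2) \<in> borel_measurable (hausdorff_measure 2)" for n
      by (simp cong: measurable_cong_sets)
    define L where "L z = (SUP n. l n z)" for z
    have "L \<in> borel_measurable borel" unfolding L_def by measurable
    moreover have "1 \<le> path_integral L \<gamma>" if g: "\<gamma> \<in> (\<Union>n. \<Gamma> n)" for \<gamma>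
    proof -
      obtain n where n: "\<gamma> \<in> \<Gamma> n" using g by blast
      have "path_integral (l n) \<gamma> \<le> path_integral L \<gamma>"
        by (rule path_integral_mono) (auto simp: L_def intro: SUP_upper)
      then show ?thesis using l(2)[OF n] by (rule order_trans[rotated])
    qed
    moreover have "(\<integral>\<^sup>+z. (L z)\<^sup>2 \<partial>hausdorff_measure 2) < ennreal e"
    proof -
      have "(\<integral>\<^sup>+z. (L z)\<^sup>2 \<partial>hausdorff_measure 2) \<le> (\<integral>\<^sup>+z. (\<Sum>n. (l n z)\<^sup>2) \<partial>hausdorff_measure 2)"
        unfolding L_def by (intro nn_integral_mono square_SUP_le_suminf)
      also have "\<dots> = (\<Sum>n. \<integral>\<^sup>+z. (l n z)\<^sup>2 \<partial>hausdorff_measure 2)" by (intro nn_integral_suminf lH)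
      also have "\<dots> \<le> (\<Sum>n. ennreal (e / 2 * (1/2) ^ Suc n))"
        by (intro suminf_le less_imp_le[OF l(3)]) auto
      also have "\<dots> = ennreal (e / 2)" using e by (intro suminf_half_power) simp
      also have "\<dots> < ennreal e" using e by (simp add: ennreal_less_iff)
      finally show ?thesis .
    qed
    ultimately show "\<exists>l\<in>borel_measurable borel. (\<forall>\<gamma>\<in>\<Union>n. \<Gamma> n. 1 \<le> path_integral l \<gamma>) \<and>
        (\<integral>\<^sup>+z. (l z)\<^sup>2 \<partial>hausdorff_measure 2) < ennreal e" by blast
  qed
  then show ?thesis by (simp add: negl_paths_def Weak)
next
  case Strong
  then show ?thesis using assms by (auto simp: negl_paths_def)
qed

lemma exceptional_subset:
  assumes "exceptional v \<Omega> Q \<Gamma>'" "\<Gamma> \<subseteq> \<Gamma>'"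
  shows "exceptional v \<Omega> Q \<Gamma>"
  unfolding exceptional_iff
proof (intro allI impI)
  fix e :: real assume "0 < e"
  then obtain \<tau> \<Gamma>0 where *: "\<forall>i. 0 \<le> \<tau> i" "(\<Sum>i. ennreal ((\<tau> i)\<^sup>2)) < ennreal e" "\<Gamma>0\<subseteq>\<Gamma>'"
      "negl_paths v \<Omega> Q \<Gamma>0" "\<forall>\<gamma>\<in>\<Gamma>' - \<Gamma>0. 1 \<le> sum_along Q \<tau> \<gamma>"
    using assms(1) unfolding exceptional_iff by meson
  have "negl_paths v \<Omega> Q (\<Gamma>0 \<inter> \<Gamma>)" using *(4) by (rule negl_paths_subset) auto
  then show "\<exists>\<tau>. (\<forall>i. 0 \<le> \<tau> i) \<and> (\<Sum>i. ennreal ((\<tau> i)\<^sup>2)) < ennreal e \<and>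
        (\<exists>\<Gamma>0\<subseteq>\<Gamma>. negl_paths v \<Omega> Q \<Gamma>0 \<and> (\<forall>\<gamma>\<in>\<Gamma> - \<Gamma>0. 1 \<le> sum_along Q \<tau> \<gamma>))"
    using * assms(2) by (intro exI[of _ \<tau>] conjI exI[of _ "\<Gamma>0 \<inter> \<Gamma>"]) auto
qed

text \<open>The square root \<sigma> of the sum over \<open>n\<close> of the squares of \<tau>
  \<open>n\<close> dominates each \<tau> \<open>n\<close>, so it is admissible for all families at
  once, and its energy is the sum of their energies.\<close>

lemma exceptional_UN:
  assumes "\<And>n::nat. exceptional v \<Omega> Q (\<Gamma> n)"
  shows "exceptional v \<Omega> Q (\<Union>n. \<Gamma> n)"
  unfolding exceptional_iff
proof (intro allI impI)
  fix e :: real assume e: "0 < e"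
  have "\<exists>\<tau> \<Gamma>0. (\<forall>i. 0 \<le> \<tau> i) \<and> (\<Sum>i. ennreal ((\<tau> i)\<^sup>2)) < ennreal (e / 2 * (1/2) ^ Suc n) \<and>
        \<Gamma>0\<subseteq>\<Gamma> n \<and> negl_paths v \<Omega> Q \<Gamma>0 \<and> (\<forall>\<gamma>\<in>\<Gamma> n - \<Gamma>0. 1 \<le> sum_along Q \<tau> \<gamma>)" for n
  proof -
    have "0 < e / 2 * (1/2) ^ Suc n" using e by simp
    then show ?thesis using assms[of n] unfolding exceptional_iff by meson
  qed
  then obtain \<tau> \<Gamma>0 where \<tau>: "\<And>n i. 0 \<le> \<tau> n i" "\<And>n. (\<Sum>i. ennreal ((\<tau> n i)\<^sup>2)) < ennreal (e / 2 * (1/2) ^ Suc n)"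
      and \<Gamma>0: "\<And>n. \<Gamma>0 n\<subseteq>\<Gamma> n" "\<And>n. negl_paths v \<Omega> Q (\<Gamma>0 n)" "\<And>n \<gamma>. \<gamma>\<in>\<Gamma> n - \<Gamma>0 n \<Longrightarrow> 1 \<le> sum_along Q (\<tau> n) \<gamma>"
    by metis
  define s where "s i = (\<Sum>n. ennreal ((\<tau> n i)\<^sup>2))" for i
  define \<sigma> where "\<sigma> i = sqrt (enn2real (s i))" for i
  have "(\<Sum>i. s i) = (\<Sum>n. \<Sum>i. ennreal ((\<tau> n i)\<^sup>2))" unfolding s_def by (rule suminf_swap_ennreal)
  also have "\<dots> \<le> (\<Sum>n. ennreal (e / 2 * (1/2) ^ Suc n))"
    by (intro suminf_le less_imp_le[OF \<tau>(2)]) auto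
  also have "\<dots> = ennreal (e / 2)" using e by (intro suminf_half_power) simp
  also have "\<dots> < ennreal e" using e by (simp add: ennreal_less_iff)
  finally have s: "(\<Sum>i. s i) < ennreal e" .
  have "s i \<le> (\<Sum>i. s i)" for i using sum_le_suminf[of s "{i}"] by simp
  then have sfin: "s i < top" for i using le_less_trans[OF _ less_trans[OF s ennreal_less_top]] by blast
  have \<sigma>2: "ennreal ((\<sigma> i)\<^sup>2) = s i" for i using sfin[of i] by (simp add: \<sigma>_def)
  have "\<tau> n i \<le> \<sigma> i" for n i
  proof -
    have "(\<Sum>m\<in>{n}. ennreal ((\<tau> m i)\<^sup>2)) \<le> s i"
      unfolding s_def by (rule sum_le_suminf) auto
    also have "\<dots> = ennreal ((\<sigma> i)\<^sup>2)" by (rule \<sigma>2[symmetric])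
    finally have "ennreal ((\<tau> n i)\<^sup>2) \<le> ennreal ((\<sigma> i)\<^sup>2)" by (simp only: sum.insert sum.empty finite.emptyI empty_iff not_False_eq_True add_0_right)
    then have "(\<tau> n i)\<^sup>2 \<le> (\<sigma> i)\<^sup>2" by (subst (asm) ennreal_le_iff) auto
    then show ?thesis by (rule power2_le_imp_le) (simp add: \<sigma>_def)
  qed
  then have le: "sum_along Q (\<tau> n) \<gamma> \<le> sum_along Q \<sigma> \<gamma>" for n \<gamma>
    unfolding sum_along_eq_disk_sum by (intro disk_sum_mono) auto
  show "\<exists>\<tau>. (\<forall>i. 0 \<le> \<tau> i) \<and> (\<Sum>i. ennreal ((\<tau> i)\<^sup>2)) < ennreal e \<and>
        (\<exists>\<Gamma>0\<subseteq>(\<Union>n. \<Gamma> n). negl_paths v \<Omega> Q \<Gamma>0 \<and> (\<forall>\<gamma>\<in>(\<Union>n. \<Gamma> n) - \<Gamma>0. 1 \<le> sum_along Q \<tau> \<gamma>))"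
  proof (intro exI[of _ \<sigma>] conjI exI[of _ "\<Union>n. \<Gamma>0 n"] allI ballI)
    show "(\<Sum>i. ennreal ((\<sigma> i)\<^sup>2)) < ennreal e" using s by (simp add: \<sigma>2)
    show "negl_paths v \<Omega> Q (\<Union>n. \<Gamma>0 n)" using \<Gamma>0(2) by (rule negl_paths_UN)
    fix \<gamma> assume "\<gamma> \<in> (\<Union>n. \<Gamma> n) - (\<Union>n. \<Gamma>0 n)"
    then obtain n where "\<gamma> \<in> \<Gamma> n - \<Gamma>0 n" by blast
    from order_trans[OF \<Gamma>0(3)[OF this] le] show "1 \<le> sum_along Q \<sigma> \<gamma>" .
  qed (use \<Gamma>0(1) in \<open>auto simp: \<sigma>_def\<close>)
qed

lemma exceptional_Un:
  assumes "exceptional v \<Omega> Q \<Gamma>" "exceptional v \<Omega> Q \<Gamma>'"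
  shows "exceptional v \<Omega> Q (\<Gamma> \<union> \<Gamma>')"
proof -
  have "exceptional v \<Omega> Q (\<Union>n::nat. if n = 0 then \<Gamma> else \<Gamma>')"
    using assms by (intro exceptional_UN) auto
  then show ?thesis by (rule exceptional_subset) (auto split: if_splits)
qed

lemma negl_paths_exceptional: "negl_paths v \<Omega> Q \<Gamma> \<Longrightarrow> exceptional v \<Omega> Q \<Gamma>"
  unfolding exceptional_iff by (auto intro!: exI[of _ "\<lambda>_. 0"] exI[of _ \<Gamma>])

text \<open>The upper gradient inequality is known for a path as a whole but is applied to its
  subpaths. Discarding every path that has a bad subpath makes this legitimate, provided the
  enlarged family is still exceptional.\<close>

definition superpaths :: "plane_path set \<Rightarrow> plane_path set" where
  "superpaths \<Gamma> = {\<gamma>. \<exists>\<gamma>'\<in>\<Gamma>. subpath_of \<gamma>' \<gamma>}"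

lemma negl_superpaths:
  assumes "negl_paths v \<Omega> Q \<Gamma>"
  shows "negl_paths v \<Omega> Q (superpaths \<Gamma>)"
proof (cases v)
  case Weak
  have "mod2 \<Gamma> = 0" using assms by (simp add: negl_paths_def Weak)
  then have "\<exists>l\<in>borel_measurable borel. (\<forall>\<gamma>\<in>superpaths \<Gamma>. 1 \<le> path_integral l \<gamma>) \<and>
     (\<integral>\<^sup>+z. (l z)\<^sup>2 \<partial>hausdorff_measure 2) < ennreal e" if e: "0 < e" for e
  proof -
    obtain l where l: "l \<in> borel_measurable borel" "\<forall>\<gamma>\<in>\<Gamma>. 1 \<le> path_integral l \<gamma>"
      "(\<integral>\<^sup>+z. (l z)\<^sup>2 \<partial>hausdorff_measure 2) < ennreal e"
      using \<open>mod2 \<Gamma> = 0\<close> e unfolding mod2_zero_iff by blast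
    have "1 \<le> path_integral l \<gamma>" if g: "\<gamma> \<in> superpaths \<Gamma>" for \<gamma>
    proof -
      obtain \<gamma>' where "\<gamma>' \<in> \<Gamma>" "subpath_of \<gamma>' \<gamma>" using g unfolding superpaths_def by blast
      then show ?thesis using l(2) path_integral_subpath order_trans by blast
    qed
    then show ?thesis using l by blast
  qed
  then have "mod2 (superpaths \<Gamma>) = 0" unfolding mod2_zero_iff by blast
  then show ?thesis by (simp add: negl_paths_def Weak)
next
  case Strong
  show ?thesis unfolding negl_paths_def Strong modulus_version.case
  proof
    fix \<gamma> assume "\<gamma> \<in> superpaths \<Gamma>"
    then obtain \<gamma>' where \<gamma>': "\<gamma>' \<in> \<Gamma>" "subpath_of \<gamma>' \<gamma>" unfolding superpaths_def by blast
    then have "hausdorff 1 (path_trace \<gamma>' \<inter> carpet \<Omega> Q) \<le> hausdorff 1 (path_trace \<gamma> \<inter> carpet \<Omega> Q)"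
      using path_trace_subpath by (intro hausdorff_mono) blast
    then show "hausdorff 1 (path_trace \<gamma> \<inter> carpet \<Omega> Q) \<noteq> 0"
      using assms \<gamma>'(1) by (auto simp: negl_paths_def Strong)
  qed
qed

text \<open>A longer path meets more disks and has larger path integrals and a larger part in the
  carpet, so whatever was admissible for the subpaths remains admissible.\<close>

lemma exceptional_superpaths:
  assumes "exceptional v \<Omega> Q \<Gamma>"
  shows "exceptional v \<Omega> Q (superpaths \<Gamma>)"
  unfolding exceptional_iff
proof (intro allI impI)
  fix e :: real assume "0 < e"
  then obtain \<tau> \<Gamma>0 where *: "\<forall>i. 0 \<le> \<tau> i" "(\<Sum>i. ennreal ((\<tau> i)\<^sup>2)) < ennreal e" "\<Gamma>0\<subseteq>\<Gamma>"
      "negl_paths v \<Omega> Q \<Gamma>0" "\<forall>\<gamma>\<in>\<Gamma> - \<Gamma>0. 1 \<le> sum_along Q \<tau> \<gamma>"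
    using assms(1) unfolding exceptional_iff by meson
  show "\<exists>\<tau>. (\<forall>i. 0 \<le> \<tau> i) \<and> (\<Sum>i. ennreal ((\<tau> i)\<^sup>2)) < ennreal e \<and>
        (\<exists>\<Gamma>0\<subseteq>superpaths \<Gamma>. negl_paths v \<Omega> Q \<Gamma>0 \<and> (\<forall>\<gamma>\<in>superpaths \<Gamma> - \<Gamma>0. 1 \<le> sum_along Q \<tau> \<gamma>))"
  proof (intro exI[of _ \<tau>] conjI exI[of _ "superpaths \<Gamma>0"] ballI)
    show "superpaths \<Gamma>0 \<subseteq> superpaths \<Gamma>" using *(3) by (auto simp: superpaths_def)
    show "negl_paths v \<Omega> Q (superpaths \<Gamma>0)" using *(4) by (rule negl_superpaths)
    fix \<gamma> assume "\<gamma> \<in> superpaths \<Gamma> - superpaths \<Gamma>0"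
    then obtain \<gamma>' where \<gamma>': "\<gamma>' \<in> \<Gamma> - \<Gamma>0" "subpath_of \<gamma>' \<gamma>" by (auto simp: superpaths_def)
    have "sum_along Q \<tau> \<gamma>' \<le> sum_along Q \<tau> \<gamma>"
      unfolding sum_along_eq_disk_sum by (intro disk_sum_subset meeting_mono path_trace_subpath \<gamma>'(2))
    then show "1 \<le> sum_along Q \<tau> \<gamma>" using *(5) \<gamma>'(1) by (meson order_trans)
  qed (use * in auto)
qed

text \<open>Every positive multiple of \<rho> restricted to \<open>J\<close> has infinite sum along
  these paths and is admissible, while its energy can be made as small as desired.\<close>

lemma exceptional_infinite_sum_on:
  assumes \<rho>: "\<And>i. 0 \<le> \<rho> i" and fin: "disk_sum (\<lambda>i. (\<rho> i)\<^sup>2) J < \<infinity>"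
  shows "exceptional v \<Omega> Q {\<gamma>. disk_sum \<rho> (meeting Q (path_trace \<gamma>) \<inter> J) = \<infinity>}"
  unfolding exceptional_iff
proof (intro allI impI)
  fix e :: real assume e: "0 < e"
  obtain A where A: "disk_sum (\<lambda>i. (\<rho> i)\<^sup>2) J = ennreal A" "0 \<le> A"
    using fin by (cases "disk_sum (\<lambda>i. (\<rho> i)\<^sup>2) J") auto
  \<comment> \<open>The denominator \<open>1 + A\<close> gives \<open>c^2 * A < e\<close> and
    remains positive when the energy \<open>A\<close> vanishes.\<close>
  define c where "c = sqrt (e / (1 + A))"
  have c: "0 < c" "c\<^sup>2 = e / (1 + A)" using e A(2) by (auto simp: c_def)
  define \<tau> where "\<tau> i = (if i \<in> J then c * \<rho> i else 0)" for i
  have "(\<Sum>i. ennreal ((\<tau> i)\<^sup>2)) = disk_sum (\<lambda>i. c\<^sup>2 * (\<rho> i)\<^sup>2) J"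
    unfolding disk_sum_def by (intro suminf_cong) (auto simp: \<tau>_def indicator_def power_mult_distrib)
  also have "\<dots> = ennreal (c\<^sup>2 * A)" using A c(1) by (simp add: disk_sum_cmult ennreal_mult)
  also have "c\<^sup>2 * A < e" unfolding c(2) using e A(2) by (simp add: field_simps)
  then have "ennreal (c\<^sup>2 * A) < ennreal e" using e by (simp add: ennreal_less_iff A(2))
  finally have 1: "(\<Sum>i. ennreal ((\<tau> i)\<^sup>2)) < ennreal e" .
  have 2: "sum_along Q \<tau> \<gamma> = ennreal c * disk_sum \<rho> (meeting Q (path_trace \<gamma>) \<inter> J)" for \<gamma>
    unfolding sum_along_eq_disk_sum disk_sum_cmult[OF less_imp_le[OF c(1)], symmetric]
    unfolding disk_sum_def by (intro suminf_cong) (auto simp: \<tau>_def indicator_def)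
  show "\<exists>\<tau>. (\<forall>i. 0 \<le> \<tau> i) \<and> (\<Sum>i. ennreal ((\<tau> i)\<^sup>2)) < ennreal e \<and>
        (\<exists>\<Gamma>0\<subseteq>{\<gamma>. disk_sum \<rho> (meeting Q (path_trace \<gamma>) \<inter> J) = \<infinity>}. negl_paths v \<Omega> Q \<Gamma>0 \<and>
         (\<forall>\<gamma>\<in>{\<gamma>. disk_sum \<rho> (meeting Q (path_trace \<gamma>) \<inter> J) = \<infinity>} - \<Gamma>0. 1 \<le> sum_along Q \<tau> \<gamma>))"
  proof (intro exI[of _ \<tau>] conjI exI[of _ "{}"] ballI allI)
    show "negl_paths v \<Omega> Q {}"
      by (auto simp: negl_paths_def mod2_zero_iff split: modulus_version.split intro!: bexI[of _ "\<lambda>_. 0"])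
  qed (use 1 2 \<rho> c(1) in \<open>auto simp: \<tau>_def ennreal_mult_top\<close>)
qed

subsection \<open>Arc length\<close>

text \<open>The inscribed polygon length occurring in \<open>arc_length\<close>, as a recursion on
  the list of times instead of a sum over positions, so that induction is available.\<close>

fun poly_length :: "(real \<Rightarrow> complex) \<Rightarrow> real list \<Rightarrow> ennreal" where
  "poly_length f (x # y # zs) = ennreal (dist (f x) (f y)) + poly_length f (y # zs)"
| "poly_length f _ = 0"

lemma sum_dist_eq_poly_length:
  "(\<Sum>k<length ts - 1. ennreal (dist (f (ts ! k)) (f (ts ! Suc k)))) = poly_length f ts"
proof (induction f ts rule: poly_length.induct)
  case (1 f x y zs)
  have "(\<Sum>k<length (x # y # zs) - 1. ennreal (dist (f ((x # y # zs) ! k)) (f ((x # y # zs) ! Suc k)))) =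
     (\<Sum>k<Suc (length (y # zs) - 1). ennreal (dist (f ((x # y # zs) ! k)) (f ((x # y # zs) ! Suc k))))"
    by simp
  also have "\<dots> = ennreal (dist (f x) (f y)) +
     (\<Sum>k<length (y # zs) - 1. ennreal (dist (f ((y # zs) ! k)) (f ((y # zs) ! Suc k))))"
    by (subst sum.lessThan_Suc_shift) simp
  finally show ?case using 1 by simp
qed auto

lemma arc_length_eq:
  "arc_length f a b = (SUP ts\<in>{ts. sorted ts \<and> set ts \<subseteq> {a..b}}. poly_length f ts)"
  by (simp only: arc_length_def sum_dist_eq_poly_length)

lemma poly_length_le_arc_length: "sorted ts \<Longrightarrow> set ts \<subseteq> {a..b} \<Longrightarrow> poly_length f ts \<le> arc_length f a b"
  unfolding arc_length_eq by (rule SUP_upper) simp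

lemma dist_le_arc_length:
  assumes "s \<in> {a..b}" "t \<in> {a..b}"
  shows "ennreal (dist (f s) (f t)) \<le> arc_length f a b"
proof (cases "s \<le> t")
  case True
  then show ?thesis using poly_length_le_arc_length[of "[s, t]" a b f] assms by simp
next
  case False
  then show ?thesis using poly_length_le_arc_length[of "[t, s]" a b f] assms by (simp add: dist_commute)
qed

lemma poly_length_Cons_ge: "poly_length f ts \<le> poly_length f (x # ts)"
  by (cases ts) auto

lemma poly_length_const: "\<forall>x\<in>set ts. x = t \<Longrightarrow> poly_length f ts = 0"
  by (induction f ts rule: poly_length.induct) auto

lemma poly_length_append_ge: "poly_length f ts + poly_length f us \<le> poly_length f (ts @ us)"
proof (induction f ts rule: poly_length.induct)
  case (1 f x y zs)
  then show ?case by (simp add: add.assoc add_left_mono)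
next
  case ("2_2" f x)
  then show ?case using poly_length_Cons_ge[of f us x] by simp
qed auto

lemma poly_length_Cons_Cons_le:
  "poly_length f (x # zs) \<le> ennreal (dist (f x) (f y)) + poly_length f (y # zs)"
proof (cases zs)
  case (Cons z us)
  have "ennreal (dist (f x) (f z)) \<le> ennreal (dist (f x) (f y)) + ennreal (dist (f y) (f z))"
    by (metis dist_triangle ennreal_leI ennreal_plus zero_le_dist)
  then show ?thesis using Cons by (simp add: add.assoc[symmetric] add_right_mono)
qed simp

text \<open>By the triangle inequality, inserting the time \<open>t\<close> between its neighbours
  cannot shorten the polygon. This is the nontrivial half of the additivity of arc length.\<close>

lemma poly_length_split:
  "sorted ts \<Longrightarrow> poly_length f ts \<le>
     poly_length f (filter (\<lambda>x. x \<le> t) ts @ [t]) + poly_length f (t # filter (\<lambda>x. t < x) ts)"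
proof (induction f ts rule: poly_length.induct)
  case (1 f x y zs)
  have s: "sorted (y # zs)" "x \<le> y" "\<forall>z\<in>set zs. y \<le> z" using 1(2) by auto
  consider "y \<le> t" | "x \<le> t" "t < y" | "t < x" by linarith
  then show ?case
  proof cases
    case 1
    then have "x \<le> t" using s by simp
    then show ?thesis using 1 "1.IH"[OF s(1)] by (simp add: add.assoc add_left_mono)
  next
    case 2
    have no: "filter (\<lambda>x. x \<le> t) zs = []" "filter (\<lambda>x. t < x) zs = zs"
      using 2 s(3) by (auto simp: filter_empty_conv filter_id_conv)
    have "poly_length f (x # y # zs) \<le> ennreal (dist (f x) (f t)) + poly_length f (t # y # zs)"
      by (rule poly_length_Cons_Cons_le)
    then show ?thesis using 2 no by simp
  next
    case 3
    have no: "filter (\<lambda>x. x \<le> t) zs = []" "filter (\<lambda>x. t < x) zs = zs"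
      using 3 s(2,3) by (auto simp: filter_empty_conv filter_id_conv)
    show ?thesis using 3 no s(2) poly_length_Cons_ge[of f "x # y # zs" t] by simp
  qed
qed auto

lemma arc_length_add:
  assumes "a \<le> t" "t \<le> b"
  shows "arc_length f a t + arc_length f t b = arc_length f a b"
proof (rule antisym)
  have "poly_length f ts + arc_length f t b \<le> arc_length f a b"
    if ts: "sorted ts" "set ts \<subseteq> {a..t}" for ts
  proof -
    have "poly_length f ts + poly_length f us \<le> arc_length f a b"
      if us: "sorted us" "set us \<subseteq> {t..b}" for us
    proof -
      have "poly_length f (ts @ us) \<le> arc_length f a b"
        using ts us assms by (intro poly_length_le_arc_length) (auto simp: sorted_append subset_iff intro: order_trans)
      then show ?thesis using poly_length_append_ge order_trans by blast
    qed
    then show ?thesis unfolding arc_length_eq[of f t b]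
      by (subst ennreal_SUP_add_right) (auto intro!: SUP_least exI[of _ "[]"])
  qed
  then show "arc_length f a t + arc_length f t b \<le> arc_length f a b"
    unfolding arc_length_eq[of f a t]
    by (subst ennreal_SUP_add_left[symmetric]) (auto intro!: SUP_least exI[of _ "[]"])
  show "arc_length f a b \<le> arc_length f a t + arc_length f t b"
    unfolding arc_length_eq[of f a b]
  proof (rule SUP_least)
    fix ts assume ts: "ts \<in> {ts. sorted ts \<and> set ts \<subseteq> {a..b}}"
    have "poly_length f ts \<le>
       poly_length f (filter (\<lambda>x. x \<le> t) ts @ [t]) + poly_length f (t # filter (\<lambda>x. t < x) ts)"
      using ts by (intro poly_length_split) auto
    also have "\<dots> \<le> arc_length f a t + arc_length f t b"
      using ts assms by (intro add_mono poly_length_le_arc_length) (auto simp: sorted_append sorted_wrt_filter)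
    finally show "poly_length f ts \<le> arc_length f a t + arc_length f t b" .
  qed
qed

lemma arc_length_mono_right: "a \<le> t \<Longrightarrow> t \<le> t' \<Longrightarrow> arc_length f a t \<le> arc_length f a t'"
  using arc_length_add[of a t t' f] by (metis le_iff_add)

lemma poly_length_snoc:
  "poly_length f (ts @ [x, y]) = poly_length f (ts @ [x]) + ennreal (dist (f x) (f y))"
  by (induction f ts rule: poly_length.induct) (auto simp: add.assoc)

lemma poly_length_rev: "poly_length f (rev ts) = poly_length f ts"
proof (induction f ts rule: poly_length.induct)
  case (1 f x y zs)
  have "poly_length f (rev (x # y # zs)) = poly_length f (rev zs @ [y, x])" by simp
  also have "\<dots> = poly_length f (rev (y # zs)) + ennreal (dist (f y) (f x))"
    by (simp add: poly_length_snoc)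
  finally show ?case using 1 by (simp add: add.commute dist_commute)
qed auto

lemma poly_length_map: "poly_length f (map g ts) = poly_length (f \<circ> g) ts"
  by (induction "f \<circ> g" ts rule: poly_length.induct) auto

text \<open>Time reversal, by which continuity of arc length from the left follows from continuity
  from the right.\<close>

lemma arc_length_reflect: "arc_length (f \<circ> uminus) (-b) (-a) = arc_length f a b"
proof (rule antisym)
  have le: "arc_length (f \<circ> uminus) (-b) (-a) \<le> arc_length f a b" for f :: "real \<Rightarrow> complex" and a b
    unfolding arc_length_eq[of "f \<circ> uminus"]
  proof (rule SUP_least)
    fix ts assume ts: "ts \<in> {ts. sorted ts \<and> set ts \<subseteq> {-b..-a}}"
    have "sorted (rev (map uminus ts))"
      using ts by (simp add: sorted_wrt_rev sorted_wrt_map)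
    then have "poly_length f (rev (map uminus ts)) \<le> arc_length f a b"
      using ts by (intro poly_length_le_arc_length) force+
    then show "poly_length (f \<circ> uminus) ts \<le> arc_length f a b"
      by (simp add: poly_length_rev poly_length_map)
  qed
  show "arc_length (f \<circ> uminus) (-b) (-a) \<le> arc_length f a b" by (rule le)
  show "arc_length f a b \<le> arc_length (f \<circ> uminus) (-b) (-a)"
    using le[of "f \<circ> uminus" "-a" "-b"] by (simp add: o_def)
qed

text \<open>A polygon nearly exhausts the length \<open>r\<close> of the curve on
  \<open>[t, b]\<close>. Moving its starting time from \<open>t\<close> to a nearby
  \<open>t'\<close> loses only the distance of the two points, so almost all length lies on
  \<open>[t', b]\<close> and little remains for \<open>[t, t']\<close>.\<close>

lemma arc_length_small_right:
  assumes cont: "continuous_on {a..b} f" and fin: "arc_length f a b < \<infinity>"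
    and t: "a \<le> t" "t < b" and e: "0 < e"
  shows "\<exists>\<eta>>0. \<forall>t'\<in>{t..b}. t' < t + \<eta> \<longrightarrow> arc_length f t t' \<le> ennreal e"
proof -
  define A where "A = arc_length f t b"
  have A: "A < top" using arc_length_add[of a t b f] t fin unfolding A_def
    by (metis add.commute infinity_ennreal_def le_iff_add le_less_trans less_imp_le)
  show ?thesis
  proof (cases "A \<le> ennreal e")
    case True
    have "arc_length f t t' \<le> ennreal e" if "t' \<in> {t..b}" for t'
      using arc_length_mono_right[of t t' b f] that True unfolding A_def by (auto intro: order_trans)
    then show ?thesis by (intro exI[of _ 1]) auto
  next
    case False
    obtain r where r: "A = ennreal r" "0 \<le> r" using A by (cases A) auto
    have "e < r" using False r by (metis ennreal_leI not_le)
    then have "ennreal (r - e/2) < A" using e r by (simp add: ennreal_less_iff)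
    then obtain us where us: "sorted us" "set us \<subseteq> {t..b}" "ennreal (r - e/2) < poly_length f us"
      unfolding A_def arc_length_eq less_SUP_iff by auto
    \<comment> \<open>Copies of \<open>t\<close> are removed so that the next vertex
      \<open>x\<close> lies strictly after \<open>t\<close>; this leaves room for \<open>t'\<close>
      between \<open>t\<close> and \<open>x\<close>.\<close>
    define ts where "ts = filter (\<lambda>x. t < x) us"
    have "poly_length f (filter (\<lambda>x. x \<le> t) us @ [t]) = 0"
      using us(2) by (intro poly_length_const[of _ t]) force
    with poly_length_split[OF us(1), of f t]
    have us_le: "poly_length f us \<le> poly_length f (t # ts)" by (simp add: ts_def)
    have ts: "sorted ts" "set ts \<subseteq> {t<..b}" using us by (auto simp: ts_def sorted_wrt_filter)
    have "ts \<noteq> []" using us(3) us_le by (cases ts) auto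
    then obtain x zs where xz: "ts = x # zs" by (cases ts) auto
    then have x: "t < x" "x \<le> b" using ts by auto
    have "continuous (at t within {a..b}) f" using cont t by (simp add: continuous_on_eq_continuous_within)
    then obtain d where d: "0 < d" "\<And>t'. t' \<in> {a..b} \<Longrightarrow> dist t' t < d \<Longrightarrow> dist (f t') (f t) < e/2"
      unfolding continuous_within_eps_delta using e by (metis half_gt_zero)
    show ?thesis
    proof (intro exI[of _ "min d (x - t)"] conjI ballI impI)
      fix t' assume t': "t' \<in> {t..b}" "t' < t + min d (x - t)"
      have "poly_length f (t' # ts) \<le> arc_length f t' b"
      proof (rule poly_length_le_arc_length)
        have *: "t' \<le> z \<and> z \<le> b" if z: "z \<in> set ts" for z
        proof -
          have "x \<le> z" using z ts(1) by (auto simp: xz)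
          moreover have "z \<le> b" using z ts(2) by auto
          ultimately show ?thesis using t' by simp
        qed
        then show "sorted (t' # ts)" using ts(1) by simp
        show "set (t' # ts) \<subseteq> {t'..b}" using * t' by auto
      qed
      moreover have "poly_length f (t # ts) \<le> ennreal (dist (f t) (f t')) + poly_length f (t' # ts)"
        by (rule poly_length_Cons_Cons_le)
      moreover have "dist (f t) (f t') \<le> e/2"
      proof -
        have "t' - t < d" using t'(2) by (simp add: min_def split: if_splits)
        then have "dist (f t') (f t) < e/2" using t' t(1) by (intro d(2)) (auto simp: dist_real_def)
        then show ?thesis by (simp add: dist_commute)
      qed
      ultimately have "ennreal (r - e/2) \<le> ennreal (e/2) + arc_length f t' b"
        using us(3) us_le by (meson add_mono ennreal_leI less_imp_le order_trans)
      moreover have "arc_length f t t' + arc_length f t' b = ennreal r"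
        using arc_length_add[of t t' b f] t' r(1) by (simp add: A_def)
      moreover obtain p q where pq: "arc_length f t t' = ennreal p" "0 \<le> p" "arc_length f t' b = ennreal q" "0 \<le> q"
        using calculation(2) by (cases "arc_length f t t'"; cases "arc_length f t' b") auto
      ultimately have "r - e/2 \<le> e/2 + q" "p + q = r"
        using e r(2) by (auto simp flip: ennreal_plus)
      then show "arc_length f t t' \<le> ennreal e" using pq by (simp add: ennreal_leI)
    qed (use d(1) x in auto)
  qed
qed

lemma arc_length_small_left:
  assumes cont: "continuous_on {a..b} f" and fin: "arc_length f a b < \<infinity>"
    and t: "a < t" "t \<le> b" and e: "0 < e"
  shows "\<exists>\<eta>>0. \<forall>t'\<in>{a..t}. t - \<eta> < t' \<longrightarrow> arc_length f t' t \<le> ennreal e"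
proof -
  have "continuous_on {-b..-a} (f \<circ> uminus)"
    by (intro continuous_on_compose continuous_on_subset[OF cont]) (auto intro: continuous_intros)
  moreover have "arc_length (f \<circ> uminus) (-b) (-a) < \<infinity>" using fin by (simp add: arc_length_reflect)
  ultimately obtain \<eta> where \<eta>: "\<eta> > 0" "\<forall>t'\<in>{-t..-a}. t' < -t + \<eta> \<longrightarrow> arc_length (f \<circ> uminus) (-t) t' \<le> ennreal e"
    using arc_length_small_right[of "-b" "-a" "f \<circ> uminus" "-t" e] t e by auto
  have "arc_length f t' t \<le> ennreal e" if "t' \<in> {a..t}" "t - \<eta> < t'" for t'
    using \<eta>(2)[rule_format, of "-t'"] that arc_length_reflect[of f t t'] by auto
  then show ?thesis using \<eta>(1) by blast
qed

lemma continuous_on_arc_length: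
  assumes cont: "continuous_on {a..b} f" and fin: "arc_length f a b < \<infinity>"
  shows "continuous_on {a..b} (\<lambda>t. enn2real (arc_length f a t))"
proof -
  define g where "g t = enn2real (arc_length f a t)" for t
  have g: "arc_length f a t = ennreal (g t)" if "t \<in> {a..b}" for t
    using arc_length_mono_right[of a t b f] that fin by (auto simp: g_def intro: le_less_trans)
  have gd: "arc_length f s t = ennreal (g t - g s)" "g s \<le> g t" if "a \<le> s" "s \<le> t" "t \<le> b" for s t
  proof -
    have eq: "ennreal (g s) + arc_length f s t = ennreal (g t)"
      using arc_length_add[of a s t f] g[of s] g[of t] that by simp
    then obtain r where r: "arc_length f s t = ennreal r" "0 \<le> r" by (cases "arc_length f s t") auto
    then have "g s + r = g t" using eq by (simp add: g_def flip: ennreal_plus)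
    then show "arc_length f s t = ennreal (g t - g s)" "g s \<le> g t" using r by auto
  qed
  have "\<exists>d>0. \<forall>t'\<in>{a..b}. dist t' t < d \<longrightarrow> dist (g t') (g t) < e" if t: "t \<in> {a..b}" and e: "0 < e" for t e
  proof -
    have "\<exists>\<eta>>0. \<forall>t'\<in>{t..b}. t' < t + \<eta> \<longrightarrow> arc_length f t t' \<le> ennreal (e/2)"
    proof (cases "t < b")
      case True
      then show ?thesis using arc_length_small_right[OF cont fin, of t "e/2"] t e by auto
    next
      case False
      then have "t = b" using t by simp
      then show ?thesis using gd(1)[of b b] t by (intro exI[of _ 1]) auto
    qed
    then obtain p where p: "0 < p" "\<And>t'. t' \<in> {t..b} \<Longrightarrow> t' < t + p \<Longrightarrow> arc_length f t t' \<le> ennreal (e/2)" by blast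
    have "\<exists>\<eta>>0. \<forall>t'\<in>{a..t}. t - \<eta> < t' \<longrightarrow> arc_length f t' t \<le> ennreal (e/2)"
    proof (cases "a < t")
      case True
      then show ?thesis using arc_length_small_left[OF cont fin, of t "e/2"] t e by auto
    next
      case False
      then have "t = a" using t by simp
      then show ?thesis using gd(1)[of a a] t by (intro exI[of _ 1]) auto
    qed
    then obtain q where q: "0 < q" "\<And>t'. t' \<in> {a..t} \<Longrightarrow> t - q < t' \<Longrightarrow> arc_length f t' t \<le> ennreal (e/2)" by blast
    have "dist (g t') (g t) < e" if t': "t' \<in> {a..b}" "dist t' t < min p q" for t'
    proof (cases "t \<le> t'")
      case True
      then have "ennreal (g t' - g t) \<le> ennreal (e/2)"
        using p(2)[of t'] gd(1)[of t t'] t t' by (auto simp: dist_real_def)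
      then show ?thesis using gd(2)[of t t'] True t t' e by (auto simp: dist_real_def)
    next
      case False
      then have "ennreal (g t - g t') \<le> ennreal (e/2)"
        using q(2)[of t'] gd(1)[of t' t] t t' by (auto simp: dist_real_def)
      then show ?thesis using gd(2)[of t' t] False t t' e by (auto simp: dist_real_def)
    qed
    then show ?thesis using p(1) q(1) by (intro exI[of _ "min p q"]) auto
  qed
  then show ?thesis unfolding continuous_on_iff g_def[symmetric] by blast
qed

text \<open>Arc length parametrization is 1-Lipschitz. If the arc length parameters at which the
  curve is in \<open>E\<close> formed a null set, the part of the curve in \<open>E\<close> would
  have zero length; hence they have positive measure and the integral is infinite.\<close>

lemma path_integral_infinity_indicator:
  assumes cont: "continuous_on {a..b} f" and "a \<le> b"
    and F: "closed {t \<in> {a..b}. f t \<in> E}" and pos: "hausdorff 1 (f ` {a..b} \<inter> E) \<noteq> 0"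
  shows "path_integral (\<lambda>z. \<infinity> * indicator E z) ({a..b}, f) \<ge> 1"
proof (cases "locally_rectifiable ({a..b}, f)")
  case False
  then show ?thesis by (simp add: path_integral_def)
next
  case True
  then have fin: "arc_length f a b < \<infinity>" using \<open>a \<le> b\<close> by (auto simp: locally_rectifiable_def)
  define g where "g t = enn2real (arc_length f a t)" for t
  have g: "arc_length f a t = ennreal (g t)" "0 \<le> g t" "g t \<le> g b" if "t \<in> {a..b}" for t
    using arc_length_mono_right[of a t b f] that fin
    by (auto simp: g_def intro: le_less_trans intro!: enn2real_mono)
  have lip: "dist (f s) (f t) \<le> \<bar>g s - g t\<bar>" if "s \<in> {a..b}" "t \<in> {a..b}" for s t
    using that
  proof (induction s t rule: linorder_wlog)
    case (le s t)
    have eq: "ennreal (g s) + arc_length f s t = ennreal (g t)"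
      using arc_length_add[of a s t f] g[of s] g[of t] le by simp
    moreover have "ennreal (dist (f s) (f t)) \<le> arc_length f s t" using le by (intro dist_le_arc_length) auto
    ultimately have "ennreal (g s) + ennreal (dist (f s) (f t)) \<le> ennreal (g t)" by (metis add_left_mono)
    then have "g s + dist (f s) (f t) \<le> g t" using g[of s] g[of t] le by (simp flip: ennreal_plus)
    then show ?case by simp
  qed (simp add: dist_commute abs_minus_commute)
  define P where "P = arc_length_param f a b"
  have P: "P (g t) = f t" if t: "t \<in> {a..b}" for t
  proof -
    define t' where "t' = (SOME t'. t' \<in> {a..b} \<and> arc_length f a t' = ennreal (g t))"
    have "t' \<in> {a..b} \<and> arc_length f a t' = ennreal (g t)"
      unfolding t'_def by (rule someI[of _ t]) (use t g in auto)
    then have "t' \<in> {a..b}" "g t' = g t" using g t by (auto simp: g_def)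
    then have "f t' = f t" using lip[of t' t] t by simp
    then show ?thesis by (simp add: P_def arc_length_param_def t'_def)
  qed
  \<comment> \<open>Continuity of the length function \<open>g\<close> is used here: it makes the
    parameter set compact, thus Borel.\<close>
  define A where "A = g ` {t \<in> {a..b}. f t \<in> E}"
  have "compact {t \<in> {a..b}. f t \<in> E}" using F by (auto simp: compact_eq_bounded_closed intro: bounded_subset[OF bounded_closed_interval[of a b]])
  moreover have "continuous_on {t \<in> {a..b}. f t \<in> E} g"
    unfolding g_def by (rule continuous_on_subset[OF continuous_on_arc_length[OF cont fin]]) auto
  ultimately have "compact A" unfolding A_def by (intro compact_continuous_image)
  then have A: "A \<in> sets lborel" by (simp add: borel_compact)
  have "A \<notin> null_sets lborel"
  proof
    assume "A \<in> null_sets lborel"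
    then have "hausdorff 1 (P ` A) = 0"
      by (rule hausdorff_1_lipschitz_image_null) (use lip in \<open>auto simp: A_def P\<close>)
    moreover have "P ` A = f ` {a..b} \<inter> E" by (auto simp: A_def image_image P intro!: image_eqI)
    ultimately show False using pos by simp
  qed
  then have A0: "emeasure lborel A \<noteq> 0" using A by (simp add: null_sets_def)
  have "\<infinity> = (\<integral>\<^sup>+s. \<infinity> * indicator A s \<partial>lborel)"
    using A0 nn_integral_cmult_indicator[OF A, of \<infinity>] by (simp only: ennreal_top_mult infinity_ennreal_def if_False)
  also have "\<dots> \<le> (\<integral>\<^sup>+s\<in>{0..enn2real (arc_length f a b)}. \<infinity> * indicator E (P s) \<partial>lborel)"
    using g P by (intro nn_integral_mono) (auto simp: A_def g_def[symmetric] indicator_def)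
  also have "\<dots> \<le> path_integral (\<lambda>z. \<infinity> * indicator E z) ({a..b}, f)"
    using True \<open>a \<le> b\<close> unfolding path_integral_def P_def
    by (auto intro!: SUP_upper2[of "(a, b)"])
  finally show ?thesis by (simp add: top_unique)
qed

subsection \<open>Lines\<close>

lemma poly_length_plane_line:
  "sorted ts \<Longrightarrow> ts \<noteq> [] \<Longrightarrow> poly_length (plane_line h c) ts = ennreal (last ts - hd ts)"
proof (induction "plane_line h c" ts rule: poly_length.induct)
  case (1 x y zs)
  then have "y \<le> last (y # zs)" by (cases zs) auto
  with 1 show ?case by (simp flip: ennreal_plus)
qed auto

lemma arc_length_plane_line:
  assumes "a \<le> b"
  shows "arc_length (plane_line h c) a b = ennreal (b - a)"
proof (rule antisym)
  show "arc_length (plane_line h c) a b \<le> ennreal (b - a)"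
    unfolding arc_length_eq
  proof (rule SUP_least)
    fix ts assume ts: "ts \<in> {ts. sorted ts \<and> set ts \<subseteq> {a..b}}"
    show "poly_length (plane_line h c) ts \<le> ennreal (b - a)"
    proof (cases "ts = []")
      case False
      then have "hd ts \<in> {a..b}" "last ts \<in> {a..b}" using ts by (auto dest: hd_in_set last_in_set)
      then show ?thesis using False ts by (auto simp: poly_length_plane_line intro!: ennreal_leI)
    qed simp
  qed
  show "ennreal (b - a) \<le> arc_length (plane_line h c) a b"
    using poly_length_le_arc_length[of "[a, b]" a b "plane_line h c"] assms by simp
qed

lemma path_integral_plane_line_le:
  assumes l [measurable]: "l \<in> borel_measurable borel" and "a \<le> b"
  shows "path_integral l ({a..b}, plane_line h c) \<le> (\<integral>\<^sup>+t\<in>{a..b}. l (plane_line h c t) \<partial>lborel)"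
proof -
  have m [measurable]: "plane_line h c \<in> borel_measurable borel"
    by (intro borel_measurable_continuous_onI continuous_intros)
  have lr: "locally_rectifiable ({a..b}, plane_line h c)"
    by (auto simp: locally_rectifiable_def arc_length_plane_line)
  have "(\<integral>\<^sup>+s\<in>{0..enn2real (arc_length (plane_line h c) p q)}. l (arc_length_param (plane_line h c) p q s) \<partial>lborel)
     \<le> (\<integral>\<^sup>+t\<in>{a..b}. l (plane_line h c t) \<partial>lborel)" if pq: "a \<le> p" "p \<le> q" "q \<le> b" for p q
  proof -
    have par: "arc_length_param (plane_line h c) p q s = plane_line h c (p + s)" if s: "s \<in> {0..q - p}" for s
    proof -
      have "(SOME t. t \<in> {p..q} \<and> arc_length (plane_line h c) p t = ennreal s) = p + s"
        using s by (intro some_equality) (auto simp: arc_length_plane_line)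
      then show ?thesis by (simp add: arc_length_param_def)
    qed
    have "(\<integral>\<^sup>+s\<in>{0..enn2real (arc_length (plane_line h c) p q)}. l (arc_length_param (plane_line h c) p q s) \<partial>lborel)
        = (\<integral>\<^sup>+s. l (plane_line h c (p + 1 * s)) * indicator {p..q} (p + 1 * s) \<partial>lborel)"
      using pq par by (intro nn_integral_cong) (auto simp: arc_length_plane_line indicator_def)
    also have "\<dots> = (\<integral>\<^sup>+t. l (plane_line h c t) * indicator {p..q} t \<partial>lborel)"
      by (subst nn_integral_real_affine[of _ 1 p]) auto
    also have "\<dots> \<le> (\<integral>\<^sup>+t\<in>{a..b}. l (plane_line h c t) \<partial>lborel)"
      using pq by (intro nn_integral_mono) (auto simp: indicator_def)
    finally show ?thesis .
  qed
  then show ?thesis unfolding path_integral_def using lr by (auto intro!: SUP_least)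
qed

text \<open>Markov's inequality bounds the measure of the set where all \<open>F k\<close> are at
  least 1 by \<open>C * (1/2)^k\<close>, for each \<open>k\<close>.\<close>

lemma AE_ex_small:
  fixes F :: "nat \<Rightarrow> 'a \<Rightarrow> ennreal"
  assumes F [measurable]: "\<And>k. F k \<in> borel_measurable M" and C: "\<And>k. (\<integral>\<^sup>+x. F k x \<partial>M) \<le> ennreal (C * (1/2) ^ k)"
  shows "AE x in M. \<exists>k. F k x < 1"
proof (rule AE_I')
  define A where "A = {x \<in> space M. \<forall>k. 1 \<le> F k x}"
  have A: "A \<in> sets M" unfolding A_def by measurable
  have "emeasure M A \<le> ennreal (C * (1/2) ^ k)" for k
  proof -
    have "emeasure M A = (\<integral>\<^sup>+x. indicator A x \<partial>M)" using A by simp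
    also have "\<dots> \<le> (\<integral>\<^sup>+x. F k x \<partial>M)" by (intro nn_integral_mono) (auto simp: A_def indicator_def)
    also have "\<dots> \<le> ennreal (C * (1/2) ^ k)" by (rule C)
    finally show ?thesis .
  qed
  moreover have "(\<lambda>k. ennreal (C * (1/2) ^ k)) \<longlonglongrightarrow> ennreal (C * 0)"
    by (intro tendsto_ennrealI tendsto_intros) auto
  ultimately have "emeasure M A \<le> ennreal (C * 0)" by (intro LIMSEQ_le_const) auto
  then show "A \<in> null_sets M" using A by (auto simp: null_sets_def)
  show "{x \<in> space M. \<not> (\<exists>k. F k x < 1)} \<subseteq> A" by (auto simp: A_def not_less)
qed

text \<open>Admissible functions with energies below \<open>(1/4)^k\<close> have line integrals
  whose average over the lines is of order \<open>(1/2)^k\<close>. So on almost every line some of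
  these integrals is below 1, and no segment of that line belongs to the family. Restricting lines
  and segments to \<open>[-N, N]\<close> keeps the averages finite.\<close>

lemma AE_line_not_mod2_null:
  assumes "mod2 \<Gamma> = 0"
  shows "AE c in lborel. \<forall>a b. a \<le> b \<longrightarrow> ({a..b}, plane_line h c) \<notin> \<Gamma>"
proof -
  have "AE c in lborel. c \<in> {-real N..real N} \<longrightarrow> (\<forall>a b. -real N \<le> a \<and> a \<le> b \<and> b \<le> real N \<longrightarrow> ({a..b}, plane_line h c) \<notin> \<Gamma>)" for N :: nat
  proof -
    let ?I = "{-real N..real N}"
    have "\<exists>l\<in>borel_measurable borel. (\<forall>\<gamma>\<in>\<Gamma>. 1 \<le> path_integral l \<gamma>) \<and>
       (\<integral>\<^sup>+z. (l z)\<^sup>2 \<partial>hausdorff_measure 2) < ennreal ((1/4) ^ k)" for k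
      using assms unfolding mod2_zero_iff by simp
    then obtain l where l [measurable]: "\<And>k::nat. l k \<in> borel_measurable borel"
      and l1: "\<And>k \<gamma>. \<gamma> \<in> \<Gamma> \<Longrightarrow> 1 \<le> path_integral (l k) \<gamma>"
      and l2: "\<And>k. (\<integral>\<^sup>+z. (l k z)\<^sup>2 \<partial>hausdorff_measure 2) < ennreal ((1/4) ^ k)" by metis
    have m [measurable]: "(\<lambda>p. plane_line h (fst p) (snd p)) \<in> borel_measurable (lborel \<Otimes>\<^sub>M lborel)"
      using plane_line_measurable[of h] by (simp cong: measurable_cong_sets)
    define F where "F k c = (\<integral>\<^sup>+t. l k (plane_line h c t) * indicator ?I t * indicator ?I c \<partial>lborel)" for k c
    have m2: "(\<lambda>(c, t). l k (plane_line h c t) * indicator ?I t * indicator ?I c) \<in> borel_measurable (lborel \<Otimes>\<^sub>M lborel)" for k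
      using measurable_compose[OF m l[of k]] by (simp add: case_prod_unfold)
    have F [measurable]: "F k \<in> borel_measurable lborel" for k
      unfolding F_def using lborel.borel_measurable_nn_integral[OF m2] by simp
    have "(\<integral>\<^sup>+c. F k c \<partial>lborel) \<le> ennreal ((6 + (2 * real N)\<^sup>2) * (1/2) ^ k)" for k
    proof -
      \<comment> \<open>Young's inequality takes the place of Cauchy-Schwarz. The weight
        \<open>2^k\<close> balances both terms at \<open>(1/2)^k\<close>, since the energy is below
        \<open>(1/4)^k\<close>.\<close>
      have sq: "x \<le> ennreal (2 ^ k) * x\<^sup>2 + ennreal ((1/2) ^ k)" for x :: ennreal
      proof (cases x)
        case (real r)
        have "r \<le> 2 ^ k * r\<^sup>2 + (1/2) ^ k"
        proof -
          have "0 \<le> 2 ^ k * (r - (1/2) ^ k)\<^sup>2" by simp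
          also have "\<dots> = 2 ^ k * r\<^sup>2 - 2 * r + (1/2) ^ k"
            by (simp add: power2_eq_square algebra_simps power_divide)
          finally show ?thesis using real by linarith
        qed
        then have "ennreal r \<le> ennreal (2 ^ k * r\<^sup>2 + (1/2) ^ k)" by (rule ennreal_leI)
        moreover have pos: "0 \<le> 2 ^ k * r\<^sup>2" "0 \<le> (1/2::real) ^ k" "0 \<le> (2::real) ^ k" by simp_all
        ultimately show ?thesis
          by (simp only: ennreal_plus[OF pos(1,2)] ennreal_mult[OF pos(3) zero_le_power2] ennreal_power real)
      qed (simp add: ennreal_mult_top power2_eq_square)
      have "(\<integral>\<^sup>+c. F k c \<partial>lborel) \<le> (\<integral>\<^sup>+c. \<integral>\<^sup>+t. ennreal (2 ^ k) * (l k (plane_line h c t))\<^sup>2 + ennreal ((1/2) ^ k) * indicator ?I t * indicator ?I c \<partial>lborel \<partial>lborel)"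
        unfolding F_def using sq by (intro nn_integral_mono) (auto simp: indicator_def)
      also have "\<dots> = (\<integral>\<^sup>+c. (\<integral>\<^sup>+t. ennreal (2 ^ k) * (l k (plane_line h c t))\<^sup>2 \<partial>lborel) + (\<integral>\<^sup>+t. ennreal ((1/2) ^ k) * indicator ?I t * indicator ?I c \<partial>lborel) \<partial>lborel)"
      proof (intro nn_integral_cong nn_integral_add)
        fix c
        have "plane_line h c \<in> borel_measurable borel" by (intro borel_measurable_continuous_onI continuous_intros)
        from measurable_compose[OF this l[of k]]
        show "(\<lambda>t. ennreal (2 ^ k) * (l k (plane_line h c t))\<^sup>2) \<in> borel_measurable lborel" by simp
      qed simp
      also have "\<dots> = (\<integral>\<^sup>+c. (\<integral>\<^sup>+t. ennreal (2 ^ k) * (l k (plane_line h c t))\<^sup>2 \<partial>lborel) \<partial>lborel) + (\<integral>\<^sup>+c. (\<integral>\<^sup>+t. ennreal ((1/2) ^ k) * indicator ?I t * indicator ?I c \<partial>lborel) \<partial>lborel)"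
      proof (intro nn_integral_add)
        have "(\<lambda>(c, t). ennreal (2 ^ k) * (l k (plane_line h c t))\<^sup>2) \<in> borel_measurable (lborel \<Otimes>\<^sub>M lborel)"
          using measurable_compose[OF m l[of k]] by (simp add: case_prod_unfold)
        from lborel.borel_measurable_nn_integral[OF this]
        show "(\<lambda>c. \<integral>\<^sup>+t. ennreal (2 ^ k) * (l k (plane_line h c t))\<^sup>2 \<partial>lborel) \<in> borel_measurable lborel" by simp
      qed simp
      also have "\<dots> \<le> 6 * (\<integral>\<^sup>+z. ennreal (2 ^ k) * (l k z)\<^sup>2 \<partial>hausdorff_measure 2) + ennreal ((2 * real N)\<^sup>2 * (1/2) ^ k)"
      proof (intro add_mono)
        show "(\<integral>\<^sup>+c. (\<integral>\<^sup>+t. ennreal (2 ^ k) * (l k (plane_line h c t))\<^sup>2 \<partial>lborel) \<partial>lborel)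
           \<le> 6 * (\<integral>\<^sup>+z. ennreal (2 ^ k) * (l k z)\<^sup>2 \<partial>hausdorff_measure 2)"
          by (rule nn_integral_plane_line_le) measurable
        have "(\<integral>\<^sup>+t. ennreal ((1/2) ^ k) * indicator ?I t * indicator ?I c \<partial>lborel) = ennreal ((1/2) ^ k * (2 * real N)) * indicator ?I c" for c
          by (simp add: nn_integral_multc nn_integral_cmult_indicator ennreal_mult del: ennreal_half)
        then have "(\<integral>\<^sup>+c. (\<integral>\<^sup>+t. ennreal ((1/2) ^ k) * indicator ?I t * indicator ?I c \<partial>lborel) \<partial>lborel) = (\<integral>\<^sup>+c. ennreal ((1/2) ^ k * (2 * real N)) * indicator ?I c \<partial>lborel)"
          by (intro nn_integral_cong)
        also have "\<dots> = ennreal ((1/2) ^ k * (2 * real N)) * ennreal (2 * real N)"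
          by (subst nn_integral_cmult_indicator) auto
        also have "\<dots> = ennreal ((2 * real N)\<^sup>2 * (1/2) ^ k)"
          by (subst ennreal_mult[symmetric]) (auto simp: power2_eq_square mult_ac)
        finally show "(\<integral>\<^sup>+c. (\<integral>\<^sup>+t. ennreal ((1/2) ^ k) * indicator ?I t * indicator ?I c \<partial>lborel) \<partial>lborel) \<le> ennreal ((2 * real N)\<^sup>2 * (1/2) ^ k)"
          by simp
      qed
      also have "(\<integral>\<^sup>+z. ennreal (2 ^ k) * (l k z)\<^sup>2 \<partial>hausdorff_measure 2) = ennreal (2 ^ k) * (\<integral>\<^sup>+z. (l k z)\<^sup>2 \<partial>hausdorff_measure 2)"
        by (intro nn_integral_cmult) (simp cong: measurable_cong_sets)
      also have "6 * (ennreal (2 ^ k) * (\<integral>\<^sup>+z. (l k z)\<^sup>2 \<partial>hausdorff_measure 2)) \<le> 6 * (ennreal (2 ^ k) * ennreal ((1/4) ^ k))"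
        using l2[of k] by (intro mult_left_mono) auto
      also have "6 * (ennreal (2 ^ k) * ennreal ((1/4) ^ k)) = ennreal (6 * (1/2) ^ k)"
      proof -
        have "(2::real) ^ k * (1/4) ^ k = (1/2) ^ k" by (simp flip: power_mult_distrib)
        then show ?thesis by (metis ennreal_mult ennreal_numeral zero_le_numeral zero_le_power zero_le_divide_1_iff mult_nonneg_nonneg)
      qed
      also have "ennreal (6 * (1/2) ^ k) + ennreal ((2 * real N)\<^sup>2 * (1/2) ^ k) = ennreal ((6 + (2 * real N)\<^sup>2) * (1/2) ^ k)"
        by (subst ennreal_plus[symmetric]) (auto simp: algebra_simps)
      finally show ?thesis by (simp add: add_right_mono)
    qed
    from AE_ex_small[OF F this] show ?thesis
    proof eventually_elim
      case (elim c)
      then obtain k where k: "F k c < 1" by blast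
      show ?case
      proof (intro impI allI notI)
        fix a b assume c: "c \<in> ?I" and ab: "-real N \<le> a \<and> a \<le> b \<and> b \<le> real N" and g: "({a..b}, plane_line h c) \<in> \<Gamma>"
        have "1 \<le> path_integral (l k) ({a..b}, plane_line h c)" using l1 g by blast
        also have "\<dots> \<le> (\<integral>\<^sup>+t\<in>{a..b}. l k (plane_line h c t) \<partial>lborel)"
          using ab by (intro path_integral_plane_line_le) auto
        also have "\<dots> \<le> F k c" unfolding F_def using c ab by (intro nn_integral_mono) (auto simp: indicator_def)
        finally show False using k by simp
      qed
    qed
  qed
  then have "AE c in lborel. \<forall>N::nat. c \<in> {-real N..real N} \<longrightarrow> (\<forall>a b. -real N \<le> a \<and> a \<le> b \<and> b \<le> real N \<longrightarrow> ({a..b}, plane_line h c) \<notin> \<Gamma>)"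
    by (simp add: AE_all_countable)
  then show ?thesis
  proof eventually_elim
    case (elim c)
    show ?case
    proof (intro allI impI)
      fix a b :: real assume "a \<le> b"
      obtain N :: nat where "max \<bar>c\<bar> (max \<bar>a\<bar> \<bar>b\<bar>) \<le> real N" using real_arch_simple by blast
      then show "({a..b}, plane_line h c) \<notin> \<Gamma>" using elim[rule_format, of N a b] \<open>a \<le> b\<close>
        by (auto simp: abs_le_iff)
    qed
  qed
qed

lemma AE_lborel_open_ex:
  fixes U :: "real set"
  assumes "AE c in lborel. P c" "open U" "U \<noteq> {}"
  shows "\<exists>c\<in>U. P c"
proof (rule ccontr)
  assume *: "\<not> ?thesis"
  obtain N where N: "N \<in> null_sets lborel" "{c \<in> space lborel. \<not> P c} \<subseteq> N"
    using assms(1) by (auto elim!: AE_E simp: null_sets_def)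
  then have "U \<subseteq> N" using * by auto
  moreover have "negligible N" using N(1) by (auto simp: negligible_iff_null_sets null_sets_completion_iff2)
  ultimately show False using open_not_negligible[OF assms(2,3)] negligible_subset by blast
qed

section \<open>Rectangles with sides parallel to the axes\<close>

definition rect :: "real \<Rightarrow> real \<Rightarrow> real \<Rightarrow> real \<Rightarrow> complex set" where
  "rect a1 b1 a2 b2 = cbox (Complex a1 a2) (Complex b1 b2)"

definition open_rect :: "real \<Rightarrow> real \<Rightarrow> real \<Rightarrow> real \<Rightarrow> complex set" where
  "open_rect a1 b1 a2 b2 = box (Complex a1 a2) (Complex b1 b2)"

lemma mem_rect: "z \<in> rect a1 b1 a2 b2 \<longleftrightarrow> Re z \<in> {a1..b1} \<and> Im z \<in> {a2..b2}"
  by (auto simp: rect_def in_cbox_complex_iff)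

lemma mem_open_rect: "z \<in> open_rect a1 b1 a2 b2 \<longleftrightarrow> Re z \<in> {a1<..<b1} \<and> Im z \<in> {a2<..<b2}"
  by (auto simp: open_rect_def in_box_complex_iff)

lemma open_rect_props: "open (open_rect a1 b1 a2 b2)" "compact (rect a1 b1 a2 b2)"
  "open_rect a1 b1 a2 b2 \<subseteq> rect a1 b1 a2 b2"
  by (auto simp: rect_def open_rect_def box_subset_cbox[THEN subsetD])

lemma connected_meets_rect_boundary:
  assumes "connected C" "C \<inter> open_rect a1 b1 a2 b2 \<noteq> {}" "C - open_rect a1 b1 a2 b2 \<noteq> {}"
  shows "C \<inter> (rect a1 b1 a2 b2 - open_rect a1 b1 a2 b2) \<noteq> {}"
proof -
  have "C \<inter> frontier (open_rect a1 b1 a2 b2) \<noteq> {}" using assms by (rule connected_Int_frontier)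
  moreover have "frontier (open_rect a1 b1 a2 b2) \<subseteq> rect a1 b1 a2 b2 - open_rect a1 b1 a2 b2"
    by (auto simp: open_rect_def rect_def frontier_box split: if_splits)
  ultimately show ?thesis by blast
qed

lemma rect_lines:
  "rect a1 b1 a2 b2 = (\<Union>c\<in>{a2..b2}. plane_line True c ` {a1..b1})"
  "rect a1 b1 a2 b2 = (\<Union>c\<in>{a1..b1}. plane_line False c ` {a2..b2})"
  by (auto simp: mem_rect plane_line_def image_iff complex_eq_iff)

lemma plane_line_in_rect:
  "c \<in> {a2..b2} \<Longrightarrow> plane_line True c ` {a1..b1} \<subseteq> rect a1 b1 a2 b2"
  "c \<in> {a1..b1} \<Longrightarrow> plane_line False c ` {a2..b2} \<subseteq> rect a1 b1 a2 b2"
  by (auto simp: mem_rect plane_line_def)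

subsection \<open>Two elementary inequalities\<close>

text \<open>The map \<open>x + s / x\<close> increases on \<open>[m, M]\<close> because
  \<open>s \<le> m^2\<close>, so differences are largest at the endpoints, where they are computed
  exactly. This treats the disks on whose boundary the cutoff is 1 and yields the gain.\<close>

lemma abs_diff_add_inverse_le:
  fixes A B m M s \<delta> :: real
  assumes "0 < \<delta>" "\<delta> \<le> m" "m \<le> A" "A \<le> M" "m \<le> B" "B \<le> M" "0 \<le> s" "s \<le> \<delta>\<^sup>2"
  shows "\<bar>(A + s / A) - (B + s / B)\<bar> \<le> (M - m) * (1 - s / (M * m))"
proof -
  have diff: "(y + s / y) - (x + s / x) = (y - x) * (1 - s / (y * x))" if "0 < x" "0 < y" for x y
    using that by (simp add: field_simps)
  have mono: "x + s / x \<le> y + s / y" if xy: "m \<le> x" "x \<le> y" for x y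
  proof -
    have pos: "0 < x" "0 < y" using xy assms by auto
    have "\<delta> * \<delta> \<le> y * x" using xy assms by (intro mult_mono) auto
    then have "s \<le> y * x" using assms(8) by (simp add: power2_eq_square)
    then have "s / (y * x) \<le> 1" using pos by (simp add: divide_le_eq)
    then have "0 \<le> (y - x) * (1 - s / (y * x))" using xy by (intro mult_nonneg_nonneg) auto
    then show ?thesis using diff[OF pos] by linarith
  qed
  have "m + s / m \<le> A + s / A" "A + s / A \<le> M + s / M" "m + s / m \<le> B + s / B" "B + s / B \<le> M + s / M"
    using mono assms by auto
  then have "\<bar>(A + s / A) - (B + s / B)\<bar> \<le> (M + s / M) - (m + s / m)" by linarith
  also have "\<dots> = (M - m) * (1 - s / (M * m))" using assms by (intro diff) auto
  finally show ?thesis .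
qed

text \<open>The case \<open>q \<ge> \<bar>p - q\<bar>\<close> absorbs the cross term into the gain \<open>s * q\<^sup>2 / (A * B)\<close>; otherwise \<open>p\<close> and \<open>q\<close>
  are themselves at most \<open>2 * \<bar>p - q\<bar>\<close>.\<close>

lemma square_diff_add_weighted_inverse_le:
  fixes A B p q \<delta> :: real
  assumes \<delta>: "0 < \<delta>" "\<delta> \<le> A" "\<delta> \<le> B" and pq: "0 \<le> p" "p \<le> 1" "0 \<le> q" "q \<le> 1"
  defines "s \<equiv> \<delta>\<^sup>2 / 4"
  shows "((A + s * p\<^sup>2 / A) - (B + s * q\<^sup>2 / B))\<^sup>2 \<le> (A - B)\<^sup>2 + 18 * s * (p - q)\<^sup>2"
proof -
  have main: "((A + s * p\<^sup>2 / A) - (B + s * q\<^sup>2 / B))\<^sup>2 \<le> (A - B)\<^sup>2 + 18 * s * (p - q)\<^sup>2"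
    if AB: "\<delta> \<le> A" "\<delta> \<le> B" and pq: "0 \<le> p" "p \<le> 1" "0 \<le> q" "q \<le> 1"
      and D0: "0 \<le> (A + s * p\<^sup>2 / A) - (B + s * q\<^sup>2 / B)" for A B p q :: real
  proof -
    define D where "D = (A + s * p\<^sup>2 / A) - (B + s * q\<^sup>2 / B)"
    define d where "d = \<bar>p - q\<bar>"
    have pos: "0 < A" "0 < B" "0 < s" using \<delta>(1) AB by (auto simp: s_def)
    have d: "0 \<le> d" "d \<le> 1" "p \<le> q + d" "d\<^sup>2 = (p - q)\<^sup>2" using pq by (auto simp: d_def)
    have sA: "4 * s \<le> A * A" "4 * s \<le> A * B" "4 * s \<le> B * B"
      using mult_mono[of \<delta> A \<delta> A] mult_mono[of \<delta> A \<delta> B] mult_mono[of \<delta> B \<delta> B] AB \<delta>(1)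
      by (auto simp: s_def power2_eq_square)
    have "D\<^sup>2 \<le> (A - B)\<^sup>2 + 18 * s * d\<^sup>2"
    proof (cases "B \<le> A")
      case True
      define X where "X = A - B"
      have X: "0 \<le> X" "X \<le> A" using True pos by (auto simp: X_def)
      have p2: "p\<^sup>2 \<le> q\<^sup>2 + d * (d + 2 * q)"
      proof -
        have "p\<^sup>2 \<le> (q + d)\<^sup>2" using pq d by (intro power_mono) auto
        then show ?thesis by (simp add: power2_eq_square algebra_simps)
      qed
      show ?thesis
      proof (cases "d \<le> q \<and> 0 < q")
        case True
        \<comment> \<open>\<theta> is the relative contraction of \<open>A - B\<close> caused by the
          term \<open>s * q^2 / x\<close>; \<open>b\<close> is the error from replacing
          \<open>p\<close> by \<open>q\<close>.\<close>
        define \<theta> where "\<theta> = s * q\<^sup>2 / (A * B)"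
        define b where "b = s * (d * (d + 2 * q)) / A"
        have \<theta>: "0 < \<theta>" using True pos by (simp add: \<theta>_def)
        have \<theta>1: "\<theta> \<le> 1"
        proof -
          have "s * q\<^sup>2 \<le> s * 1" using pq pos by (intro mult_left_mono power_le_one) auto
          also have "\<dots> \<le> A * B" using sA pos by linarith
          finally show ?thesis using pos by (simp add: \<theta>_def divide_le_eq)
        qed
        have b0: "0 \<le> b" using pos d pq by (simp add: b_def)
        have "s * p\<^sup>2 / A \<le> s * (q\<^sup>2 + d * (d + 2 * q)) / A"
          using p2 pos by (intro divide_right_mono mult_left_mono) auto
        also have "\<dots> = s * q\<^sup>2 / B - X * \<theta> + b"
          using pos by (simp add: X_def \<theta>_def b_def field_simps)
        finally have "D \<le> X * (1 - \<theta>) + b" by (simp add: D_def X_def algebra_simps)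
        then have "D\<^sup>2 \<le> (X * (1 - \<theta>) + b)\<^sup>2" using D0 by (intro power_mono) (auto simp: D_def)
        \<comment> \<open>Young's inequality with weight \<theta> splits off the cross term at the
          price \<theta> times the square of \<open>X * (1 - \<theta>)\<close>, and this price is
          covered because \<open>(1 + \<theta>) * (1 - \<theta>)^2 \<le> 1\<close>.\<close>
        also have "\<dots> \<le> X\<^sup>2 + 2 * b\<^sup>2 / \<theta>"
        proof -
          let ?Y = "X * (1 - \<theta>)"
          have "0 \<le> (\<theta> * ?Y - b)\<^sup>2" by simp
          then have "2 * ?Y * b * \<theta> \<le> \<theta> * (\<theta> * ?Y\<^sup>2) + b\<^sup>2" by (simp add: power2_eq_square algebra_simps)
          then have "2 * ?Y * b \<le> \<theta> * ?Y\<^sup>2 + b\<^sup>2 / \<theta>" using \<theta> by (simp add: field_simps)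
          moreover have "b\<^sup>2 \<le> b\<^sup>2 / \<theta>" using \<theta> \<theta>1 by (simp add: le_divide_eq mult_left_le)
          moreover have "(1 + \<theta>) * ?Y\<^sup>2 \<le> X\<^sup>2"
          proof -
            have "(1 + \<theta>) * (1 - \<theta>)\<^sup>2 = (1 - \<theta>\<^sup>2) * (1 - \<theta>)" by (simp add: power2_eq_square algebra_simps)
            also have "\<dots> \<le> 1 * 1" using \<theta> \<theta>1 by (intro mult_mono) (auto simp: power_le_one)
            finally have "X\<^sup>2 * ((1 + \<theta>) * (1 - \<theta>)\<^sup>2) \<le> X\<^sup>2 * 1" by (intro mult_left_mono) auto
            moreover have "(1 + \<theta>) * ?Y\<^sup>2 = X\<^sup>2 * ((1 + \<theta>) * (1 - \<theta>)\<^sup>2)" by (subst power_mult_distrib) simp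
            ultimately show ?thesis by (simp only: mult_1_right)
          qed
          moreover have "(?Y + b)\<^sup>2 = ?Y\<^sup>2 + 2 * ?Y * b + b\<^sup>2" by (simp add: power2_sum)
          ultimately show ?thesis by (simp add: distrib_right)
        qed
        also have "2 * b\<^sup>2 / \<theta> = 2 * s * d\<^sup>2 * (B / A) * ((d + 2 * q) / q)\<^sup>2"
          using pos True by (simp add: b_def \<theta>_def field_simps power2_eq_square)
        \<comment> \<open>The inequality \<open>d \<le> q\<close> bounds
          \<open>(d + 2 * q) / q\<close> by 3, which is the origin of \<open>18 = 2 * 3^2\<close>;
          the other cases give smaller constants.\<close>
        also have "\<dots> \<le> 2 * s * d\<^sup>2 * 1 * 3\<^sup>2"
        proof -
          have "B / A \<le> 1" using \<open>B \<le> A\<close> pos by simp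
          moreover have "(d + 2 * q) / q \<le> 3" using True by (simp add: divide_le_eq)
          then have "((d + 2 * q) / q)\<^sup>2 \<le> 3\<^sup>2" using d pq by (intro power_mono) auto
          ultimately show ?thesis using pos by (intro mult_mono mult_nonneg_nonneg) auto
        qed
        finally show ?thesis by (simp add: X_def)
      next
        case False
        then have qd: "q \<le> d" using d(1) pq by auto
        then have "p \<le> 2 * d" using d(3) by linarith
        then have "p\<^sup>2 \<le> (2 * d)\<^sup>2" using pq by (intro power_mono) auto
        then have "s * p\<^sup>2 / A \<le> s * (4 * d\<^sup>2) / A"
          using pos by (intro divide_right_mono mult_left_mono) (auto simp: power_mult_distrib)
        moreover have "0 \<le> s * q\<^sup>2 / B" using pos by simp
        moreover have "s * (4 * d\<^sup>2) / A = 4 * (s * d\<^sup>2 / A)" by simp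
        moreover have "(A + a) - (B + b) \<le> A - B + c'" if "a \<le> c" "0 \<le> b" "c = c'" for a b c c' :: real
          using that by linarith
        ultimately have "D \<le> X + 4 * (s * d\<^sup>2 / A)" unfolding D_def X_def by blast
        then have "D\<^sup>2 \<le> (X + 4 * (s * d\<^sup>2 / A))\<^sup>2" using D0 by (intro power_mono) (auto simp: D_def)
        also have "\<dots> = X\<^sup>2 + 8 * (s * d\<^sup>2) * (X / A) + 16 * (s * d\<^sup>2) * ((s / (A * A)) * d\<^sup>2)"
          using pos by (simp add: power2_eq_square field_simps)
        also have "\<dots> \<le> X\<^sup>2 + 8 * (s * d\<^sup>2) * 1 + 16 * (s * d\<^sup>2) * ((1 / 4) * 1)"
        proof -
          have "X / A \<le> 1" using X pos by simp
          moreover have "s / (A * A) \<le> 1 / 4" using sA pos by (simp add: divide_le_eq)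
          moreover have "d\<^sup>2 \<le> 1" using d(1,2) by (rule power_le_one)
          ultimately have "(s / (A * A)) * d\<^sup>2 \<le> (1 / 4) * 1" using pos by (intro mult_mono) auto
          moreover have "X / A \<le> 1" using X pos by simp
          moreover have "0 \<le> s * d\<^sup>2" using pos by simp
          ultimately show ?thesis by (intro add_mono mult_left_mono) auto
        qed
        also have "\<dots> \<le> X\<^sup>2 + 18 * s * d\<^sup>2" using pos by simp
        finally show ?thesis by (simp add: X_def)
      qed
    next
      case False
      \<comment> \<open>When \<open>A < B\<close>, the negative term \<open>A - B\<close> absorbs
        the excess of \<open>s * p^2 / A\<close> over \<open>s * p^2 / B\<close>, so that only the
        difference of the cutoff terms over the common denominator \<open>B\<close>
        survives.\<close>
      define Y where "Y = B - A"
      have Y: "0 < Y" using False by (simp add: Y_def)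
      have "s * p\<^sup>2 / A = s * p\<^sup>2 / (A * B) * Y + s * p\<^sup>2 / B" using pos by (simp add: Y_def field_simps)
      moreover have "s * p\<^sup>2 / (A * B) * Y \<le> 1 * Y"
      proof (rule mult_right_mono)
        have "s * p\<^sup>2 \<le> s * 1" using pq pos by (intro mult_left_mono power_le_one) auto
        also have "\<dots> \<le> A * B" using sA pos by linarith
        finally show "s * p\<^sup>2 / (A * B) \<le> 1" using pos by (simp add: divide_le_eq)
      qed (use Y in simp)
      moreover have "s * (p\<^sup>2 - q\<^sup>2) / B = s * p\<^sup>2 / B - s * q\<^sup>2 / B"
        by (simp add: diff_divide_distrib right_diff_distrib)
      moreover have "(A + a) - (B + f) \<le> g" if "a = c + e" "c \<le> 1 * (B - A)" "g = e - f" for a c e f g :: real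
        unfolding that(1,3) using that(2) by simp
      ultimately have "D \<le> s * (p\<^sup>2 - q\<^sup>2) / B" unfolding D_def Y_def by blast
      also have "\<dots> \<le> s * (2 * d) / B"
      proof -
        have "p\<^sup>2 - q\<^sup>2 = (p - q) * (p + q)" by (simp add: power2_eq_square algebra_simps)
        also have "\<dots> \<le> d * 2" using pq by (intro mult_mono) (auto simp: d_def)
        finally show ?thesis using pos by (intro divide_right_mono mult_left_mono) auto
      qed
      finally have "D\<^sup>2 \<le> (s * (2 * d) / B)\<^sup>2" using D0 by (intro power_mono) (auto simp: D_def)
      also have "\<dots> = s * d\<^sup>2 * (4 * s / (B * B))" using pos by (simp add: power2_eq_square field_simps)
      also have "\<dots> \<le> s * d\<^sup>2 * 1" using sA pos by (intro mult_left_mono) (auto simp: divide_le_eq)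
      also have "\<dots> \<le> (A - B)\<^sup>2 + 18 * s * d\<^sup>2" using pos by (simp add: add_increasing)
      finally show ?thesis .
    qed
    then show ?thesis unfolding D_def d(4) .
  qed
  show ?thesis
  proof (cases "0 \<le> (A + s * p\<^sup>2 / A) - (B + s * q\<^sup>2 / B)")
    case True
    then show ?thesis using main[of A B p q] assms by blast
  next
    case False
    have "((B + s * q\<^sup>2 / B) - (A + s * p\<^sup>2 / A))\<^sup>2 \<le> (B - A)\<^sup>2 + 18 * s * (q - p)\<^sup>2"
      using False assms by (intro main) auto
    then show ?thesis by (simp add: power2_commute)
  qed
qed

text \<open>With \<open>r = sqrt t\<close>, the logarithm is at most \<open>2 * (r - 1)\<close>, and
  \<open>(r - 1)^2 = (t - 1)^2 / (r + 1)^2\<close>. For \<open>t = M / m\<close> the right side is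
  \<open>4 * (M - m)^2 / (M * m)\<close>, which is the form of the gain in the energy.\<close>

lemma ln_square_le:
  fixes t :: real
  assumes "1 \<le> t"
  shows "(ln t)\<^sup>2 \<le> 4 * ((t - 1)\<^sup>2 / t)"
proof -
  define r where "r = sqrt t"
  have r: "1 \<le> r" "t = r\<^sup>2" using assms by (auto simp: r_def)
  have "ln t = 2 * ln r" using r by (simp add: ln_realpow)
  also have "\<dots> \<le> 2 * (r - 1)" using r ln_le_minus_one[of r] by simp
  finally have "(ln t)\<^sup>2 \<le> (2 * (r - 1))\<^sup>2" using assms by (intro power_mono) auto
  also have "\<dots> = 4 * (r - 1)\<^sup>2" by (subst power_mult_distrib) simp
  also have "(r - 1)\<^sup>2 \<le> (t - 1)\<^sup>2 / t"
  proof -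
    have "r\<^sup>2 \<le> (r + 1)\<^sup>2" using r by (intro power_mono) auto
    then have "(r - 1)\<^sup>2 * r\<^sup>2 \<le> (r - 1)\<^sup>2 * (r + 1)\<^sup>2" by (intro mult_left_mono) auto
    also have "\<dots> = (t - 1)\<^sup>2" unfolding r(2) by (simp add: power2_eq_square algebra_simps)
    finally show ?thesis using r by (simp add: le_divide_eq)
  qed
  finally show ?thesis by simp
qed

text \<open>Provides a crude gradient of \<open>ln (w + \<delta>)\<close>, which degenerates as
  \<delta> tends to 0 but suffices to start the passage to oscillations.\<close>

lemma abs_ln_diff_le:
  fixes x y \<delta> :: real
  assumes "0 < \<delta>" "0 \<le> x" "0 \<le> y"
  shows "\<bar>ln (x + \<delta>) - ln (y + \<delta>)\<bar> \<le> \<bar>x - y\<bar> / \<delta>"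
proof -
  have *: "ln (a + \<delta>) - ln (b + \<delta>) \<le> (a - b) / \<delta>" if "0 \<le> b" "b \<le> a" for a b
  proof -
    have "ln (a + \<delta>) - ln (b + \<delta>) = ln ((a + \<delta>) / (b + \<delta>))" using that assms(1) by (subst ln_div) auto
    also have "\<dots> \<le> (a + \<delta>) / (b + \<delta>) - 1" using that assms(1) by (intro ln_le_minus_one) auto
    also have "\<dots> = (a - b) / (b + \<delta>)" using that assms(1) by (simp add: field_simps)
    also have "\<dots> \<le> (a - b) / \<delta>" using that assms(1) by (intro divide_left_mono) auto
    finally show ?thesis .
  qed
  show ?thesis
  proof (cases "y \<le> x")
    case True
    then have "ln (y + \<delta>) \<le> ln (x + \<delta>)" using assms by simp
    then show ?thesis using *[OF assms(3) True] True by simp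
  next
    case False
    then have "ln (x + \<delta>) \<le> ln (y + \<delta>)" using assms by simp
    then show ?thesis using *[of x y] assms False by simp
  qed
qed

subsection \<open>Geometry of the peripheral disks\<close>

locale sierpinski_carpet =
  fixes \<Omega> :: "complex set" and Q :: "nat \<Rightarrow> complex set"
  assumes rel: "relative_sierpinski_carpet \<Omega> Q"
begin

abbreviation S where "S \<equiv> carpet \<Omega> Q"

lemma open_Omega: "open \<Omega>" and connected_Omega: "connected \<Omega>"
  and interior_S: "interior S = {}" and hausdorff_S: "hausdorff 2 S = 0"
  using rel by (auto simp: relative_sierpinski_carpet_def)

lemma Q_props: "open (Q i)" "connected (Q i)" "bounded (Q i)" "Q i \<noteq> {}" "closure (Q i) \<subseteq> \<Omega>"
proof -
  have "jordan_region (Q i)" "compactly_contained (Q i) \<Omega>"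
    using rel by (auto simp: relative_sierpinski_carpet_def)
  then obtain c where "simple_path c" "pathfinish c = pathstart c" "Q i = inside (path_image c)"
    unfolding jordan_region_def by blast
  then show "open (Q i)" "connected (Q i)" "bounded (Q i)" "Q i \<noteq> {}"
    using Jordan_inside_outside[of c] by auto
  show "closure (Q i) \<subseteq> \<Omega>" using \<open>compactly_contained (Q i) \<Omega>\<close> by (simp add: compactly_contained_def)
qed

lemma disjoint_closure: "i \<noteq> j \<Longrightarrow> closure (Q i) \<inter> closure (Q j) = {}"
  using rel by (auto simp: relative_sierpinski_carpet_def)

lemma disjoint_Q: "i \<noteq> j \<Longrightarrow> Q i \<inter> Q j = {}"
  using disjoint_closure[of i j] closure_subset by blast

lemma closure_Q: "closure (Q i) = Q i \<union> frontier (Q i)" "Q i \<inter> frontier (Q i) = {}"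
  using Q_props[of i] by (auto simp: frontier_def interior_open closure_subset[THEN subsetD])

lemma compact_closure_Q: "compact (closure (Q i))"
  using Q_props[of i] by (simp add: compact_closure)

lemma Q_unique: "z \<in> closure (Q i) \<Longrightarrow> z \<in> closure (Q j) \<Longrightarrow> i = j"
  using disjoint_closure by blast

lemma in_Q_closure: "z \<in> Q i \<Longrightarrow> z \<in> closure (Q i)"
  using closure_subset by blast

lemma frontier_Q_closure: "z \<in> frontier (Q i) \<Longrightarrow> z \<in> closure (Q i)"
  by (simp add: frontier_def)

lemma S_iff: "z \<in> S \<longleftrightarrow> z \<in> \<Omega> \<and> (\<forall>i. z \<notin> Q i)"
  by (auto simp: carpet_def)

lemma frontier_Q_subset: "frontier (Q i) \<subseteq> S"
proof
  fix z assume z: "z \<in> frontier (Q i)"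
  then have "z \<in> closure (Q i)" by (rule frontier_Q_closure)
  moreover have "z \<notin> Q j" for j
    using z closure_Q(2)[of i] Q_unique[of z i j] frontier_Q_closure[OF z] in_Q_closure[of z j] by auto
  ultimately show "z \<in> S" using Q_props(5)[of i] by (auto simp: S_iff)
qed

lemma S_closure_Q: "z \<in> S \<Longrightarrow> z \<in> closure (Q i) \<Longrightarrow> z \<in> frontier (Q i)"
  using closure_Q(1)[of i] by (auto simp: S_iff)

lemma frontier_Q_nonempty: "frontier (Q i) \<noteq> {}"
  using Q_props[of i] by (intro frontier_not_empty) (auto intro: not_bounded_UNIV)

lemma S_borel: "S \<in> sets borel"
  unfolding carpet_def using open_Omega Q_props(1) by (intro sets.Diff sets.countable_UN) auto

lemma diameter_Q_pos: "0 < diameter (Q i)"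
proof -
  obtain x where "x \<in> Q i" using Q_props(4) by blast
  then obtain e where e: "0 < e" "ball x e \<subseteq> Q i" using Q_props(1) open_contains_ball by blast
  then have "diameter (ball x e) \<le> diameter (Q i)" using Q_props(3) by (intro diameter_subset) auto
  then show ?thesis using e by simp
qed

lemma S_disk_near:
  assumes "open U" "U \<inter> \<Omega> \<noteq> {}"
  obtains i where "Q i \<inter> U \<noteq> {}"
proof -
  have "\<not> U \<inter> \<Omega> \<subseteq> S"
    using interior_S interior_maximal[of "U \<inter> \<Omega>" S] assms open_Omega by auto
  then obtain x i where "x \<in> U" "x \<in> Q i" by (auto simp: S_iff)
  then show ?thesis using that[of i] by blast
qed

lemma connected_meets_frontier:
  "connected C \<Longrightarrow> C \<inter> Q i \<noteq> {} \<Longrightarrow> C - Q i \<noteq> {} \<Longrightarrow> C \<inter> frontier (Q i) \<noteq> {}"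
  by (rule connected_Int_frontier)

text \<open>Fatness gives the part of \<open>Q i\<close> in the ball of radius \<open>r i\<close> an
  area of at least \<open>K1 * (r i)^2\<close>. These parts are disjoint and lie in one ball of
  radius \<open>R\<close>, whose area is at most \<open>2 * pi * R^2\<close>.\<close>

lemma packing:
  obtains C where "0 < C"
    "\<And>J r y R. 0 \<le> R \<Longrightarrow> (\<And>i. i \<in> J \<Longrightarrow> \<exists>x\<in>Q i. 0 < r i \<and> r i < diameter (Q i) \<and> ball x (r i) \<subseteq> ball y R) \<Longrightarrow>
       disk_sum (\<lambda>i. (r i)\<^sup>2) J \<le> ennreal (C * R\<^sup>2)"
proof -
  obtain K1 where K1: "0 < K1" "\<And>i x r. x \<in> Q i \<Longrightarrow> 0 < r \<Longrightarrow> r < diameter (Q i) \<Longrightarrow>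
        hausdorff 2 (ball x r \<inter> Q i) \<ge> ennreal (K1 * r\<^sup>2)"
    using rel unfolding relative_sierpinski_carpet_def by blast
  have main: "disk_sum (\<lambda>i. (r i)\<^sup>2) J \<le> ennreal (2 * pi / K1 * R\<^sup>2)"
    if R: "0 \<le> R" and J: "\<And>i. i \<in> J \<Longrightarrow> \<exists>x\<in>Q i. 0 < r i \<and> r i < diameter (Q i) \<and> ball x (r i) \<subseteq> ball y R"
    for J r y R
  proof -
    obtain x where x: "\<And>i. i \<in> J \<Longrightarrow> x i \<in> Q i \<and> 0 < r i \<and> r i < diameter (Q i) \<and> ball (x i) (r i) \<subseteq> ball y R"
      using J by metis
    define B where "B i = (if i \<in> J then ball (x i) (r i) \<inter> Q i else {})" for i
    have B: "B i \<in> sets borel" for i using Q_props(1) by (auto simp: B_def intro!: borel_open)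
    have dB: "disjoint_family B" using disjoint_Q by (auto simp: disjoint_family_on_def B_def)
    have "ennreal K1 * disk_sum (\<lambda>i. (r i)\<^sup>2) J = disk_sum (\<lambda>i. K1 * (r i)\<^sup>2) J"
      using K1(1) by (simp add: disk_sum_cmult)
    also have "\<dots> \<le> (\<Sum>i. hausdorff 2 (B i))"
      unfolding disk_sum_def using x K1(2) by (intro suminf_le) (auto simp: B_def indicator_def)
    also have "\<dots> = (\<Sum>i. emeasure (hausdorff_measure 2) (B i))" using B by (simp add: emeasure_hausdorff_measure)
    also have "\<dots> = emeasure (hausdorff_measure 2) (\<Union>i. B i)"
      using B dB by (intro suminf_emeasure) auto
    also have "\<dots> = hausdorff 2 (\<Union>i. B i)" using B by (intro emeasure_hausdorff_measure) auto
    also have "\<dots> \<le> hausdorff 2 (ball y R)" using x by (intro hausdorff_mono) (auto simp: B_def split: if_splits)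
    also have "\<dots> \<le> ennreal (2 * pi * R\<^sup>2)" by (rule hausdorff_2_ball_le)
    finally have "ennreal (1 / K1) * (ennreal K1 * disk_sum (\<lambda>i. (r i)\<^sup>2) J) \<le> ennreal (1 / K1) * ennreal (2 * pi * R\<^sup>2)"
      by (rule mult_left_mono) simp
    moreover have "ennreal (1 / K1) * (ennreal K1 * disk_sum (\<lambda>i. (r i)\<^sup>2) J) = disk_sum (\<lambda>i. (r i)\<^sup>2) J"
      using K1(1) by (simp add: mult.assoc[symmetric] ennreal_mult[symmetric])
    moreover have "ennreal (1 / K1) * ennreal (2 * pi * R\<^sup>2) = ennreal (2 * pi / K1 * R\<^sup>2)"
      using K1(1) R by (simp add: ennreal_mult[symmetric])
    ultimately show ?thesis by simp
  qed
  show ?thesis by (rule that[of "2 * pi / K1"], use K1(1) in simp, rule main)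
qed

text \<open>Half the diameter respects the strict upper bound on radii in the fatness condition, and
  the cap \<open>e\<close> keeps the balls close to \<open>K\<close> even for large disks, so
  packing applies.\<close>

lemma disk_sum_min_diameter:
  assumes "bounded K" and e: "0 < e"
  shows "disk_sum (\<lambda>i. (min (diameter (Q i) / 2) e)\<^sup>2) (meeting Q K) < \<infinity>"
proof -
  obtain C where C: "0 < C" "\<And>J r y R. 0 \<le> R \<Longrightarrow> (\<And>i. i \<in> J \<Longrightarrow> \<exists>x\<in>Q i. 0 < r i \<and> r i < diameter (Q i) \<and> ball x (r i) \<subseteq> ball y R) \<Longrightarrow>
       disk_sum (\<lambda>i. (r i)\<^sup>2) J \<le> ennreal (C * R\<^sup>2)" using packing by blast
  obtain R where R: "0 < R" "K \<subseteq> ball 0 R" using bounded_subset_ballD[OF assms(1)] by blast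
  have "disk_sum (\<lambda>i. (min (diameter (Q i) / 2) e)\<^sup>2) (meeting Q K) \<le> ennreal (C * (R + e)\<^sup>2)"
  proof (rule C(2))
    fix i assume "i \<in> meeting Q K"
    then obtain x where x: "x \<in> Q i" "x \<in> K" by (auto simp: meeting_def)
    have "ball x (min (diameter (Q i) / 2) e) \<subseteq> ball 0 (R + e)"
      using x(2) R(2) by (intro ball_trivial ball_subset_ball_iff[THEN iffD2]) (auto simp: subset_iff)
    then show "\<exists>x\<in>Q i. 0 < min (diameter (Q i) / 2) e \<and> min (diameter (Q i) / 2) e < diameter (Q i) \<and>
        ball x (min (diameter (Q i) / 2) e) \<subseteq> ball 0 (R + e)"
      using x(1) diameter_Q_pos[of i] e by (intro bexI[of _ x]) auto
  qed (use R e in auto)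
  then show ?thesis by (rule le_less_trans) simp
qed

lemma finite_large_disks:
  assumes "bounded K" "0 < e"
  shows "finite {i \<in> meeting Q K. e \<le> diameter (Q i)}"
proof (rule ccontr)
  assume inf: "infinite {i \<in> meeting Q K. e \<le> diameter (Q i)}"
  have "disk_sum (\<lambda>i. (min (diameter (Q i) / 2) e)\<^sup>2) {i \<in> meeting Q K. e \<le> diameter (Q i)} = \<infinity>"
  proof (rule disk_sum_infinite[OF inf])
    show "0 < (e/2)\<^sup>2" using assms(2) by simp
    fix i assume "i \<in> {i \<in> meeting Q K. e \<le> diameter (Q i)}"
    then show "(e/2)\<^sup>2 \<le> (min (diameter (Q i) / 2) e)\<^sup>2" using assms(2) by (intro power_mono) auto
  qed
  moreover have "disk_sum (\<lambda>i. (min (diameter (Q i) / 2) e)\<^sup>2) {i \<in> meeting Q K. e \<le> diameter (Q i)} < \<infinity>"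
    by (rule le_less_trans[OF disk_sum_subset disk_sum_min_diameter[OF assms]]) auto
  ultimately show False by simp
qed

text \<open>Only finitely many disks meeting \<open>K\<close> have diameter at least 2; for the
  others the diameter is twice the capped radius of the packing estimate.\<close>

lemma disk_sum_diameter_finite:
  assumes "bounded K"
  shows "disk_sum (\<lambda>i. (diameter (Q i))\<^sup>2) (meeting Q K) < \<infinity>"
proof -
  let ?F = "{i \<in> meeting Q K. 2 \<le> diameter (Q i)}"
  let ?r = "\<lambda>i. min (diameter (Q i) / 2) 1"
  have F: "finite ?F" using finite_large_disks[OF assms, of 2] by simp
  have "disk_sum (\<lambda>i. (diameter (Q i))\<^sup>2) (meeting Q K) \<le>
     disk_sum (\<lambda>i. (diameter (Q i))\<^sup>2) ?F + disk_sum (\<lambda>i. (diameter (Q i))\<^sup>2) (meeting Q K - ?F)"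
    by (subst disk_sum_Un_disjoint[symmetric]) (auto intro: disk_sum_subset)
  also have "disk_sum (\<lambda>i. (diameter (Q i))\<^sup>2) (meeting Q K - ?F) \<le> disk_sum (\<lambda>i. 4 * (?r i)\<^sup>2) (meeting Q K)"
    by (rule disk_sum_mono) (auto simp: min_def power_divide)
  also have "\<dots> = 4 * disk_sum (\<lambda>i. (?r i)\<^sup>2) (meeting Q K)" by (subst disk_sum_cmult) auto
  finally have "disk_sum (\<lambda>i. (diameter (Q i))\<^sup>2) (meeting Q K) \<le>
     disk_sum (\<lambda>i. (diameter (Q i))\<^sup>2) ?F + 4 * disk_sum (\<lambda>i. (?r i)\<^sup>2) (meeting Q K)"
    by (simp add: add_left_mono)
  also have "\<dots> < \<infinity>"
    using F disk_sum_min_diameter[OF assms zero_less_one]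
    by (auto simp: disk_sum_finite ennreal_mult_less_top ennreal_add_less_top ennreal_sum_less_top)
  finally show ?thesis .
qed

subsection \<open>Almost every line\<close>

definition line_hits :: "bool \<Rightarrow> real \<Rightarrow> real \<Rightarrow> nat \<Rightarrow> real set" where
  "line_hits h a b i = {c. Q i \<inter> plane_line h c ` {a..b} \<noteq> {}}"

lemma mem_line_hits: "c \<in> line_hits h a b i \<longleftrightarrow> i \<in> meeting Q (plane_line h c ` {a..b})"
  by (simp add: line_hits_def meeting_def)

lemma open_line_hits: "open (line_hits h a b i)"
proof -
  have "line_hits h a b i = (\<Union>t\<in>{a..b}. (\<lambda>c. plane_line h c t) -` Q i)"
    by (auto simp: line_hits_def)
  also have "open \<dots>"
    by (intro open_UN ballI open_vimage Q_props(1)) (intro continuous_intros)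
  finally show ?thesis .
qed

lemma emeasure_line_hits_le: "emeasure lborel (line_hits h a b i) \<le> ennreal (diameter (Q i))"
proof (cases "line_hits h a b i = {}")
  case False
  let ?P = "line_hits h a b i" and ?d = "diameter (Q i)"
  have d: "\<bar>c - c'\<bar> \<le> ?d" if cc: "c \<in> ?P" "c' \<in> ?P" for c c'
  proof -
    obtain t t' where "plane_line h c t \<in> Q i" "plane_line h c' t' \<in> Q i" using cc by (auto simp: line_hits_def)
    then have "dist (plane_line h c t) (plane_line h c' t') \<le> ?d"
      using Q_props(3) by (intro diameter_bounded_bound) auto
    then show ?thesis using cross_coord_lipschitz[of h "plane_line h c t" "plane_line h c' t'"] by simp
  qed
  obtain c0 where c0: "c0 \<in> ?P" using False by blast
  have bdd: "bdd_above ?P" "bdd_below ?P"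
  proof -
    show "bdd_above ?P" by (rule bdd_aboveI[of _ "c0 + ?d"]) (use d[OF _ c0] in \<open>force simp: abs_le_iff\<close>)
    show "bdd_below ?P" by (rule bdd_belowI[of _ "c0 - ?d"]) (use d[OF c0] in \<open>force simp: abs_le_iff\<close>)
  qed
  have "Sup ?P \<le> Inf ?P + ?d"
  proof (rule cSup_least[OF False])
    fix c assume c: "c \<in> ?P"
    have "c - ?d \<le> Inf ?P"
      by (rule cInf_greatest[OF False]) (use d[OF c] in \<open>force simp: abs_le_iff\<close>)
    then show "c \<le> Inf ?P + ?d" by simp
  qed
  have "emeasure lborel ?P \<le> emeasure lborel {Inf ?P..Sup ?P}"
    using bdd by (intro emeasure_mono) (auto intro: cInf_lower cSup_upper)
  also have "\<dots> \<le> ennreal ?d"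
    using \<open>Sup ?P \<le> Inf ?P + ?d\<close> cInf_le_cSup[OF False bdd] by (simp add: ennreal_leI)
  finally show ?thesis .
qed simp

lemma disk_sum_line_eq:
  "disk_sum \<tau> (meeting Q (plane_line h c ` {a..b})) = (\<Sum>i. ennreal (\<tau> i) * indicator (line_hits h a b i) c)"
  unfolding disk_sum_def by (intro suminf_cong) (auto simp: indicator_def mem_line_hits)

lemma disk_sum_line_measurable [measurable]:
  "(\<lambda>c. disk_sum \<tau> (meeting Q (plane_line h c ` {a..b}))) \<in> borel_measurable borel"
proof -
  have [measurable]: "line_hits h a b i \<in> sets borel" for i using open_line_hits by (rule borel_open)
  show ?thesis unfolding disk_sum_line_eq by measurable
qed

lemma nn_integral_disk_sum_line:
  assumes "I \<in> sets borel"
  shows "(\<integral>\<^sup>+c\<in>I. disk_sum \<tau> (meeting Q (plane_line h c ` {a..b})) \<partial>lborel) =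
    (\<Sum>i. ennreal (\<tau> i) * emeasure lborel (line_hits h a b i \<inter> I))"
proof -
  have m: "line_hits h a b i \<inter> I \<in> sets lborel" for i using open_line_hits[of h a b i] assms by auto
  have "(\<integral>\<^sup>+c\<in>I. disk_sum \<tau> (meeting Q (plane_line h c ` {a..b})) \<partial>lborel) =
    (\<integral>\<^sup>+c. (\<Sum>i. ennreal (\<tau> i) * indicator (line_hits h a b i \<inter> I) c) \<partial>lborel)"
    unfolding disk_sum_line_eq ennreal_suminf_multc[symmetric]
    by (intro nn_integral_cong suminf_cong) (auto simp: indicator_def)
  also have "\<dots> = (\<Sum>i. \<integral>\<^sup>+c. ennreal (\<tau> i) * indicator (line_hits h a b i \<inter> I) c \<partial>lborel)"
    using m by (intro nn_integral_suminf) auto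
  also have "\<dots> = (\<Sum>i. ennreal (\<tau> i) * emeasure lborel (line_hits h a b i \<inter> I))"
    using m by (intro suminf_cong nn_integral_cmult_indicator) auto
  finally show ?thesis .
qed

text \<open>The basic length-area estimate: a disk is met only by lines whose parameter lies in its
  shadow, of length at most its diameter, so it contributes at most \<tau> \<open>i\<close> times
  the diameter to the average.\<close>

lemma nn_integral_disk_sum_line_le:
  assumes I: "I \<in> sets borel" and K: "\<And>c. c \<in> I \<Longrightarrow> plane_line h c ` {a..b} \<subseteq> K"
  shows "(\<integral>\<^sup>+c\<in>I. disk_sum \<tau> (meeting Q (plane_line h c ` {a..b})) \<partial>lborel) \<le>
    disk_sum (\<lambda>i. \<tau> i * diameter (Q i)) (meeting Q K)"
  unfolding nn_integral_disk_sum_line[OF I]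
  unfolding disk_sum_def
proof (intro suminf_le allI)
  fix i
  show "ennreal (\<tau> i) * emeasure lborel (line_hits h a b i \<inter> I) \<le> ennreal (\<tau> i * diameter (Q i)) * indicator (meeting Q K) i"
  proof (cases "i \<in> meeting Q K")
    case True
    have "emeasure lborel (line_hits h a b i \<inter> I) \<le> emeasure lborel (line_hits h a b i)"
      using open_line_hits[of h a b i] by (intro emeasure_mono) auto
    then have "ennreal (\<tau> i) * emeasure lborel (line_hits h a b i \<inter> I) \<le> ennreal (\<tau> i) * ennreal (diameter (Q i))"
      using order_trans[OF _ emeasure_line_hits_le[of h a b i]] by (intro mult_left_mono) auto
    then show ?thesis using True diameter_Q_pos[of i] by (simp add: ennreal_mult'')
  next
    case False
    have "c \<notin> line_hits h a b i" if "c \<in> I" for c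
      using False meeting_mono[OF K[OF that], of Q] by (auto simp: mem_line_hits)
    then have "line_hits h a b i \<inter> I = {}" by blast
    then show ?thesis by simp
  qed
qed auto

text \<open>As the carpet has zero area, Fubini leaves a null set of parameters on almost every
  line, and a line is parametrized isometrically.\<close>

lemma AE_line_hausdorff_S: "AE c in lborel. \<forall>a b. hausdorff 1 (plane_line h c ` {a..b} \<inter> S) = 0"
proof -
  let ?M = "lborel \<Otimes>\<^sub>M lborel :: (real \<times> real) measure"
  let ?A = "{p. plane_line h (fst p) (snd p) \<in> S}"
  have m: "?A \<in> sets ?M"
  proof -
    have "(\<lambda>p. plane_line h (fst p) (snd p)) \<in> borel_measurable ?M"
      using plane_line_measurable[of h] by (simp cong: measurable_cong_sets)
    from measurable_sets[OF this S_borel] show ?thesis by (simp add: vimage_def space_pair_measure)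
  qed
  have "emeasure ?M ?A = 0"
    using emeasure_plane_line_le[OF S_borel, of h] hausdorff_S by simp
  then have "AE p in ?M. plane_line h (fst p) (snd p) \<notin> S"
    using m by (intro AE_I'[of ?A]) auto
  then have "AE c in lborel. AE t in lborel. plane_line h c t \<notin> S"
    using lborel_pair.AE_pair by fastforce
  then show ?thesis
  proof eventually_elim
    case (elim c)
    let ?N = "{t. plane_line h c t \<in> S}"
    have "plane_line h c \<in> borel_measurable borel" by (intro borel_measurable_continuous_onI continuous_intros)
    from measurable_sets[OF this S_borel] have "?N \<in> sets lborel" by (simp add: vimage_def)
    with elim have "?N \<in> null_sets lborel" by (subst AE_iff_null_sets) auto
    then have "hausdorff 1 (plane_line h c ` ?N) = 0"
      by (rule hausdorff_1_lipschitz_image_null) simp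
    moreover have "hausdorff 1 (plane_line h c ` {a..b} \<inter> S) \<le> hausdorff 1 (plane_line h c ` ?N)" for a b
      by (intro hausdorff_mono) auto
    ultimately show ?case by simp
  qed
qed

lemma AE_line_not_negl:
  assumes "negl_paths v \<Omega> Q \<Gamma>"
  shows "AE c in lborel. \<forall>a b. a \<le> b \<longrightarrow> ({a..b}, plane_line h c) \<notin> \<Gamma>"
proof (cases v)
  case Weak
  then show ?thesis using assms by (intro AE_line_not_mod2_null) (simp add: negl_paths_def)
next
  case Strong
  show ?thesis
    using AE_line_hausdorff_S[of h]
  proof eventually_elim
    case (elim c)
    then show ?case using assms by (auto simp: negl_paths_def Strong path_trace_def)
  qed
qed

text \<open>The discrete counterpart of the argument for \<open>mod2\<close>. Young's inequality is
  applied to \<tau> times the diameter, and the squared diameters of the disks meeting a bounded set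
  play the role of the area.\<close>

lemma AE_line_not_exceptional:
  assumes "exceptional v \<Omega> Q \<Gamma>"
  shows "AE c in lborel. \<forall>a b. a \<le> b \<longrightarrow> ({a..b}, plane_line h c) \<notin> \<Gamma>"
proof -
  have "AE c in lborel. c \<in> {-real N..real N} \<longrightarrow> (\<forall>a b. -real N \<le> a \<and> a \<le> b \<and> b \<le> real N \<longrightarrow> ({a..b}, plane_line h c) \<notin> \<Gamma>)" for N :: nat
  proof -
    let ?I = "{-real N..real N}"
    define K where "K = (\<Union>c\<in>?I. plane_line h c ` ?I)"
    have "bounded K"
    proof -
      have "norm z \<le> 2 * real N" if z: "z \<in> K" for z
      proof -
        have "\<bar>Re z\<bar> \<le> real N" "\<bar>Im z\<bar> \<le> real N"
          using z by (auto simp: K_def plane_line_def abs_le_iff split: if_splits)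
        then show ?thesis using cmod_le[of z] by linarith
      qed
      then show ?thesis unfolding bounded_iff by blast
    qed
    from disk_sum_diameter_finite[OF this] obtain D
      where D: "disk_sum (\<lambda>i. (diameter (Q i))\<^sup>2) (meeting Q K) = ennreal D" "0 \<le> D"
      by (cases "disk_sum (\<lambda>i. (diameter (Q i))\<^sup>2) (meeting Q K)") auto
    have "\<exists>\<tau> \<Gamma>0. (\<forall>i. 0 \<le> \<tau> i) \<and> (\<Sum>i. ennreal ((\<tau> i)\<^sup>2)) < ennreal ((1/4) ^ k) \<and>
        \<Gamma>0\<subseteq>\<Gamma> \<and> negl_paths v \<Omega> Q \<Gamma>0 \<and> (\<forall>\<gamma>\<in>\<Gamma> - \<Gamma>0. 1 \<le> sum_along Q \<tau> \<gamma>)" for k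
    proof -
      have "(0::real) < (1/4) ^ k" by simp
      then show ?thesis using assms unfolding exceptional_iff by meson
    qed
    then obtain \<tau> \<Gamma>0 where \<tau>: "\<And>k i. 0 \<le> \<tau> k i" "\<And>k::nat. (\<Sum>i. ennreal ((\<tau> k i)\<^sup>2)) < ennreal ((1/4) ^ k)"
      and \<Gamma>0: "\<And>k. negl_paths v \<Omega> Q (\<Gamma>0 k)" "\<And>k \<gamma>. \<gamma> \<in> \<Gamma> - \<Gamma>0 k \<Longrightarrow> 1 \<le> sum_along Q (\<tau> k) \<gamma>"
      by metis
    define F where "F k c = disk_sum (\<tau> k) (meeting Q (plane_line h c ` ?I)) * indicator ?I c" for k c
    have F: "F k \<in> borel_measurable lborel" for k unfolding F_def by measurable
    have "(\<integral>\<^sup>+c. F k c \<partial>lborel) \<le> ennreal ((1 + D) * (1/2) ^ k)" for k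
    proof -
      have "(\<integral>\<^sup>+c. F k c \<partial>lborel) \<le> disk_sum (\<lambda>i. \<tau> k i * diameter (Q i)) (meeting Q K)"
        unfolding F_def by (rule nn_integral_disk_sum_line_le) (simp, unfold K_def, blast)
      also have "\<dots> \<le> disk_sum (\<lambda>i. 2 ^ k * (\<tau> k i)\<^sup>2 + (1/2) ^ k * (diameter (Q i))\<^sup>2) (meeting Q K)"
      proof (rule disk_sum_mono)
        fix i
        have "0 \<le> 2 ^ k * (\<tau> k i - (1/2) ^ k * diameter (Q i))\<^sup>2" by simp
        also have "\<dots> = 2 ^ k * (\<tau> k i)\<^sup>2 - 2 * (\<tau> k i * diameter (Q i)) + (1/2) ^ k * (diameter (Q i))\<^sup>2"
          by (simp add: power2_eq_square algebra_simps power_divide)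
        finally show "\<tau> k i * diameter (Q i) \<le> 2 ^ k * (\<tau> k i)\<^sup>2 + (1/2) ^ k * (diameter (Q i))\<^sup>2"
          using \<tau>(1)[of k i] diameter_Q_pos[of i] mult_nonneg_nonneg[of "\<tau> k i" "diameter (Q i)"] by linarith
      qed simp
      also have "\<dots> = ennreal (2 ^ k) * disk_sum (\<lambda>i. (\<tau> k i)\<^sup>2) (meeting Q K) + ennreal ((1/2) ^ k) * ennreal D"
      proof -
        have "0 \<le> (2::real) ^ k" "0 \<le> (1/2::real) ^ k" by simp_all
        note c = this[THEN disk_sum_cmult]
        show ?thesis
          unfolding D(1)[symmetric] c[symmetric] by (rule disk_sum_add) simp_all
      qed
      also have "disk_sum (\<lambda>i. (\<tau> k i)\<^sup>2) (meeting Q K) \<le> ennreal ((1/4) ^ k)"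
      proof -
        have "disk_sum (\<lambda>i. (\<tau> k i)\<^sup>2) UNIV = (\<Sum>i. ennreal ((\<tau> k i)\<^sup>2))" by (simp add: disk_sum_def)
        with less_imp_le[OF \<tau>(2)[of k]] have "disk_sum (\<lambda>i. (\<tau> k i)\<^sup>2) UNIV \<le> ennreal ((1/4) ^ k)" by (simp only:)
        then show ?thesis by (rule order_trans[OF disk_sum_subset[OF subset_UNIV]])
      qed
      also have "ennreal (2 ^ k) * ennreal ((1/4) ^ k) + ennreal ((1/2) ^ k) * ennreal D = ennreal ((1 + D) * (1/2) ^ k)"
      proof -
        have "(2::real) ^ k * (1/4) ^ k = (1/2) ^ k" by (simp flip: power_mult_distrib)
        then have "(1 + D) * (1/2) ^ k = 2 ^ k * (1/4) ^ k + (1/2) ^ k * D" by (simp add: algebra_simps)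
        moreover have pos: "0 \<le> (2::real) ^ k" "0 \<le> (1/4::real) ^ k" "0 \<le> (1/2::real) ^ k" by simp_all
        ultimately show ?thesis
          by (simp only: ennreal_plus[OF mult_nonneg_nonneg[OF pos(1,2)] mult_nonneg_nonneg[OF pos(3) D(2)]]
              ennreal_mult[OF pos(1,2)] ennreal_mult[OF pos(3) D(2)])
      qed
      finally show ?thesis by (simp add: add_right_mono mult_left_mono)
    qed
    from AE_ex_small[OF F this] have "AE c in lborel. \<exists>k. F k c < 1" .
    moreover have "AE c in lborel. \<forall>k a b. a \<le> b \<longrightarrow> ({a..b}, plane_line h c) \<notin> \<Gamma>0 k"
      by (subst AE_all_countable) (intro allI AE_line_not_negl[of v] \<Gamma>0(1))
    ultimately show ?thesis
    proof eventually_elim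
      case (elim c)
      then obtain k where k: "F k c < 1" by blast
      show ?case
      proof (intro impI allI notI)
        fix a b assume c: "c \<in> ?I" and ab: "-real N \<le> a \<and> a \<le> b \<and> b \<le> real N" and g: "({a..b}, plane_line h c) \<in> \<Gamma>"
        have "1 \<le> sum_along Q (\<tau> k) ({a..b}, plane_line h c)" using \<Gamma>0(2) g elim(2) ab by blast
        also have "\<dots> \<le> F k c" using ab c
          by (auto simp: sum_along_eq_disk_sum F_def path_trace_def intro!: disk_sum_subset meeting_mono)
        finally show False using k by simp
      qed
    qed
  qed
  then have "AE c in lborel. \<forall>N::nat. c \<in> {-real N..real N} \<longrightarrow> (\<forall>a b. -real N \<le> a \<and> a \<le> b \<and> b \<le> real N \<longrightarrow> ({a..b}, plane_line h c) \<notin> \<Gamma>)"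
    by (simp add: AE_all_countable)
  then show ?thesis
  proof eventually_elim
    case (elim c)
    show ?case
    proof (intro allI impI)
      fix a b :: real assume "a \<le> b"
      obtain N :: nat where "max \<bar>c\<bar> (max \<bar>a\<bar> \<bar>b\<bar>) \<le> real N" using real_arch_simple by blast
      then show "({a..b}, plane_line h c) \<notin> \<Gamma>" using elim[rule_format, of N a b] \<open>a \<le> b\<close>
        by (auto simp: abs_le_iff)
    qed
  qed
qed

subsection \<open>Almost every curve\<close>

definition curve_in :: "real \<Rightarrow> real \<Rightarrow> (real \<Rightarrow> complex) \<Rightarrow> bool" where
  "curve_in a b \<phi> \<longleftrightarrow> a \<le> b \<and> continuous_on {a..b} \<phi> \<and> \<phi> ` {a..b} \<subseteq> \<Omega>"

text \<open>Only curves on compact intervals are considered. Paths on other intervals are reached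
  through their compact subpaths by means of \<open>superpaths\<close>.\<close>

definition ae_curve :: "modulus_version \<Rightarrow> (real \<Rightarrow> real \<Rightarrow> (real \<Rightarrow> complex) \<Rightarrow> bool) \<Rightarrow> bool" where
  "ae_curve v P \<longleftrightarrow> (\<exists>\<Gamma>. exceptional v \<Omega> Q \<Gamma> \<and>
     (\<forall>a b \<phi>. curve_in a b \<phi> \<longrightarrow> ({a..b}, \<phi>) \<notin> \<Gamma> \<longrightarrow> P a b \<phi>))"

lemma curve_in_sub: "curve_in a b \<phi> \<Longrightarrow> a \<le> s \<Longrightarrow> s \<le> t \<Longrightarrow> t \<le> b \<Longrightarrow> curve_in s t \<phi>"
  by (auto simp: curve_in_def intro: continuous_on_subset)

lemma ae_curve_mono:
  assumes "ae_curve v P" "\<And>a b \<phi>. curve_in a b \<phi> \<Longrightarrow> P a b \<phi> \<Longrightarrow> P' a b \<phi>"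
  shows "ae_curve v P'"
  using assms unfolding ae_curve_def by meson

lemma ae_curve_conj:
  assumes "ae_curve v P" "ae_curve v P'"
  shows "ae_curve v (\<lambda>a b \<phi>. P a b \<phi> \<and> P' a b \<phi>)"
proof -
  obtain \<Gamma> \<Gamma>' where "exceptional v \<Omega> Q \<Gamma>" "\<forall>a b \<phi>. curve_in a b \<phi> \<longrightarrow> ({a..b}, \<phi>) \<notin> \<Gamma> \<longrightarrow> P a b \<phi>"
      "exceptional v \<Omega> Q \<Gamma>'" "\<forall>a b \<phi>. curve_in a b \<phi> \<longrightarrow> ({a..b}, \<phi>) \<notin> \<Gamma>' \<longrightarrow> P' a b \<phi>"
    using assms unfolding ae_curve_def by blast
  then show ?thesis
    unfolding ae_curve_def by (intro exI[of _ "\<Gamma> \<union> \<Gamma>'"]) (auto intro: exceptional_Un)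
qed

lemma ae_curve_sub:
  assumes "ae_curve v P"
  shows "ae_curve v (\<lambda>a b \<phi>. \<forall>s t. a \<le> s \<longrightarrow> s \<le> t \<longrightarrow> t \<le> b \<longrightarrow> P s t \<phi>)"
proof -
  obtain \<Gamma> where G: "exceptional v \<Omega> Q \<Gamma>" "\<And>a b \<phi>. curve_in a b \<phi> \<Longrightarrow> ({a..b}, \<phi>) \<notin> \<Gamma> \<Longrightarrow> P a b \<phi>"
    using assms unfolding ae_curve_def by blast
  have "P s t \<phi>" if "curve_in a b \<phi>" "({a..b}, \<phi>) \<notin> superpaths \<Gamma>" "a \<le> s" "s \<le> t" "t \<le> b" for a b \<phi> s t
  proof (rule G(2))
    show "curve_in s t \<phi>" using that curve_in_sub by blast
    have "subpath_of ({s..t}, \<phi>) ({a..b}, \<phi>)" using that by (auto simp: subpath_of_def is_interval_cc)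
    then show "({s..t}, \<phi>) \<notin> \<Gamma>" using that(2) by (auto simp: superpaths_def)
  qed
  then show ?thesis unfolding ae_curve_def using exceptional_superpaths[OF G(1)] by blast
qed

lemma ae_curve_line:
  assumes "ae_curve v P"
  shows "AE c in lborel. \<forall>a b. a \<le> b \<longrightarrow> plane_line h c ` {a..b} \<subseteq> \<Omega> \<longrightarrow> P a b (plane_line h c)"
proof -
  obtain \<Gamma> where G: "exceptional v \<Omega> Q \<Gamma>" "\<And>a b \<phi>. curve_in a b \<phi> \<Longrightarrow> ({a..b}, \<phi>) \<notin> \<Gamma> \<Longrightarrow> P a b \<phi>"
    using assms unfolding ae_curve_def by blast
  from AE_line_not_exceptional[OF G(1), of h] show ?thesis
  proof eventually_elim
    case (elim c)
    have "continuous_on {a..b} (plane_line h c)" for a b by (intro continuous_intros)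
    then show ?case using elim G(2) by (auto simp: curve_in_def)
  qed
qed

text \<open>For the weak modulus, the function that is \<infinity> on the carpet and 0 elsewhere has
  zero energy and is admissible for the curves whose part in the carpet has positive length. The
  strong modulus ignores such curves by definition.\<close>

lemma ae_curve_hausdorff_zero: "ae_curve v (\<lambda>a b \<phi>. hausdorff 1 (\<phi> ` {a..b} \<inter> S) = 0)"
proof -
  define \<Gamma> where "\<Gamma> = {({a..b}, \<phi>) | a b \<phi>. curve_in a b \<phi> \<and> hausdorff 1 (\<phi> ` {a..b} \<inter> S) \<noteq> 0}"
  have "negl_paths v \<Omega> Q \<Gamma>"
  proof (cases v)
    case Weak
    define l :: "complex \<Rightarrow> ennreal" where "l z = \<infinity> * indicator S z" for z
    have lm: "l \<in> borel_measurable borel" unfolding l_def using S_borel by measurable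
    have "1 \<le> path_integral l \<gamma>" if g: "\<gamma> \<in> \<Gamma>" for \<gamma>
    proof -
      obtain a b \<phi> where \<gamma>: "\<gamma> = ({a..b}, \<phi>)" "curve_in a b \<phi>" "hausdorff 1 (\<phi> ` {a..b} \<inter> S) \<noteq> 0"
        using g unfolding \<Gamma>_def by blast
      have "closed ({a..b} \<inter> \<phi> -` (- (\<Union>i. Q i)))"
        using \<gamma>(2) Q_props(1) by (intro continuous_closed_preimage) (auto simp: curve_in_def)
      moreover have "{a..b} \<inter> \<phi> -` (- (\<Union>i. Q i)) = {t \<in> {a..b}. \<phi> t \<in> S}"
        using \<gamma>(2) by (auto simp: curve_in_def carpet_def)
      ultimately show ?thesis
        unfolding \<gamma>(1) l_def using \<gamma>(2,3) by (intro path_integral_infinity_indicator) (auto simp: curve_in_def)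
    qed
    moreover have "(\<integral>\<^sup>+z. (l z)\<^sup>2 \<partial>hausdorff_measure 2) = 0"
    proof -
      have "(\<integral>\<^sup>+z. (l z)\<^sup>2 \<partial>hausdorff_measure 2) = (\<integral>\<^sup>+z. \<infinity> * indicator S z \<partial>hausdorff_measure 2)"
        by (intro nn_integral_cong) (auto simp: l_def indicator_def power2_eq_square ennreal_top_mult)
      also have "\<dots> = \<infinity> * emeasure (hausdorff_measure 2) S"
        using S_borel by (intro nn_integral_cmult_indicator) simp
      also have "\<dots> = 0" using S_borel hausdorff_S by (simp add: emeasure_hausdorff_measure)
      finally show ?thesis .
    qed
    ultimately have "mod2 \<Gamma> = 0" unfolding mod2_zero_iff using lm by (intro allI impI bexI[of _ l]) simp_all
    then show ?thesis by (simp add: negl_paths_def Weak)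
  next
    case Strong
    show ?thesis unfolding negl_paths_def Strong modulus_version.case
    proof
      fix \<gamma> assume "\<gamma> \<in> \<Gamma>"
      then obtain a b \<phi> where "\<gamma> = ({a..b}, \<phi>)" "hausdorff 1 (\<phi> ` {a..b} \<inter> S) \<noteq> 0"
        unfolding \<Gamma>_def by blast
      then show "hausdorff 1 (path_trace \<gamma> \<inter> S) \<noteq> 0" by (simp add: path_trace_def)
    qed
  qed
  then have "exceptional v \<Omega> Q \<Gamma>" by (rule negl_paths_exceptional)
  moreover have "hausdorff 1 (\<phi> ` {a..b} \<inter> S) = 0" if "curve_in a b \<phi>" "({a..b}, \<phi>) \<notin> \<Gamma>" for a b \<phi>
    using that unfolding \<Gamma>_def by blast
  ultimately show ?thesis unfolding ae_curve_def by (intro exI[of _ \<Gamma>]) simp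
qed

text \<open>Non-negativity is included because \<open>disk_sum\<close> would silently truncate
  negative terms, while their squares would still count.\<close>

definition loc_sq :: "(nat \<Rightarrow> real) \<Rightarrow> bool" where
  "loc_sq \<rho> \<longleftrightarrow> (\<forall>i. 0 \<le> \<rho> i) \<and>
     (\<forall>K. compact K \<longrightarrow> K \<subseteq> \<Omega> \<longrightarrow> disk_sum (\<lambda>i. (\<rho> i)\<^sup>2) (meeting Q K) < \<infinity>)"

lemma loc_sq_diameter:
  assumes "0 \<le> L"
  shows "loc_sq (\<lambda>i. L * diameter (Q i))"
  unfolding loc_sq_def
proof (intro conjI allI impI)
  fix i show "0 \<le> L * diameter (Q i)" using assms diameter_Q_pos[of i] by simp
next
  fix K assume "compact K" "K \<subseteq> \<Omega>"
  then have "disk_sum (\<lambda>i. (diameter (Q i))\<^sup>2) (meeting Q K) < \<infinity>"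
    by (intro disk_sum_diameter_finite compact_imp_bounded)
  then show "disk_sum (\<lambda>i. (L * diameter (Q i))\<^sup>2) (meeting Q K) < \<infinity>"
    using disk_sum_cmult[of "L\<^sup>2" "\<lambda>i. (diameter (Q i))\<^sup>2" "meeting Q K"]
    by (simp add: power_mult_distrib ennreal_mult_less_top)
qed

lemma loc_sq_add:
  assumes "loc_sq \<rho>" "loc_sq \<tau>" "0 \<le> a" "0 \<le> b"
  shows "loc_sq (\<lambda>i. a * \<rho> i + b * \<tau> i)"
  unfolding loc_sq_def
proof (intro conjI allI impI)
  fix i show "0 \<le> a * \<rho> i + b * \<tau> i" using assms by (simp add: loc_sq_def)
next
  fix K assume K: "compact K" "K \<subseteq> \<Omega>"
  have "(a * r + b * t)\<^sup>2 \<le> (2 * a\<^sup>2) * r\<^sup>2 + (2 * b\<^sup>2) * t\<^sup>2" for r t :: real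
    using zero_le_power2[of "a * r - b * t"] by (simp add: power2_eq_square algebra_simps)
  then have "disk_sum (\<lambda>i. (a * \<rho> i + b * \<tau> i)\<^sup>2) (meeting Q K) \<le>
      disk_sum (\<lambda>i. (2 * a\<^sup>2) * (\<rho> i)\<^sup>2 + (2 * b\<^sup>2) * (\<tau> i)\<^sup>2) (meeting Q K)"
    by (intro disk_sum_mono) auto
  also have "\<dots> = disk_sum (\<lambda>i. (2 * a\<^sup>2) * (\<rho> i)\<^sup>2) (meeting Q K) + disk_sum (\<lambda>i. (2 * b\<^sup>2) * (\<tau> i)\<^sup>2) (meeting Q K)"
    by (rule disk_sum_add) auto
  also have "\<dots> = ennreal (2 * a\<^sup>2) * disk_sum (\<lambda>i. (\<rho> i)\<^sup>2) (meeting Q K) + ennreal (2 * b\<^sup>2) * disk_sum (\<lambda>i. (\<tau> i)\<^sup>2) (meeting Q K)"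
    by (subst (1 2) disk_sum_cmult) auto
  also have "\<dots> < \<infinity>" using assms(1,2) K by (auto simp: loc_sq_def ennreal_mult_less_top)
  finally show "disk_sum (\<lambda>i. (a * \<rho> i + b * \<tau> i)\<^sup>2) (meeting Q K) < \<infinity>" .
qed

text \<open>Square summability is only local, so an exhaustion of \<Omega> by compact sets gives
  countably many exceptional families; a compact curve lies in one member of the exhaustion.\<close>

lemma ae_curve_finite_sum:
  assumes "loc_sq \<rho>"
  shows "ae_curve v (\<lambda>a b \<phi>. disk_sum \<rho> (meeting Q (\<phi> ` {a..b})) < \<infinity>)"
proof -
  have "\<exists>C::nat \<Rightarrow> complex set. (\<forall>n. compact (C n) \<and> C n \<subseteq> \<Omega>) \<and> (\<forall>K. compact K \<and> K \<subseteq> \<Omega> \<longrightarrow> (\<exists>n. K \<subseteq> C n))"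
  proof (rule open_Union_compact_subsets[OF open_Omega])
    fix C :: "nat \<Rightarrow> complex set"
    assume C: "\<And>n. compact (C n)" "\<And>n. C n \<subseteq> \<Omega>" "\<And>K. compact K \<Longrightarrow> K \<subseteq> \<Omega> \<Longrightarrow> \<exists>N. \<forall>n\<ge>N. K \<subseteq> C n"
    have "\<exists>n. K \<subseteq> C n" if "compact K \<and> K \<subseteq> \<Omega>" for K
    proof -
      obtain N where "\<forall>n\<ge>N. K \<subseteq> C n" using C(3)[of K] \<open>compact K \<and> K \<subseteq> \<Omega>\<close> by auto
      then have "K \<subseteq> C N" by simp
      then show ?thesis ..
    qed
    then show ?thesis using C(1,2) by (intro exI[of _ C]) simp
  qed
  then obtain C :: "nat \<Rightarrow> complex set" where
    *: "(\<forall>n. compact (C n) \<and> C n \<subseteq> \<Omega>) \<and> (\<forall>K. compact K \<and> K \<subseteq> \<Omega> \<longrightarrow> (\<exists>n. K \<subseteq> C n))" ..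
  then have C: "\<And>n. compact (C n)" "\<And>n. C n \<subseteq> \<Omega>"
      "\<And>K. compact K \<Longrightarrow> K \<subseteq> \<Omega> \<Longrightarrow> \<exists>n. K \<subseteq> C n"
    by simp_all
  define \<Gamma> where "\<Gamma> n = {\<gamma>. disk_sum \<rho> (meeting Q (path_trace \<gamma>) \<inter> meeting Q (C n)) = \<infinity>}" for n :: nat
  have "exceptional v \<Omega> Q (\<Union>n. \<Gamma> n)"
    unfolding \<Gamma>_def using assms C(1,2)
    by (intro exceptional_UN exceptional_infinite_sum_on) (auto simp: loc_sq_def)
  moreover have "disk_sum \<rho> (meeting Q (\<phi> ` {a..b})) < \<infinity>"
    if "curve_in a b \<phi>" "({a..b}, \<phi>) \<notin> (\<Union>n. \<Gamma> n)" for a b \<phi>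
  proof -
    have "compact (\<phi> ` {a..b})" "\<phi> ` {a..b} \<subseteq> \<Omega>"
      using that(1) by (auto simp: curve_in_def intro: compact_continuous_image)
    then obtain n where "\<phi> ` {a..b} \<subseteq> C n" using C(3) by blast
    then have "meeting Q (\<phi> ` {a..b}) \<inter> meeting Q (C n) = meeting Q (\<phi> ` {a..b})"
      using meeting_mono by blast
    moreover have "disk_sum \<rho> (meeting Q (\<phi> ` {a..b}) \<inter> meeting Q (C n)) < \<infinity>"
      using that(2) by (simp add: \<Gamma>_def path_trace_def less_top)
    ultimately show ?thesis by simp
  qed
  ultimately show ?thesis unfolding ae_curve_def by (intro exI[of _ "\<Union>n. \<Gamma> n"]) simp
qed

subsection \<open>Oscillation sums control differences along curves\<close>

text \<open>Quantifying over all pairs of times lets the property pass to subcurves, and the sum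
  extends only over the disks met between the two times. Times in disks are excluded, as
  \<open>h\<close> matters on the carpet only.\<close>

definition curve_bound :: "(complex \<Rightarrow> real) \<Rightarrow> (nat \<Rightarrow> real) \<Rightarrow> real \<Rightarrow> real \<Rightarrow> (real \<Rightarrow> complex) \<Rightarrow> bool" where
  "curve_bound h \<rho> a b \<phi> \<longleftrightarrow> (\<forall>s t. a \<le> s \<longrightarrow> s \<le> t \<longrightarrow> t \<le> b \<longrightarrow> \<phi> s \<in> S \<longrightarrow> \<phi> t \<in> S \<longrightarrow>
     ennreal \<bar>h (\<phi> s) - h (\<phi> t)\<bar> \<le> disk_sum \<rho> (meeting Q (\<phi> ` {s..t})))"

lemma curve_bound_sub: "curve_bound h \<rho> a b \<phi> \<Longrightarrow> a \<le> s \<Longrightarrow> t \<le> b \<Longrightarrow> curve_bound h \<rho> s t \<phi>"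
  unfolding curve_bound_def by (meson order_trans)

lemma curve_boundD:
  "curve_bound h \<rho> a b \<phi> \<Longrightarrow> a \<le> s \<Longrightarrow> s \<le> t \<Longrightarrow> t \<le> b \<Longrightarrow> \<phi> s \<in> S \<Longrightarrow> \<phi> t \<in> S \<Longrightarrow>
     ennreal \<bar>h (\<phi> s) - h (\<phi> t)\<bar> \<le> disk_sum \<rho> (meeting Q (\<phi> ` {s..t}))"
  unfolding curve_bound_def by blast

text \<open>
  Two times are linked if the curve is at the same point or at the same closed disk. The relation is
  closed because only finitely many disks that meet the curve are large.
\<close>

lemma closed_links:
  assumes "curve_in a b \<phi>"
  defines "J \<equiv> meeting Q (\<phi> ` {a..b})"
  shows "closed {p. fst p \<in> {a..b} \<and> snd p \<in> {a..b} \<and> (\<phi> (fst p) = \<phi> (snd p) \<or>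
     (\<exists>j\<in>J. \<phi> (fst p) \<in> closure (Q j) \<and> \<phi> (snd p) \<in> closure (Q j)))}" (is "closed ?L")
proof -
  have cont: "continuous_on {a..b} \<phi>" and bd: "bounded (\<phi> ` {a..b})"
    using assms(1) by (auto simp: curve_in_def intro: compact_imp_bounded compact_continuous_image)
  define D where "D m = {p \<in> {a..b} \<times> {a..b}. dist (\<phi> (fst p)) (\<phi> (snd p)) \<le> 1 / real (Suc m)}" for m
  define E where "E j = {p \<in> {a..b} \<times> {a..b}. \<phi> (fst p) \<in> closure (Q j) \<and> \<phi> (snd p) \<in> closure (Q j)}" for j
  define F where "F m = {j \<in> J. 1 / real (Suc m) \<le> diameter (Q j)}" for m
  have c1: "continuous_on ({a..b} \<times> {a..b}) (\<lambda>p. \<phi> (fst p))" "continuous_on ({a..b} \<times> {a..b}) (\<lambda>p. \<phi> (snd p))"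
    by (auto intro!: continuous_on_compose2[OF cont] continuous_intros)
  have D: "closed (D m)" for m
  proof -
    have "D m = ({a..b} \<times> {a..b}) \<inter> (\<lambda>p. dist (\<phi> (fst p)) (\<phi> (snd p))) -` {..1 / real (Suc m)}"
      by (auto simp: D_def)
    then show ?thesis by (auto intro!: continuous_closed_preimage continuous_on_dist c1 closed_Times)
  qed
  have E: "closed (E j)" for j
  proof -
    have "E j = (({a..b} \<times> {a..b}) \<inter> (\<lambda>p. \<phi> (fst p)) -` closure (Q j)) \<inter> (({a..b} \<times> {a..b}) \<inter> (\<lambda>p. \<phi> (snd p)) -` closure (Q j))"
      by (auto simp: E_def)
    moreover have "closed \<dots>"
      by (intro closed_Int continuous_closed_preimage c1 closed_Times closed_closure closed_atLeastAtMost)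
    ultimately show ?thesis by simp
  qed
  have fin: "finite (F m)" for m
    unfolding F_def J_def using finite_large_disks[OF bd, of "1 / real (Suc m)"] by simp
  have "?L = (\<Inter>m. D m \<union> (\<Union>j\<in>F m. E j))"
  proof (intro equalityI subsetI)
    fix p assume p: "p \<in> ?L"
    then have p1: "p \<in> {a..b} \<times> {a..b}" by (cases p) auto
    show "p \<in> (\<Inter>m. D m \<union> (\<Union>j\<in>F m. E j))"
    proof
      fix m
      from p consider "\<phi> (fst p) = \<phi> (snd p)" | j where "j \<in> J" "\<phi> (fst p) \<in> closure (Q j)" "\<phi> (snd p) \<in> closure (Q j)"
        by blast
      then show "p \<in> D m \<union> (\<Union>j\<in>F m. E j)"
      proof cases
        case 1
        then show ?thesis using p1 by (auto simp: D_def)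
      next
        case 2
        show ?thesis
        proof (cases "1 / real (Suc m) \<le> diameter (Q j)")
          case True
          then show ?thesis using 2 p1 by (auto simp: F_def E_def)
        next
          case False
          have "dist (\<phi> (fst p)) (\<phi> (snd p)) \<le> diameter (closure (Q j))"
            using 2 compact_closure_Q by (intro diameter_bounded_bound compact_imp_bounded)
          then have "dist (\<phi> (fst p)) (\<phi> (snd p)) \<le> 1 / real (Suc m)"
            using False diameter_closure[OF Q_props(3)[of j]] by linarith
          then show ?thesis using p1 by (auto simp: D_def)
        qed
      qed
    qed
  next
    fix p assume p: "p \<in> (\<Inter>m. D m \<union> (\<Union>j\<in>F m. E j))"
    then have p1: "p \<in> {a..b} \<times> {a..b}" by (auto simp: D_def E_def)
    show "p \<in> ?L"
    proof (cases "\<phi> (fst p) = \<phi> (snd p)")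
      case True
      then show ?thesis using p1 by auto
    next
      case False
      then have "0 < dist (\<phi> (fst p)) (\<phi> (snd p))" by simp
      then obtain m where "1 / real (Suc m) < dist (\<phi> (fst p)) (\<phi> (snd p))"
        by (rule nat_approx_posE)
      then have "p \<notin> D m" by (auto simp: D_def)
      then obtain j where "j \<in> F m" "p \<in> E j" using p by blast
      then show ?thesis using p1 by (auto simp: F_def E_def)
    qed
  qed
  then show ?thesis using D E fin by (auto intro!: closed_INT closed_Un closed_UN)
qed

text \<open>
  Among the linked pairs around all visits to \<open>Q k\<close> take one farthest apart. Then no disk meets both
  remaining pieces of the curve, so no disk is counted twice when the link replaces the middle piece.
\<close>

lemma curve_bound_replace_endpoints:
  assumes cv: "curve_in a b \<phi>" and ab: "\<phi> a \<in> S" "\<phi> b \<in> S" and cb: "curve_bound h \<rho> a b \<phi>"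
    and osc: "\<And>i x y. x \<in> frontier (Q i) \<Longrightarrow> y \<in> frontier (Q i) \<Longrightarrow> \<bar>h x - h y\<bar> \<le> \<rho>' i"
    and \<rho>': "\<And>i. i \<noteq> k \<Longrightarrow> \<rho>' i = \<rho> i"
  shows "ennreal \<bar>h (\<phi> a) - h (\<phi> b)\<bar> \<le> disk_sum \<rho>' (meeting Q (\<phi> ` {a..b}))"
proof -
  define J where "J = meeting Q (\<phi> ` {a..b})"
  have le: "a \<le> b" and cont: "continuous_on {a..b} \<phi>" and sub: "\<phi> ` {a..b} \<subseteq> \<Omega>"
    using cv by (auto simp: curve_in_def)
  have inO: "\<phi> r \<in> \<Omega>" if "r \<in> {a..b}" for r using sub that by blast
  have sum_eq: "disk_sum \<rho> A = disk_sum \<rho>' A" if "k \<notin> A" for A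
  proof -
    have "\<rho>' i = \<rho> i" if "i \<in> A" for i using that \<open>k \<notin> A\<close> by (intro \<rho>') auto
    then show ?thesis unfolding disk_sum_def by (intro suminf_cong) (auto simp: indicator_def)
  qed
  show ?thesis
  proof (cases "k \<in> J")
    case False
    then show ?thesis using curve_boundD[OF cb, of a b] le ab sum_eq by (simp add: J_def)
  next
    case True
    define V where "V = {a..b} \<inter> \<phi> -` closure (Q k)"
    have "closed V" unfolding V_def by (intro continuous_closed_preimage cont) auto
    then have V: "compact V" unfolding compact_eq_bounded_closed
      by (auto simp: V_def intro: bounded_subset[OF bounded_closed_interval[of a b]])
    have "V \<noteq> {}" using True in_Q_closure by (auto simp: J_def meeting_def V_def)
    then obtain \<alpha> \<beta> where \<alpha>: "\<alpha> \<in> V" "\<And>r. r \<in> V \<Longrightarrow> \<alpha> \<le> r" and \<beta>: "\<beta> \<in> V" "\<And>r. r \<in> V \<Longrightarrow> r \<le> \<beta>"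
      using compact_attains_inf[OF V] compact_attains_sup[OF V] by metis
    have \<alpha>\<beta>: "a \<le> \<alpha>" "\<alpha> \<le> \<beta>" "\<beta> \<le> b" using \<alpha> \<beta> by (auto simp: V_def)
    define link where "link s t \<longleftrightarrow> \<phi> s = \<phi> t \<or> (\<exists>j\<in>J. \<phi> s \<in> closure (Q j) \<and> \<phi> t \<in> closure (Q j))" for s t
    \<comment> \<open>The first and last visits \<alpha> and \<beta> to the closed disk
      \<open>k\<close> are linked through \<open>k\<close>, so the compact set \<open>P\<close> of
      linked pairs enclosing them is nonempty and the distance of times has a maximizer.\<close>
    define P where "P = ({a..\<alpha>} \<times> {\<beta>..b}) \<inter> {p. fst p \<in> {a..b} \<and> snd p \<in> {a..b} \<and> link (fst p) (snd p)}"
    have "closed {p. fst p \<in> {a..b} \<and> snd p \<in> {a..b} \<and> link (fst p) (snd p)}"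
      unfolding link_def J_def by (rule closed_links[OF cv])
    then have "compact P" unfolding P_def by (intro compact_Int_closed compact_Times) auto
    moreover have "(\<alpha>, \<beta>) \<in> P" using \<alpha>\<beta> \<alpha>(1) \<beta>(1) True by (auto simp: P_def link_def V_def)
    moreover have "continuous_on P (\<lambda>p. snd p - fst p)" by (intro continuous_intros)
    ultimately obtain p where p: "p \<in> P" "\<And>q. q \<in> P \<Longrightarrow> snd q - fst q \<le> snd p - fst p"
      using continuous_attains_sup[of P "\<lambda>p. snd p - fst p"] by blast
    define s where "s = fst p"
    define t where "t = snd p"
    have st: "a \<le> s" "s \<le> \<alpha>" "\<beta> \<le> t" "t \<le> b" "link s t" using p(1) by (auto simp: P_def s_def t_def)
    have mx: "s' = s \<and> t' = t" if "a \<le> s'" "s' \<le> s" "t \<le> t'" "t' \<le> b" "link s' t'" for s' t'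
      using p(2)[of "(s', t')"] that st \<alpha>\<beta> by (auto simp: P_def s_def t_def)
    have st': "s \<in> {a..b}" "t \<in> {a..b}" "s \<le> t" using st \<alpha>\<beta> by auto
    have linkQ: "\<phi> r \<in> closure (Q j)" "j \<in> J" if "r \<in> {a..b}" "r' \<in> {a..b}" "link r r' \<or> link r' r" "\<phi> r' \<in> Q j" for r r' j
    proof -
      show "j \<in> J" using that(2,4) by (auto simp: J_def meeting_def)
      show "\<phi> r \<in> closure (Q j)" using that(3) in_Q_closure[OF that(4)] Q_unique[of "\<phi> r'" j] unfolding link_def
        by metis
    qed
    \<comment> \<open>If the curve were inside a disk at time \<open>s\<close>, it would be there
      slightly earlier too, with the link intact, contradicting maximality. The other endpoint is
      handled symmetrically.\<close>
    have sS: "\<phi> s \<in> S"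
    proof (rule ccontr)
      assume "\<phi> s \<notin> S"
      then obtain j where j: "\<phi> s \<in> Q j" using inO st' by (auto simp: S_iff)
      have "a < s" using j ab(1) st(1) by (cases "a = s") (auto simp: S_iff)
      obtain d where d: "0 < d" "\<And>r. r \<in> {a..b} \<Longrightarrow> dist r s < d \<Longrightarrow> \<phi> r \<in> Q j"
        using cont[unfolded continuous_on_topological, rule_format, OF st'(1) Q_props(1) j]
        by (metis dist_commute open_contains_ball mem_ball subsetD)
      define s' where "s' = max a (s - d/2)"
      have s': "a \<le> s'" "s' < s" "s - s' < d" using \<open>a < s\<close> d(1) by (auto simp: s'_def)
      then have "\<phi> s' \<in> Q j" using st' by (intro d(2)) (auto simp: dist_real_def)
      moreover have "\<phi> t \<in> closure (Q j)" "j \<in> J" using linkQ[of t s j] st' st(5) j by auto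
      ultimately have "link s' t" using in_Q_closure by (auto simp: link_def)
      then show False using mx[of s' t] s' st by auto
    qed
    have tS: "\<phi> t \<in> S"
    proof (rule ccontr)
      assume "\<phi> t \<notin> S"
      then obtain j where j: "\<phi> t \<in> Q j" using inO st' by (auto simp: S_iff)
      have "t < b" using j ab(2) st(4) by (cases "t = b") (auto simp: S_iff)
      obtain d where d: "0 < d" "\<And>r. r \<in> {a..b} \<Longrightarrow> dist r t < d \<Longrightarrow> \<phi> r \<in> Q j"
        using cont[unfolded continuous_on_topological, rule_format, OF st'(2) Q_props(1) j]
        by (metis dist_commute open_contains_ball mem_ball subsetD)
      define t' where "t' = min b (t + d/2)"
      have t': "t' \<le> b" "t < t'" "t' - t < d" using \<open>t < b\<close> d(1) by (auto simp: t'_def)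
      then have "\<phi> t' \<in> Q j" using st' by (intro d(2)) (auto simp: dist_real_def)
      moreover have "\<phi> s \<in> closure (Q j)" "j \<in> J" using linkQ[of s t j] st' st(5) j by auto
      ultimately have "link s t'" using in_Q_closure by (auto simp: link_def)
      then show False using mx[of s t'] t' st by auto
    qed
    define A where "A = meeting Q (\<phi> ` {a..s})"
    define B where "B = meeting Q (\<phi> ` {t..b})"
    have AJ: "A \<subseteq> J" "B \<subseteq> J" unfolding A_def B_def J_def using st' by (intro meeting_mono image_mono; force)+
    have AB: "A \<inter> B = {}"
    proof (rule ccontr)
      assume "A \<inter> B \<noteq> {}"
      then obtain j where "j \<in> A" "j \<in> B" by blast
      then obtain s' t' where *: "s' \<in> {a..s}" "t' \<in> {t..b}" "\<phi> s' \<in> Q j" "\<phi> t' \<in> Q j"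
        unfolding A_def B_def meeting_def by blast
      moreover have "j \<in> J" using \<open>j \<in> A\<close> AJ(1) by blast
      ultimately have "link s' t'" unfolding link_def using in_Q_closure by blast
      then have "s' = s" using mx[of s' t'] * by auto
      then show False using * sS by (auto simp: S_iff)
    qed
    have k: "k \<notin> A" "k \<notin> B"
    proof -
      show "k \<notin> A"
      proof
        assume "k \<in> A"
        then obtain r where r: "r \<in> {a..s}" "\<phi> r \<in> Q k" unfolding A_def meeting_def by blast
        then have "r \<in> V" using st' in_Q_closure by (auto simp: V_def)
        then have "r = s" using \<alpha>(2) r st by force
        then show False using r sS by (auto simp: S_iff)
      qed
      show "k \<notin> B"
      proof
        assume "k \<in> B"
        then obtain r where r: "r \<in> {t..b}" "\<phi> r \<in> Q k" unfolding B_def meeting_def by blast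
        then have "r \<in> V" using st' in_Q_closure by (auto simp: V_def)
        then have "r = t" using \<beta>(2) r st by force
        then show False using r tS by (auto simp: S_iff)
      qed
    qed
    have tri: "\<bar>h (\<phi> a) - h (\<phi> b)\<bar> \<le> \<bar>h (\<phi> a) - h (\<phi> s)\<bar> + \<bar>h (\<phi> s) - h (\<phi> t)\<bar> + \<bar>h (\<phi> t) - h (\<phi> b)\<bar>" by linarith
    have b1: "ennreal \<bar>h (\<phi> a) - h (\<phi> s)\<bar> \<le> disk_sum \<rho>' A"
      using curve_boundD[OF cb, of a s] st' st ab sS sum_eq[OF k(1)] by (simp add: A_def)
    have b3: "ennreal \<bar>h (\<phi> t) - h (\<phi> b)\<bar> \<le> disk_sum \<rho>' B"
      using curve_boundD[OF cb, of t b] st' st ab tS sum_eq[OF k(2)] by (simp add: B_def)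
    have "ennreal \<bar>h (\<phi> a) - h (\<phi> b)\<bar> \<le> ennreal \<bar>h (\<phi> a) - h (\<phi> s)\<bar> + ennreal \<bar>h (\<phi> s) - h (\<phi> t)\<bar> + ennreal \<bar>h (\<phi> t) - h (\<phi> b)\<bar>"
      using tri by (simp add: ennreal_leI flip: ennreal_plus)
    also have "\<dots> \<le> disk_sum \<rho>' A + ennreal \<bar>h (\<phi> s) - h (\<phi> t)\<bar> + disk_sum \<rho>' B"
      by (intro add_mono b1 b3 order_refl)
    also have "\<dots> \<le> disk_sum \<rho>' J"
    proof -
      from st(5) consider "\<phi> s = \<phi> t" | j where "j \<in> J" "\<phi> s \<in> closure (Q j)" "\<phi> t \<in> closure (Q j)"
        unfolding link_def by blast
      then show ?thesis
      proof cases
        case 1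
        then show ?thesis using disk_sum_Un_disjoint[OF AB, of \<rho>'] disk_sum_subset[of "A \<union> B" J \<rho>'] AJ by simp
      next
        case 2
        have "j \<notin> A"
        proof
          assume "j \<in> A"
          then obtain r where r: "r \<in> {a..s}" "\<phi> r \<in> Q j" unfolding A_def meeting_def by blast
          then have "link r t" using 2 in_Q_closure by (auto simp: link_def)
          then have "r = s" using mx[of r t] r st by auto
          then show False using r sS by (auto simp: S_iff)
        qed
        moreover have "j \<notin> B"
        proof
          assume "j \<in> B"
          then obtain r where r: "r \<in> {t..b}" "\<phi> r \<in> Q j" unfolding B_def meeting_def by blast
          then have "link s r" using 2 in_Q_closure by (auto simp: link_def)
          then have "r = t" using mx[of s r] r st by auto
          then show False using r tS by (auto simp: S_iff)
        qed
        ultimately have "disk_sum \<rho>' (insert j (A \<union> B)) = ennreal (\<rho>' j) + (disk_sum \<rho>' A + disk_sum \<rho>' B)"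
          using disk_sum_insert[of j "A \<union> B" \<rho>'] disk_sum_Un_disjoint[OF AB, of \<rho>'] by simp
        moreover have "\<bar>h (\<phi> s) - h (\<phi> t)\<bar> \<le> \<rho>' j"
          using 2 S_closure_Q[OF sS] S_closure_Q[OF tS] by (intro osc) auto
        then have "disk_sum \<rho>' A + ennreal \<bar>h (\<phi> s) - h (\<phi> t)\<bar> + disk_sum \<rho>' B \<le>
           disk_sum \<rho>' A + ennreal (\<rho>' j) + disk_sum \<rho>' B"
          by (intro add_mono ennreal_leI order_refl)
        ultimately have "disk_sum \<rho>' A + ennreal \<bar>h (\<phi> s) - h (\<phi> t)\<bar> + disk_sum \<rho>' B \<le> disk_sum \<rho>' (insert j (A \<union> B))"
          by (simp add: ac_simps)
        also have "\<dots> \<le> disk_sum \<rho>' J" using 2 AJ by (intro disk_sum_subset) auto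
        finally show ?thesis .
      qed
    qed
    finally show ?thesis by (simp add: J_def)
  qed
qed

text \<open>One disk is replaced at a time. Since the link in a single replacement may pass through
  any disk, the current sequence must dominate all oscillations, and \<open>w \<le> \<rho>\<close>
  preserves this.\<close>

lemma curve_bound_replace_finite:
  assumes "finite F" and cv: "curve_in a b \<phi>" and cb: "curve_bound h \<rho> a b \<phi>"
    and osc: "\<And>i x y. x \<in> frontier (Q i) \<Longrightarrow> y \<in> frontier (Q i) \<Longrightarrow> \<bar>h x - h y\<bar> \<le> w i"
    and w: "\<And>i. w i \<le> \<rho> i"
  shows "curve_bound h (\<lambda>i. if i \<in> F then w i else \<rho> i) a b \<phi>"
  using \<open>finite F\<close>
proof induction
  case empty
  then show ?case using cb by simp
next
  case (insert i0 F)
  show ?case unfolding curve_bound_def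
  proof (intro allI impI)
    fix s t assume st: "a \<le> s" "s \<le> t" "t \<le> b" "\<phi> s \<in> S" "\<phi> t \<in> S"
    show "ennreal \<bar>h (\<phi> s) - h (\<phi> t)\<bar> \<le> disk_sum (\<lambda>i. if i \<in> insert i0 F then w i else \<rho> i) (meeting Q (\<phi> ` {s..t}))"
    proof (rule curve_bound_replace_endpoints[where k = i0])
      show "curve_in s t \<phi>" by (rule curve_in_sub[OF cv st(1-3)])
      show "curve_bound h (\<lambda>i. if i \<in> F then w i else \<rho> i) s t \<phi>" by (rule curve_bound_sub[OF insert.IH st(1,3)])
      show "\<bar>h x - h y\<bar> \<le> (if i \<in> insert i0 F then w i else \<rho> i)"
        if "x \<in> frontier (Q i)" "y \<in> frontier (Q i)" for i x y
        using osc[OF that] w[of i] by simp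
    qed (use st insert.hyps in auto)
  qed
qed

text \<open>After the first \<open>n\<close> terms are replaced, the remaining terms of \<rho> along
  the curve have arbitrarily small sum. Finiteness of the sum is essential for this limit, and
  almost every curve has it when \<rho> is locally square summable.\<close>

proposition curve_bound_osc:
  assumes cv: "curve_in a b \<phi>" and cb: "curve_bound h \<rho> a b \<phi>"
    and osc: "\<And>i x y. x \<in> frontier (Q i) \<Longrightarrow> y \<in> frontier (Q i) \<Longrightarrow> \<bar>h x - h y\<bar> \<le> w i"
    and w: "\<And>i. w i \<le> \<rho> i" and fin: "disk_sum \<rho> (meeting Q (\<phi> ` {a..b})) < \<infinity>"
  shows "curve_bound h w a b \<phi>"
  unfolding curve_bound_def
proof (intro allI impI)
  fix s t assume st: "a \<le> s" "s \<le> t" "t \<le> b" "\<phi> s \<in> S" "\<phi> t \<in> S"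
  let ?J = "meeting Q (\<phi> ` {s..t})"
  have finJ: "disk_sum \<rho> ?J < \<infinity>"
    by (rule le_less_trans[OF disk_sum_subset[OF meeting_mono] fin]) (use st in auto)
  show "ennreal \<bar>h (\<phi> s) - h (\<phi> t)\<bar> \<le> disk_sum w ?J"
  proof (rule ennreal_le_epsilon)
    fix e :: real assume "0 < e"
    then obtain n where n: "disk_sum \<rho> (?J - {..<n}) < ennreal e" using disk_sum_tail[OF finJ] by blast
    have "curve_bound h (\<lambda>i. if i \<in> {..<n} then w i else \<rho> i) a b \<phi>"
      using curve_bound_replace_finite[OF _ cv cb osc w, of "{..<n}"] by simp
    then have "ennreal \<bar>h (\<phi> s) - h (\<phi> t)\<bar> \<le> disk_sum (\<lambda>i. if i \<in> {..<n} then w i else \<rho> i) ?J"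
      using st by (intro curve_boundD)
    also have "\<dots> = disk_sum (\<lambda>i. if i \<in> {..<n} then w i else \<rho> i) (?J \<inter> {..<n}) +
        disk_sum (\<lambda>i. if i \<in> {..<n} then w i else \<rho> i) (?J - {..<n})"
      by (subst disk_sum_Un_disjoint[symmetric]) (auto simp: Int_Diff_Un)
    also have "\<dots> \<le> disk_sum w ?J + disk_sum \<rho> (?J - {..<n})"
      by (intro add_mono disk_sum_mono) auto
    also have "\<dots> \<le> disk_sum w ?J + ennreal e" using n by (intro add_left_mono) simp
    finally show "ennreal \<bar>h (\<phi> s) - h (\<phi> t)\<bar> \<le> disk_sum w ?J + ennreal e" .
  qed
qed

text \<open>The image of the curve under \<open>f\<close> contains the interval between the two
  values. Points of the carpet contribute a null set to it, and every disk met contributes a set of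
  length at most its diameter.\<close>

lemma curve_bound_lipschitz:
  assumes cv: "curve_in a b \<phi>" and H: "hausdorff 1 (\<phi> ` {a..b} \<inter> S) = 0"
    and lip: "\<And>x y. \<bar>f x - f y\<bar> \<le> dist x y"
  shows "curve_bound f (\<lambda>i. diameter (Q i)) a b \<phi>"
  unfolding curve_bound_def
proof (intro allI impI)
  fix s t assume st: "a \<le> s" "s \<le> t" "t \<le> b" "\<phi> s \<in> S" "\<phi> t \<in> S"
  let ?J = "meeting Q (\<phi> ` {s..t})"
  have cont: "continuous_on {s..t} \<phi>" and sub: "\<phi> ` {s..t} \<subseteq> \<Omega>"
    using curve_in_sub[OF cv st(1-3)] by (auto simp: curve_in_def)
  have contf: "continuous_on UNIV f"
    unfolding continuous_on_iff using lip by (metis dist_real_def le_less_trans)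
  have "hausdorff 1 (\<phi> ` {s..t} \<inter> S) \<le> hausdorff 1 (\<phi> ` {a..b} \<inter> S)" using st by (intro hausdorff_mono) auto
  then have "negligible (f ` (\<phi> ` {s..t} \<inter> S))"
    using H by (intro hausdorff_1_null_lipschitz_image lip) simp
  then obtain N where N: "N \<in> null_sets lborel" "f ` (\<phi> ` {s..t} \<inter> S) \<subseteq> N"
    by (auto simp: negligible_iff_null_sets null_sets_completion_iff2)
  have "\<exists>I. I \<in> sets borel \<and> f ` Q i \<subseteq> I \<and> emeasure lborel I \<le> ennreal (diameter (Q i))" for i
  proof (rule pairwise_close_subset_interval[of "f ` Q i" "diameter (Q i)"])
    fix c c' assume "c \<in> f ` Q i" "c' \<in> f ` Q i"
    then obtain x y where "x \<in> Q i" "y \<in> Q i" "c = f x" "c' = f y" by blast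
    then show "\<bar>c - c'\<bar> \<le> diameter (Q i)" using lip[of x y] diameter_bounded_bound[OF Q_props(3), of x i y] by simp
  qed (use diameter_Q_pos[of i] in auto)
  then obtain I where I: "\<And>i. I i \<in> sets borel" "\<And>i. f ` Q i \<subseteq> I i" "\<And>i. emeasure lborel (I i) \<le> ennreal (diameter (Q i))"
    by metis
  define I' where "I' i = (if i \<in> ?J then I i else {})" for i
  have I': "I' i \<in> sets lborel" for i using I(1) by (simp add: I'_def)
  define x where "x = min (f (\<phi> s)) (f (\<phi> t))"
  define y where "y = max (f (\<phi> s)) (f (\<phi> t))"
  have con: "connected (f ` \<phi> ` {s..t})"
    using cont contf by (intro connected_continuous_image) (auto intro: continuous_on_subset)
  have "{x..y} \<subseteq> f ` \<phi> ` {s..t}"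
  proof -
    have "x \<in> f ` \<phi> ` {s..t}" "y \<in> f ` \<phi> ` {s..t}" using st(2) by (auto simp: x_def y_def min_def max_def)
    then show ?thesis using con unfolding connected_iff_interval by (meson atLeastAtMost_iff subsetI)
  qed
  also have "\<dots> \<subseteq> N \<union> (\<Union>i. I' i)"
  proof
    fix z assume "z \<in> f ` \<phi> ` {s..t}"
    then obtain r where r: "r \<in> {s..t}" "z = f (\<phi> r)" by blast
    show "z \<in> N \<union> (\<Union>i. I' i)"
    proof (cases "\<phi> r \<in> S")
      case True
      then show ?thesis using r N(2) by blast
    next
      case False
      moreover have "\<phi> r \<in> \<Omega>" using r sub by blast
      ultimately obtain i where i: "\<phi> r \<in> Q i" by (auto simp: S_iff)
      then have "i \<in> ?J" using r by (auto simp: meeting_def)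
      then have "z \<in> I' i" using i I(2)[of i] r by (auto simp: I'_def)
      then show ?thesis by blast
    qed
  qed
  finally have "emeasure lborel {x..y} \<le> emeasure lborel (N \<union> (\<Union>i. I' i))"
    using N(1) I' by (intro emeasure_mono) auto
  also have "\<dots> \<le> emeasure lborel N + emeasure lborel (\<Union>i. I' i)"
    using N(1) I' by (intro emeasure_subadditive) auto
  also have "\<dots> \<le> 0 + (\<Sum>i. emeasure lborel (I' i))"
    using N(1) I' by (intro add_mono emeasure_subadditive_countably) auto
  also have "\<dots> \<le> disk_sum (\<lambda>i. diameter (Q i)) ?J"
    unfolding disk_sum_def using I(3) by (auto intro!: suminf_le simp: I'_def)
  finally have "emeasure lborel {x..y} \<le> disk_sum (\<lambda>i. diameter (Q i)) ?J" .
  moreover have "emeasure lborel {x..y} = ennreal \<bar>f (\<phi> s) - f (\<phi> t)\<bar>"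
    by (cases "f (\<phi> s) \<le> f (\<phi> t)") (simp_all add: x_def y_def)
  ultimately show "ennreal \<bar>f (\<phi> s) - f (\<phi> t)\<bar> \<le> disk_sum (\<lambda>i. diameter (Q i)) ?J" by simp
qed

subsection \<open>Real-valued Sobolev functions\<close>

text \<open>A supremum of differences is easier to bound than a difference of a supremum and an
  infimum; \<open>osc_eq\<close> identifies the two for bounded boundary values.\<close>

definition osc :: "(complex \<Rightarrow> real) \<Rightarrow> nat \<Rightarrow> real" where
  "osc h i = (SUP p\<in>frontier (Q i) \<times> frontier (Q i). \<bar>h (fst p) - h (snd p)\<bar>)"

definition disk_bounded :: "(complex \<Rightarrow> real) \<Rightarrow> bool" where
  "disk_bounded h \<longleftrightarrow> (\<forall>i. bounded (h ` frontier (Q i)))"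

lemma bounded_osc_image:
  assumes "disk_bounded h"
  shows "bdd_above ((\<lambda>p. \<bar>h (fst p) - h (snd p)\<bar>) ` (frontier (Q i) \<times> frontier (Q i)))"
proof -
  obtain B where B: "\<And>x. x \<in> frontier (Q i) \<Longrightarrow> \<bar>h x\<bar> \<le> B"
    using assms unfolding disk_bounded_def bounded_iff by (metis image_eqI real_norm_def)
  have "\<bar>h x - h y\<bar> \<le> B + B" if "x \<in> frontier (Q i)" "y \<in> frontier (Q i)" for x y
    using B[OF that(1)] B[OF that(2)] by (simp add: abs_le_iff)
  then show ?thesis by (intro bdd_aboveI[of _ "B + B"]) auto
qed

lemma osc_upper:
  assumes "disk_bounded h" "x \<in> frontier (Q i)" "y \<in> frontier (Q i)"
  shows "\<bar>h x - h y\<bar> \<le> osc h i"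
  unfolding osc_def using cSUP_upper[OF _ bounded_osc_image[OF assms(1)], of "(x, y)" i] assms(2,3) by simp

lemma osc_least:
  assumes "\<And>x y. x \<in> frontier (Q i) \<Longrightarrow> y \<in> frontier (Q i) \<Longrightarrow> \<bar>h x - h y\<bar> \<le> c"
  shows "osc h i \<le> c"
  unfolding osc_def using assms frontier_Q_nonempty[of i] by (intro cSUP_least) auto

lemma osc_nonneg: "disk_bounded h \<Longrightarrow> 0 \<le> osc h i"
  using osc_upper[of h _ i] frontier_Q_nonempty[of i] by force

lemma osc_eq:
  assumes "disk_bounded h"
  shows "osc h i = Sup (h ` frontier (Q i)) - Inf (h ` frontier (Q i))"
proof (rule antisym)
  let ?F = "frontier (Q i)"
  have bdd: "bdd_above (h ` ?F)" "bdd_below (h ` ?F)"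
    using assms by (auto simp: disk_bounded_def intro: bounded_imp_bdd_above bounded_imp_bdd_below)
  show "osc h i \<le> Sup (h ` ?F) - Inf (h ` ?F)"
  proof (rule osc_least)
    fix x y assume "x \<in> ?F" "y \<in> ?F"
    then have "h x \<le> Sup (h ` ?F)" "h y \<le> Sup (h ` ?F)" "Inf (h ` ?F) \<le> h x" "Inf (h ` ?F) \<le> h y"
      using bdd by (auto intro: cSup_upper cInf_lower)
    then show "\<bar>h x - h y\<bar> \<le> Sup (h ` ?F) - Inf (h ` ?F)" by linarith
  qed
  have "Sup (h ` ?F) \<le> Inf (h ` ?F) + osc h i"
  proof (rule cSup_least)
    fix z assume "z \<in> h ` ?F"
    then obtain x where x: "x \<in> ?F" "z = h x" by blast
    have "h x - osc h i \<le> Inf (h ` ?F)"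
    proof (rule cInf_greatest)
      fix w assume "w \<in> h ` ?F"
      then obtain y where "y \<in> ?F" "w = h y" by blast
      then show "h x - osc h i \<le> w" using osc_upper[OF assms x(1), of y] by (simp add: abs_le_iff)
    qed (use frontier_Q_nonempty[of i] in simp)
    then show "z \<le> Inf (h ` ?F) + osc h i" using x by simp
  qed (use frontier_Q_nonempty[of i] in simp)
  then show "Sup (h ` ?F) - Inf (h ` ?F) \<le> osc h i" by simp
qed

lemma disk_max_real: "disk_bounded h \<Longrightarrow> disk_max (Q i) (\<lambda>x. ereal (h x)) = ereal (Sup (h ` frontier (Q i)))"
  unfolding disk_max_def using frontier_Q_nonempty by (intro SUP_ereal_eq) (auto simp: disk_bounded_def)

lemma disk_min_real: "disk_bounded h \<Longrightarrow> disk_min (Q i) (\<lambda>x. ereal (h x)) = ereal (Inf (h ` frontier (Q i)))"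
  unfolding disk_min_def using frontier_Q_nonempty by (intro INF_ereal_eq) (auto simp: disk_bounded_def)

lemma disk_osc_real: "disk_bounded h \<Longrightarrow> disk_osc (Q i) (\<lambda>x. ereal (h x)) = ereal (osc h i)"
  by (simp add: disk_osc_def disk_max_real disk_min_real osc_eq)

lemma disk_cong:
  assumes "\<And>x. x \<in> frontier U \<Longrightarrow> f x = g x"
  shows "disk_max U f = disk_max U g" "disk_min U f = disk_min U g" "disk_osc U f = disk_osc U g"
proof -
  show "disk_max U f = disk_max U g" "disk_min U f = disk_min U g"
    using assms by (auto simp: disk_max_def disk_min_def intro!: SUP_cong INF_cong)
  then show "disk_osc U f = disk_osc U g" by (simp add: disk_osc_def)
qed

lemma energy_on_real:
  assumes "\<And>i. disk_osc (Q i) g = ereal (r i)"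
  shows "energy_on Q J g = disk_sum (\<lambda>i. (r i)\<^sup>2) J"
  unfolding energy_on_def assms infsum_ennreal_eq_suminf disk_sum_def
  by (simp add: power2_eq_square e2ennreal_ereal)

text \<open>Passage from extended to real values. Where \<open>g\<close> is infinite,
  \<open>h\<close> takes the default value 0; finiteness of the disk maxima and minima excludes this
  on the boundaries of disks, and almost no curve meets such a point elsewhere. Local energy bounds
  pass from balls to compact sets by finite covers.\<close>

lemma sobolev_loc_real:
  assumes g: "g \<in> sobolev_loc v \<Omega> Q"
  defines "h \<equiv> \<lambda>x. real_of_ereal (g x)"
  shows "\<And>i x. x \<in> frontier (Q i) \<Longrightarrow> g x = ereal (h x)" "disk_bounded h"
    "\<And>i. disk_max (Q i) g = ereal (Sup (h ` frontier (Q i)))"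
    "\<And>i. disk_osc (Q i) g = ereal (osc h i)"
    "loc_sq (osc h)" "ae_curve v (curve_bound h (osc h))"
    "ae_curve v (\<lambda>a b \<phi>. \<forall>r\<in>{a..b}. \<phi> r \<in> S \<longrightarrow> g (\<phi> r) = ereal (h (\<phi> r)))"
proof -
  have fin: "\<bar>disk_max (Q i) g\<bar> \<noteq> \<infinity>" "\<bar>disk_min (Q i) g\<bar> \<noteq> \<infinity>" for i
    using g by (auto simp: sobolev_loc_def)
  have rng: "g x \<le> disk_max (Q i) g" "disk_min (Q i) g \<le> g x" if "x \<in> frontier (Q i)" for i x
    using that by (auto simp: disk_max_def disk_min_def intro: SUP_upper INF_lower)
  show eq: "g x = ereal (h x)" if "x \<in> frontier (Q i)" for i x
  proof -
    have "\<bar>g x\<bar> \<noteq> \<infinity>"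
      using rng[OF that] fin[of i] by (cases "g x"; cases "disk_max (Q i) g"; cases "disk_min (Q i) g") auto
    then show ?thesis by (simp add: h_def ereal_real)
  qed
  show bd: "disk_bounded h"
    unfolding disk_bounded_def
  proof
    fix i
    obtain M m where "disk_max (Q i) g = ereal M" "disk_min (Q i) g = ereal m"
      using fin[of i] by (cases "disk_max (Q i) g"; cases "disk_min (Q i) g") auto
    then have "m \<le> h x \<and> h x \<le> M" if "x \<in> frontier (Q i)" for x using rng[OF that] eq[OF that] by simp
    then have "h ` frontier (Q i) \<subseteq> {m..M}" by auto
    then show "bounded (h ` frontier (Q i))" by (rule bounded_subset[OF bounded_closed_interval])
  qed
  show "disk_max (Q i) g = ereal (Sup (h ` frontier (Q i)))" for i
    using disk_cong(1)[of "Q i" g "\<lambda>x. ereal (h x)"] eq disk_max_real[OF bd] by simp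
  show osc: "disk_osc (Q i) g = ereal (osc h i)" for i
    using disk_cong(3)[of "Q i" g "\<lambda>x. ereal (h x)"] eq disk_osc_real[OF bd] by simp
  show "loc_sq (osc h)"
    unfolding loc_sq_def
  proof (intro conjI allI impI)
    fix K assume K: "compact K" "K \<subseteq> \<Omega>"
    have ball: "disk_sum (\<lambda>i. (osc h i)\<^sup>2) (meeting Q (ball x r)) < \<infinity>" if "compactly_contained (ball x r) \<Omega>" for x r
      using g that energy_on_real[of g "osc h", OF osc] by (auto simp: sobolev_loc_def)
    have "\<exists>r>0. compactly_contained (ball x r) \<Omega>" if x: "x \<in> K" for x
    proof -
      obtain e where e: "0 < e" "cball x e \<subseteq> \<Omega>" using open_Omega K(2) x open_contains_cball by blast
      then show ?thesis by (intro exI[of _ e]) (auto simp: compactly_contained_def)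
    qed
    then obtain r where r: "\<And>x. x \<in> K \<Longrightarrow> 0 < r x \<and> compactly_contained (ball x (r x)) \<Omega>" by metis
    have cov: "K \<subseteq> (\<Union>x\<in>K. ball x (r x))"
    proof
      fix x assume "x \<in> K"
      then show "x \<in> (\<Union>x\<in>K. ball x (r x))" using r[of x] by (intro UN_I[of x]) auto
    qed
    obtain D where D: "D \<subseteq> K" "finite D" "K \<subseteq> (\<Union>x\<in>D. ball x (r x))"
      by (rule compactE_image[OF K(1) _ cov]) auto
    have "disk_sum (\<lambda>i. (osc h i)\<^sup>2) (\<Union>x\<in>D. meeting Q (ball x (r x))) < \<infinity>"
      using D(2,1)
    proof (induction D)
      case (insert x D)
      have "disk_sum (\<lambda>i. (osc h i)\<^sup>2) (\<Union>x\<in>insert x D. meeting Q (ball x (r x))) \<le>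
         disk_sum (\<lambda>i. (osc h i)\<^sup>2) (meeting Q (ball x (r x))) + disk_sum (\<lambda>i. (osc h i)\<^sup>2) (\<Union>x\<in>D. meeting Q (ball x (r x)))"
        using disk_sum_Un_le by simp
      also have "\<dots> < \<infinity>" using insert ball[of x "r x"] r[of x] by simp
      finally show ?case .
    qed simp
    moreover have "meeting Q K \<subseteq> (\<Union>x\<in>D. meeting Q (ball x (r x)))"
    proof
      fix i assume "i \<in> meeting Q K"
      then obtain z where z: "z \<in> Q i" "z \<in> K" unfolding meeting_def by blast
      then obtain x where "x \<in> D" "z \<in> ball x (r x)" using D(3) by blast
      then show "i \<in> (\<Union>x\<in>D. meeting Q (ball x (r x)))" using z unfolding meeting_def by blast
    qed
    ultimately show "disk_sum (\<lambda>i. (osc h i)\<^sup>2) (meeting Q K) < \<infinity>"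
      by (rule le_less_trans[OF disk_sum_subset, rotated])
  qed (rule osc_nonneg[OF bd])
  have "upper_gradient v \<Omega> Q (\<lambda>i. real_of_ereal (disk_osc (Q i) g)) g"
    using g by (simp add: sobolev_loc_def)
  then obtain \<Gamma> where \<Gamma>: "exceptional v \<Omega> Q \<Gamma>"
    "\<And>\<gamma> x y. \<gamma> \<in> paths_in \<Omega> - \<Gamma> \<Longrightarrow> x \<in> path_trace \<gamma> \<inter> S \<Longrightarrow> y \<in> path_trace \<gamma> \<inter> S \<Longrightarrow>
        \<bar>g x\<bar> \<noteq> \<infinity> \<and> \<bar>g y\<bar> \<noteq> \<infinity> \<and> \<bar>g x - g y\<bar> \<le> enn2ereal (sum_along Q (osc h) \<gamma>)"
    unfolding upper_gradient_def osc exceptional_def[symmetric] real_of_ereal.simps Bex_def[symmetric]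
    by (elim exE conjE) (rule that, assumption, simp)
  have cp: "({a..b}, \<phi>) \<in> paths_in \<Omega>" if "curve_in a b \<phi>" for a b \<phi>
    using that by (auto simp: curve_in_def paths_in_def is_path_def path_trace_def is_interval_cc)
  have ae: "ae_curve v (\<lambda>a b \<phi>. (\<forall>r\<in>{a..b}. \<phi> r \<in> S \<longrightarrow> g (\<phi> r) = ereal (h (\<phi> r))) \<and>
     (\<phi> a \<in> S \<longrightarrow> \<phi> b \<in> S \<longrightarrow> ennreal \<bar>h (\<phi> a) - h (\<phi> b)\<bar> \<le> disk_sum (osc h) (meeting Q (\<phi> ` {a..b}))))"
    unfolding ae_curve_def
  proof (intro exI[of _ \<Gamma>] conjI \<Gamma>(1) allI impI ballI)
    fix a b \<phi> r assume cv: "curve_in a b \<phi>" and G: "({a..b}, \<phi>) \<notin> \<Gamma>"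
    have g1: "({a..b}, \<phi>) \<in> paths_in \<Omega> - \<Gamma>" using cp[OF cv] G by simp
    have tr: "\<phi> r \<in> path_trace ({a..b}, \<phi>)" if "r \<in> {a..b}" for r using that by (simp add: path_trace_def)
    have fin': "g (\<phi> r) = ereal (h (\<phi> r))" if "r \<in> {a..b}" "\<phi> r \<in> S" for r
      using \<Gamma>(2)[OF g1, of "\<phi> r" "\<phi> r"] tr that by (simp add: h_def ereal_real)
    show "g (\<phi> r) = ereal (h (\<phi> r))" if "r \<in> {a..b}" "\<phi> r \<in> S" using fin' that .
    assume S: "\<phi> a \<in> S" "\<phi> b \<in> S"
    have ab: "a \<in> {a..b}" "b \<in> {a..b}" using cv by (auto simp: curve_in_def)
    have "\<bar>g (\<phi> a) - g (\<phi> b)\<bar> \<le> enn2ereal (sum_along Q (osc h) ({a..b}, \<phi>))"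
      using \<Gamma>(2)[OF g1, of "\<phi> a" "\<phi> b"] tr ab S by simp
    then have "ereal \<bar>h (\<phi> a) - h (\<phi> b)\<bar> \<le> enn2ereal (disk_sum (osc h) (meeting Q (\<phi> ` {a..b})))"
      using fin'[OF ab(1) S(1)] fin'[OF ab(2) S(2)] by (simp add: sum_along_eq_disk_sum path_trace_def)
    then show "ennreal \<bar>h (\<phi> a) - h (\<phi> b)\<bar> \<le> disk_sum (osc h) (meeting Q (\<phi> ` {a..b}))"
      by (simp add: less_eq_ennreal.rep_eq enn2ereal_ennreal)
  qed
  from ae show "ae_curve v (\<lambda>a b \<phi>. \<forall>r\<in>{a..b}. \<phi> r \<in> S \<longrightarrow> g (\<phi> r) = ereal (h (\<phi> r)))"
    by (rule ae_curve_mono) blast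
  from ae_curve_sub[OF ae] show "ae_curve v (curve_bound h (osc h))"
    by (rule ae_curve_mono) (simp add: curve_bound_def)
qed

text \<open>A convenient sufficient condition for competitors: the gradient \<rho> need not be the
  sequence of oscillations of \<zeta>, only a locally square summable sequence dominating
  it.\<close>

definition test_function :: "modulus_version \<Rightarrow> complex set \<Rightarrow> (complex \<Rightarrow> real) \<Rightarrow> bool" where
  "test_function v V \<zeta> \<longleftrightarrow> (\<forall>x\<in>S - V. \<zeta> x = 0) \<and> (\<exists>B. \<forall>x\<in>S. \<bar>\<zeta> x\<bar> \<le> B) \<and>
     (\<exists>\<rho>. loc_sq \<rho> \<and> (\<forall>i. \<forall>x\<in>frontier (Q i). \<forall>y\<in>frontier (Q i). \<bar>\<zeta> x - \<zeta> y\<bar> \<le> \<rho> i) \<and>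
        ae_curve v (curve_bound \<zeta> \<rho>))"

lemma frontier_disjoint_open:
  assumes "open V" "i \<notin> meeting Q V" "x \<in> frontier (Q i)"
  shows "x \<notin> V"
  using assms open_Int_closure_eq_empty[of V "Q i"] by (auto simp: meeting_def frontier_def)

lemma ae_curve_bound_osc:
  assumes "loc_sq \<rho>" "\<And>i x y. x \<in> frontier (Q i) \<Longrightarrow> y \<in> frontier (Q i) \<Longrightarrow> \<bar>h x - h y\<bar> \<le> \<rho> i"
    "disk_bounded h" "ae_curve v (curve_bound h \<rho>)"
  shows "ae_curve v (curve_bound h (osc h))"
  using ae_curve_conj[OF assms(4) ae_curve_finite_sum[OF assms(1)]]
proof (rule ae_curve_mono)
  fix a b \<phi> assume cv: "curve_in a b \<phi>" and *: "curve_bound h \<rho> a b \<phi> \<and> disk_sum \<rho> (meeting Q (\<phi> ` {a..b})) < \<infinity>"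
  show "curve_bound h (osc h) a b \<phi>"
    by (rule curve_bound_osc[OF cv conjunct1[OF *] osc_upper[OF assms(3)] osc_least[OF assms(2)] conjunct2[OF *]])
qed

text \<open>A disk that does not meet the open set \<open>V\<close> has its boundary outside
  \<open>V\<close>, where \<zeta> vanishes; hence the global sums reduce to disks meeting the
  compact closure of \<open>V\<close>. The oscillations become an upper gradient by
  \<open>ae_curve_bound_osc\<close>, and a general path is cut down to the compact piece between two
  times.\<close>

lemma test_function_sobolev:
  assumes V: "open V" "compactly_contained V \<Omega>" and t: "test_function v V \<zeta>"
  shows "(\<lambda>x. ereal (\<zeta> x)) \<in> sobolev v \<Omega> Q" "disk_bounded \<zeta>"
proof -
  obtain B \<rho> where z0: "\<And>x. x \<in> S \<Longrightarrow> x \<notin> V \<Longrightarrow> \<zeta> x = 0" and B: "\<And>x. x \<in> S \<Longrightarrow> \<bar>\<zeta> x\<bar> \<le> B"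
    and \<rho>: "loc_sq \<rho>" "\<And>i x y. x \<in> frontier (Q i) \<Longrightarrow> y \<in> frontier (Q i) \<Longrightarrow> \<bar>\<zeta> x - \<zeta> y\<bar> \<le> \<rho> i"
       "ae_curve v (curve_bound \<zeta> \<rho>)"
    using t unfolding test_function_def by blast
  let ?g = "\<lambda>x. ereal (\<zeta> x)"
  have frS: "x \<in> S" if "x \<in> frontier (Q i)" for x i using that frontier_Q_subset by blast
  show bd: "disk_bounded \<zeta>"
    unfolding disk_bounded_def bounded_iff using B[OF frS] by (intro allI exI[of _ B]) auto
  have B0: "0 \<le> B"
  proof -
    obtain x where "x \<in> frontier (Q 0)" using frontier_Q_nonempty by blast
    then show ?thesis using B[OF frS] by (meson abs_ge_zero order_trans)
  qed
  have osc_le: "osc \<zeta> i \<le> \<rho> i" for i using \<rho>(2) by (rule osc_least)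
  have out: "\<zeta> x = 0" if "i \<notin> meeting Q V" "x \<in> frontier (Q i)" for i x
    using z0[OF frS[OF that(2)]] frontier_disjoint_open[OF V(1) that] by blast
  have cV: "compact (closure V)" "closure V \<subseteq> \<Omega>" using V(2) by (auto simp: compactly_contained_def)
  have mV: "meeting Q V \<subseteq> meeting Q (closure V)" by (intro meeting_mono closure_subset)
  have "energy_on Q UNIV ?g < \<infinity>"
  proof -
    have "energy_on Q UNIV ?g = disk_sum (\<lambda>i. (osc \<zeta> i)\<^sup>2) UNIV"
      by (intro energy_on_real disk_osc_real bd)
    also have "\<dots> \<le> disk_sum (\<lambda>i. (osc \<zeta> i)\<^sup>2) (meeting Q V)"
      unfolding disk_sum_def
    proof (intro suminf_le allI)
      fix i
      have "osc \<zeta> i = 0" if "i \<notin> meeting Q V"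
        using osc_nonneg[OF bd, of i] osc_least[of i \<zeta> 0] out[OF that] by force
      then show "ennreal ((osc \<zeta> i)\<^sup>2) * indicator UNIV i \<le> ennreal ((osc \<zeta> i)\<^sup>2) * indicator (meeting Q V) i"
        by (cases "i \<in> meeting Q V") auto
    qed auto
    also have "\<dots> \<le> disk_sum (\<lambda>i. (\<rho> i)\<^sup>2) (meeting Q (closure V))"
      using mV osc_le osc_nonneg[OF bd] by (intro disk_sum_mono power_mono) auto
    also have "\<dots> < \<infinity>" using \<rho>(1) cV unfolding loc_sq_def by blast
    finally show ?thesis .
  qed
  moreover have "mass_on Q UNIV ?g < \<infinity>"
  proof -
    have "mass_on Q UNIV ?g = (\<Sum>i. ennreal ((Sup (\<zeta> ` frontier (Q i)))\<^sup>2 * (diameter (Q i))\<^sup>2))"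
      unfolding mass_on_def disk_max_real[OF bd] infsum_UNIV_eq_suminf
      by (simp add: power2_eq_square e2ennreal_ereal)
    also have "\<dots> \<le> disk_sum (\<lambda>i. B\<^sup>2 * (diameter (Q i))\<^sup>2) (meeting Q (closure V))"
      unfolding disk_sum_def
    proof (intro suminf_le allI)
      fix i
      let ?s = "Sup (\<zeta> ` frontier (Q i))"
      have ne: "\<zeta> ` frontier (Q i) \<noteq> {}" using frontier_Q_nonempty by simp
      show "ennreal (?s\<^sup>2 * (diameter (Q i))\<^sup>2) \<le> ennreal (B\<^sup>2 * (diameter (Q i))\<^sup>2) * indicator (meeting Q (closure V)) i"
      proof (cases "i \<in> meeting Q V")
        case True
        have "\<bar>?s\<bar> \<le> B" using ne B frS by (intro cSup_abs_le) auto
        then have "?s\<^sup>2 \<le> B\<^sup>2" using B0 by (metis abs_le_square_iff abs_of_nonneg)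
        then show ?thesis using True mV by (auto simp: indicator_def intro!: ennreal_leI mult_right_mono)
      next
        case False
        have "\<zeta> ` frontier (Q i) = {0}" using out[OF False] ne by auto
        then show ?thesis by simp
      qed
    qed auto
    also have "\<dots> = ennreal (B\<^sup>2) * disk_sum (\<lambda>i. (diameter (Q i))\<^sup>2) (meeting Q (closure V))"
      by (rule disk_sum_cmult) simp
    also have "\<dots> < \<infinity>"
      using disk_sum_diameter_finite[OF compact_imp_bounded[OF cV(1)]] by (simp add: ennreal_mult_less_top)
    finally show ?thesis .
  qed
  moreover have "mass_on Q J ?g \<le> mass_on Q UNIV ?g" "energy_on Q J ?g \<le> energy_on Q UNIV ?g" for J
    unfolding mass_on_def energy_on_def infsum_ennreal_eq_suminf
    by (auto intro!: suminf_le simp: indicator_def)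
  moreover have "upper_gradient v \<Omega> Q (\<lambda>i. real_of_ereal (disk_osc (Q i) ?g)) ?g"
  proof -
    have "ae_curve v (curve_bound \<zeta> (osc \<zeta>))" using \<rho> bd by (intro ae_curve_bound_osc)
    then obtain \<Gamma> where \<Gamma>: "exceptional v \<Omega> Q \<Gamma>"
        "\<And>a b \<phi>. curve_in a b \<phi> \<Longrightarrow> ({a..b}, \<phi>) \<notin> \<Gamma> \<Longrightarrow> curve_bound \<zeta> (osc \<zeta>) a b \<phi>"
      unfolding ae_curve_def by blast
    have key: "\<bar>ereal (\<zeta> (\<phi> s)) - ereal (\<zeta> (\<phi> t))\<bar> \<le> enn2ereal (sum_along Q (osc \<zeta>) (I, \<phi>))"
      if g: "(I, \<phi>) \<in> paths_in \<Omega>" "(I, \<phi>) \<notin> superpaths \<Gamma>" and st: "s \<in> I" "t \<in> I" "\<phi> s \<in> S" "\<phi> t \<in> S" "s \<le> t"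
      for I \<phi> s t
    proof -
      have I: "is_interval I" "continuous_on (closure I) \<phi>" "\<phi> ` I \<subseteq> \<Omega>"
        using g(1) by (auto simp: paths_in_def is_path_def path_trace_def)
      have sub: "{s..t} \<subseteq> I" using mem_is_interval_1_I[OF I(1) st(1,2)] by auto
      have cont: "continuous_on {s..t} \<phi>"
        using continuous_on_subset[OF I(2) order_trans[OF sub closure_subset]] .
      have cv: "curve_in s t \<phi>" using sub cont I(3) st(5) by (auto simp: curve_in_def)
      have "subpath_of ({s..t}, \<phi>) (I, \<phi>)" using sub st(5) by (auto simp: subpath_of_def is_interval_cc)
      then have "({s..t}, \<phi>) \<notin> \<Gamma>" using g(2) by (auto simp: superpaths_def)
      from curve_boundD[OF \<Gamma>(2)[OF cv this], of s t]
      have "ennreal \<bar>\<zeta> (\<phi> s) - \<zeta> (\<phi> t)\<bar> \<le> disk_sum (osc \<zeta>) (meeting Q (\<phi> ` {s..t}))" using st by simp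
      also have "\<dots> \<le> sum_along Q (osc \<zeta>) (I, \<phi>)"
        unfolding sum_along_eq_disk_sum path_trace_def using sub
        by (intro disk_sum_subset meeting_mono) auto
      finally show ?thesis by (simp add: less_eq_ennreal.rep_eq enn2ereal_ennreal)
    qed
    show ?thesis
      unfolding upper_gradient_def disk_osc_real[OF bd] real_of_ereal.simps
    proof (intro exI[of _ "paths_in \<Omega> \<inter> superpaths \<Gamma>"] conjI ballI)
      show "carpet_modulus v \<Omega> Q (paths_in \<Omega> \<inter> superpaths \<Gamma>) = 0"
        using exceptional_subset[OF exceptional_superpaths[OF \<Gamma>(1)], of "paths_in \<Omega> \<inter> superpaths \<Gamma>"]
        by (auto simp: exceptional_def)
      fix \<gamma> x y assume g: "\<gamma> \<in> paths_in \<Omega> - paths_in \<Omega> \<inter> superpaths \<Gamma>"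
        and xy: "x \<in> path_trace \<gamma> \<inter> S" "y \<in> path_trace \<gamma> \<inter> S"
      obtain I \<phi> where \<gamma>: "\<gamma> = (I, \<phi>)" by (cases \<gamma>)
      have g': "(I, \<phi>) \<in> paths_in \<Omega>" "(I, \<phi>) \<notin> superpaths \<Gamma>" using g by (auto simp: \<gamma>)
      obtain s t where st: "s \<in> I" "t \<in> I" "x = \<phi> s" "y = \<phi> t" using xy by (auto simp: \<gamma> path_trace_def)
      show "\<bar>ereal (\<zeta> x) - ereal (\<zeta> y)\<bar> \<le> enn2ereal (sum_along Q (osc \<zeta>) \<gamma>)"
      proof (cases "s \<le> t")
        case True
        then show ?thesis using key[OF g', of s t] st xy by (simp add: \<gamma>)
      next
        case False
        then show ?thesis using key[OF g', of t s] st xy by (simp add: \<gamma> abs_minus_commute)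
      qed
    qed auto
  qed
  ultimately show "?g \<in> sobolev v \<Omega> Q"
    unfolding sobolev_def sobolev_loc_def
    by (auto simp: disk_max_real[OF bd] disk_min_real[OF bd] intro: le_less_trans)
qed

lemma harmonic_real:
  assumes u: "carpet_harmonic v \<Omega> Q (\<lambda>x. ereal (u x))"
    and V: "open V" "compactly_contained V \<Omega>" and t: "test_function v V \<zeta>"
  shows "disk_sum (\<lambda>i. (osc u i)\<^sup>2) (meeting Q V) \<le> disk_sum (\<lambda>i. (osc (\<lambda>x. u x + \<zeta> x) i)\<^sup>2) (meeting Q V)"
proof -
  have "(\<lambda>x. ereal (u x)) \<in> sobolev_loc v \<Omega> Q" using u by (simp add: carpet_harmonic_def)
  note bu = sobolev_loc_real(2)[OF this, simplified]
  have bz: "disk_bounded \<zeta>" using test_function_sobolev(2)[OF V t] .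
  have bs: "disk_bounded (\<lambda>x. u x + \<zeta> x)"
    unfolding disk_bounded_def
  proof
    fix i
    obtain A B where "\<And>x. x \<in> frontier (Q i) \<Longrightarrow> \<bar>u x\<bar> \<le> A" "\<And>x. x \<in> frontier (Q i) \<Longrightarrow> \<bar>\<zeta> x\<bar> \<le> B"
      using bu bz unfolding disk_bounded_def bounded_iff by (metis image_eqI real_norm_def)
    then have "\<bar>u x + \<zeta> x\<bar> \<le> A + B" if "x \<in> frontier (Q i)" for x
      using that by (meson abs_triangle_ineq add_mono order_trans)
    then show "bounded ((\<lambda>x. u x + \<zeta> x) ` frontier (Q i))" unfolding bounded_iff by (intro exI[of _ "A + B"]) auto
  qed
  have z: "\<forall>x\<in>S - V. ereal (\<zeta> x) = 0" using t by (simp add: test_function_def zero_ereal_def)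
  have "\<forall>V \<zeta>. open V \<and> compactly_contained V \<Omega> \<and> \<zeta> \<in> sobolev v \<Omega> Q \<and> (\<forall>x\<in>S - V. \<zeta> x = 0) \<longrightarrow>
        dirichlet_energy Q V (\<lambda>x. ereal (u x)) \<le> dirichlet_energy Q V (\<lambda>x. ereal (u x) + \<zeta> x)"
    using u by (simp add: carpet_harmonic_def)
  from this[rule_format, of V "\<lambda>x. ereal (\<zeta> x)"]
  have "dirichlet_energy Q V (\<lambda>x. ereal (u x)) \<le> dirichlet_energy Q V (\<lambda>x. ereal (u x) + ereal (\<zeta> x))"
    using V test_function_sobolev(1)[OF V t] z by blast
  then show ?thesis
    unfolding dirichlet_energy_def plus_ereal.simps
      energy_on_real[of _ "osc u", OF disk_osc_real[OF bu]] energy_on_real[of _ "osc (\<lambda>x. u x + \<zeta> x)", OF disk_osc_real[OF bs]] .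
qed

lemma frontier_S: "x \<in> frontier (Q i) \<Longrightarrow> x \<in> S"
  using frontier_Q_subset by blast

lemma curve_bound_combination:
  assumes "curve_bound f \<rho> a b \<phi>" "curve_bound g \<tau> a b \<phi>" "0 \<le> \<alpha>" "0 \<le> \<beta>"
    and nn: "\<And>i. 0 \<le> \<rho> i" "\<And>i. 0 \<le> \<tau> i"
    and le: "\<And>x y. x \<in> S \<Longrightarrow> y \<in> S \<Longrightarrow> \<bar>h x - h y\<bar> \<le> \<alpha> * \<bar>f x - f y\<bar> + \<beta> * \<bar>g x - g y\<bar>"
  shows "curve_bound h (\<lambda>i. \<alpha> * \<rho> i + \<beta> * \<tau> i) a b \<phi>"
  unfolding curve_bound_def
proof (intro allI impI)
  fix s t assume st: "a \<le> s" "s \<le> t" "t \<le> b" "\<phi> s \<in> S" "\<phi> t \<in> S"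
  let ?J = "meeting Q (\<phi> ` {s..t})"
  have "ennreal \<bar>h (\<phi> s) - h (\<phi> t)\<bar> \<le> ennreal (\<alpha> * \<bar>f (\<phi> s) - f (\<phi> t)\<bar> + \<beta> * \<bar>g (\<phi> s) - g (\<phi> t)\<bar>)"
    by (intro ennreal_leI le st)
  also have "\<dots> = ennreal \<alpha> * ennreal \<bar>f (\<phi> s) - f (\<phi> t)\<bar> + ennreal \<beta> * ennreal \<bar>g (\<phi> s) - g (\<phi> t)\<bar>"
    using assms(3,4) by (simp add: ennreal_mult)
  also have "\<dots> \<le> ennreal \<alpha> * disk_sum \<rho> ?J + ennreal \<beta> * disk_sum \<tau> ?J"
    by (intro add_mono mult_left_mono curve_boundD[OF assms(1)] curve_boundD[OF assms(2)] st zero_le)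
  also have "\<dots> = disk_sum (\<lambda>i. \<alpha> * \<rho> i + \<beta> * \<tau> i) ?J"
    unfolding disk_sum_cmult[OF assms(3), symmetric] disk_sum_cmult[OF assms(4), symmetric]
    by (rule disk_sum_add[symmetric]) (use assms(3,4) nn in simp_all)
  finally show "ennreal \<bar>h (\<phi> s) - h (\<phi> t)\<bar> \<le> disk_sum (\<lambda>i. \<alpha> * \<rho> i + \<beta> * \<tau> i) ?J" .
qed

lemma compact_neighbourhood:
  assumes "compact K" "K \<subseteq> \<Omega>"
  obtains e where "0 < e" "(\<Union>x\<in>K. cball x e) \<subseteq> \<Omega>" "compact (\<Union>x\<in>K. cball x e)"
proof -
  obtain e where e: "0 < e" "(\<Union>x\<in>K. cball x e) \<subseteq> \<Omega>"
    using compact_subset_open_imp_cball_epsilon_subset[OF assms(1) open_Omega assms(2)] by auto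
  have "(\<Union>x\<in>K. cball x e) = (\<Union>x\<in>K. \<Union>y\<in>cball 0 e. {x + y})"
  proof (intro SUP_cong refl)
    fix x :: complex
    show "cball x e = (\<Union>y\<in>cball 0 e. {x + y})"
    proof (intro equalityI subsetI)
      fix z assume "z \<in> cball x e"
      then show "z \<in> (\<Union>y\<in>cball 0 e. {x + y})"
        by (intro UN_I[of "z - x"]) (auto simp: dist_norm norm_minus_commute)
    qed (auto simp: dist_norm)
  qed
  moreover have "compact (\<Union>x\<in>K. \<Union>y\<in>cball 0 e. {x + y})"
    using assms(1) by (intro compact_sums') auto
  ultimately show ?thesis using that e by simp
qed

text \<open>Only finitely many disks meeting \<open>K\<close> are so large that they can leave a
  fixed neighbourhood of \<open>K\<close>; adding their closures keeps the set compact. A cutoff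
  equal to 1 on \<open>K'\<close> is then 1 on the full boundary of every disk meeting
  \<open>K\<close>.\<close>

lemma compact_disk_hull:
  assumes "compact K" "K \<subseteq> \<Omega>"
  obtains K' where "compact K'" "K' \<subseteq> \<Omega>" "K \<subseteq> K'" "\<And>i. i \<in> meeting Q K \<Longrightarrow> closure (Q i) \<subseteq> K'"
proof -
  obtain e where e: "0 < e" "(\<Union>x\<in>K. cball x e) \<subseteq> \<Omega>" "compact (\<Union>x\<in>K. cball x e)"
    using compact_neighbourhood[OF assms] by blast
  define F where "F = {i \<in> meeting Q K. e \<le> diameter (Q i)}"
  have F: "finite F" unfolding F_def using finite_large_disks[OF compact_imp_bounded[OF assms(1)] e(1)] .
  define K' where "K' = (\<Union>x\<in>K. cball x e) \<union> (\<Union>i\<in>F. closure (Q i))"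
  show ?thesis
  proof (rule that[of K'])
    show "compact K'" unfolding K'_def using compact_closure_Q by (intro compact_Un[OF e(3)] compact_UN[OF F]) auto
    show "K' \<subseteq> \<Omega>" unfolding K'_def using e(2) Q_props(5) by blast
    show "K \<subseteq> K'" unfolding K'_def using e(1) by force
    fix i assume i: "i \<in> meeting Q K"
    show "closure (Q i) \<subseteq> K'"
    proof (cases "i \<in> F")
      case False
      then have d: "diameter (Q i) < e" using i by (simp add: F_def)
      obtain x where x: "x \<in> Q i" "x \<in> K" using i by (auto simp: meeting_def)
      have "z \<in> cball x e" if z: "z \<in> closure (Q i)" for z
      proof -
        have "dist x z \<le> diameter (closure (Q i))"
          using z in_Q_closure[OF x(1)] compact_closure_Q by (intro diameter_bounded_bound compact_imp_bounded)
        then show ?thesis using d diameter_closure[OF Q_props(3)[of i]] by simp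
      qed
      then show ?thesis using x(2) unfolding K'_def by blast
    qed (auto simp: K'_def)
  qed
qed

lemma rect_nhd:
  assumes "z \<in> \<Omega>"
  obtains r where "0 < r" "rect (Re z - r) (Re z + r) (Im z - r) (Im z + r) \<subseteq> \<Omega>"
proof -
  obtain e where e: "0 < e" "cball z e \<subseteq> \<Omega>" using open_Omega assms open_contains_cball by blast
  have "y \<in> cball z e" if "y \<in> rect (Re z - e/2) (Re z + e/2) (Im z - e/2) (Im z + e/2)" for y
  proof -
    have "\<bar>Re (z - y)\<bar> \<le> e/2" "\<bar>Im (z - y)\<bar> \<le> e/2" using that unfolding abs_le_iff mem_rect by simp_all
    then show ?thesis using cmod_le[of "z - y"] by (simp add: dist_norm)
  qed
  then have "rect (Re z - e/2) (Re z + e/2) (Im z - e/2) (Im z + e/2) \<subseteq> \<Omega>" using e(2) by blast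
  then show ?thesis using that[of "e/2"] e(1) by simp
qed

subsection \<open>Linking values along curves\<close>

text \<open>The values of \<open>h\<close> that the set \<open>A\<close> sees: at its points in the
  carpet and on the whole boundary of each disk it meets. Two curves crossing at a point of \<Omega>
  share such a value even if they cross inside a disk, where \<open>h\<close> carries no
  information.\<close>

definition hvals :: "(complex \<Rightarrow> real) \<Rightarrow> complex set \<Rightarrow> real set" where
  "hvals h A = h ` (A \<inter> S) \<union> (\<Union>i\<in>meeting Q A. h ` frontier (Q i))"

lemma hvals_mono: "A \<subseteq> B \<Longrightarrow> hvals h A \<subseteq> hvals h B"
  using meeting_mono[of A B Q] by (auto simp: hvals_def)

lemma hvals_point_nonempty:
  assumes "z \<in> \<Omega>"
  shows "hvals h {z} \<noteq> {}"
proof (cases "z \<in> S")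
  case False
  then obtain i where "z \<in> Q i" using assms by (auto simp: S_iff)
  then have "i \<in> meeting Q {z}" by (auto simp: meeting_def)
  then show ?thesis using frontier_Q_nonempty[of i] unfolding hvals_def by blast
qed (auto simp: hvals_def)

lemma hvals_Un: "hvals h (A \<union> B) = hvals h A \<union> hvals h B"
  by (auto simp: hvals_def meeting_def)

lemma hvals_frontier: "i \<in> meeting Q A \<Longrightarrow> x \<in> frontier (Q i) \<Longrightarrow> h x \<in> hvals h A"
  unfolding hvals_def by blast

lemma hvals_S: "x \<in> A \<Longrightarrow> x \<in> S \<Longrightarrow> h x \<in> hvals h A"
  unfolding hvals_def by blast

lemma hvals_common:
  assumes "z \<in> A" "z \<in> B" "z \<in> \<Omega>"
  obtains x where "x \<in> hvals h A" "x \<in> hvals h B"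
proof -
  obtain x where "x \<in> hvals h {z}" using hvals_point_nonempty[OF assms(3)] by blast
  then show ?thesis using that[of x] hvals_mono[of "{z}" A h] hvals_mono[of "{z}" B h] assms(1,2) by blast
qed

text \<open>One \<open>B\<close> leads from a boundary value of a disk to a point where the curve
  crosses that boundary, one \<open>B\<close> leads along the curve, and one \<open>B\<close> leads
  back to a boundary value. A curve staying inside one disk meets no carpet point and is treated
  separately.\<close>

lemma curve_hvals_close:
  assumes cv: "curve_in a b \<phi>" and cb: "curve_bound h l a b \<phi>"
    and hosc: "\<And>i x y. x \<in> frontier (Q i) \<Longrightarrow> y \<in> frontier (Q i) \<Longrightarrow> \<bar>h x - h y\<bar> \<le> l i"
    and B: "disk_sum l (meeting Q (\<phi> ` {a..b})) \<le> ennreal B" "0 \<le> B"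
    and xy: "x \<in> hvals h (\<phi> ` {a..b})" "y \<in> hvals h (\<phi> ` {a..b})"
  shows "\<bar>x - y\<bar> \<le> 3 * B"
proof -
  let ?A = "\<phi> ` {a..b}"
  let ?J = "meeting Q ?A"
  have key0: "\<bar>h (\<phi> s) - h (\<phi> t)\<bar> \<le> B"
    if le: "s \<in> {a..b}" "t \<in> {a..b}" "\<phi> s \<in> S" "\<phi> t \<in> S" "s \<le> t" for s t
  proof -
    have "ennreal \<bar>h (\<phi> s) - h (\<phi> t)\<bar> \<le> disk_sum l (meeting Q (\<phi> ` {s..t}))"
      using le by (intro curve_boundD[OF cb]) auto
    also have "\<dots> \<le> disk_sum l ?J" using le by (intro disk_sum_subset meeting_mono image_mono) auto
    also note B(1)
    finally show ?thesis using B(2) by simp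
  qed
  have key1: "\<bar>h (\<phi> s) - h (\<phi> t)\<bar> \<le> B" if "s \<in> {a..b}" "t \<in> {a..b}" "\<phi> s \<in> S" "\<phi> t \<in> S" for s t
    using key0[of s t] key0[of t s] that by (cases "s \<le> t") (simp_all add: abs_minus_commute)
  have key2: "\<bar>h x - h y\<bar> \<le> B" if "i \<in> ?J" "x \<in> frontier (Q i)" "y \<in> frontier (Q i)" for x y i
  proof -
    have "ennreal (l i) \<le> ennreal B" using disk_sum_upper[OF that(1), of l] B(1) by (rule order_trans)
    then have "l i \<le> B" using B(2) by simp
    then show ?thesis using hosc[OF that(2,3)] by linarith
  qed
  have con: "connected ?A" using cv by (intro connected_continuous_image) (auto simp: curve_in_def)
  show ?thesis
  proof (cases "\<exists>k. ?A \<subseteq> Q k")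
    case True
    then obtain k where k: "?A \<subseteq> Q k" by blast
    have no: "?A \<inter> S = {}" using k by (auto simp: S_iff)
    have eqk: "i = k" if "i \<in> ?J" for i
    proof (rule ccontr)
      assume "i \<noteq> k"
      then have "Q i \<inter> Q k = {}" by (rule disjoint_Q)
      then show False using that k unfolding meeting_def by blast
    qed
    have "\<exists>p. k \<in> ?J \<and> p \<in> frontier (Q k) \<and> z = h p" if z: "z \<in> hvals h ?A" for z
    proof -
      obtain i p where "i \<in> ?J" "p \<in> frontier (Q i)" "z = h p" using z no unfolding hvals_def by blast
      then show ?thesis using eqk[of i] by blast
    qed
    from this[OF xy(1)] this[OF xy(2)]
    obtain p q where "k \<in> ?J" "p \<in> frontier (Q k)" "x = h p" "q \<in> frontier (Q k)" "y = h q" by blast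
    then have "\<bar>x - y\<bar> \<le> B" using key2[of k p q] by simp
    then show ?thesis using B(2) by linarith
  next
    case False
    have comp: "\<exists>p\<in>?A \<inter> S. \<bar>z - h p\<bar> \<le> B" if z: "z \<in> hvals h ?A" for z
    proof -
      consider p where "p \<in> ?A \<inter> S" "z = h p" | i q where "i \<in> ?J" "q \<in> frontier (Q i)" "z = h q"
        using z unfolding hvals_def by blast
      then show ?thesis
      proof cases
        case 1
        then show ?thesis using B(2) by (intro bexI[of _ p]) auto
      next
        case 2
        have "?A \<inter> Q i \<noteq> {}" using 2(1) by (auto simp: meeting_def)
        moreover have "?A - Q i \<noteq> {}" using False by blast
        ultimately obtain p where p: "p \<in> ?A" "p \<in> frontier (Q i)"
          using connected_meets_frontier[OF con] by blast
        then have "p \<in> S" using frontier_Q_subset by blast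
        then show ?thesis using key2[OF 2(1,2) p(2)] 2(3) p(1) by auto
      qed
    qed
    obtain p q where p: "p \<in> ?A \<inter> S" "\<bar>x - h p\<bar> \<le> B" and q: "q \<in> ?A \<inter> S" "\<bar>y - h q\<bar> \<le> B"
      using comp xy by meson
    obtain s t where "s \<in> {a..b}" "t \<in> {a..b}" "p = \<phi> s" "q = \<phi> t" using p q by blast
    then have "\<bar>h p - h q\<bar> \<le> B" using key1 p q by auto
    then show ?thesis using p(2) q(2) by (simp add: abs_le_iff)
  qed
qed

subsection \<open>Small rectangles around interior points of the carpet\<close>

text \<open>The exempt index \<open>k\<close> allows \<open>y\<close> to lie on the boundary of
  \<open>Q k\<close>; the choice \<open>k = n\<close> exempts nothing.\<close>

lemma interior_point_avoids:
  assumes "y \<in> \<Omega>" "\<And>i. i < n \<Longrightarrow> i \<noteq> k \<Longrightarrow> y \<notin> closure (Q i)"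
  obtains r where "0 < r" "cball y r \<subseteq> \<Omega>" "\<And>i. i < n \<Longrightarrow> i \<noteq> k \<Longrightarrow> Q i \<inter> cball y r = {}"
proof -
  define U where "U = \<Omega> - (\<Union>i\<in>{..<n} - {k}. closure (Q i))"
  have "open U" unfolding U_def by (intro open_Diff open_Omega closed_UN) auto
  moreover have "y \<in> U" using assms by (auto simp: U_def)
  ultimately obtain r where r: "0 < r" "cball y r \<subseteq> U" using open_contains_cball by blast
  show ?thesis
  proof (rule that[OF r(1)])
    show "cball y r \<subseteq> \<Omega>" using r(2) by (auto simp: U_def)
    show "Q i \<inter> cball y r = {}" if "i < n" "i \<noteq> k" for i
      using r(2) that in_Q_closure[of _ i] by (fastforce simp: U_def)
  qed
qed

lemma carpet_interior_closure: "y \<in> carpet_interior \<Omega> Q \<Longrightarrow> y \<notin> closure (Q i)"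
  using closure_Q(1)[of i] by (auto simp: carpet_interior_def S_iff)

text \<open>A tail of the sum is small, and \<open>y\<close> has positive distance from each of the
  finitely many closed disks preceding the tail.\<close>

lemma small_sum_near:
  assumes "y \<in> carpet_interior \<Omega> Q" "disk_sum \<rho> J < \<infinity>" "0 < (e::real)"
  obtains r where "0 < r" "cball y r \<subseteq> \<Omega>" "disk_sum \<rho> (J \<inter> meeting Q (cball y r)) \<le> ennreal e"
proof -
  obtain n where n: "disk_sum \<rho> (J - {..<n}) < ennreal e" using disk_sum_tail[OF assms(2,3)] by blast
  have "y \<in> \<Omega>" using assms(1) by (auto simp: carpet_interior_def S_iff)
  then obtain r where r: "0 < r" "cball y r \<subseteq> \<Omega>" "\<And>i. i < n \<Longrightarrow> i \<noteq> n \<Longrightarrow> Q i \<inter> cball y r = {}"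
    using interior_point_avoids[of y n n] carpet_interior_closure[OF assms(1)] by blast
  have "J \<inter> meeting Q (cball y r) \<subseteq> J - {..<n}" using r(3) by (auto simp: meeting_def)
  then have "disk_sum \<rho> (J \<inter> meeting Q (cball y r)) \<le> disk_sum \<rho> (J - {..<n})" by (rule disk_sum_subset)
  also have "\<dots> \<le> ennreal e" using n by simp
  finally show ?thesis using that r by blast
qed

text \<open>
  The disks meeting the square of side \<open>2 * s\<close> project to sets of length at most \<open>2 * min (diam / 2) s\<close>,
  and the squares of these lengths sum to \<open>O(s\<^sup>2)\<close> by the packing bound, whatever the size of the disks.
\<close>

lemma small_line:
  assumes y: "y \<in> carpet_interior \<Omega> Q" and \<rho>: "loc_sq \<rho>" and \<tau>: "0 < \<tau>"
  obtains r where "0 < r" "\<And>h s \<alpha> P. 0 < s \<Longrightarrow> s < r \<Longrightarrow> cross_coord h y - s \<le> \<alpha> \<Longrightarrow> \<alpha> + s/2 \<le> cross_coord h y + s \<Longrightarrow>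
     AE c in lborel. P c \<Longrightarrow>
     \<exists>c\<in>{\<alpha><..<\<alpha> + s/2}. P c \<and>
       disk_sum \<rho> (meeting Q (plane_line h c ` {cross_coord (\<not> h) y - s..cross_coord (\<not> h) y + s})) \<le> ennreal \<tau>"
proof -
  obtain C where C: "0 < C" "\<And>J r y R. 0 \<le> R \<Longrightarrow> (\<And>i. i \<in> J \<Longrightarrow> \<exists>x\<in>Q i. 0 < r i \<and> r i < diameter (Q i) \<and> ball x (r i) \<subseteq> ball y R) \<Longrightarrow>
       disk_sum (\<lambda>i. (r i)\<^sup>2) J \<le> ennreal (C * R\<^sup>2)" using packing by blast
  have \<rho>0: "0 \<le> \<rho> i" for i using \<rho> by (simp add: loc_sq_def)
  \<comment> \<open>With \<kappa> as weight in Young's inequality and energy at most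
    \<tau>\<kappa>/8, the energy term and the packing term \<open>16 * C * s * \<kappa>\<close> both
    become \<open>s * \<tau> / 8\<close>. Their sum is half of \<tau> times the length
    \<open>s/2\<close> of the parameter interval.\<close>
  define \<kappa> where "\<kappa> = \<tau> / (128 * C)"
  have \<kappa>: "0 < \<kappa>" using \<tau> C(1) by (simp add: \<kappa>_def)
  have "y \<in> \<Omega>" using y by (auto simp: carpet_interior_def S_iff)
  then obtain r1 where r1: "0 < r1" "cball y r1 \<subseteq> \<Omega>" using open_Omega open_contains_cball by blast
  have "disk_sum (\<lambda>i. (\<rho> i)\<^sup>2) (meeting Q (cball y r1)) < \<infinity>" using \<rho> r1(2) by (simp add: loc_sq_def)
  moreover have "0 < \<tau> * \<kappa> / 8" using \<tau> \<kappa> by simp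
  ultimately obtain r2 where r2: "0 < r2"
    "disk_sum (\<lambda>i. (\<rho> i)\<^sup>2) (meeting Q (cball y r1) \<inter> meeting Q (cball y r2)) \<le> ennreal (\<tau> * \<kappa> / 8)"
    using small_sum_near[OF y] by metis
  define r where "r = min r1 r2 / 2"
  show ?thesis
  proof (rule that[of r])
    show "0 < r" using r1 r2 by (simp add: r_def)
    fix h s \<alpha> and P :: "real \<Rightarrow> bool"
    assume s: "0 < s" "s < r" and \<alpha>: "cross_coord h y - s \<le> \<alpha>" "\<alpha> + s/2 \<le> cross_coord h y + s"
      and P: "AE c in lborel. P c"
    let ?I = "{\<alpha><..<\<alpha> + s/2}"
    let ?T = "{cross_coord (\<not> h) y - s..cross_coord (\<not> h) y + s}"
    define K where "K = cball y (2 * s)"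
    have seg: "plane_line h c ` ?T \<subseteq> K" if "c \<in> ?I" for c
    proof
      fix z assume "z \<in> plane_line h c ` ?T"
      then obtain t where t: "t \<in> ?T" "z = plane_line h c t" by blast
      have "\<bar>cross_coord h (y - z)\<bar> \<le> s" "\<bar>cross_coord (\<not> h) (y - z)\<bar> \<le> s"
        using t that \<alpha> by (auto simp: cross_coord_def plane_line_def abs_le_iff split: if_splits)
      then have "\<bar>Re (y - z)\<bar> \<le> s" "\<bar>Im (y - z)\<bar> \<le> s" by (cases h; simp add: cross_coord_def)+
      then show "z \<in> K" using cmod_le[of "y - z"] by (simp add: K_def dist_norm)
    qed
    define \<sigma> where "\<sigma> i = min (diameter (Q i) / 2) s" for i
    have \<sigma>: "0 < \<sigma> i" "\<sigma> i < diameter (Q i)" for i using diameter_Q_pos[of i] s by (auto simp: \<sigma>_def)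
    have pack: "disk_sum (\<lambda>i. (\<sigma> i)\<^sup>2) (meeting Q K) \<le> ennreal (C * (4 * s)\<^sup>2)"
    proof (rule C(2))
      fix i assume "i \<in> meeting Q K"
      then obtain x where x: "x \<in> Q i" "x \<in> K" by (auto simp: meeting_def)
      have "ball x (\<sigma> i) \<subseteq> ball y (4 * s)"
      proof
        fix z assume "z \<in> ball x (\<sigma> i)"
        then have "dist x z < s" by (simp add: \<sigma>_def)
        then show "z \<in> ball y (4 * s)" using x(2) dist_triangle[of y z x] s by (simp add: K_def)
      qed
      then show "\<exists>x\<in>Q i. 0 < \<sigma> i \<and> \<sigma> i < diameter (Q i) \<and> ball x (\<sigma> i) \<subseteq> ball y (4 * s)"
        using x(1) \<sigma> by blast
    qed (use s in simp)
    have energy: "disk_sum (\<lambda>i. (\<rho> i)\<^sup>2) (meeting Q K) \<le> ennreal (\<tau> * \<kappa> / 8)"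
    proof -
      have "K \<subseteq> cball y r1" "K \<subseteq> cball y r2" using s by (auto simp: K_def r_def)
      then have "meeting Q K \<subseteq> meeting Q (cball y r1) \<inter> meeting Q (cball y r2)" using meeting_mono by blast
      then show ?thesis using r2(2) by (rule order_trans[OF disk_sum_subset])
    qed
    have "(\<integral>\<^sup>+c\<in>?I. disk_sum \<rho> (meeting Q (plane_line h c ` ?T)) \<partial>lborel) =
       (\<Sum>i. ennreal (\<rho> i) * emeasure lborel (line_hits h (cross_coord (\<not> h) y - s) (cross_coord (\<not> h) y + s) i \<inter> ?I))"
      by (rule nn_integral_disk_sum_line) simp
    also have "\<dots> \<le> disk_sum (\<lambda>i. \<rho> i * (2 * \<sigma> i)) (meeting Q K)"
      unfolding disk_sum_def
    proof (intro suminf_le allI)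
      fix i
      let ?H = "line_hits h (cross_coord (\<not> h) y - s) (cross_coord (\<not> h) y + s) i"
      show "ennreal (\<rho> i) * emeasure lborel (?H \<inter> ?I) \<le> ennreal (\<rho> i * (2 * \<sigma> i)) * indicator (meeting Q K) i"
      proof (cases "i \<in> meeting Q K")
        case True
        have "emeasure lborel (?H \<inter> ?I) \<le> ennreal (diameter (Q i))"
          using open_line_hits by (intro order_trans[OF emeasure_mono emeasure_line_hits_le]) auto
        moreover have "emeasure lborel (?H \<inter> ?I) \<le> emeasure lborel ?I" by (intro emeasure_mono) auto
        then have "emeasure lborel (?H \<inter> ?I) \<le> ennreal (s/2)" using s by simp
        then have "emeasure lborel (?H \<inter> ?I) \<le> ennreal (2 * s)"
          using s by (elim order_trans) (simp add: ennreal_leI)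
        ultimately have "emeasure lborel (?H \<inter> ?I) \<le> ennreal (2 * \<sigma> i)" by (auto simp: \<sigma>_def min_def)
        then have "ennreal (\<rho> i) * emeasure lborel (?H \<inter> ?I) \<le> ennreal (\<rho> i) * ennreal (2 * \<sigma> i)"
          by (intro mult_left_mono) auto
        then show ?thesis using True \<rho>0[of i] \<sigma>(1)[of i] by (simp add: ennreal_mult)
      next
        case False
        have "c \<notin> ?H" if "c \<in> ?I" for c
          using False meeting_mono[OF seg[OF that], of Q] by (auto simp: mem_line_hits)
        then have "?H \<inter> ?I = {}" by blast
        then show ?thesis by simp
      qed
    qed auto
    also have "\<dots> \<le> disk_sum (\<lambda>i. (s / \<kappa>) * (\<rho> i)\<^sup>2 + (\<kappa> / s) * (\<sigma> i)\<^sup>2) (meeting Q K)"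
    proof (rule disk_sum_mono)
      fix i
      have "0 \<le> (s / \<kappa>) * (\<rho> i - (\<kappa> / s) * \<sigma> i)\<^sup>2" using s \<kappa> by simp
      also have "\<dots> = (s / \<kappa>) * (\<rho> i)\<^sup>2 + (\<kappa> / s) * (\<sigma> i)\<^sup>2 - \<rho> i * (2 * \<sigma> i)"
        using s \<kappa> by (simp add: power2_eq_square field_simps)
      finally show "\<rho> i * (2 * \<sigma> i) \<le> (s / \<kappa>) * (\<rho> i)\<^sup>2 + (\<kappa> / s) * (\<sigma> i)\<^sup>2" by simp
    qed simp
    also have "\<dots> = disk_sum (\<lambda>i. (s / \<kappa>) * (\<rho> i)\<^sup>2) (meeting Q K) + disk_sum (\<lambda>i. (\<kappa> / s) * (\<sigma> i)\<^sup>2) (meeting Q K)"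
      using s \<kappa> by (intro disk_sum_add) auto
    also have "disk_sum (\<lambda>i. (s / \<kappa>) * (\<rho> i)\<^sup>2) (meeting Q K) = ennreal (s / \<kappa>) * disk_sum (\<lambda>i. (\<rho> i)\<^sup>2) (meeting Q K)"
      using s \<kappa> by (intro disk_sum_cmult) auto
    also have "disk_sum (\<lambda>i. (\<kappa> / s) * (\<sigma> i)\<^sup>2) (meeting Q K) = ennreal (\<kappa> / s) * disk_sum (\<lambda>i. (\<sigma> i)\<^sup>2) (meeting Q K)"
      using s \<kappa> by (intro disk_sum_cmult) auto
    also have "ennreal (s / \<kappa>) * disk_sum (\<lambda>i. (\<rho> i)\<^sup>2) (meeting Q K) + ennreal (\<kappa> / s) * disk_sum (\<lambda>i. (\<sigma> i)\<^sup>2) (meeting Q K)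
       \<le> ennreal (s / \<kappa>) * ennreal (\<tau> * \<kappa> / 8) + ennreal (\<kappa> / s) * ennreal (C * (4 * s)\<^sup>2)"
      by (intro add_mono mult_left_mono energy pack) auto
    also have "\<dots> = ennreal (s / \<kappa> * (\<tau> * \<kappa> / 8) + \<kappa> / s * (C * (4 * s)\<^sup>2))"
      using s \<kappa> \<tau> C(1) by (simp add: ennreal_mult[symmetric] ennreal_plus[symmetric] del: ennreal_plus)
    also have "s / \<kappa> * (\<tau> * \<kappa> / 8) + \<kappa> / s * (C * (4 * s)\<^sup>2) = s * \<tau> / 4"
    proof -
      have "s / \<kappa> * (\<tau> * \<kappa> / 8) = s * \<tau> / 8" using \<kappa> by simp
      moreover have "\<kappa> / s * (C * (4 * s)\<^sup>2) = s * \<tau> / 8"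
        using s C(1) by (simp add: \<kappa>_def power2_eq_square)
      ultimately show ?thesis by linarith
    qed
    finally have int: "(\<integral>\<^sup>+c\<in>?I. disk_sum \<rho> (meeting Q (plane_line h c ` ?T)) \<partial>lborel) \<le> ennreal (s * \<tau> / 4)" .
    show "\<exists>c\<in>?I. P c \<and> disk_sum \<rho> (meeting Q (plane_line h c ` ?T)) \<le> ennreal \<tau>"
    proof (rule ccontr)
      assume no: "\<not> ?thesis"
      \<comment> \<open>If no suitable line existed, the sum would exceed \<tau> on almost every
        line of the interval, and its integral would be at least \<open>s * \<tau> / 2\<close>,
        twice the bound just obtained.\<close>
      have "ennreal \<tau> * ennreal (s/2) = (\<integral>\<^sup>+c. ennreal \<tau> * indicator ?I c \<partial>lborel)"
        using s by (subst nn_integral_cmult_indicator) auto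
      also have "\<dots> \<le> (\<integral>\<^sup>+c\<in>?I. disk_sum \<rho> (meeting Q (plane_line h c ` ?T)) \<partial>lborel)"
      proof (rule nn_integral_mono_AE)
        show "AE c in lborel. ennreal \<tau> * indicator ?I c \<le> disk_sum \<rho> (meeting Q (plane_line h c ` ?T)) * indicator ?I c"
          using P
        proof eventually_elim
          case (elim c)
          then have "c \<in> ?I \<Longrightarrow> \<not> disk_sum \<rho> (meeting Q (plane_line h c ` ?T)) \<le> ennreal \<tau>" using no by blast
          then show ?case by (cases "c \<in> ?I") auto
        qed
      qed
      also note int
      finally have "ennreal \<tau> * ennreal (s/2) \<le> ennreal (s * \<tau> / 4)" .
      moreover have "ennreal \<tau> * ennreal (s/2) = ennreal (\<tau> * (s/2))" using s \<tau> by (intro ennreal_mult[symmetric]) auto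
      ultimately have "ennreal (\<tau> * (s/2)) \<le> ennreal (s * \<tau> / 4)" by metis
      then have "\<tau> * (s/2) \<le> s * \<tau> / 4" using s \<tau> by (subst (asm) ennreal_le_iff) auto
      moreover have "0 < s * \<tau>" using s \<tau> by simp
      ultimately show False by (simp add: mult.commute)
    qed
  qed
qed

text \<open>The four sides are taken from generic lines to the left, right, below and above
  \<open>y\<close>, each with oscillation sum at most \<tau>. Values along one side differ by at
  most \<open>3 * \<tau>\<close>, and adjacent sides share a value at their corner. The predicate
  \<open>P\<close> carries further almost sure requirements on the sides.\<close>

lemma small_rect:
  assumes y: "y \<in> carpet_interior \<Omega> Q" and h: "loc_sq (osc h)" "disk_bounded h" "ae_curve v (curve_bound h (osc h))"
    and \<tau>: "0 < \<tau>" and P: "AE c in lborel. P True c" "AE c in lborel. P False c" and e: "0 < e"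
  obtains a1 b1 a2 b2 where "y \<in> open_rect a1 b1 a2 b2" "rect a1 b1 a2 b2 \<subseteq> cball y e"
    "rect a1 b1 a2 b2 \<subseteq> \<Omega>" "P False a1" "P False b1" "P True a2" "P True b2"
    "\<And>p q. p \<in> hvals h (rect a1 b1 a2 b2 - open_rect a1 b1 a2 b2) \<Longrightarrow>
       q \<in> hvals h (rect a1 b1 a2 b2 - open_rect a1 b1 a2 b2) \<Longrightarrow> \<bar>p - q\<bar> \<le> 12 * \<tau>"
    "\<And>i. i \<in> meeting Q (rect a1 b1 a2 b2 - open_rect a1 b1 a2 b2) \<Longrightarrow> osc h i \<le> \<tau>"
proof -
  have "y \<in> \<Omega>" using y by (auto simp: carpet_interior_def S_iff)
  then obtain r0 where r0: "0 < r0" "cball y r0 \<subseteq> \<Omega>" using open_Omega open_contains_cball by blast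
  obtain r1 where r1: "0 < r1" "\<And>h' s \<alpha> P. 0 < s \<Longrightarrow> s < r1 \<Longrightarrow> cross_coord h' y - s \<le> \<alpha> \<Longrightarrow> \<alpha> + s/2 \<le> cross_coord h' y + s \<Longrightarrow>
     AE c in lborel. P c \<Longrightarrow>
     \<exists>c\<in>{\<alpha><..<\<alpha> + s/2}. P c \<and>
       disk_sum (osc h) (meeting Q (plane_line h' c ` {cross_coord (\<not> h') y - s..cross_coord (\<not> h') y + s})) \<le> ennreal \<tau>"
    by (rule small_line[OF y h(1) \<tau>]) blast
  define s where "s = min r1 (min r0 e) / 4"
  have s: "0 < s" "s < r1" "2 * s \<le> r0" "2 * s \<le> e" using r0 r1 e by (auto simp: s_def)
  define X where "X = Re y"
  define Y where "Y = Im y"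
  have cc: "cross_coord False y = X" "cross_coord True y = Y" "cross_coord (\<not> True) y = X" "cross_coord (\<not> False) y = Y"
    by (simp_all add: cross_coord_def X_def Y_def)
  define G where "G h' c \<longleftrightarrow> P h' c \<and>
      (\<forall>a b. a \<le> b \<longrightarrow> plane_line h' c ` {a..b} \<subseteq> \<Omega> \<longrightarrow> curve_bound h (osc h) a b (plane_line h' c))" for h' c
  have G: "AE c in lborel. G h' c" for h'
    unfolding G_def using P ae_curve_line[OF h(3), of h'] by (cases h') auto
  define L where "L h' c = plane_line h' c ` {cross_coord (\<not> h') y - s..cross_coord (\<not> h') y + s}" for h' c
  have ex: "\<exists>c\<in>{\<alpha><..<\<alpha> + s/2}. G h' c \<and> disk_sum (osc h) (meeting Q (L h' c)) \<le> ennreal \<tau>"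
    if "cross_coord h' y - s \<le> \<alpha>" "\<alpha> + s/2 \<le> cross_coord h' y + s" for h' \<alpha>
    unfolding L_def by (rule r1(2)[OF s(1,2) that G])
  obtain a1 where a1: "X - s < a1" "a1 < X" "G False a1" "disk_sum (osc h) (meeting Q (L False a1)) \<le> ennreal \<tau>"
    using ex[of False "X - s"] s(1) unfolding cc by force
  obtain b1 where b1: "X < b1" "b1 < X + s" "G False b1" "disk_sum (osc h) (meeting Q (L False b1)) \<le> ennreal \<tau>"
    using ex[of False X] s(1) unfolding cc by force
  obtain a2 where a2: "Y - s < a2" "a2 < Y" "G True a2" "disk_sum (osc h) (meeting Q (L True a2)) \<le> ennreal \<tau>"
    using ex[of True "Y - s"] s(1) unfolding cc by force
  obtain b2 where b2: "Y < b2" "b2 < Y + s" "G True b2" "disk_sum (osc h) (meeting Q (L True b2)) \<le> ennreal \<tau>"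
    using ex[of True Y] s(1) unfolding cc by force
  have big: "rect (X - s) (X + s) (Y - s) (Y + s) \<subseteq> cball y (2 * s)"
  proof
    fix z assume "z \<in> rect (X - s) (X + s) (Y - s) (Y + s)"
    then have "\<bar>Re (y - z)\<bar> \<le> s" "\<bar>Im (y - z)\<bar> \<le> s" unfolding abs_le_iff mem_rect X_def Y_def by simp_all
    then show "z \<in> cball y (2 * s)" using cmod_le[of "y - z"] by (simp add: dist_norm)
  qed
  let ?R = "rect a1 b1 a2 b2" and ?V = "open_rect a1 b1 a2 b2"
  let ?E = "?R - ?V"
  have sub: "?R \<subseteq> rect (X - s) (X + s) (Y - s) (Y + s)" using a1 b1 a2 b2 by (auto simp: mem_rect)
  have L\<Omega>: "L False a1 \<subseteq> \<Omega>" "L False b1 \<subseteq> \<Omega>" "L True a2 \<subseteq> \<Omega>" "L True b2 \<subseteq> \<Omega>"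
  proof -
    have "rect (X - s) (X + s) (Y - s) (Y + s) \<subseteq> \<Omega>" using big r0(2) s by (auto simp: subset_iff)
    then have "L False c \<subseteq> \<Omega>" if "c \<in> {X - s..X + s}" for c
      using plane_line_in_rect(2)[OF that, of "Y - s" "Y + s"] unfolding L_def cc by blast
    moreover have "L True c \<subseteq> \<Omega>" if "c \<in> {Y - s..Y + s}" for c
      using plane_line_in_rect(1)[OF that, of "X - s" "X + s"] \<open>rect (X - s) (X + s) (Y - s) (Y + s) \<subseteq> \<Omega>\<close> unfolding L_def cc by blast
    ultimately show "L False a1 \<subseteq> \<Omega>" "L False b1 \<subseteq> \<Omega>" "L True a2 \<subseteq> \<Omega>" "L True b2 \<subseteq> \<Omega>"
      using a1 b1 a2 b2 s by auto
  qed
  have close: "\<bar>p - q\<bar> \<le> 3 * \<tau>" if g: "G h' c" "disk_sum (osc h) (meeting Q (L h' c)) \<le> ennreal \<tau>" "L h' c \<subseteq> \<Omega>"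
    and pq: "p \<in> hvals h (L h' c)" "q \<in> hvals h (L h' c)" for h' c p q
  proof -
    let ?a = "cross_coord (\<not> h') y - s" and ?b = "cross_coord (\<not> h') y + s"
    have le: "?a \<le> ?b" using s by simp
    have cv: "curve_in ?a ?b (plane_line h' c)"
      using le g(3) unfolding curve_in_def L_def by (auto intro!: continuous_intros)
    have cb: "curve_bound h (osc h) ?a ?b (plane_line h' c)"
      using g(1,3) le unfolding G_def L_def by blast
    show ?thesis
      by (rule curve_hvals_close[OF cv cb osc_upper[OF h(2)]]) (use g(2) pq \<tau> in \<open>auto simp: L_def\<close>)
  qed
  note c1 = close[OF a1(3,4) L\<Omega>(1)] and c2 = close[OF b1(3,4) L\<Omega>(2)] and c3 = close[OF a2(3,4) L\<Omega>(3)] and c4 = close[OF b2(3,4) L\<Omega>(4)]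
  have inL: "Complex c d \<in> L False c" "Complex c d \<in> L True d" if "c \<in> {X - s..X + s}" "d \<in> {Y - s..Y + s}" for c d
    using that unfolding L_def cc by (auto simp: plane_line_def)
  have E: "?E \<subseteq> L False a1 \<union> L False b1 \<union> L True a2 \<union> L True b2"
  proof
    fix z assume z: "z \<in> ?E"
    then have zr: "Re z \<in> {X - s..X + s}" "Im z \<in> {Y - s..Y + s}" using sub by (auto simp: mem_rect)
    have "Re z = a1 \<or> Re z = b1 \<or> Im z = a2 \<or> Im z = b2" using z by (auto simp: mem_rect mem_open_rect)
    then show "z \<in> L False a1 \<union> L False b1 \<union> L True a2 \<union> L True b2"
      using inL[OF zr] by (auto simp: complex_surj)
  qed
  have rng: "a1 \<in> {X - s..X + s}" "b1 \<in> {X - s..X + s}" "a2 \<in> {Y - s..Y + s}" "b2 \<in> {Y - s..Y + s}"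
    using a1 b1 a2 b2 s by auto
  obtain v13 where v13: "v13 \<in> hvals h (L False a1)" "v13 \<in> hvals h (L True a2)"
    using hvals_common[of "Complex a1 a2"] inL[OF rng(1,3)] L\<Omega>(1) by blast
  obtain v14 where v14: "v14 \<in> hvals h (L False a1)" "v14 \<in> hvals h (L True b2)"
    using hvals_common[of "Complex a1 b2"] inL[OF rng(1,4)] L\<Omega>(1) by blast
  obtain v23 where v23: "v23 \<in> hvals h (L False b1)" "v23 \<in> hvals h (L True a2)"
    using hvals_common[of "Complex b1 a2"] inL[OF rng(2,3)] L\<Omega>(2) by blast
  obtain v24 where v24: "v24 \<in> hvals h (L False b1)" "v24 \<in> hvals h (L True b2)"
    using hvals_common[of "Complex b1 b2"] inL[OF rng(2,4)] L\<Omega>(2) by blast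
  have hE: "p \<in> hvals h (L False a1) \<or> p \<in> hvals h (L False b1) \<or> p \<in> hvals h (L True a2) \<or> p \<in> hvals h (L True b2)"
    if "p \<in> hvals h ?E" for p
  proof -
    have "p \<in> hvals h (L False a1 \<union> L False b1 \<union> L True a2 \<union> L True b2)" using hvals_mono[OF E] that by blast
    then show ?thesis by (auto simp: hvals_def meeting_def)
  qed
  show ?thesis
  proof (rule that[of a1 b1 a2 b2])
    show "y \<in> ?V" using a1 b1 a2 b2 by (simp add: mem_open_rect X_def Y_def)
    show "?R \<subseteq> cball y e" using sub big s by (auto simp: subset_iff intro: order_trans)
    show "?R \<subseteq> \<Omega>" using sub big s r0(2) by (auto simp: subset_iff intro: order_trans)
    show "P False a1" "P False b1" "P True a2" "P True b2" using a1 b1 a2 b2 by (auto simp: G_def)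
    show "osc h i \<le> \<tau>" if "i \<in> meeting Q ?E" for i
    proof -
      have "i \<in> meeting Q (L False a1) \<or> i \<in> meeting Q (L False b1) \<or> i \<in> meeting Q (L True a2) \<or> i \<in> meeting Q (L True b2)"
        using meeting_mono[OF E, of Q] that by (auto simp: meeting_def)
      then have "ennreal (osc h i) \<le> ennreal \<tau>"
        using a1(4) b1(4) a2(4) b2(4) disk_sum_upper[of i _ "osc h"] order_trans by blast
      then show ?thesis using \<tau> by simp
    qed
    \<comment> \<open>Every side either contains the corner \<open>(a1, a2)\<close> or is adjacent
      to a side containing it, so at most two steps of length \<open>3 * \<tau>\<close> lead to the
      reference value \<open>v13\<close>.\<close>
    have corner: "\<bar>p - v13\<bar> \<le> 6 * \<tau>" if pE: "p \<in> hvals h ?E" for p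
    proof -
      consider "p \<in> hvals h (L False a1)" | "p \<in> hvals h (L False b1)" | "p \<in> hvals h (L True a2)" | "p \<in> hvals h (L True b2)"
        using hE[OF pE] by blast
      then show ?thesis
      proof cases
        case 1
        show ?thesis using c1[OF 1 v13(1)] \<tau> by linarith
      next
        case 2
        show ?thesis using c2[OF 2 v23(1)] c3[OF v23(2) v13(2)] by linarith
      next
        case 3
        show ?thesis using c3[OF 3 v13(2)] \<tau> by linarith
      next
        case 4
        show ?thesis using c4[OF 4 v14(2)] c1[OF v14(1) v13(1)] by linarith
      qed
    qed
    show "\<bar>p - q\<bar> \<le> 12 * \<tau>" if "p \<in> hvals h ?E" "q \<in> hvals h ?E" for p q
      using corner[OF that(1)] corner[OF that(2)] by linarith
  qed
qed

subsection \<open>Accessible points\<close>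

text \<open>The real form of the value \<open>disk_max\<close> attached to a disk, through which the
  normalized version is defined.\<close>

definition disk_sup :: "(complex \<Rightarrow> real) \<Rightarrow> nat \<Rightarrow> real" where
  "disk_sup h i = Sup (h ` frontier (Q i))"

lemma disk_sup_near:
  assumes "disk_bounded h" "x \<in> frontier (Q i)"
  shows "\<bar>disk_sup h i - h x\<bar> \<le> osc h i"
proof -
  have b: "bounded (h ` frontier (Q i))" using assms(1) by (simp add: disk_bounded_def)
  have "h x \<le> Sup (h ` frontier (Q i))" "Inf (h ` frontier (Q i)) \<le> h x"
    using assms(2) b by (auto intro!: cSup_upper cInf_lower bounded_imp_bdd_above bounded_imp_bdd_below)
  then show ?thesis using osc_eq[OF assms(1), of i] by (simp add: disk_sup_def)
qed

text \<open>Between the last time in the closure of \<open>Q i\<close> and the next time in the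
  closure of \<open>Q j\<close>, the curve meets neither disk. Their oscillations, spent on
  comparing suprema with boundary values, are therefore available in addition to the sum over that
  piece.\<close>

lemma disk_sup_diff:
  assumes cv: "curve_in a b \<phi>" and cb: "curve_bound h (osc h) a b \<phi>" and h: "disk_bounded h"
    and i: "\<phi> a \<in> Q i" and j: "\<phi> b \<in> Q j"
  shows "ennreal \<bar>disk_sup h i - disk_sup h j\<bar> \<le> disk_sum (osc h) (meeting Q (\<phi> ` {a..b}))"
proof (cases "i = j")
  case False
  have ab: "a \<le> b" and cont: "continuous_on {a..b} \<phi>" using cv by (auto simp: curve_in_def)
  have closed_part: "compact {t \<in> {c..b}. \<phi> t \<in> closure (Q k)}" if "a \<le> c" for c k
  proof -
    have "closed ({c..b} \<inter> \<phi> -` closure (Q k))"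
      using that cont by (intro continuous_closed_preimage) (auto intro: continuous_on_subset)
    moreover have "bounded ({c..b} \<inter> \<phi> -` closure (Q k))" by (rule bounded_subset[of "{c..b}"]) auto
    moreover have "{t \<in> {c..b}. \<phi> t \<in> closure (Q k)} = {c..b} \<inter> \<phi> -` closure (Q k)" by blast
    ultimately show ?thesis by (simp add: compact_eq_bounded_closed)
  qed
  have crossing: "\<exists>t\<in>{c..d}. \<phi> t \<in> frontier (Q k)"
    if "a \<le> c" "c \<le> d" "d \<le> b" "r \<in> {c..d}" "\<phi> r \<in> Q k" "s \<in> {c..d}" "\<phi> s \<notin> Q k" for c d r s k
  proof -
    have "connected (\<phi> ` {c..d})"
      using that cont by (intro connected_continuous_image) (auto intro: continuous_on_subset)
    then have "\<phi> ` {c..d} \<inter> frontier (Q k) \<noteq> {}"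
      by (rule connected_meets_frontier) (use that in blast)+
    then show ?thesis by blast
  qed
  define E where "E = {t \<in> {a..b}. \<phi> t \<in> closure (Q i)}"
  have "compact E" unfolding E_def by (rule closed_part) simp
  moreover have "a \<in> E" using ab in_Q_closure[OF i] by (simp add: E_def)
  ultimately obtain p where p: "p \<in> E" "\<And>t. t \<in> E \<Longrightarrow> t \<le> p" using compact_attains_sup[of E] by blast
  have pab: "a \<le> p" "p \<le> b" "\<phi> p \<in> closure (Q i)" using p(1) by (auto simp: E_def)
  have pfr: "\<phi> p \<in> frontier (Q i)"
  proof (rule ccontr)
    assume "\<phi> p \<notin> frontier (Q i)"
    then have "\<phi> p \<in> Q i" using pab(3) closure_Q(1) by blast
    moreover have "\<phi> b \<notin> Q i" using j disjoint_Q[OF False] by blast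
    ultimately obtain t where t: "t \<in> {p..b}" "\<phi> t \<in> frontier (Q i)" using crossing[of p b p i b] pab by auto
    then have "t \<in> E" using pab frontier_Q_closure by (auto simp: E_def)
    then have "t = p" using p(2)[of t] t(1) by auto
    then show False using t(2) \<open>\<phi> p \<notin> frontier (Q i)\<close> by simp
  qed
  define F where "F = {t \<in> {p..b}. \<phi> t \<in> closure (Q j)}"
  have "compact F" unfolding F_def by (rule closed_part) (rule pab)
  moreover have "b \<in> F" using pab in_Q_closure[OF j] by (simp add: F_def)
  ultimately obtain q where q: "q \<in> F" "\<And>t. t \<in> F \<Longrightarrow> q \<le> t" using compact_attains_inf[of F] by blast
  have qab: "p \<le> q" "q \<le> b" "\<phi> q \<in> closure (Q j)" using q(1) by (auto simp: F_def)
  have qfr: "\<phi> q \<in> frontier (Q j)"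
  proof (rule ccontr)
    assume "\<phi> q \<notin> frontier (Q j)"
    then have "\<phi> q \<in> Q j" using qab(3) closure_Q(1) by blast
    moreover have "\<phi> p \<notin> Q j" using pab(3) disjoint_closure[OF False] in_Q_closure by blast
    ultimately obtain t where t: "t \<in> {p..q}" "\<phi> t \<in> frontier (Q j)" using crossing[of p q q j p] pab qab by auto
    then have "t \<in> F" using qab frontier_Q_closure by (auto simp: F_def)
    then have "t = q" using q(2)[of t] t(1) by auto
    then show False using t(2) \<open>\<phi> q \<notin> frontier (Q j)\<close> by simp
  qed
  let ?J = "meeting Q (\<phi> ` {p..q})"
  have "i \<notin> ?J"
  proof
    assume "i \<in> ?J"
    then obtain t where t: "t \<in> {p..q}" "\<phi> t \<in> Q i" unfolding meeting_def by blast
    then have "t \<in> E" using pab qab in_Q_closure by (auto simp: E_def)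
    then have "t = p" using p(2)[of t] t(1) by auto
    then show False using t(2) pfr closure_Q(2) by blast
  qed
  have "j \<notin> ?J"
  proof
    assume "j \<in> ?J"
    then obtain t where t: "t \<in> {p..q}" "\<phi> t \<in> Q j" unfolding meeting_def by blast
    then have "t \<in> F" using pab qab in_Q_closure by (auto simp: F_def)
    then have "t = q" using q(2)[of t] t(1) by auto
    then show False using t(2) qfr closure_Q(2) by blast
  qed
  have S: "\<phi> p \<in> S" "\<phi> q \<in> S" using pfr qfr frontier_Q_subset by blast+
  have o: "0 \<le> osc h k" for k using h by (rule osc_nonneg)
  have "\<bar>disk_sup h i - disk_sup h j\<bar> \<le> osc h i + (osc h j + \<bar>h (\<phi> p) - h (\<phi> q)\<bar>)"
    using disk_sup_near[OF h pfr] disk_sup_near[OF h qfr] by linarith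
  then have "ennreal \<bar>disk_sup h i - disk_sup h j\<bar> \<le> ennreal (osc h i + (osc h j + \<bar>h (\<phi> p) - h (\<phi> q)\<bar>))"
    by (rule ennreal_leI)
  also have "\<dots> = ennreal (osc h i) + (ennreal (osc h j) + ennreal \<bar>h (\<phi> p) - h (\<phi> q)\<bar>)"
    using o by simp
  also have "\<dots> \<le> ennreal (osc h i) + (ennreal (osc h j) + disk_sum (osc h) ?J)"
    using curve_boundD[OF cb pab(1) qab(1,2) S] by (intro add_left_mono)
  also have "\<dots> = disk_sum (osc h) (insert i (insert j ?J))"
    using \<open>i \<notin> ?J\<close> \<open>j \<notin> ?J\<close> False by (simp add: disk_sum_insert)
  also have "\<dots> \<le> disk_sum (osc h) (meeting Q (\<phi> ` {a..b}))"
  proof (rule disk_sum_subset)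
    have "?J \<subseteq> meeting Q (\<phi> ` {a..b})" using pab qab by (intro meeting_mono image_mono) auto
    moreover have "i \<in> meeting Q (\<phi> ` {a..b})" "j \<in> meeting Q (\<phi> ` {a..b})"
      using i j ab by (auto simp: meeting_def)
    ultimately show "insert i (insert j ?J) \<subseteq> meeting Q (\<phi> ` {a..b})" by blast
  qed
  finally show ?thesis .
qed simp

text \<open>Generic segments are legitimate access paths, so every point of
  \<open>carpet_interior\<close> on them is accessible. Compactness of the segment makes the
  oscillation sum finite outright, which covers both finiteness conditions.\<close>

lemma AE_line_good_path:
  assumes g: "g \<in> sobolev_loc v \<Omega> Q"
  shows "AE c in lborel. \<forall>a b. a < b \<longrightarrow> plane_line h c ` {a..b} \<subseteq> \<Omega> \<longrightarrow> ({a..b}, plane_line h c) \<in> good_paths \<Omega> Q g"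
proof -
  define H where "H x = real_of_ereal (g x)" for x
  note H = sobolev_loc_real[OF g, folded H_def]
  have M: "disk_max (Q i) g = ereal (disk_sup H i)" for i using H(3)[of i] by (simp add: disk_sup_def)
  show ?thesis
    using ae_curve_line[OF H(6), of h] ae_curve_line[OF ae_curve_finite_sum[OF H(5), of v], of h] AE_line_hausdorff_S[of h]
  proof eventually_elim
    case (elim c)
    show ?case
    proof (intro allI impI)
      fix a b :: real
      assume ab: "a < b" and sub: "plane_line h c ` {a..b} \<subseteq> \<Omega>"
      let ?\<gamma> = "({a..b}, plane_line h c)"
      have fin: "disk_sum (osc H) (meeting Q (plane_line h c ` {a..b})) < \<infinity>" using elim(2) ab sub by simp
      have nc: "\<not> plane_line h c constant_on {a..b}"
      proof
        assume "plane_line h c constant_on {a..b}"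
        then have "plane_line h c a = plane_line h c b" using ab by (auto simp: constant_on_def)
        then show False using ab by (auto simp: plane_line_def split: if_splits)
      qed
      have pi: "?\<gamma> \<in> paths_in \<Omega>"
      proof -
        have "continuous_on {a..b} (plane_line h c)" by (intro continuous_intros)
        then show ?thesis using ab sub by (simp add: paths_in_def is_path_def path_trace_def is_interval_cc)
      qed
      have osc1: "\<bar>disk_max (Q i) g - disk_max (Q j) g\<bar> \<le> enn2ereal (disk_sum (osc H) (meeting Q (path_trace \<gamma>')))"
        if \<gamma>': "subpath_of \<gamma>' ?\<gamma>" and ij: "i \<in> meeting Q (path_trace \<gamma>')" "j \<in> meeting Q (path_trace \<gamma>')" for \<gamma>' i j
      proof -
        have I: "is_interval (fst \<gamma>')" "fst \<gamma>' \<subseteq> {a..b}" "path_trace \<gamma>' = plane_line h c ` fst \<gamma>'"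
          using \<gamma>' by (auto simp: subpath_of_def path_trace_def)
        have *: "ennreal \<bar>disk_sup H i - disk_sup H j\<bar> \<le> disk_sum (osc H) (meeting Q (path_trace \<gamma>'))"
          if st: "s \<in> fst \<gamma>'" "t \<in> fst \<gamma>'" "s \<le> t" "plane_line h c s \<in> Q i" "plane_line h c t \<in> Q j" for s t i j
        proof -
          have sub': "{s..t} \<subseteq> fst \<gamma>'" using mem_is_interval_1_I[OF I(1) st(1,2)] by (simp add: subset_iff)
          then have "plane_line h c ` {s..t} \<subseteq> \<Omega>" using sub I(2) by blast
          moreover have "continuous_on {s..t} (plane_line h c)" by (intro continuous_intros)
          ultimately have "curve_in s t (plane_line h c)" "curve_bound H (osc H) s t (plane_line h c)"
            using st(3) elim(1) by (simp_all add: curve_in_def)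
          then have "ennreal \<bar>disk_sup H i - disk_sup H j\<bar> \<le> disk_sum (osc H) (meeting Q (plane_line h c ` {s..t}))"
            by (rule disk_sup_diff[OF _ _ H(2) st(4,5)])
          also have "\<dots> \<le> disk_sum (osc H) (meeting Q (path_trace \<gamma>'))"
            unfolding I(3) using sub' by (intro disk_sum_subset meeting_mono image_mono)
          finally show ?thesis .
        qed
        obtain s t where st: "s \<in> fst \<gamma>'" "t \<in> fst \<gamma>'" "plane_line h c s \<in> Q i" "plane_line h c t \<in> Q j"
          using ij unfolding meeting_def I(3) by auto
        have "ennreal \<bar>disk_sup H i - disk_sup H j\<bar> \<le> disk_sum (osc H) (meeting Q (path_trace \<gamma>'))"
          using *[of s t i j] *[of t s j i] st by (cases "s \<le> t") (simp_all add: abs_minus_commute)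
        then show ?thesis by (simp add: M ereal_le_enn2ereal_iff)
      qed
      have fin1: "disk_sum (osc H) (meeting Q (path_trace \<gamma>')) < \<infinity>" if "subpath_of \<gamma>' ?\<gamma>" for \<gamma>'
      proof -
        have "disk_sum (osc H) (meeting Q (path_trace \<gamma>')) \<le> disk_sum (osc H) (meeting Q (plane_line h c ` {a..b}))"
          using path_trace_subpath[OF that] by (intro disk_sum_subset meeting_mono) (simp add: path_trace_def)
        then show ?thesis using fin by (rule le_less_trans)
      qed
      have hz: "hausdorff 1 (path_trace ?\<gamma> \<inter> S) = 0" using elim(3) by (simp add: path_trace_def)
      have fin0: "disk_sum (osc H) (meeting Q (path_trace ?\<gamma>)) < \<infinity>" using fin by (simp add: path_trace_def)
      show "?\<gamma> \<in> good_paths \<Omega> Q g"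
        unfolding good_paths_def Let_def sum_along_eq_disk_sum H(4) real_of_ereal.simps mem_Collect_eq fst_conv snd_conv
        by (intro conjI allI impI ballI; (rule nc pi hz fin0 | (erule fin1) | (erule (2) osc1)))
    qed
  qed
qed

text \<open>The oscillation sum is only known to be finite on subpaths compactly contained in
  \<Omega>. The path is therefore restricted to a short time window near a time at which its
  extension reaches \<open>y\<close>; disks that realize the lower limit are met within this window,
  whichever kind of access is given.\<close>

lemma access_segment:
  assumes y: "y \<in> carpet_interior \<Omega> Q" and g: "g \<in> sobolev_loc v \<Omega> Q"
    and \<gamma>0: "\<gamma>0 \<in> good_paths \<Omega> Q g" and acc: "access_path \<Omega> Q y \<gamma>0 \<gamma>"
    and lim: "liminf_along Q (\<lambda>i. disk_max (Q i) g) y \<gamma> = ereal a"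
  defines "H \<equiv> \<lambda>x. real_of_ereal (g x)"
  obtains \<phi> :: "real \<Rightarrow> complex" and C :: "real set"
  where "is_interval C" "continuous_on C \<phi>" "\<phi> ` C \<subseteq> \<Omega>" "hausdorff 1 (\<phi> ` C \<inter> S) = 0"
    "disk_sum (osc H) (meeting Q (\<phi> ` C)) < \<infinity>"
    "\<And>s t i j. s \<in> C \<Longrightarrow> t \<in> C \<Longrightarrow> \<phi> s \<in> Q i \<Longrightarrow> \<phi> t \<in> Q j \<Longrightarrow>
       ennreal \<bar>disk_sup H i - disk_sup H j\<bar> \<le> disk_sum (osc H) (meeting Q (\<phi> ` closed_segment s t))"
    "\<And>e. 0 < e \<Longrightarrow> \<exists>s\<in>C. \<exists>i. \<phi> s \<in> Q i \<and> Q i \<subseteq> ball y e \<and> \<bar>disk_sup H i - a\<bar> < e"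
proof -
  note H = sobolev_loc_real[OF g, folded H_def]
  have M: "disk_max (Q i) g = ereal (disk_sup H i)" for i using H(3)[of i] by (simp add: disk_sup_def)
  define I where "I = fst \<gamma>"
  define \<phi> where "\<phi> = snd \<gamma>0"
  have p0: "is_path \<gamma>0" "path_trace \<gamma>0 \<subseteq> \<Omega>" using \<gamma>0 by (auto simp: good_paths_def Let_def paths_in_def)
  have good: "hausdorff 1 (path_trace \<gamma>0 \<inter> S) = 0"
    "\<And>\<gamma>' i j. subpath_of \<gamma>' \<gamma>0 \<Longrightarrow> i \<in> meeting Q (path_trace \<gamma>') \<Longrightarrow> j \<in> meeting Q (path_trace \<gamma>') \<Longrightarrow>
       \<bar>disk_max (Q i) g - disk_max (Q j) g\<bar> \<le> enn2ereal (disk_sum (osc H) (meeting Q (path_trace \<gamma>')))"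
    "\<And>\<gamma>'. subpath_of \<gamma>' \<gamma>0 \<Longrightarrow> compactly_contained (path_trace \<gamma>') \<Omega> \<Longrightarrow> disk_sum (osc H) (meeting Q (path_trace \<gamma>')) < \<infinity>"
    using \<gamma>0 unfolding good_paths_def Let_def sum_along_eq_disk_sum H(4) by auto
  have sub: "subpath_of \<gamma> \<gamma>0"
    using acc p0(1) by (auto simp: access_path_def subpath_of_def is_path_def split: if_splits)
  have I: "is_interval I" "I \<subseteq> fst \<gamma>0" "snd \<gamma> = \<phi>" using sub by (auto simp: subpath_of_def I_def \<phi>_def)
  have cont: "continuous_on (closure (fst \<gamma>0)) \<phi>" "bounded (fst \<gamma>0)" using p0(1) by (auto simp: is_path_def \<phi>_def)
  have clI: "closure I \<subseteq> closure (fst \<gamma>0)" using I(2) by (rule closure_mono)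
  have tr: "path_trace \<gamma> = \<phi> ` I" by (simp add: path_trace_def I I_def)
  define A where "A e = {i \<in> meeting Q (\<phi> ` I). Q i \<subseteq> ball y e}" for e
  have near: "\<exists>s\<in>I. \<exists>i. \<phi> s \<in> Q i \<and> Q i \<subseteq> ball y e \<and> \<bar>disk_sup H i - a\<bar> < e" if e: "0 < e" for e
  proof -
    have L: "(SUP \<epsilon>\<in>{0<..}. INF i\<in>A \<epsilon>. ereal (disk_sup H i)) = ereal a"
      using lim unfolding liminf_along_def tr M A_def by simp
    have "ereal (a - e) < (SUP \<epsilon>\<in>{0<..}. INF i\<in>A \<epsilon>. ereal (disk_sup H i))" unfolding L using e by simp
    then obtain d where d: "0 < d" "ereal (a - e) < (INF i\<in>A d. ereal (disk_sup H i))"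
      unfolding less_SUP_iff by auto
    let ?m = "min d e"
    have "(INF i\<in>A ?m. ereal (disk_sup H i)) \<le> ereal a"
      unfolding L[symmetric] using d e by (intro SUP_upper) auto
    also have "\<dots> < ereal (a + e)" using e by simp
    finally obtain i where i: "i \<in> A ?m" "disk_sup H i < a + e" unfolding INF_less_iff by auto
    have "i \<in> A d" using i(1) by (auto simp: A_def)
    then have "(INF i\<in>A d. ereal (disk_sup H i)) \<le> ereal (disk_sup H i)" by (rule INF_lower)
    then have "ereal (a - e) < ereal (disk_sup H i)" using d(2) by (rule less_le_trans[rotated])
    then have "\<bar>disk_sup H i - a\<bar> < e" using i(2) by simp
    moreover have "Q i \<subseteq> ball y e" using i(1) by (auto simp: A_def)
    moreover obtain s where "s \<in> I" "\<phi> s \<in> Q i" using i(1) unfolding A_def meeting_def by blast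
    ultimately show ?thesis by blast
  qed
  have "\<exists>t i. t \<in> I \<and> \<phi> t \<in> Q i \<and> Q i \<subseteq> ball y (inverse (Suc n)) \<and> \<bar>disk_sup H i - a\<bar> < inverse (Suc n)" for n
    using near[of "inverse (Suc n)"] by auto
  then obtain t k where t: "\<And>n. t n \<in> I" "\<And>n. \<phi> (t n) \<in> Q (k n)" "\<And>n. Q (k n) \<subseteq> ball y (inverse (Suc n))"
    "\<And>n. \<bar>disk_sup H (k n) - a\<bar> < inverse (Suc n)" by metis
  \<comment> \<open>A subsequence of the times at which the path meets these shrinking disks
    converges, and the continuous extension takes the value \<open>y\<close> at the limit. The limit
    time may lie outside \<open>I\<close>.\<close>
  have "compact (closure I)" using bounded_subset[OF cont(2) I(2)] by (simp add: compact_closure)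
  moreover have "\<forall>n. t n \<in> closure I" using t(1) closure_subset by blast
  ultimately obtain \<tau> r where \<tau>: "\<tau> \<in> closure I" "strict_mono r" "(t \<circ> r) \<longlonglongrightarrow> \<tau>"
    unfolding compact_def by blast
  have inv: "(\<lambda>n. inverse (real (Suc (r n)))) \<longlonglongrightarrow> 0"
    using LIMSEQ_subseq_LIMSEQ[OF LIMSEQ_inverse_real_of_nat \<tau>(2)] by (simp add: o_def)
  have "(\<lambda>n. \<phi> ((t \<circ> r) n)) \<longlonglongrightarrow> \<phi> \<tau>"
  proof (rule continuous_on_tendsto_compose[OF cont(1) \<tau>(3)])
    show "\<tau> \<in> closure (fst \<gamma>0)" using \<tau>(1) clI by blast
    show "\<forall>\<^sub>F n in sequentially. (t \<circ> r) n \<in> closure (fst \<gamma>0)"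
      using t(1) clI closure_subset[of I] by (intro always_eventually) auto
  qed
  moreover have "(\<lambda>n. \<phi> ((t \<circ> r) n)) \<longlonglongrightarrow> y"
  proof (rule metric_tendsto_imp_tendsto[OF inv], rule always_eventually, rule allI)
    fix n
    have "\<phi> (t (r n)) \<in> ball y (inverse (Suc (r n)))" using t(2,3)[of "r n"] by blast
    then show "dist (\<phi> ((t \<circ> r) n)) y \<le> dist (inverse (real (Suc (r n)))) 0" by (simp add: dist_commute)
  qed
  ultimately have \<phi>\<tau>: "\<phi> \<tau> = y" by (rule LIMSEQ_unique)
  have "y \<in> \<Omega>" using y by (auto simp: carpet_interior_def S_iff)
  then obtain \<rho> where \<rho>: "0 < \<rho>" "cball y \<rho> \<subseteq> \<Omega>" using open_Omega open_contains_cball by blast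
  have "continuous_on (closure I) \<phi>" using cont(1) clI by (rule continuous_on_subset)
  then obtain \<eta> where \<eta>: "0 < \<eta>" "\<And>s. s \<in> closure I \<Longrightarrow> dist s \<tau> < \<eta> \<Longrightarrow> dist (\<phi> s) (\<phi> \<tau>) < \<rho>"
    using \<tau>(1) \<rho>(1) unfolding continuous_on_iff by meson
  \<comment> \<open>By continuity the path stays within \<rho> of \<open>y\<close> on this window,
    so its trace there is compactly contained in \<Omega>.\<close>
  define C where "C = I \<inter> ball \<tau> \<eta>"
  have C: "is_interval C" "C \<subseteq> fst \<gamma>0" "C \<subseteq> I"
    using I by (auto simp: C_def intro!: is_interval_Int) (simp add: is_interval_convex_1)
  have CB: "\<phi> ` C \<subseteq> cball y \<rho>"
    using \<eta>(2) \<phi>\<tau> closure_subset[of I] by (force simp: C_def dist_commute)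
  have cc: "compactly_contained (\<phi> ` C) \<Omega>"
  proof -
    have "closure (\<phi> ` C) \<subseteq> cball y \<rho>" using CB by (intro closure_minimal) auto
    then show ?thesis using \<rho>(2) bounded_subset[OF bounded_cball] CB
      by (auto simp: compactly_contained_def compact_closure)
  qed
  have near': "\<exists>s\<in>C. \<exists>i. \<phi> s \<in> Q i \<and> Q i \<subseteq> ball y e \<and> \<bar>disk_sup H i - a\<bar> < e" if e: "0 < e" for e
  proof -
    have "eventually (\<lambda>n. inverse (real (Suc (r n))) < e) sequentially" using inv e by (rule order_tendstoD)
    moreover have "eventually (\<lambda>n. dist ((t \<circ> r) n) \<tau> < \<eta>) sequentially" using \<tau>(3) \<eta>(1) by (rule tendstoD)
    ultimately have "eventually (\<lambda>n. inverse (real (Suc (r n))) < e \<and> dist ((t \<circ> r) n) \<tau> < \<eta>) sequentially"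
      by (rule eventually_conj)
    then obtain n where n: "inverse (real (Suc (r n))) < e" "dist (t (r n)) \<tau> < \<eta>"
      by (auto simp: eventually_sequentially)
    have "t (r n) \<in> C" using t(1) n(2) by (simp add: C_def dist_commute)
    moreover have "Q (k (r n)) \<subseteq> ball y e" using t(3)[of "r n"] n(1) by fastforce
    moreover have "\<bar>disk_sup H (k (r n)) - a\<bar> < e" using t(4)[of "r n"] n(1) by linarith
    ultimately show ?thesis using t(2) by blast
  qed
  have sp: "subpath_of (D, \<phi>) \<gamma>0" if "D \<noteq> {}" "is_interval D" "D \<subseteq> C" for D
    using that C by (auto simp: subpath_of_def \<phi>_def)
  have "C \<noteq> {}" using near'[of 1] by auto
  show ?thesis
  proof (rule that[where C = C and \<phi> = \<phi>])
    show "is_interval C" by fact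
    show "continuous_on C \<phi>" using cont(1) C(2) closure_subset by (rule continuous_on_subset[OF _ order_trans])
    show "\<phi> ` C \<subseteq> \<Omega>" using CB \<rho>(2) by blast
    have "\<phi> ` C \<inter> S \<subseteq> path_trace \<gamma>0 \<inter> S" using C(2) by (auto simp: path_trace_def \<phi>_def)
    then have "hausdorff 1 (\<phi> ` C \<inter> S) \<le> hausdorff 1 (path_trace \<gamma>0 \<inter> S)" by (rule hausdorff_mono)
    then show "hausdorff 1 (\<phi> ` C \<inter> S) = 0" using good(1) by simp
    show "disk_sum (osc H) (meeting Q (\<phi> ` C)) < \<infinity>"
      using good(3)[OF sp[OF \<open>C \<noteq> {}\<close> C(1) order_refl]] cc by (simp add: path_trace_def)
    show "ennreal \<bar>disk_sup H i - disk_sup H j\<bar> \<le> disk_sum (osc H) (meeting Q (\<phi> ` closed_segment s t))"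
      if "s \<in> C" "t \<in> C" "\<phi> s \<in> Q i" "\<phi> t \<in> Q j" for s t i j
    proof -
      have "closed_segment s t \<subseteq> C" using that C(1) by (simp add: is_interval_convex_1 closed_segment_subset)
      then have "subpath_of (closed_segment s t, \<phi>) \<gamma>0"
        by (intro sp) (auto simp: is_interval_convex_1)
      moreover have "i \<in> meeting Q (path_trace (closed_segment s t, \<phi>))" "j \<in> meeting Q (path_trace (closed_segment s t, \<phi>))"
        using that by (auto simp: meeting_def path_trace_def)
      ultimately have "\<bar>disk_max (Q i) g - disk_max (Q j) g\<bar> \<le>
          enn2ereal (disk_sum (osc H) (meeting Q (path_trace (closed_segment s t, \<phi>))))" by (rule good(2))
      then show ?thesis by (simp add: M ereal_le_enn2ereal_iff path_trace_def)
    qed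
    show "\<exists>s\<in>C. \<exists>i. \<phi> s \<in> Q i \<and> Q i \<subseteq> ball y e \<and> \<bar>disk_sup H i - a\<bar> < e" if "0 < e" for e
      using that by (rule near')
  qed
qed

text \<open>The value obtained along an arbitrary access path is compared with the value along a
  generic line through a small rectangle that both have to cross. The total 18 is 1 for the
  approximation of \<open>a\<close>, 1 along the access path, 1 inside the disk it exits through, 12
  around the rectangle and 3 along the line.\<close>

lemma accessible_value_on_line:
  assumes y: "y \<in> carpet_interior \<Omega> Q" and g: "g \<in> sobolev_loc v \<Omega> Q"
    and \<gamma>0: "\<gamma>0 \<in> good_paths \<Omega> Q g" and acc: "access_path \<Omega> Q y \<gamma>0 \<gamma>"
    and lim: "liminf_along Q (\<lambda>i. disk_max (Q i) g) y \<gamma> = ereal a"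
  defines "H \<equiv> \<lambda>x. real_of_ereal (g x)"
  assumes b: "b1 \<le> Re y" "Re y < b2" and line: "plane_line True (Im y) ` {b1..b2} \<subseteq> \<Omega>"
    and cb: "curve_bound H (osc H) b1 b2 (plane_line True (Im y))"
    and fin: "disk_sum (osc H) (meeting Q (plane_line True (Im y) ` {b1..b2})) < \<infinity>"
  shows "a = H y"
proof -
  note H = sobolev_loc_real[OF g, folded H_def]
  obtain \<phi> :: "real \<Rightarrow> complex" and C :: "real set" where C: "is_interval C" "continuous_on C \<phi>" "\<phi> ` C \<subseteq> \<Omega>"
    and H1: "hausdorff 1 (\<phi> ` C \<inter> S) = 0" and Cfin: "disk_sum (osc H) (meeting Q (\<phi> ` C)) < \<infinity>"
    and diff: "\<And>s t i j. s \<in> C \<Longrightarrow> t \<in> C \<Longrightarrow> \<phi> s \<in> Q i \<Longrightarrow> \<phi> t \<in> Q j \<Longrightarrow>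
       ennreal \<bar>disk_sup H i - disk_sup H j\<bar> \<le> disk_sum (osc H) (meeting Q (\<phi> ` closed_segment s t))"
    and near: "\<And>e. 0 < e \<Longrightarrow> \<exists>s\<in>C. \<exists>i. \<phi> s \<in> Q i \<and> Q i \<subseteq> ball y e \<and> \<bar>disk_sup H i - a\<bar> < e"
    by (rule access_segment[OF y g \<gamma>0 acc lim, folded H_def]) blast
  have yS: "y \<in> S" using y by (simp add: carpet_interior_def)
  obtain s0 i0 where s0: "s0 \<in> C" "\<phi> s0 \<in> Q i0" using near[of 1] by auto
  have "\<phi> s0 \<noteq> y" using s0(2) yS by (auto simp: S_iff)
  then have d0: "0 < dist y (\<phi> s0)" by simp
  \<comment> \<open>The carpet part of the access path has zero length, so its coordinates form null
    sets. Sides avoiding them are crossed by the path inside disks only, which is where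
    \<open>diff\<close> can be applied.\<close>
  define P where "P h c \<longleftrightarrow> c \<notin> cross_coord h ` (\<phi> ` C \<inter> S)" for h c
  have P: "AE c in lborel. P h c" for h
    unfolding P_def
    by (intro negligible_AE_lborel hausdorff_1_null_lipschitz_image[OF H1] cross_coord_lipschitz)
  have bound: "\<bar>a - H y\<bar> \<le> 18 * \<tau>" if \<tau>: "0 < \<tau>" for \<tau>
  proof -
    obtain r1 where r1: "0 < r1" "disk_sum (osc H) (meeting Q (\<phi> ` C) \<inter> meeting Q (cball y r1)) \<le> ennreal \<tau>"
      using small_sum_near[OF y Cfin \<tau>] by blast
    let ?l = "plane_line True (Im y)"
    obtain r2 where r2: "0 < r2" "disk_sum (osc H) (meeting Q (?l ` {b1..b2}) \<inter> meeting Q (cball y r2)) \<le> ennreal \<tau>"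
      using small_sum_near[OF y fin \<tau>] by blast
    \<comment> \<open>The rectangle must be small enough that both oscillation sums are at most
      \<tau>, that the access path has a point \<open>\<phi> s0\<close> outside, and that the right
      side is reached before \<open>b2\<close>.\<close>
    define e where "e = min (min r1 r2) (min (dist y (\<phi> s0) / 2) (b2 - Re y))"
    have e: "0 < e" "e \<le> r1" "e \<le> r2" "e \<le> b2 - Re y"
      using r1(1) r2(1) d0 b by (simp_all add: e_def)
    have "e \<le> dist y (\<phi> s0) / 2" unfolding e_def by (rule min.coboundedI2) (rule min.cobounded1)
    then have e4: "e < dist y (\<phi> s0)" using d0 by linarith
    obtain x1 x2 y1 y2 where yV: "y \<in> open_rect x1 x2 y1 y2" and Re: "rect x1 x2 y1 y2 \<subseteq> cball y e"
      and R\<Omega>: "rect x1 x2 y1 y2 \<subseteq> \<Omega>" and Px: "P False x1" "P False x2" "P True y1" "P True y2"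
      and bd: "\<And>p q. p \<in> hvals H (rect x1 x2 y1 y2 - open_rect x1 x2 y1 y2) \<Longrightarrow>
         q \<in> hvals H (rect x1 x2 y1 y2 - open_rect x1 x2 y1 y2) \<Longrightarrow> \<bar>p - q\<bar> \<le> 12 * \<tau>"
      and small: "\<And>i. i \<in> meeting Q (rect x1 x2 y1 y2 - open_rect x1 x2 y1 y2) \<Longrightarrow> osc H i \<le> \<tau>"
      by (rule small_rect[OF y H(5) H(2) H(6) \<tau> P P e(1)], rule that; assumption)
    let ?R = "rect x1 x2 y1 y2" and ?V = "open_rect x1 x2 y1 y2"
    let ?E = "?R - ?V"
    obtain e' where e': "0 < e'" "ball y e' \<subseteq> ?V" using yV open_rect_props(1) open_contains_ball by blast
    obtain s i where s: "s \<in> C" "\<phi> s \<in> Q i" "Q i \<subseteq> ball y (min e' \<tau>)" "\<bar>disk_sup H i - a\<bar> < min e' \<tau>"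
      using near[of "min e' \<tau>"] e'(1) \<tau> by auto
    have sV: "\<phi> s \<in> ?V" using s(2,3) e'(2) by fastforce
    have s0V: "\<phi> s0 \<notin> ?V"
    proof
      assume "\<phi> s0 \<in> ?V"
      then have "\<phi> s0 \<in> cball y e" using Re open_rect_props(3) by blast
      then show False using e4 by simp
    qed
    \<comment> \<open>Running linearly from the time \<open>s\<close> near \<open>y\<close> to the
      time \<open>s0\<close> outside, whichever is larger, makes the first exit from the rectangle
      independent of their order.\<close>
    define p where "p = \<phi> \<circ> linepath s s0"
    have sub: "closed_segment s t \<subseteq> C" if "t \<in> C" for t
      using that s(1) C(1) by (simp add: is_interval_convex_1 closed_segment_subset)
    have "path p" unfolding p_def
      using C(2) sub[OF s0(1)] by (intro path_continuous_image) (auto intro: continuous_on_subset)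
    moreover have "pathfinish p \<notin> ?V" using s0V by (simp add: p_def pathfinish_def linepath_1')
    ultimately obtain w where w: "0 \<le> w" "w \<le> 1" "\<And>x. 0 \<le> x \<and> x < w \<Longrightarrow> p x \<in> interior ?V"
      "p w \<notin> interior ?V" "w = 0 \<or> p w \<in> closure ?V"
      by (rule subpath_to_frontier_explicit) blast
    have int: "interior ?V = ?V" using open_rect_props(1) by (rule interior_open)
    have "p 0 \<in> ?V" using sV by (simp add: p_def linepath_0')
    then have w0: "w \<noteq> 0" using w(4) int by auto
    have clV: "closure ?V \<subseteq> ?R" using open_rect_props(2,3) by (intro closure_minimal) (auto simp: compact_imp_closed)
    define t where "t = linepath s s0 w"
    have "t \<in> closed_segment s s0" using w(1,2) unfolding t_def by (metis atLeastAtMost_iff image_eqI path_image_def path_image_linepath)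
    then have tC: "t \<in> C" using sub[OF s0(1)] by blast
    have tE: "\<phi> t \<in> ?E" using w(4,5) w0 clV int by (auto simp: p_def t_def)
    have inR: "\<phi> ` closed_segment s t \<subseteq> ?R"
    proof
      fix z assume "z \<in> \<phi> ` closed_segment s t"
      then obtain \<theta> where \<theta>: "0 \<le> \<theta>" "\<theta> \<le> 1" "z = \<phi> ((1 - \<theta>) *\<^sub>R s + \<theta> *\<^sub>R t)"
        by (auto simp: in_segment)
      have "(1 - \<theta>) *\<^sub>R s + \<theta> *\<^sub>R t = linepath s s0 (\<theta> * w)"
        by (simp add: t_def linepath_def algebra_simps)
      then have z: "z = p (\<theta> * w)" using \<theta>(3) by (simp add: p_def)
      have "\<theta> * w \<le> 1 * w" using \<theta>(2) w(1) by (rule mult_right_mono)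
      then consider "\<theta> * w < w" | "\<theta> * w = w" by linarith
      then show "z \<in> ?R"
      proof cases
        case 1
        then have "p (\<theta> * w) \<in> ?V" using w(3)[of "\<theta> * w"] w(1) \<theta>(1) int by simp
        then show ?thesis using z open_rect_props(3) by blast
      next
        case 2
        then show ?thesis unfolding z 2 using tE by (simp add: p_def t_def)
      qed
    qed
    have "\<phi> t \<notin> S"
    proof
      assume "\<phi> t \<in> S"
      then have "\<phi> t \<in> \<phi> ` C \<inter> S" using tC by blast
      then have "cross_coord h (\<phi> t) \<in> cross_coord h ` (\<phi> ` C \<inter> S)" for h by (rule imageI)
      then have "\<not> P h (cross_coord h (\<phi> t))" for h by (simp add: P_def)
      from this[of False] this[of True] have "\<not> P False (Re (\<phi> t))" "\<not> P True (Im (\<phi> t))"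
        by (simp_all add: cross_coord_def)
      moreover have "Re (\<phi> t) = x1 \<or> Re (\<phi> t) = x2 \<or> Im (\<phi> t) = y1 \<or> Im (\<phi> t) = y2"
        using tE by (auto simp: mem_rect mem_open_rect)
      ultimately show False using Px by metis
    qed
    then obtain j where j: "\<phi> t \<in> Q j" using C(3) tC S_iff by blast
    have jE: "j \<in> meeting Q ?E" using j tE unfolding meeting_def by blast
    obtain q where q: "q \<in> frontier (Q j)" using frontier_Q_nonempty by blast
    have "ennreal \<bar>disk_sup H i - disk_sup H j\<bar> \<le> disk_sum (osc H) (meeting Q (\<phi> ` closed_segment s t))"
      by (rule diff[OF s(1) tC s(2) j])
    also have "\<dots> \<le> disk_sum (osc H) (meeting Q (\<phi> ` C) \<inter> meeting Q (cball y r1))"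
    proof (rule disk_sum_subset)
      have "\<phi> ` closed_segment s t \<subseteq> \<phi> ` C" using sub[OF tC] by blast
      moreover have "\<phi> ` closed_segment s t \<subseteq> cball y r1" using inR Re e(2) by fastforce
      ultimately show "meeting Q (\<phi> ` closed_segment s t) \<subseteq> meeting Q (\<phi> ` C) \<inter> meeting Q (cball y r1)"
        by (intro Int_greatest meeting_mono)
    qed
    also note r1(2)
    finally have ij: "\<bar>disk_sup H i - disk_sup H j\<bar> \<le> \<tau>" using \<tau> by simp
    have jq: "\<bar>disk_sup H j - H q\<bar> \<le> \<tau>" using disk_sup_near[OF H(2) q] small[OF jE] by linarith
    have qE: "H q \<in> hvals H ?E" using q jE unfolding hvals_def by blast
    have yR: "x1 < Re y" "Re y < x2" "y1 < Im y" "Im y < y2" using yV by (auto simp: mem_open_rect)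
    have x2b: "x2 \<le> b2"
    proof -
      have "Complex x2 (Im y) \<in> ?R" using yR by (simp add: mem_rect)
      then have "dist y (Complex x2 (Im y)) \<le> e" using Re by (simp add: subset_iff)
      moreover have "\<bar>Re (y - Complex x2 (Im y))\<bar> \<le> dist y (Complex x2 (Im y))"
        unfolding dist_norm by (rule abs_Re_le_cmod)
      ultimately show ?thesis using e(4) by simp
    qed
    let ?L = "?l ` {Re y..x2}"
    have LR: "?L \<subseteq> ?R"
      using yR by (auto simp: plane_line_def mem_rect)
    have Lb: "?L \<subseteq> ?l ` {b1..b2}" using b x2b by (intro image_mono) auto
    obtain x where x: "x \<in> hvals H ?E" "x \<in> hvals H ?L"
    proof -
      let ?z = "Complex x2 (Im y)"
      have "?z \<in> ?E" "?z \<in> ?L" "?z \<in> \<Omega>"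
        using yR R\<Omega> by (auto simp: mem_rect mem_open_rect plane_line_def)
      then show ?thesis using hvals_common[of ?z ?E ?L H] that by blast
    qed
    have yL: "H y \<in> hvals H ?L"
    proof -
      have "y = ?l (Re y)" by (simp add: plane_line_def)
      then have "y \<in> ?L \<inter> S" using yR yS by auto
      then show ?thesis unfolding hvals_def by blast
    qed
    have "\<bar>x - H y\<bar> \<le> 3 * \<tau>"
    proof (rule curve_hvals_close[OF _ _ osc_upper[OF H(2)] _ _ x(2) yL])
      have "continuous_on {Re y..x2} ?l" by (intro continuous_intros)
      then show "curve_in (Re y) x2 ?l" using Lb line yR by (auto simp: curve_in_def)
      show "curve_bound H (osc H) (Re y) x2 ?l" using cb b(1) x2b by (rule curve_bound_sub)
      have "?L \<subseteq> cball y r2" using LR Re e(3) by fastforce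
      then have "meeting Q ?L \<subseteq> meeting Q (?l ` {b1..b2}) \<inter> meeting Q (cball y r2)"
        using Lb by (intro Int_greatest meeting_mono)
      then show "disk_sum (osc H) (meeting Q ?L) \<le> ennreal \<tau>" using r2(2) by (rule order_trans[OF disk_sum_subset])
    qed (use \<tau> in auto)
    then show ?thesis using bd[OF qE x(1)] jq ij s(4) by linarith
  qed
  show ?thesis
  proof (rule ccontr)
    assume "a \<noteq> H y"
    then have "\<bar>a - H y\<bar> \<le> 18 * (\<bar>a - H y\<bar> / 36)" by (intro bound) simp
    then show False using \<open>a \<noteq> H y\<close> by simp
  qed
qed

end

subsection \<open>Non-negative minimizers\<close>

text \<open>Collects what the Harnack argument uses, in real-valued form, so that the cases of a
  maximum and of a minimum become two interpretations of the same locale.\<close>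

locale nonneg_harmonic = sierpinski_carpet +
  fixes v :: modulus_version and w :: "complex \<Rightarrow> real"
  assumes w_nonneg: "\<And>x. x \<in> S \<Longrightarrow> 0 \<le> w x"
    and w_bounded: "disk_bounded w"
    and w_loc: "loc_sq (osc w)"
    and w_curve: "ae_curve v (curve_bound w (osc w))"
    and w_min: "\<And>V \<zeta>. open V \<Longrightarrow> compactly_contained V \<Omega> \<Longrightarrow> test_function v V \<zeta> \<Longrightarrow>
       disk_sum (\<lambda>i. (osc w i)\<^sup>2) (meeting Q V) \<le> disk_sum (\<lambda>i. (osc (\<lambda>x. w x + \<zeta> x) i)\<^sup>2) (meeting Q V)"
begin

definition mx :: "nat \<Rightarrow> real" where "mx i = Sup (w ` frontier (Q i))"
definition mn :: "nat \<Rightarrow> real" where "mn i = Inf (w ` frontier (Q i))"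

lemma w_le_mx: "x \<in> frontier (Q i) \<Longrightarrow> w x \<le> mx i"
  unfolding mx_def using w_bounded
  by (intro cSup_upper) (auto simp: disk_bounded_def intro: bounded_imp_bdd_above)

lemma mn_le_w: "x \<in> frontier (Q i) \<Longrightarrow> mn i \<le> w x"
  unfolding mn_def using w_bounded
  by (intro cInf_lower) (auto simp: disk_bounded_def intro: bounded_imp_bdd_below)

lemma mn_nonneg: "0 \<le> mn i"
  unfolding mn_def using frontier_Q_nonempty[of i] w_nonneg[OF frontier_S]
  by (intro cInf_greatest) auto

lemma mn_le_mx: "mn i \<le> mx i"
proof -
  obtain x where "x \<in> frontier (Q i)" using frontier_Q_nonempty by blast
  then show ?thesis using w_le_mx mn_le_w order_trans by blast
qed

lemma mx_nonneg: "0 \<le> mx i"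
  using mn_nonneg mn_le_mx by (rule order_trans)

lemma osc_w: "osc w i = mx i - mn i"
  unfolding mx_def mn_def by (rule osc_eq[OF w_bounded])

text \<open>The competitor \<open>w + s * \<eta>\<^sup>2 / (w + \<delta>)\<close> for a cutoff \<open>\<eta>\<close> and \<open>s = \<delta>\<^sup>2 / 4\<close>.\<close>

lemma log_energy_bound:
  assumes K: "compact K" "K \<subseteq> \<Omega>"
  obtains C where "\<And>\<delta>. 0 < \<delta> \<Longrightarrow>
    disk_sum (\<lambda>i. (ln ((mx i + \<delta>) / (mn i + \<delta>)))\<^sup>2) (meeting Q K) \<le> ennreal C"
proof (cases "K = {}")
  case True
  then show ?thesis using that[of 0] by (simp add: meeting_def)
next
  case False
  obtain K' where K': "compact K'" "K' \<subseteq> \<Omega>" "K \<subseteq> K'" "\<And>i. i \<in> meeting Q K \<Longrightarrow> closure (Q i) \<subseteq> K'"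
    using compact_disk_hull[OF K] by blast
  obtain e where e: "0 < e" "(\<Union>x\<in>K'. cball x e) \<subseteq> \<Omega>" "compact (\<Union>x\<in>K'. cball x e)"
    using compact_neighbourhood[OF K'(1,2)] by blast
  have ne: "K' \<noteq> {}" using False K'(3) by blast
  \<comment> \<open>The cutoff \<eta> defined below is 1 on \<open>K'\<close>, hence on the
    boundaries of all disks meeting \<open>K\<close>, and vanishes off this neighbourhood;
    \<open>e * \<eta>\<close> is 1-Lipschitz.\<close>
  define V where "V = {z. infdist z K' < e}"
  have "open V" unfolding V_def by (intro open_Collect_less continuous_intros)
  have cV: "closure V \<subseteq> (\<Union>x\<in>K'. cball x e)"
  proof
    fix z assume "z \<in> closure V"
    moreover have "closed {z. infdist z K' \<le> e}" by (intro closed_Collect_le continuous_intros)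
    then have "closure V \<subseteq> {z. infdist z K' \<le> e}" by (intro closure_minimal) (auto simp: V_def)
    ultimately have z: "infdist z K' \<le> e" by blast
    obtain x where "x \<in> K'" "infdist z K' = dist z x"
      using infdist_attains_inf[OF compact_imp_closed[OF K'(1)] ne] by blast
    then show "z \<in> (\<Union>x\<in>K'. cball x e)" using z by (auto simp: dist_commute)
  qed
  have comp: "compact (closure V)" using cV e(3) by (metis closed_closure compact_Int_closed inf.absorb2)
  have V: "compactly_contained V \<Omega>" using comp cV e(2) by (auto simp: compactly_contained_def)
  have KV: "K' \<subseteq> V" using e(1) by (auto simp: V_def)
  define \<eta> where "\<eta> z = max 0 (1 - infdist z K' / e)" for z
  have \<eta>: "0 \<le> \<eta> z" "\<eta> z \<le> 1" for z using e(1) infdist_nonneg[of z K'] by (auto simp: \<eta>_def)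
  have \<eta>1: "\<eta> z = 1" if "z \<in> K'" for z using that by (simp add: \<eta>_def)
  have \<eta>0: "\<eta> z = 0" if "z \<notin> V" for z using that e(1) by (simp add: \<eta>_def V_def le_divide_eq)
  have \<eta>lip: "\<bar>e * \<eta> x - e * \<eta> y\<bar> \<le> dist x y" for x y
  proof -
    have "e * \<eta> z = max 0 (e - infdist z K')" for z using e(1) by (auto simp: \<eta>_def max_def field_simps)
    moreover have "\<bar>infdist x K' - infdist y K'\<bar> \<le> dist x y" by (rule infdist_triangle_abs)
    ultimately show ?thesis by (auto simp: max_def)
  qed
  have \<eta>diam: "\<bar>\<eta> x - \<eta> y\<bar> \<le> diameter (Q i) / e" if "x \<in> frontier (Q i)" "y \<in> frontier (Q i)" for x y i
  proof -
    have "dist x y \<le> diameter (closure (Q i))"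
      using that frontier_Q_closure compact_closure_Q by (intro diameter_bounded_bound compact_imp_bounded)
    then have "e * \<bar>\<eta> x - \<eta> y\<bar> \<le> diameter (Q i)"
      using \<eta>lip[of x y] diameter_closure[OF Q_props(3)[of i]] e(1)
      by (simp add: abs_mult right_diff_distrib[symmetric])
    then show ?thesis using e(1) by (simp add: le_divide_eq mult.commute)
  qed
  have "disk_sum (\<lambda>i. (diameter (Q i))\<^sup>2) (meeting Q (closure V)) < \<infinity>"
    by (rule disk_sum_diameter_finite[OF compact_imp_bounded[OF comp]])
  then obtain D where D: "disk_sum (\<lambda>i. (diameter (Q i))\<^sup>2) (meeting Q (closure V)) = ennreal D" "0 \<le> D"
    by (cases "disk_sum (\<lambda>i. (diameter (Q i))\<^sup>2) (meeting Q (closure V))") auto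
  have mV: "meeting Q V \<subseteq> meeting Q (closure V)" by (intro meeting_mono closure_subset)
  show ?thesis
  proof (rule that[of "4 * (18 / e\<^sup>2 * D)"])
    fix \<delta> :: real assume \<delta>: "0 < \<delta>"
    \<comment> \<open>The value is chosen for \<open>square_diff_add_weighted_inverse_le\<close>. It
      cancels at the end: gains and losses are both multiples of \<open>s\<close>, the 18 comes from
      that lemma and the 4 from \<open>ln_square_le\<close>.\<close>
    define s where "s = \<delta>\<^sup>2 / 4"
    have s: "0 < s" "s \<le> \<delta>\<^sup>2" using \<delta> by (auto simp: s_def)
    define \<zeta> where "\<zeta> x = s * (\<eta> x)\<^sup>2 / (w x + \<delta>)" for x
    have lip: "\<bar>\<zeta> x - \<zeta> y\<bar> \<le> 1/4 * \<bar>w x - w y\<bar> + \<delta> / (2 * e) * \<bar>e * \<eta> x - e * \<eta> y\<bar>" if "x \<in> S" "y \<in> S" for x y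
    proof -
      define A where "A = w x + \<delta>"
      define B where "B = w y + \<delta>"
      have AB: "\<delta> \<le> A" "\<delta> \<le> B" using w_nonneg that by (auto simp: A_def B_def)
      have pos: "0 < A" "0 < B" using AB \<delta> by auto
      have "\<zeta> x - \<zeta> y = s * (\<eta> x)\<^sup>2 * ((B - A) / (A * B)) + s / B * ((\<eta> x)\<^sup>2 - (\<eta> y)\<^sup>2)"
      proof -
        have "\<zeta> x = s * (\<eta> x)\<^sup>2 / A" "\<zeta> y = s * (\<eta> y)\<^sup>2 / B" by (simp_all add: \<zeta>_def A_def B_def)
        then show ?thesis using pos by (simp add: field_simps)
      qed
      then have "\<bar>\<zeta> x - \<zeta> y\<bar> \<le> \<bar>s * (\<eta> x)\<^sup>2 * ((B - A) / (A * B))\<bar> + \<bar>s / B * ((\<eta> x)\<^sup>2 - (\<eta> y)\<^sup>2)\<bar>"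
        by (metis abs_triangle_ineq)
      moreover have "\<bar>s * (\<eta> x)\<^sup>2 * ((B - A) / (A * B))\<bar> \<le> 1/4 * \<bar>w x - w y\<bar>"
      proof -
        have "\<delta> * \<delta> \<le> A * B" using AB \<delta> by (intro mult_mono) auto
        then have "s / (A * B) \<le> 1/4" using pos by (simp add: s_def power2_eq_square divide_le_eq)
        moreover have "(\<eta> x)\<^sup>2 \<le> 1" using \<eta> by (simp add: power_le_one)
        ultimately have "(\<eta> x)\<^sup>2 * (s / (A * B)) \<le> 1 * (1/4)" using s pos by (intro mult_mono) auto
        then have "(\<eta> x)\<^sup>2 * (s / (A * B)) * \<bar>B - A\<bar> \<le> 1/4 * \<bar>B - A\<bar>" by (intro mult_right_mono) auto
        moreover have "\<bar>s * (\<eta> x)\<^sup>2 * ((B - A) / (A * B))\<bar> = (\<eta> x)\<^sup>2 * (s / (A * B)) * \<bar>B - A\<bar>"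
          using s pos by (simp add: abs_mult)
        moreover have "\<bar>B - A\<bar> = \<bar>w x - w y\<bar>" by (simp add: A_def B_def abs_minus_commute)
        ultimately show ?thesis by simp
      qed
      moreover have "\<bar>s / B * ((\<eta> x)\<^sup>2 - (\<eta> y)\<^sup>2)\<bar> \<le> \<delta> / (2 * e) * \<bar>e * \<eta> x - e * \<eta> y\<bar>"
      proof -
        have "s / B \<le> \<delta> / 4" using AB pos \<delta> by (simp add: s_def power2_eq_square divide_le_eq)
        moreover have "\<bar>(\<eta> x)\<^sup>2 - (\<eta> y)\<^sup>2\<bar> \<le> 2 * \<bar>\<eta> x - \<eta> y\<bar>"
        proof -
          have "(\<eta> x)\<^sup>2 - (\<eta> y)\<^sup>2 = (\<eta> x + \<eta> y) * (\<eta> x - \<eta> y)" by (simp add: power2_eq_square algebra_simps)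
          then have "\<bar>(\<eta> x)\<^sup>2 - (\<eta> y)\<^sup>2\<bar> = (\<eta> x + \<eta> y) * \<bar>\<eta> x - \<eta> y\<bar>" using \<eta>[of x] \<eta>[of y] by (simp add: abs_mult)
          also have "\<dots> \<le> 2 * \<bar>\<eta> x - \<eta> y\<bar>" using \<eta>(2)[of x] \<eta>(2)[of y] by (intro mult_right_mono) auto
          finally show ?thesis .
        qed
        ultimately have "s / B * \<bar>(\<eta> x)\<^sup>2 - (\<eta> y)\<^sup>2\<bar> \<le> \<delta> / 4 * (2 * \<bar>\<eta> x - \<eta> y\<bar>)"
          using s pos \<delta> by (intro mult_mono) auto
        moreover have "\<bar>e * \<eta> x - e * \<eta> y\<bar> = e * \<bar>\<eta> x - \<eta> y\<bar>"
          using e(1) by (simp add: abs_mult right_diff_distrib[symmetric])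
        ultimately show ?thesis using s pos e(1) by (simp add: abs_mult)
      qed
      ultimately show ?thesis by linarith
    qed
    \<comment> \<open>The coefficients are those of \<open>lip\<close>; the factor
      \<open>1 *\<close> matches the shape of \<open>loc_sq_diameter\<close>.\<close>
    define \<rho> where "\<rho> i = 1/4 * osc w i + \<delta> / (2 * e) * (1 * diameter (Q i))" for i
    have "test_function v V \<zeta>"
      unfolding test_function_def
    proof (intro conjI exI[of _ "s / \<delta>"] exI[of _ \<rho>] ballI allI)
      fix x assume "x \<in> S - V"
      then show "\<zeta> x = 0" by (simp add: \<zeta>_def \<eta>0)
    next
      fix x assume x: "x \<in> S"
      have "s * (\<eta> x)\<^sup>2 / (w x + \<delta>) \<le> s * 1 / \<delta>"
        using s \<delta> w_nonneg[OF x] \<eta>[of x] by (intro frac_le mult_left_mono) (auto simp: power_le_one)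
      moreover have "0 \<le> s * (\<eta> x)\<^sup>2 / (w x + \<delta>)" using s \<delta> w_nonneg[OF x] by simp
      ultimately show "\<bar>\<zeta> x\<bar> \<le> s / \<delta>" unfolding \<zeta>_def by linarith
    next
      show "loc_sq \<rho>" unfolding \<rho>_def
        using \<delta> e(1) by (intro loc_sq_add[OF w_loc loc_sq_diameter]) auto
    next
      fix i x y assume xy: "x \<in> frontier (Q i)" "y \<in> frontier (Q i)"
      have "\<bar>e * \<eta> x - e * \<eta> y\<bar> \<le> diameter (Q i)"
        using \<eta>diam[OF xy] e(1) by (simp add: le_divide_eq abs_mult right_diff_distrib[symmetric] mult.commute)
      then have "\<delta> / (2 * e) * \<bar>e * \<eta> x - e * \<eta> y\<bar> \<le> \<delta> / (2 * e) * (1 * diameter (Q i))"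
        using \<delta> e(1) by (intro mult_left_mono) auto
      then show "\<bar>\<zeta> x - \<zeta> y\<bar> \<le> \<rho> i"
        unfolding \<rho>_def using osc_upper[OF w_bounded xy]
        by (intro order_trans[OF lip[OF frontier_S[OF xy(1)] frontier_S[OF xy(2)]] add_mono]) simp_all
    next
      show "ae_curve v (curve_bound \<zeta> \<rho>)"
        using ae_curve_conj[OF w_curve ae_curve_hausdorff_zero]
      proof (rule ae_curve_mono)
        fix a b \<phi> assume cv: "curve_in a b \<phi>" and *: "curve_bound w (osc w) a b \<phi> \<and> hausdorff 1 (\<phi> ` {a..b} \<inter> S) = 0"
        have cl: "curve_bound (\<lambda>z. e * \<eta> z) (\<lambda>i. diameter (Q i)) a b \<phi>"
          by (rule curve_bound_lipschitz[OF cv conjunct2[OF *] \<eta>lip])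
        show "curve_bound \<zeta> \<rho> a b \<phi>"
          unfolding \<rho>_def mult_1
          by (rule curve_bound_combination[OF conjunct1[OF *] cl _ _ osc_nonneg[OF w_bounded] less_imp_le[OF diameter_Q_pos] lip])
            (use \<delta> e(1) in auto)
      qed
    qed
    from w_min[OF \<open>open V\<close> V this]
    have min: "disk_sum (\<lambda>i. (osc w i)\<^sup>2) (meeting Q V) \<le> disk_sum (\<lambda>i. (osc (\<lambda>x. w x + \<zeta> x) i)\<^sup>2) (meeting Q V)" .
    define G where "G i = (mx i - mn i)\<^sup>2 / ((mx i + \<delta>) * (mn i + \<delta>))" for i
    have G0: "0 \<le> G i" for i using mn_nonneg[of i] mx_nonneg[of i] \<delta> by (simp add: G_def)
    define b where "b i = (osc (\<lambda>x. w x + \<zeta> x) i)\<^sup>2" for i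
    define c where "c i = (if i \<in> meeting Q K then s * G i else 0)" for i
    define E where "E i = (18 * s / e\<^sup>2) * (diameter (Q i))\<^sup>2" for i
    have zeta_bdd: "disk_bounded (\<lambda>x. w x + \<zeta> x)"
      unfolding disk_bounded_def bounded_iff
    proof (intro allI exI ballI)
      fix i z assume "z \<in> (\<lambda>x. w x + \<zeta> x) ` frontier (Q i)"
      then obtain x where x: "x \<in> frontier (Q i)" "z = w x + \<zeta> x" by blast
      have "s * (\<eta> x)\<^sup>2 / (w x + \<delta>) \<le> s * 1 / \<delta>"
        using s \<delta> w_nonneg[OF frontier_S[OF x(1)]] \<eta>[of x] by (intro frac_le mult_left_mono) (auto simp: power_le_one)
      moreover have "0 \<le> s * (\<eta> x)\<^sup>2 / (w x + \<delta>)" using s \<delta> w_nonneg[OF frontier_S[OF x(1)]] by simp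
      ultimately show "norm z \<le> mx i + s / \<delta>"
        using w_le_mx[OF x(1)] w_nonneg[OF frontier_S[OF x(1)]] unfolding x(2) \<zeta>_def real_norm_def by linarith
    qed
    \<comment> \<open>The inequality for a single disk: a disk meeting \<open>K\<close> has cutoff 1
      on its boundary and yields the gain \<open>c\<close>, any other disk loses at most
      \<open>E\<close>. Summation and minimality leave the gains bounded by the losses, since the
      energy of \<open>w\<close> over \<open>V\<close> is finite and cancels.\<close>
    have pt: "b i + c i \<le> (osc w i)\<^sup>2 + E i" for i
    proof (cases "i \<in> meeting Q K")
      case True
      define M where "M = mx i + \<delta>"
      define m where "m = mn i + \<delta>"
      have Mm: "\<delta> \<le> m" "m \<le> M" using mn_nonneg[of i] mn_le_mx[of i] by (auto simp: M_def m_def)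
      have pos: "0 < m" "0 < M" using Mm \<delta> by auto
      define \<theta> where "\<theta> = s / (M * m)"
      have th: "0 \<le> \<theta>" "\<theta> \<le> 1"
      proof -
        have "\<delta> * \<delta> \<le> M * m" using Mm \<delta> by (intro mult_mono) auto
        then have "s \<le> M * m" using s by (simp add: power2_eq_square)
        then show "0 \<le> \<theta>" "\<theta> \<le> 1" using s pos by (auto simp: \<theta>_def divide_le_eq)
      qed
      have "osc (\<lambda>x. w x + \<zeta> x) i \<le> (M - m) * (1 - \<theta>)"
      proof (rule osc_least)
        fix x y assume xy: "x \<in> frontier (Q i)" "y \<in> frontier (Q i)"
        have "\<eta> x = 1" "\<eta> y = 1" using K'(4)[OF True] xy frontier_Q_closure \<eta>1 by blast+
        then have "(w x + \<zeta> x) - (w y + \<zeta> y) = ((w x + \<delta>) + s / (w x + \<delta>)) - ((w y + \<delta>) + s / (w y + \<delta>))"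
          by (simp add: \<zeta>_def)
        also have "\<bar>\<dots>\<bar> \<le> (M - m) * (1 - s / (M * m))"
          using w_le_mx[OF xy(1)] w_le_mx[OF xy(2)] mn_le_w[OF xy(1)] mn_le_w[OF xy(2)] Mm \<delta> s
          by (intro abs_diff_add_inverse_le) (auto simp: M_def m_def)
        finally show "\<bar>(w x + \<zeta> x) - (w y + \<zeta> y)\<bar> \<le> (M - m) * (1 - \<theta>)" by (simp add: \<theta>_def)
      qed
      then have "b i \<le> ((M - m) * (1 - \<theta>))\<^sup>2"
        unfolding b_def using osc_nonneg[OF zeta_bdd] by (intro power_mono)
      also have "\<dots> \<le> (M - m)\<^sup>2 * (1 - \<theta>)"
      proof -
        have "(1 - \<theta>)\<^sup>2 \<le> (1 - \<theta>) * 1" unfolding power2_eq_square using th by (intro mult_left_mono) auto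
        then show ?thesis by (simp add: power_mult_distrib mult_left_mono)
      qed
      also have "\<dots> = (osc w i)\<^sup>2 - s * G i"
        by (simp add: osc_w G_def M_def m_def \<theta>_def algebra_simps)
      finally have "b i + c i \<le> (osc w i)\<^sup>2" using True by (simp add: c_def)
      moreover have "0 \<le> E i" using s by (simp add: E_def)
      ultimately show ?thesis by linarith
    next
      case False
      have "osc (\<lambda>x. w x + \<zeta> x) i \<le> sqrt ((osc w i)\<^sup>2 + E i)"
      proof (rule osc_least)
        fix x y assume xy: "x \<in> frontier (Q i)" "y \<in> frontier (Q i)"
        define A where "A = w x + \<delta>"
        define B where "B = w y + \<delta>"
        have AB: "\<delta> \<le> A" "\<delta> \<le> B" using w_nonneg frontier_S xy by (auto simp: A_def B_def)
        have "((A + s * (\<eta> x)\<^sup>2 / A) - (B + s * (\<eta> y)\<^sup>2 / B))\<^sup>2 \<le> (A - B)\<^sup>2 + 18 * s * (\<eta> x - \<eta> y)\<^sup>2"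
          unfolding s_def by (rule square_diff_add_weighted_inverse_le) (use \<delta> AB \<eta> in auto)
        also have "(A + s * (\<eta> x)\<^sup>2 / A) - (B + s * (\<eta> y)\<^sup>2 / B) = (w x + \<zeta> x) - (w y + \<zeta> y)"
          by (simp add: A_def B_def \<zeta>_def)
        also have "(A - B)\<^sup>2 \<le> (osc w i)\<^sup>2"
          using osc_upper[OF w_bounded xy] osc_nonneg[OF w_bounded, of i]
          by (simp add: A_def B_def flip: abs_le_square_iff)
        also have "18 * s * (\<eta> x - \<eta> y)\<^sup>2 \<le> 18 * s * (diameter (Q i) / e)\<^sup>2"
          using \<eta>diam[OF xy] s e(1) diameter_Q_pos[of i] by (intro mult_left_mono) (auto simp flip: abs_le_square_iff)
        also have "18 * s * (diameter (Q i) / e)\<^sup>2 = E i" by (simp add: E_def power_divide)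
        finally have "((w x + \<zeta> x) - (w y + \<zeta> y))\<^sup>2 \<le> (osc w i)\<^sup>2 + E i" by simp
        then show "\<bar>(w x + \<zeta> x) - (w y + \<zeta> y)\<bar> \<le> sqrt ((osc w i)\<^sup>2 + E i)"
          by (metis real_sqrt_abs real_sqrt_le_iff)
      qed
      then have "b i \<le> (sqrt ((osc w i)\<^sup>2 + E i))\<^sup>2"
        unfolding b_def using osc_nonneg[OF zeta_bdd] by (intro power_mono)
      also have "\<dots> = (osc w i)\<^sup>2 + E i" using s by (simp add: E_def)
      finally show ?thesis using False by (simp add: c_def)
    qed
    let ?J = "meeting Q V"
    have c0: "0 \<le> c i" for i using G0 s by (simp add: c_def)
    have E0: "0 \<le> E i" for i using s by (simp add: E_def)
    have fin: "disk_sum (\<lambda>i. (osc w i)\<^sup>2) ?J < \<infinity>"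
    proof (rule le_less_trans[OF disk_sum_subset[OF mV]])
      show "disk_sum (\<lambda>i. (osc w i)\<^sup>2) (meeting Q (closure V)) < \<infinity>"
        using w_loc comp cV e(2) by (simp add: loc_sq_def)
    qed
    have "disk_sum (\<lambda>i. (osc w i)\<^sup>2) ?J + disk_sum c ?J \<le> disk_sum b ?J + disk_sum c ?J"
      using min unfolding b_def by (rule add_right_mono)
    also have "\<dots> = disk_sum (\<lambda>i. b i + c i) ?J" using c0 by (intro disk_sum_add[symmetric]) (auto simp: b_def)
    also have "\<dots> \<le> disk_sum (\<lambda>i. (osc w i)\<^sup>2 + E i) ?J" using pt by (intro disk_sum_mono) auto
    also have "\<dots> = disk_sum (\<lambda>i. (osc w i)\<^sup>2) ?J + disk_sum E ?J" using E0 by (intro disk_sum_add) auto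
    finally have "disk_sum c ?J \<le> disk_sum E ?J"
      using fin by (auto simp: ennreal_add_left_cancel_le)
    also have "\<dots> \<le> disk_sum E (meeting Q (closure V))" by (rule disk_sum_subset[OF mV])
    also have "\<dots> = ennreal (18 * s / e\<^sup>2) * ennreal D"
      unfolding E_def D(1)[symmetric] using s by (intro disk_sum_cmult) auto
    also have "\<dots> = ennreal (18 * s / e\<^sup>2 * D)" using s D(2) by (intro ennreal_mult[symmetric]) auto
    finally have cD: "disk_sum c ?J \<le> ennreal (18 * s / e\<^sup>2 * D)" .
    have KJ: "meeting Q K \<subseteq> ?J" using K'(3) KV by (intro meeting_mono) blast
    have "disk_sum (\<lambda>i. (ln ((mx i + \<delta>) / (mn i + \<delta>)))\<^sup>2) (meeting Q K) \<le> disk_sum (\<lambda>i. 4 / s * c i) ?J"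
    proof (rule disk_sum_mono[OF _ KJ])
      fix i assume i: "i \<in> meeting Q K"
      define t where "t = (mx i + \<delta>) / (mn i + \<delta>)"
      have pos: "0 < mn i + \<delta>" "0 < mx i + \<delta>" using mn_nonneg[of i] mx_nonneg[of i] \<delta> by auto
      have "1 \<le> t" using mn_le_mx[of i] pos by (simp add: t_def)
      then have "(ln t)\<^sup>2 \<le> 4 * ((t - 1)\<^sup>2 / t)" by (rule ln_square_le)
      also have "(t - 1)\<^sup>2 / t = G i"
      proof -
        have "t - 1 = (mx i - mn i) / (mn i + \<delta>)" using pos by (simp add: t_def field_simps)
        then show ?thesis using pos by (simp add: G_def t_def power_divide power2_eq_square)
      qed
      also have "4 * G i = 4 / s * c i" using i s by (simp add: c_def)
      finally show "(ln ((mx i + \<delta>) / (mn i + \<delta>)))\<^sup>2 \<le> 4 / s * c i" by (simp add: t_def)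
    qed
    also have "\<dots> = ennreal (4 / s) * disk_sum c ?J" using s by (intro disk_sum_cmult) auto
    also have "\<dots> \<le> ennreal (4 / s) * ennreal (18 * s / e\<^sup>2 * D)" using cD by (intro mult_left_mono) auto
    also have "\<dots> = ennreal (4 * (18 / e\<^sup>2 * D))" using s D(2) by (simp add: ennreal_mult[symmetric])
    finally show "disk_sum (\<lambda>i. (ln ((mx i + \<delta>) / (mn i + \<delta>)))\<^sup>2) (meeting Q K) \<le> ennreal (4 * (18 / e\<^sup>2 * D))" .
  qed
qed

subsection \<open>Harnack inequality and minimum principle\<close>

abbreviation vals :: "complex set \<Rightarrow> real set" where
  "vals \<equiv> hvals w"

lemma vals_nonneg: "x \<in> vals A \<Longrightarrow> 0 \<le> x"
  using w_nonneg frontier_S by (auto simp: hvals_def)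

lemmas vals_frontier = hvals_frontier[where h = w]
lemmas vals_S = hvals_S[where h = w]

text \<open>The Lipschitz bound for the logarithm gives a gradient depending on \<delta>, and
  \<open>curve_bound_osc\<close> replaces it by the logarithmic oscillations. Their sum
  \<open>B\<close> then bounds differences of logarithms by \<open>3 * B\<close>, and exponentiation
  gives a ratio.\<close>

lemma curve_log_comparison:
  assumes cv: "curve_in a b \<phi>" and cb: "curve_bound w (osc w) a b \<phi>"
    and fin: "disk_sum (osc w) (meeting Q (\<phi> ` {a..b})) < \<infinity>" and \<delta>: "0 < \<delta>"
    and B: "disk_sum (\<lambda>i. ln ((mx i + \<delta>) / (mn i + \<delta>))) (meeting Q (\<phi> ` {a..b})) \<le> ennreal B" "0 \<le> B"
    and xy: "x \<in> vals (\<phi> ` {a..b})" "y \<in> vals (\<phi> ` {a..b})"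
  shows "x + \<delta> \<le> exp (3 * B) * (y + \<delta>)"
proof -
  let ?A = "\<phi> ` {a..b}"
  let ?J = "meeting Q ?A"
  define h where "h z = ln (w z + \<delta>)" for z
  define l where "l i = ln ((mx i + \<delta>) / (mn i + \<delta>))" for i
  have l: "l i = ln (mx i + \<delta>) - ln (mn i + \<delta>)" for i
    unfolding l_def using mn_nonneg[of i] mx_nonneg[of i] \<delta> by (subst ln_div) auto
  have lle: "l i \<le> 1 / \<delta> * osc w i" for i
    using abs_ln_diff_le[OF \<delta> mx_nonneg[of i] mn_nonneg[of i]] mn_le_mx[of i] by (simp add: l osc_w)
  have hosc: "\<bar>h x - h y\<bar> \<le> l i" if "x \<in> frontier (Q i)" "y \<in> frontier (Q i)" for x y i
  proof -
    have "ln (mn i + \<delta>) \<le> h z \<and> h z \<le> ln (mx i + \<delta>)" if z: "z \<in> frontier (Q i)" for z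
      unfolding h_def using mn_le_w[OF z] w_le_mx[OF z] mn_nonneg[of i] \<delta> by simp
    from this[OF that(1)] this[OF that(2)] show ?thesis unfolding l by (simp add: abs_le_iff)
  qed
  have "curve_bound h (\<lambda>i. 1 / \<delta> * osc w i + 0 * osc w i) a b \<phi>"
  proof (rule curve_bound_combination[OF cb cb])
    fix x y assume "x \<in> S" "y \<in> S"
    then show "\<bar>h x - h y\<bar> \<le> 1 / \<delta> * \<bar>w x - w y\<bar> + 0 * \<bar>w x - w y\<bar>"
      using abs_ln_diff_le[OF \<delta> w_nonneg[of x] w_nonneg[of y]] by (simp add: h_def)
  qed (use \<delta> osc_nonneg[OF w_bounded] in auto)
  then have cbh: "curve_bound h (\<lambda>i. 1 / \<delta> * osc w i) a b \<phi>" by simp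
  have finh: "disk_sum (\<lambda>i. 1 / \<delta> * osc w i) ?J < \<infinity>"
  proof -
    have "disk_sum (\<lambda>i. 1 / \<delta> * osc w i) ?J = ennreal (1 / \<delta>) * disk_sum (osc w) ?J"
      using \<delta> by (intro disk_sum_cmult) simp
    then show ?thesis using fin by (simp add: ennreal_mult_less_top)
  qed
  have cbl: "curve_bound h l a b \<phi>"
    by (rule curve_bound_osc[of a b \<phi> h "\<lambda>i. 1 / \<delta> * osc w i" l, OF cv cbh hosc lle finh])
  have sumB: "disk_sum l ?J \<le> ennreal B" using B(1) unfolding l_def .
  have hv: "ln (z + \<delta>) \<in> hvals h ?A" if "z \<in> vals ?A" for z
    using that by (auto simp: hvals_def h_def)
  have "\<bar>ln (x + \<delta>) - ln (y + \<delta>)\<bar> \<le> 3 * B"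
    by (rule curve_hvals_close[OF cv cbl hosc sumB B(2) hv[OF xy(1)] hv[OF xy(2)]])
  then have main: "ln (x + \<delta>) - ln (y + \<delta>) \<le> 3 * B" by linarith
  have pos: "0 < x + \<delta>" "0 < y + \<delta>" using vals_nonneg[OF xy(1)] vals_nonneg[OF xy(2)] \<delta> by auto
  have "ln (x + \<delta>) \<le> ln (exp (3 * B) * (y + \<delta>))" using main pos by (subst ln_mult) auto
  then show ?thesis using pos by simp
qed

text \<open>By Fatou's lemma the logarithmic oscillation along almost every line stays bounded for some \<open>\<delta> \<rightarrow> 0\<close>.\<close>

proposition harnack_line:
  assumes "a \<le> b" and sub: "(\<Union>c\<in>{c1..c2}. plane_line h c ` {a..b}) \<subseteq> \<Omega>"
  shows "AE c in lborel. c \<in> {c1..c2} \<longrightarrow>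
    (\<exists>B. \<forall>x\<in>vals (plane_line h c ` {a..b}). \<forall>y\<in>vals (plane_line h c ` {a..b}). x \<le> B * y)"
proof -
  define R where "R = (\<Union>c\<in>{c1..c2}. plane_line h c ` {a..b})"
  have "R = (\<lambda>p. plane_line h (fst p) (snd p)) ` ({c1..c2} \<times> {a..b})"
  proof (intro equalityI subsetI)
    fix z assume "z \<in> R"
    then obtain c t where "c \<in> {c1..c2}" "t \<in> {a..b}" "z = plane_line h c t" unfolding R_def by blast
    then show "z \<in> (\<lambda>p. plane_line h (fst p) (snd p)) ` ({c1..c2} \<times> {a..b})"
      by (intro image_eqI[of _ _ "(c, t)"]) auto
  next
    fix z assume "z \<in> (\<lambda>p. plane_line h (fst p) (snd p)) ` ({c1..c2} \<times> {a..b})"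
    then obtain p where "p \<in> {c1..c2} \<times> {a..b}" "z = plane_line h (fst p) (snd p)" by blast
    then show "z \<in> R" unfolding R_def by (intro UN_I[of "fst p"]) auto
  qed
  moreover have "compact \<dots>"
    by (intro compact_continuous_image compact_Times continuous_intros) auto
  ultimately have R: "compact R" "R \<subseteq> \<Omega>" using sub by (auto simp: R_def)
  obtain C where C: "\<And>\<delta>. 0 < \<delta> \<Longrightarrow> disk_sum (\<lambda>i. (ln ((mx i + \<delta>) / (mn i + \<delta>)))\<^sup>2) (meeting Q R) \<le> ennreal C"
    using log_energy_bound[OF R] by blast
  \<comment> \<open>A bound for all line averages at once: the product of logarithmic oscillation
    and diameter is at most the sum of their squares, and \<open>C\<close> serves every
    \<delta>.\<close>
  define T where "T = ennreal C + disk_sum (\<lambda>i. (diameter (Q i))\<^sup>2) (meeting Q R)"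
  have T: "T < \<infinity>" using disk_sum_diameter_finite[OF compact_imp_bounded[OF R(1)]] by (simp add: T_def)
  define \<delta> where "\<delta> n = 1 / real (Suc n)" for n
  have \<delta>: "0 < \<delta> n" for n by (simp add: \<delta>_def)
  define l where "l n i = ln ((mx i + \<delta> n) / (mn i + \<delta> n))" for n i
  have l0: "0 \<le> l n i" for n i
    unfolding l_def using mn_le_mx[of i] mn_nonneg[of i] \<delta>[of n] by (intro ln_ge_zero) simp
  let ?I = "{c1..c2}"
  define F where "F n c = disk_sum (l n) (meeting Q (plane_line h c ` {a..b})) * indicator ?I c" for n c
  have F [measurable]: "F n \<in> borel_measurable lborel" for n unfolding F_def by measurable
  have intF: "(\<integral>\<^sup>+c. F n c \<partial>lborel) \<le> T" for n
  proof -
    have "(\<integral>\<^sup>+c. F n c \<partial>lborel) \<le> disk_sum (\<lambda>i. l n i * diameter (Q i)) (meeting Q R)"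
      unfolding F_def by (rule nn_integral_disk_sum_line_le) (simp, unfold R_def, blast)
    also have "\<dots> \<le> disk_sum (\<lambda>i. (l n i)\<^sup>2 + (diameter (Q i))\<^sup>2) (meeting Q R)"
    proof (rule disk_sum_mono)
      fix i
      have "0 \<le> (l n i - diameter (Q i))\<^sup>2" by simp
      then have "2 * (l n i * diameter (Q i)) \<le> (l n i)\<^sup>2 + (diameter (Q i))\<^sup>2"
        by (simp add: power2_eq_square algebra_simps)
      moreover have "0 \<le> l n i * diameter (Q i)" using l0 diameter_Q_pos[of i] by simp
      ultimately show "l n i * diameter (Q i) \<le> (l n i)\<^sup>2 + (diameter (Q i))\<^sup>2" by linarith
    qed simp
    also have "\<dots> = disk_sum (\<lambda>i. (l n i)\<^sup>2) (meeting Q R) + disk_sum (\<lambda>i. (diameter (Q i))\<^sup>2) (meeting Q R)"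
      by (rule disk_sum_add) auto
    also have "\<dots> \<le> T" unfolding T_def l_def by (intro add_right_mono C \<delta>)
    finally show ?thesis .
  qed
  have "(\<integral>\<^sup>+c. liminf (\<lambda>n. F n c) \<partial>lborel) \<le> liminf (\<lambda>n. \<integral>\<^sup>+c. F n c \<partial>lborel)"
    by (rule nn_integral_liminf) (rule F)
  also have "\<dots> \<le> limsup (\<lambda>n. \<integral>\<^sup>+c. F n c \<partial>lborel)" by (intro Liminf_le_Limsup) simp
  also have "\<dots> \<le> T" using intF by (intro Limsup_bounded) auto
  finally have "(\<integral>\<^sup>+c. liminf (\<lambda>n. F n c) \<partial>lborel) \<noteq> \<infinity>" using T by auto
  then have "AE c in lborel. liminf (\<lambda>n. F n c) \<noteq> \<infinity>" by (intro nn_integral_PInf_AE) auto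
  moreover have "AE c in lborel. \<forall>a b. a \<le> b \<longrightarrow> plane_line h c ` {a..b} \<subseteq> \<Omega> \<longrightarrow>
      curve_bound w (osc w) a b (plane_line h c) \<and> disk_sum (osc w) (meeting Q (plane_line h c ` {a..b})) < \<infinity>"
    by (rule ae_curve_line[OF ae_curve_conj[OF w_curve ae_curve_finite_sum[OF w_loc]]])
  ultimately show ?thesis
  proof eventually_elim
    case (elim c)
    show ?case
    proof
      assume c: "c \<in> ?I"
      let ?A = "plane_line h c ` {a..b}"
      have subc: "?A \<subseteq> \<Omega>" using sub c by blast
      have cv: "curve_in a b (plane_line h c)"
        using subc assms(1) by (auto simp: curve_in_def intro!: continuous_intros)
      obtain B0 where B0: "liminf (\<lambda>n. F n c) = ennreal B0" "0 \<le> B0"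
        using elim(1) by (cases "liminf (\<lambda>n. F n c)") auto
      define B where "B = B0 + 1"
      \<comment> \<open>The margin 1 above the lower limit gives infinitely many \<open>n\<close>
        with logarithmic sum below \<open>B\<close>, so a strict violation of the Harnack
        inequality, which persists for all large \<open>n\<close>, is contradicted.\<close>
      have fr: "\<not> eventually (\<lambda>n. ennreal B \<le> F n c) sequentially"
      proof
        assume "eventually (\<lambda>n. ennreal B \<le> F n c) sequentially"
        then have "ennreal B \<le> liminf (\<lambda>n. F n c)" by (rule Liminf_bounded)
        then show False using B0 by (simp add: B_def)
      qed
      define E where "E = exp (3 * B)"
      have E1: "1 \<le> E" using B0(2) by (simp add: E_def B_def)
      have "x \<le> E * y" if xy: "x \<in> vals ?A" "y \<in> vals ?A" for x y
      proof (rule ccontr)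
        assume "\<not> x \<le> E * y"
        then have "E * y < x" by simp
        moreover have "(\<lambda>n. E * (y + \<delta> n)) \<longlonglongrightarrow> E * (y + 0)"
          unfolding \<delta>_def by (intro tendsto_intros LIMSEQ_Suc[OF lim_1_over_n])
        ultimately have ev: "eventually (\<lambda>n. E * (y + \<delta> n) < x) sequentially"
          by (intro order_tendstoD(2)) auto
        have "eventually (\<lambda>n. ennreal B \<le> F n c) sequentially"
          using ev
        proof eventually_elim
          case (elim n)
          show ?case
          proof (rule ccontr)
            assume "\<not> ennreal B \<le> F n c"
            then have "disk_sum (l n) (meeting Q ?A) \<le> ennreal B" using c by (simp add: F_def)
            then have "x + \<delta> n \<le> exp (3 * B) * (y + \<delta> n)"
              using \<open>\<forall>a b. a \<le> b \<longrightarrow> _ a b\<close> assms(1) subc B0(2) unfolding l_def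
              by (intro curve_log_comparison[OF cv _ _ \<delta> _ _ xy]) (auto simp: B_def)
            then show False using elim \<delta>[of n] by (simp add: E_def)
          qed
        qed
        then show False using fr by simp
      qed
      then show "\<exists>B. \<forall>x\<in>vals ?A. \<forall>y\<in>vals ?A. x \<le> B * y" by blast
    qed
  qed
qed

lemma harnack_zero:
  assumes "\<forall>x\<in>vals A. \<forall>y\<in>vals A. x \<le> B * y" "0 \<in> vals A" "x \<in> vals A"
  shows "x = 0"
  using assms vals_nonneg[OF assms(3)] by fastforce

definition zero_disk :: "nat \<Rightarrow> bool" where
  "zero_disk i \<longleftrightarrow> (\<forall>x\<in>frontier (Q i). w x = 0)"

text \<open>A generic vertical segment through \<open>Q i\<close> sees the value 0, so by Harnack it
  sees only 0. A generic horizontal segment through \<open>Q j\<close> crosses it and shares a value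
  with it, hence also sees only 0, and this includes the boundary of \<open>Q j\<close>.\<close>

lemma zero_disk_spread_rect:
  assumes R: "rect a1 b1 a2 b2 \<subseteq> \<Omega>" and i: "i \<in> meeting Q (open_rect a1 b1 a2 b2)"
    and x: "x \<in> frontier (Q i)" "w x = 0" and j: "j \<in> meeting Q (open_rect a1 b1 a2 b2)"
  shows "zero_disk j"
proof -
  obtain z where z: "z \<in> Q i" "z \<in> open_rect a1 b1 a2 b2" using i by (auto simp: meeting_def)
  obtain z' where z': "z' \<in> Q j" "z' \<in> open_rect a1 b1 a2 b2" using j by (auto simp: meeting_def)
  have le: "a1 \<le> b1" "a2 \<le> b2" using z by (auto simp: mem_open_rect)
  have "Re z \<in> line_hits False a2 b2 i \<inter> {a1<..<b1}"
    using z by (auto simp: line_hits_def mem_open_rect plane_line_def intro!: exI[of _ z] image_eqI[of _ _ "Im z"])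
  then have U: "open (line_hits False a2 b2 i \<inter> {a1<..<b1})" "line_hits False a2 b2 i \<inter> {a1<..<b1} \<noteq> {}"
    using open_line_hits by auto
  obtain c B where c: "c \<in> line_hits False a2 b2 i \<inter> {a1<..<b1}"
    and B: "\<forall>x\<in>vals (plane_line False c ` {a2..b2}). \<forall>y\<in>vals (plane_line False c ` {a2..b2}). x \<le> B * y"
    using AE_lborel_open_ex[OF harnack_line[OF le(2), of False a1 b1] U] R
    unfolding rect_lines(2)[symmetric] by auto
  let ?L = "plane_line False c ` {a2..b2}"
  have "i \<in> meeting Q ?L" using c by (simp add: mem_line_hits)
  then have "0 \<in> vals ?L" using vals_frontier[OF _ x(1), of ?L] x(2) by simp
  then have L0: "y = 0" if "y \<in> vals ?L" for y using harnack_zero[OF B] that by blast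
  have "Im z' \<in> line_hits True a1 b1 j \<inter> {a2<..<b2}"
    using z' by (auto simp: line_hits_def mem_open_rect plane_line_def intro!: exI[of _ z'] image_eqI[of _ _ "Re z'"])
  then have U': "open (line_hits True a1 b1 j \<inter> {a2<..<b2})" "line_hits True a1 b1 j \<inter> {a2<..<b2} \<noteq> {}"
    using open_line_hits by auto
  obtain d B' where d: "d \<in> line_hits True a1 b1 j \<inter> {a2<..<b2}"
    and B': "\<forall>x\<in>vals (plane_line True d ` {a1..b1}). \<forall>y\<in>vals (plane_line True d ` {a1..b1}). x \<le> B' * y"
    using AE_lborel_open_ex[OF harnack_line[OF le(1), of True a2 b2] U'] R
    unfolding rect_lines(1)[symmetric] by auto
  let ?L' = "plane_line True d ` {a1..b1}"
  have p: "Complex c d \<in> ?L" "Complex c d \<in> ?L'" using c d by (auto simp: plane_line_def)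
  then have "Complex c d \<in> \<Omega>" using R plane_line_in_rect(2)[of c a1 b1 a2 b2] c by auto
  then obtain y where "y \<in> vals {Complex c d}" using hvals_point_nonempty by blast
  then have y: "y \<in> vals ?L" "y \<in> vals ?L'" using hvals_mono[of "{Complex c d}" ?L] hvals_mono[of "{Complex c d}" ?L'] p by auto
  then have "0 \<in> vals ?L'" using L0 by force
  then have "y = 0" if "y \<in> vals ?L'" for y using harnack_zero[OF B'] that by blast
  moreover have "j \<in> meeting Q ?L'" using d by (simp add: mem_line_hits)
  ultimately show ?thesis using vals_frontier by (simp add: zero_disk_def)
qed

text \<open>\<open>Z\<close> collects the points near which all disks are zero disks. If a square
  around \<open>z\<close> inside \<Omega> meets \<open>Z\<close>, empty interior of the carpet
  provides a disk near that common point; it is a zero disk and spreads zero over the square. Hence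
  \<open>Z\<close> and its complement in the connected set \<Omega> are both open.\<close>

proposition zero_disk_spread:
  assumes x: "x \<in> frontier (Q i)" "w x = 0"
  shows "zero_disk j"
proof -
  have nhd: "z \<in> open_rect (Re z - r) (Re z + r) (Im z - r) (Im z + r)" if "0 < r" for z r
    using that by (auto simp: mem_open_rect)
  define Z where "Z = {z \<in> \<Omega>. \<exists>U. open U \<and> z \<in> U \<and> (\<forall>k\<in>meeting Q U. zero_disk k)}"
  have zi: "zero_disk i"
  proof -
    obtain z where z: "z \<in> Q i" using Q_props(4) by blast
    then have "z \<in> \<Omega>" using Q_props(5)[of i] in_Q_closure by blast
    then obtain r where r: "0 < r" "rect (Re z - r) (Re z + r) (Im z - r) (Im z + r) \<subseteq> \<Omega>" using rect_nhd by blast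
    have "i \<in> meeting Q (open_rect (Re z - r) (Re z + r) (Im z - r) (Im z + r))"
      using z nhd[OF r(1)] by (auto simp: meeting_def)
    then show ?thesis using zero_disk_spread_rect[OF r(2) _ x] by blast
  qed
  have openZ: "open Z"
  proof (subst open_subopen, intro ballI)
    fix z assume "z \<in> Z"
    then obtain U where U: "z \<in> \<Omega>" "open U" "z \<in> U" "\<forall>k\<in>meeting Q U. zero_disk k" unfolding Z_def by blast
    then have "U \<inter> \<Omega> \<subseteq> Z" unfolding Z_def by blast
    then show "\<exists>T. open T \<and> z \<in> T \<and> T \<subseteq> Z" using U open_Omega by (intro exI[of _ "U \<inter> \<Omega>"]) auto
  qed
  have openT: "open (\<Omega> - Z)"
  proof (subst open_subopen, intro ballI)
    fix z assume z: "z \<in> \<Omega> - Z"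
    then obtain r where r: "0 < r" "rect (Re z - r) (Re z + r) (Im z - r) (Im z + r) \<subseteq> \<Omega>" using rect_nhd by blast
    let ?V = "open_rect (Re z - r) (Re z + r) (Im z - r) (Im z + r)"
    have "?V \<inter> Z = {}"
    proof (rule ccontr)
      assume "?V \<inter> Z \<noteq> {}"
      then obtain z' U where z': "z' \<in> ?V" "z' \<in> \<Omega>" "open U" "z' \<in> U" "\<forall>k\<in>meeting Q U. zero_disk k" unfolding Z_def by blast
      have "open (U \<inter> ?V)" "(U \<inter> ?V) \<inter> \<Omega> \<noteq> {}" using z' open_rect_props(1) by auto
      then obtain k where k: "Q k \<inter> (U \<inter> ?V) \<noteq> {}" using S_disk_near by blast
      then have "zero_disk k" and kV: "k \<in> meeting Q ?V" using z'(5) by (auto simp: meeting_def)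
      obtain y where y: "y \<in> frontier (Q k)" using frontier_Q_nonempty by blast
      then have wy: "w y = 0" using \<open>zero_disk k\<close> by (simp add: zero_disk_def)
      have "zero_disk j" if "j \<in> meeting Q ?V" for j
        by (rule zero_disk_spread_rect[OF r(2) kV y wy that])
      then have "z \<in> Z" using z nhd[OF r(1), of z] open_rect_props(1) unfolding Z_def
        by (intro CollectI conjI exI[of _ ?V] ballI) simp_all
      then show False using z by simp
    qed
    then show "\<exists>T. open T \<and> z \<in> T \<and> T \<subseteq> \<Omega> - Z"
      using nhd[OF r(1)] open_rect_props(1,3) r(2) by (intro exI[of _ ?V]) blast
  qed
  have disk: "z \<in> Z \<longleftrightarrow> zero_disk k" if "z \<in> Q k" for z k
  proof
    assume "z \<in> Z"
    then obtain U where "z \<in> U" "\<forall>k\<in>meeting Q U. zero_disk k" unfolding Z_def by blast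
    then show "zero_disk k" using that by (auto simp: meeting_def)
  next
    assume zk: "zero_disk k"
    have "zero_disk l" if "l \<in> meeting Q (Q k)" for l
    proof -
      have "l = k" using that disjoint_Q[of l k] unfolding meeting_def by blast
      then show ?thesis using zk by simp
    qed
    moreover have "z \<in> \<Omega>" using Q_props(5)[of k] in_Q_closure[OF that] by blast
    ultimately show "z \<in> Z" unfolding Z_def using that Q_props(1)[of k] by (intro CollectI conjI exI[of _ "Q k"] ballI)
  qed
  obtain p where p: "p \<in> Q i" using Q_props(4) by blast
  then have "p \<in> Z \<inter> \<Omega>" using disk zi by (auto simp: Z_def)
  then have "(\<Omega> - Z) \<inter> \<Omega> = {}"
    using connectedD[OF connected_Omega openZ openT] by blast
  moreover obtain q where q: "q \<in> Q j" using Q_props(4) by blast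
  then have "q \<in> \<Omega>" using Q_props(5)[of j] in_Q_closure by blast
  ultimately show ?thesis using disk[OF q] by blast
qed

text \<open>Truncation from below at \<epsilon> is a competitor that increases no oscillation, so
  minimality forces equality on each disk. Truncation can then change \<open>w\<close> only on disks
  where \<open>w\<close> is constant, which makes the correction \<zeta> constant on every disk
  boundary and hence zero along generic segments starting at the sides.\<close>

lemma weak_min_principle:
  assumes R: "rect a1 b1 a2 b2 \<subseteq> \<Omega>"
    and bd: "\<And>x. x \<in> vals (rect a1 b1 a2 b2 - open_rect a1 b1 a2 b2) \<Longrightarrow> \<epsilon> \<le> x"
    and i: "i \<in> meeting Q (open_rect a1 b1 a2 b2)" and x: "x \<in> frontier (Q i)" and \<epsilon>: "0 < \<epsilon>"
  shows "\<epsilon> \<le> w x"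
proof -
  let ?K = "rect a1 b1 a2 b2" and ?V = "open_rect a1 b1 a2 b2"
  let ?E = "?K - ?V"
  \<comment> \<open>The closed rectangle is used because the boundary of a disk inside the open one
    may touch the sides. On boundaries of disks crossing the sides \<zeta> vanishes, as
    \<open>w \<ge> \<epsilon>\<close> there.\<close>
  define \<zeta> where "\<zeta> z = (if z \<in> ?K then max 0 (\<epsilon> - w z) else 0)" for z
  have V: "open ?V" "compactly_contained ?V \<Omega>"
  proof -
    have "closure ?V \<subseteq> ?K" by (intro closure_minimal compact_imp_closed open_rect_props)
    then show "compactly_contained ?V \<Omega>"
      using R open_rect_props(2) unfolding compactly_contained_def
      by (metis closed_closure compact_Int_closed inf.absorb2 order_trans)
  qed (rule open_rect_props(1))
  have E0: "\<zeta> z = 0" if "z \<in> S" "z \<notin> ?V" for z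
    using bd[OF vals_S[of z ?E]] that by (auto simp: \<zeta>_def)
  have cross0: "\<zeta> z = 0" if "k \<in> meeting Q ?E" "z \<in> frontier (Q k)" for k z
    using bd[OF vals_frontier[OF that]] by (auto simp: \<zeta>_def)
  have inV: "\<zeta> z = max 0 (\<epsilon> - w z)" if "z \<in> ?V" for z
    using subsetD[OF open_rect_props(3) that] by (simp add: \<zeta>_def)
  have dich: "Q k \<subseteq> ?V \<or> Q k \<inter> ?V = {}" if "k \<notin> meeting Q ?E" for k
    using connected_meets_rect_boundary[OF Q_props(2)[of k], of a1 b1 a2 b2] that by (auto simp: meeting_def)
  have inK: "\<zeta> z = max 0 (\<epsilon> - w z)" if "Q k \<subseteq> ?V" "z \<in> frontier (Q k)" for k z
  proof -
    have "closure (Q k) \<subseteq> ?K"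
      by (intro closure_minimal compact_imp_closed open_rect_props(2) order_trans[OF that(1) open_rect_props(3)])
    then show ?thesis using frontier_Q_closure[OF that(2)] by (auto simp: \<zeta>_def)
  qed
  have out0: "\<zeta> z = 0" if "Q k \<inter> ?V = {}" "z \<in> frontier (Q k)" for k z
    using frontier_disjoint_open[OF V(1), of k z] that E0[OF frontier_S[OF that(2)]] by (auto simp: meeting_def)
  have lip1: "\<bar>max 0 (\<epsilon> - p) - max 0 (\<epsilon> - q)\<bar> \<le> \<bar>p - q\<bar>" for p q :: real by (auto simp: max_def)
  have zosc: "\<bar>\<zeta> y - \<zeta> z\<bar> \<le> osc w k" if "y \<in> frontier (Q k)" "z \<in> frontier (Q k)" for k y z
  proof -
    consider "k \<in> meeting Q ?E" | "Q k \<subseteq> ?V" | "Q k \<inter> ?V = {}" using dich by blast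
    then show ?thesis
    proof cases
      case 1
      then show ?thesis using cross0 that osc_nonneg[OF w_bounded] by simp
    next
      case 2
      show ?thesis using inK[OF 2 that(1)] inK[OF 2 that(2)] lip1[of "w y" "w z"] osc_upper[OF w_bounded that] by linarith
    next
      case 3
      then show ?thesis using out0 that osc_nonneg[OF w_bounded] by simp
    qed
  qed
  have zcurve: "curve_bound \<zeta> (osc w) a b \<phi>" if cv: "curve_in a b \<phi>" and cb: "curve_bound w (osc w) a b \<phi>" for a b \<phi>
    unfolding curve_bound_def
  proof (intro allI impI)
    fix s t assume st: "a \<le> s" "s \<le> t" "t \<le> b" "\<phi> s \<in> S" "\<phi> t \<in> S"
    let ?sum = "disk_sum (osc w) (meeting Q (\<phi> ` {s..t}))"
    have cvst: "curve_in s t \<phi>" by (rule curve_in_sub[OF cv st(1-3)])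
    have wst: "ennreal \<bar>w (\<phi> p) - w (\<phi> q)\<bar> \<le> ?sum"
      if "s \<le> p" "p \<le> q" "q \<le> t" "\<phi> p \<in> S" "\<phi> q \<in> S" for p q
    proof -
      have "ennreal \<bar>w (\<phi> p) - w (\<phi> q)\<bar> \<le> disk_sum (osc w) (meeting Q (\<phi> ` {p..q}))"
        using that st by (intro curve_boundD[OF cb]) auto
      also have "\<dots> \<le> ?sum" using that by (intro disk_sum_subset meeting_mono image_mono) auto
      finally show ?thesis .
    qed
    \<comment> \<open>Crossing the sides inside a disk gives no value of \<open>w\<close>, but the
      curve must enter that disk through its boundary, where the lower bound \<epsilon> is known as
      well.\<close>
    have mid: "\<exists>r\<in>{s..t}. \<phi> r \<in> S \<and> \<epsilon> \<le> w (\<phi> r)" if "\<phi> s \<in> ?V \<or> \<phi> t \<in> ?V" "\<phi> s \<notin> ?V \<or> \<phi> t \<notin> ?V"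
    proof -
      have con: "connected (\<phi> ` {s..r})" if "r \<le> t" for r
        using cvst that by (intro connected_continuous_image) (auto simp: curve_in_def intro: continuous_on_subset)
      have "\<phi> s \<in> \<phi> ` {s..t}" "\<phi> t \<in> \<phi> ` {s..t}" using st(2) by auto
      then have "\<phi> ` {s..t} \<inter> ?V \<noteq> {}" "\<phi> ` {s..t} - ?V \<noteq> {}"
        using \<open>\<phi> s \<in> ?V \<or> \<phi> t \<in> ?V\<close> \<open>\<phi> s \<notin> ?V \<or> \<phi> t \<notin> ?V\<close> by blast+
      then obtain r where r: "r \<in> {s..t}" "\<phi> r \<in> ?E"
        using connected_meets_rect_boundary[OF con[of t]] by blast
      show ?thesis
      proof (cases "\<phi> r \<in> S")
        case True
        then show ?thesis using bd[OF vals_S[OF r(2)]] r(1) by blast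
      next
        case False
        moreover have "\<phi> r \<in> \<Omega>" using cvst r(1) by (auto simp: curve_in_def)
        ultimately obtain k where k: "\<phi> r \<in> Q k" by (auto simp: S_iff)
        have kE: "k \<in> meeting Q ?E" using k r(2) by (auto simp: meeting_def)
        have "\<phi> s \<notin> Q k" using st(4) by (auto simp: S_iff)
        moreover have "\<phi> s \<in> \<phi> ` {s..r}" "\<phi> r \<in> \<phi> ` {s..r}" using r(1) by auto
        ultimately have "\<phi> ` {s..r} \<inter> Q k \<noteq> {}" "\<phi> ` {s..r} - Q k \<noteq> {}" using k by blast+
        moreover have "connected (\<phi> ` {s..r})" using r(1) by (intro con) simp
        ultimately have "\<phi> ` {s..r} \<inter> frontier (Q k) \<noteq> {}" by (intro connected_meets_frontier)
        then obtain r' where r': "r' \<in> {s..r}" "\<phi> r' \<in> frontier (Q k)" by blast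
        then have "\<phi> r' \<in> S" "\<epsilon> \<le> w (\<phi> r')" using frontier_S bd[OF vals_frontier[OF kE]] by auto
        then show ?thesis using r' r(1) by (intro bexI[of _ r']) auto
      qed
    qed
    show "ennreal \<bar>\<zeta> (\<phi> s) - \<zeta> (\<phi> t)\<bar> \<le> ?sum"
    proof (cases "\<phi> s \<in> ?V \<longleftrightarrow> \<phi> t \<in> ?V")
      case True
      have "\<bar>\<zeta> (\<phi> s) - \<zeta> (\<phi> t)\<bar> \<le> \<bar>w (\<phi> s) - w (\<phi> t)\<bar>"
        using True inV lip1 E0[OF st(4)] E0[OF st(5)] by (cases "\<phi> s \<in> ?V") auto
      then show ?thesis using st by (intro order_trans[OF ennreal_leI wst[of s t]]) auto
    next
      case False
      then obtain r where r: "r \<in> {s..t}" "\<phi> r \<in> S" "\<epsilon> \<le> w (\<phi> r)" using mid by blast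
      show ?thesis
      proof (cases "\<phi> s \<in> ?V")
        case True
        then have "\<bar>\<zeta> (\<phi> s) - \<zeta> (\<phi> t)\<bar> \<le> \<bar>w (\<phi> s) - w (\<phi> r)\<bar>"
          using False inV E0[OF st(5)] r(3) by (auto simp: max_def)
        then show ?thesis using st r by (intro order_trans[OF ennreal_leI wst[of s r]]) auto
      next
        case sV: False
        then have "\<bar>\<zeta> (\<phi> s) - \<zeta> (\<phi> t)\<bar> \<le> \<bar>w (\<phi> r) - w (\<phi> t)\<bar>"
          using False inV E0[OF st(4)] r(3) by (auto simp: max_def)
        then show ?thesis using st r by (intro order_trans[OF ennreal_leI wst[of r t]]) auto
      qed
    qed
  qed
  have zae: "ae_curve v (curve_bound \<zeta> (osc w))" using w_curve zcurve by (rule ae_curve_mono)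
  have zb: "\<bar>\<zeta> z\<bar> \<le> \<epsilon>" if "z \<in> S" for z using w_nonneg[OF that] \<epsilon> by (auto simp: \<zeta>_def max_def)
  have test: "test_function v ?V \<zeta>"
    unfolding test_function_def
    by (intro conjI exI[of _ \<epsilon>] exI[of _ "osc w"] ballI allI w_loc zae) (use E0 zb zosc in auto)
  define g where "g z = w z + \<zeta> z" for z
  have gb: "disk_bounded g"
    unfolding disk_bounded_def bounded_iff
  proof (intro allI exI ballI)
    fix k y assume "y \<in> g ` frontier (Q k)"
    then obtain z where z: "z \<in> frontier (Q k)" "y = w z + \<zeta> z" by (auto simp: g_def)
    show "norm y \<le> mx k + \<epsilon>"
      using w_le_mx[OF z(1)] w_nonneg[OF frontier_S[OF z(1)]] zb[OF frontier_S[OF z(1)]] z(2) by (simp add: abs_le_iff)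
  qed
  have gin: "g z = max \<epsilon> (w z)" if "Q k \<subseteq> ?V" "z \<in> frontier (Q k)" for k z
    using inK[OF that] by (simp add: g_def max_def)
  have g0: "osc g k \<le> osc w k" if k: "k \<in> meeting Q ?V" for k
  proof (rule osc_least)
    fix y z assume yz: "y \<in> frontier (Q k)" "z \<in> frontier (Q k)"
    show "\<bar>g y - g z\<bar> \<le> osc w k"
    proof (cases "k \<in> meeting Q ?E")
      case True
      then show ?thesis using cross0 yz osc_upper[OF w_bounded yz] by (simp add: g_def)
    next
      case False
      then have "Q k \<subseteq> ?V" using dich k by (auto simp: meeting_def)
      then have "\<bar>g y - g z\<bar> \<le> \<bar>w y - w z\<bar>" using gin yz by (auto simp: max_def)
      then show ?thesis using osc_upper[OF w_bounded yz] by linarith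
    qed
  qed
  let ?J = "meeting Q ?V"
  have min: "disk_sum (\<lambda>k. (osc w k)\<^sup>2) ?J \<le> disk_sum (\<lambda>k. (osc g k)\<^sup>2) ?J"
    unfolding g_def by (rule w_min[OF V test])
  have fin: "disk_sum (\<lambda>k. (osc w k)\<^sup>2) ?J < \<infinity>"
  proof (rule le_less_trans[OF disk_sum_subset[OF meeting_mono[OF open_rect_props(3)]]])
    show "disk_sum (\<lambda>k. (osc w k)\<^sup>2) (meeting Q ?K) < \<infinity>"
      using w_loc R open_rect_props(2) by (simp add: loc_sq_def)
  qed
  \<comment> \<open>All other terms are at most those of \<open>w\<close> and have finite sum, so
    they can be cancelled from the inequality between the energies.\<close>
  have eq: "osc g k = osc w k" if k: "k \<in> ?J" for k
  proof -
    have J: "?J = insert k (?J - {k})" using k by blast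
    let ?r = "disk_sum (\<lambda>k. (osc w k)\<^sup>2) (?J - {k})"
    have "ennreal ((osc w k)\<^sup>2) + ?r \<le> ennreal ((osc g k)\<^sup>2) + disk_sum (\<lambda>k. (osc g k)\<^sup>2) (?J - {k})"
      using min disk_sum_insert[of k "?J - {k}"] J by (metis Diff_iff insertI1)
    also have "\<dots> \<le> ennreal ((osc g k)\<^sup>2) + ?r"
      using g0 osc_nonneg[OF gb] by (intro add_left_mono disk_sum_mono power_mono) auto
    finally have "?r + ennreal ((osc w k)\<^sup>2) \<le> ?r + ennreal ((osc g k)\<^sup>2)" by (simp add: add.commute)
    moreover have "?r < \<infinity>" by (rule le_less_trans[OF disk_sum_subset fin]) blast
    ultimately have "(osc w k)\<^sup>2 \<le> (osc g k)\<^sup>2" by (auto simp: ennreal_add_left_cancel_le)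
    then have "osc w k \<le> osc g k" using osc_nonneg[OF gb] by (rule power2_le_imp_le)
    then show ?thesis using g0[OF k] by simp
  qed
  \<comment> \<open>Equality of oscillations would force \<open>mn k \<ge> \<epsilon>\<close> if
    \<open>mx k\<close> were at least \<epsilon>. Otherwise the truncated function is constant on
    the boundary, and then so is \<open>w\<close>.\<close>
  have low: "mx k < \<epsilon> \<and> mx k = mn k" if k: "k \<in> ?J" "k \<notin> meeting Q ?E" "mn k < \<epsilon>" for k
  proof -
    have kV: "Q k \<subseteq> ?V" using dich[OF k(2)] k(1) by (auto simp: meeting_def)
    have "osc g k \<le> max \<epsilon> (mx k) - \<epsilon>"
    proof (rule osc_least)
      fix y z assume yz: "y \<in> frontier (Q k)" "z \<in> frontier (Q k)"
      have "\<epsilon> \<le> g u \<and> g u \<le> max \<epsilon> (mx k)" if "u \<in> frontier (Q k)" for u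
        using gin[OF kV that] w_le_mx[OF that] by auto
      from this[OF yz(1)] this[OF yz(2)] show "\<bar>g y - g z\<bar> \<le> max \<epsilon> (mx k) - \<epsilon>" by (simp add: abs_le_iff)
    qed
    then have "mx k - mn k \<le> max \<epsilon> (mx k) - \<epsilon>" using eq[OF k(1)] by (simp add: osc_w)
    then show ?thesis using k(3) mn_le_mx[of k] by (auto simp: max_def split: if_splits)
  qed
  have z0: "osc \<zeta> k \<le> 0" for k
  proof (rule osc_least)
    fix y z assume yz: "y \<in> frontier (Q k)" "z \<in> frontier (Q k)"
    consider "k \<in> meeting Q ?E" | "k \<notin> meeting Q ?E" "Q k \<subseteq> ?V" | "Q k \<inter> ?V = {}" using dich by blast
    then show "\<bar>\<zeta> y - \<zeta> z\<bar> \<le> 0"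
    proof cases
      case 1
      then show ?thesis using cross0 yz by simp
    next
      case 2
      have kJ: "k \<in> ?J" using 2(2) Q_props(4)[of k] by (auto simp: meeting_def)
      show ?thesis
      proof (cases "mn k < \<epsilon>")
        case True
        have "w y = w z" using low[OF kJ 2(1) True] w_le_mx[OF yz(1)] w_le_mx[OF yz(2)] mn_le_w[OF yz(1)] mn_le_w[OF yz(2)] by linarith
        then show ?thesis using inK[OF 2(2)] yz by simp
      next
        case False
        then have "\<epsilon> \<le> w y" "\<epsilon> \<le> w z" using mn_le_w[OF yz(1)] mn_le_w[OF yz(2)] by linarith+
        then show ?thesis using inK[OF 2(2)] yz by simp
      qed
    next
      case 3
      then show ?thesis using out0 yz by simp
    qed
  qed
  show ?thesis
  proof (cases "i \<in> meeting Q ?E")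
    case True
    then show ?thesis using bd vals_frontier x by blast
  next
    case False
    have iV: "Q i \<subseteq> ?V" using dich[OF False] i by (auto simp: meeting_def)
    show ?thesis
    proof (cases "mn i < \<epsilon>")
      case F: False
      then show ?thesis using mn_le_w[OF x] by linarith
    next
      case True
      obtain z where z: "z \<in> Q i" "z \<in> ?V" using i by (auto simp: meeting_def)
      have le: "a1 \<le> b1" "a2 \<le> b2" using z by (auto simp: mem_open_rect)
      have "Re z \<in> line_hits False a2 b2 i \<inter> {a1<..<b1}"
        using z by (auto simp: line_hits_def mem_open_rect plane_line_def intro!: exI[of _ z] image_eqI[of _ _ "Im z"])
      then have U: "open (line_hits False a2 b2 i \<inter> {a1<..<b1})" "line_hits False a2 b2 i \<inter> {a1<..<b1} \<noteq> {}"
        using open_line_hits by auto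
      have zb': "disk_bounded \<zeta>" by (rule test_function_sobolev(2)[OF V test])
      \<comment> \<open>A vertical segment that meets \<open>Q i\<close> and along which \<zeta> is
        controlled by its own oscillations, all of which are zero. It starts on the lower side,
        where \<zeta> or its value on a crossing disk is zero.\<close>
      obtain c where c: "c \<in> line_hits False a2 b2 i \<inter> {a1<..<b1}"
        and P: "\<And>a b. a \<le> b \<Longrightarrow> plane_line False c ` {a..b} \<subseteq> \<Omega> \<Longrightarrow> curve_bound \<zeta> (osc \<zeta>) a b (plane_line False c)"
        using AE_lborel_open_ex[OF ae_curve_line[OF ae_curve_bound_osc[OF w_loc zosc zb' zae], of False] U] by blast
      let ?L = "plane_line False c ` {a2..b2}"
      have LK: "?L \<subseteq> ?K" using c by (intro plane_line_in_rect) auto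
      have cb: "curve_bound \<zeta> (osc \<zeta>) a2 b2 (plane_line False c)" using P[OF le(2)] LK R by blast
      have con: "connected (plane_line False c ` {a2..t})" for t
        by (intro connected_continuous_image continuous_intros) auto
      have e: "plane_line False c a2 \<in> ?E" using c le by (auto simp: mem_rect mem_open_rect plane_line_def)
      moreover have "plane_line False c a2 \<in> ?L" using le by simp
      ultimately have "?L - Q i \<noteq> {}" using iV by blast
      moreover have "?L \<inter> Q i \<noteq> {}" using c by (auto simp: line_hits_def)
      ultimately obtain t where t: "t \<in> {a2..b2}" "plane_line False c t \<in> frontier (Q i)"
        using connected_meets_frontier[OF con[of b2], of i] by blast
      have "\<exists>r\<in>{a2..t}. plane_line False c r \<in> S \<and> \<zeta> (plane_line False c r) = 0"
      proof (cases "plane_line False c a2 \<in> S")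
        case True
        then show ?thesis using E0[OF True] e t(1) by (intro bexI[of _ a2]) auto
      next
        case nS: False
        have "plane_line False c a2 \<in> \<Omega>" using e R by blast
        with nS obtain k where k: "plane_line False c a2 \<in> Q k" by (auto simp: S_iff)
        have kE: "k \<in> meeting Q ?E" using k e by (auto simp: meeting_def)
        have "plane_line False c t \<notin> Q k" using frontier_S[OF t(2)] by (auto simp: S_iff)
        moreover have "plane_line False c a2 \<in> plane_line False c ` {a2..t}" "plane_line False c t \<in> plane_line False c ` {a2..t}"
          using t(1) by auto
        ultimately have "plane_line False c ` {a2..t} \<inter> Q k \<noteq> {}" "plane_line False c ` {a2..t} - Q k \<noteq> {}" using k by blast+
        then obtain r where "r \<in> {a2..t}" "plane_line False c r \<in> frontier (Q k)"
          using connected_meets_frontier[OF con[of t], of k] by blast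
        then show ?thesis using cross0[OF kE] frontier_S by blast
      qed
      then obtain r where r: "r \<in> {a2..t}" "plane_line False c r \<in> S" "\<zeta> (plane_line False c r) = 0" by blast
      have "ennreal \<bar>\<zeta> (plane_line False c r) - \<zeta> (plane_line False c t)\<bar> \<le> disk_sum (osc \<zeta>) (meeting Q (plane_line False c ` {r..t}))"
        using r t frontier_S[OF t(2)] by (intro curve_boundD[OF cb]) auto
      also have "\<dots> \<le> disk_sum (\<lambda>_. 0) UNIV" by (rule disk_sum_mono[OF z0]) simp
      also have "\<dots> = 0" by (simp add: disk_sum_def)
      finally have "\<zeta> (plane_line False c t) = 0" using r(3) by (simp add: ennreal_eq_0_iff)
      then have "\<epsilon> \<le> w (plane_line False c t)" using inK[OF iV t(2)] by (simp add: max_def split: if_splits)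
      then show ?thesis using low[OF i False True] w_le_mx[OF t(2)] by linarith
    qed
  qed
qed

text \<open>The rectangle and its Harnack constants are fixed before the smallness \<open>e\<close>,
  so letting \<open>e\<close> tend to 0 turns the comparison of values into vanishing. The left side
  is moreover chosen to hit a disk \<open>Q k\<close>, which turns vanishing on that side into a
  zero disk.\<close>

lemma near_zero_disk:
  assumes x0: "x0 \<in> \<Omega>"
    and near: "\<And>e r. 0 < e \<Longrightarrow> 0 < r \<Longrightarrow> \<exists>i. Q i \<inter> ball x0 r \<noteq> {} \<and> (\<exists>x\<in>frontier (Q i). w x < e)"
  shows "\<exists>i. zero_disk i"
proof -
  obtain \<rho> where \<rho>: "0 < \<rho>" "rect (Re x0 - \<rho>) (Re x0 + \<rho>) (Im x0 - \<rho>) (Im x0 + \<rho>) \<subseteq> \<Omega>" by (rule rect_nhd[OF x0])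
  define X where "X = Re x0"
  define Y where "Y = Im x0"
  let ?R = "rect (X - \<rho>) (X + \<rho>) (Y - \<rho>) (Y + \<rho>)"
  have R: "?R \<subseteq> \<Omega>" using \<rho>(2) by (simp add: X_def Y_def)
  have "Complex (X - \<rho>/2) Y \<in> open_rect (X - \<rho>) X (Y - \<rho>) (Y + \<rho>)" "Complex (X - \<rho>/2) Y \<in> ?R"
    using \<rho>(1) by (simp_all add: mem_open_rect mem_rect)
  then have "open_rect (X - \<rho>) X (Y - \<rho>) (Y + \<rho>) \<inter> \<Omega> \<noteq> {}" using R by blast
  \<comment> \<open>This disk meets the left half of the square, which leaves an open set of
    abscissas to the left of \<open>x0\<close> whose vertical segments hit it.\<close>
  then obtain k where "Q k \<inter> open_rect (X - \<rho>) X (Y - \<rho>) (Y + \<rho>) \<noteq> {}" by (rule S_disk_near[OF open_rect_props(1)])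
  then obtain z where z: "z \<in> Q k" "z \<in> open_rect (X - \<rho>) X (Y - \<rho>) (Y + \<rho>)" by blast
  define L where "L h c = (if h then plane_line True c ` {X - \<rho>..X + \<rho>} else plane_line False c ` {Y - \<rho>..Y + \<rho>})" for h c
  have LR: "L True c \<subseteq> ?R" if "c \<in> {Y - \<rho>..Y + \<rho>}" for c
    using plane_line_in_rect(1)[OF that] by (simp add: L_def)
  have LR': "L False c \<subseteq> ?R" if "c \<in> {X - \<rho>..X + \<rho>}" for c
    using plane_line_in_rect(2)[OF that] by (simp add: L_def)
  define G where "G h c \<longleftrightarrow> (\<exists>B. \<forall>x\<in>vals (L h c). \<forall>y\<in>vals (L h c). x \<le> B * y)" for h c
  have le: "X - \<rho> \<le> X + \<rho>" "Y - \<rho> \<le> Y + \<rho>" using \<rho>(1) by auto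
  have AE: "AE c in lborel. c \<in> {Y - \<rho>..Y + \<rho>} \<longrightarrow> G True c" "AE c in lborel. c \<in> {X - \<rho>..X + \<rho>} \<longrightarrow> G False c"
    using harnack_line[OF le(1), of True "Y - \<rho>" "Y + \<rho>"] harnack_line[OF le(2), of False "X - \<rho>" "X + \<rho>"] R
    unfolding rect_lines[symmetric] G_def L_def by simp_all
  have "Re z \<in> line_hits False (Y - \<rho>) (Y + \<rho>) k \<inter> {X - \<rho><..<X}"
    using z by (auto simp: line_hits_def mem_open_rect plane_line_def intro!: exI[of _ z] image_eqI[of _ _ "Im z"])
  then have "open (line_hits False (Y - \<rho>) (Y + \<rho>) k \<inter> {X - \<rho><..<X})" "line_hits False (Y - \<rho>) (Y + \<rho>) k \<inter> {X - \<rho><..<X} \<noteq> {}"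
    using open_line_hits by auto
  from AE_lborel_open_ex[OF AE(2) this]
  obtain c1 where c1: "c1 \<in> line_hits False (Y - \<rho>) (Y + \<rho>) k" "X - \<rho> < c1" "c1 < X" "G False c1" using \<rho>(1) by auto
  obtain c2 where c2: "X < c2" "c2 < X + \<rho>" "G False c2"
    using AE_lborel_open_ex[OF AE(2), of "{X<..<X + \<rho>}"] \<rho>(1) by auto
  obtain d1 where d1: "Y - \<rho> < d1" "d1 < Y" "G True d1"
    using AE_lborel_open_ex[OF AE(1), of "{Y - \<rho><..<Y}"] \<rho>(1) by auto
  obtain d2 where d2: "Y < d2" "d2 < Y + \<rho>" "G True d2"
    using AE_lborel_open_ex[OF AE(1), of "{Y<..<Y + \<rho>}"] \<rho>(1) by auto
  obtain B1 B2 B3 B4 where B: "\<forall>x\<in>vals (L False c1). \<forall>y\<in>vals (L False c1). x \<le> B1 * y"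
      "\<forall>x\<in>vals (L False c2). \<forall>y\<in>vals (L False c2). x \<le> B2 * y"
      "\<forall>x\<in>vals (L True d1). \<forall>y\<in>vals (L True d1). x \<le> B3 * y"
      "\<forall>x\<in>vals (L True d2). \<forall>y\<in>vals (L True d2). x \<le> B4 * y"
    using c1(4) c2(3) d1(3) d2(3) unfolding G_def by blast
  define B where "B = max 1 (max (max B1 B2) (max B3 B4))"
  have B1: "1 \<le> B" and Ble: "B1 \<le> B" "B2 \<le> B" "B3 \<le> B" "B4 \<le> B" by (auto simp: B_def)
  have har: "x \<le> B * y" if "\<forall>x\<in>vals A. \<forall>y\<in>vals A. x \<le> b * y" "b \<le> B" "x \<in> vals A" "y \<in> vals A" for A b x y
  proof -
    have "x \<le> b * y" using that by blast
    also have "\<dots> \<le> B * y" using that(2) vals_nonneg[OF that(4)] by (rule mult_right_mono)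
    finally show ?thesis .
  qed
  note h1 = har[OF B(1) Ble(1)] and h2 = har[OF B(2) Ble(2)] and h3 = har[OF B(3) Ble(3)] and h4 = har[OF B(4) Ble(4)]
  have common: "\<exists>v. v \<in> vals (L False c) \<and> v \<in> vals (L True d)" if "c \<in> {X - \<rho>..X + \<rho>}" "d \<in> {Y - \<rho>..Y + \<rho>}" for c d
  proof -
    let ?p = "Complex c d"
    have p: "?p \<in> L False c" "?p \<in> L True d" using that by (auto simp: L_def plane_line_def)
    then have "?p \<in> \<Omega>" using LR[OF that(2)] R by blast
    then obtain v where "v \<in> vals {?p}" using hvals_point_nonempty by blast
    then show ?thesis using hvals_mono[of "{?p}" "L False c"] hvals_mono[of "{?p}" "L True d"] p by blast
  qed
  have rng: "c1 \<in> {X - \<rho>..X + \<rho>}" "c2 \<in> {X - \<rho>..X + \<rho>}" "d1 \<in> {Y - \<rho>..Y + \<rho>}" "d2 \<in> {Y - \<rho>..Y + \<rho>}"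
    using c1 c2 d1 d2 \<rho>(1) by auto
  obtain v13 where v13: "v13 \<in> vals (L False c1)" "v13 \<in> vals (L True d1)" using common rng by blast
  obtain v14 where v14: "v14 \<in> vals (L False c1)" "v14 \<in> vals (L True d2)" using common rng by blast
  obtain v23 where v23: "v23 \<in> vals (L False c2)" "v23 \<in> vals (L True d1)" using common rng by blast
  let ?E = "rect c1 c2 d1 d2 - open_rect c1 c2 d1 d2"
  have sub: "rect c1 c2 d1 d2 \<subseteq> ?R" using c1 c2 d1 d2 by (auto simp: mem_rect)
  have E: "?E \<subseteq> L False c1 \<union> L False c2 \<union> (L True d1 \<union> L True d2)"
  proof
    fix p assume p: "p \<in> ?E"
    then have pr: "Re p \<in> {X - \<rho>..X + \<rho>}" "Im p \<in> {Y - \<rho>..Y + \<rho>}" using sub by (auto simp: mem_rect)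
    have "p \<in> L False (Re p)" "p \<in> L True (Im p)"
      using pr by (auto simp: L_def plane_line_def complex_eq_iff image_iff)
    moreover have "Re p = c1 \<or> Re p = c2 \<or> Im p = d1 \<or> Im p = d2" using p by (auto simp: mem_rect mem_open_rect)
    ultimately show "p \<in> L False c1 \<union> L False c2 \<union> (L True d1 \<union> L True d2)" by auto
  qed
  \<comment> \<open>At most three Harnack steps are taken, the worst case being the way from the
    left side over the lower side to the right side; \<open>B \<ge> 1\<close> brings shorter ways to
    the same exponent.\<close>
  have bound: "x \<le> B * (B * (B * y))" if x: "x \<in> vals (L False c1)" and y: "y \<in> vals ?E" for x y
  proof -
    have y0: "0 \<le> y" using y by (rule vals_nonneg)
    have up: "t \<le> B * t" if "0 \<le> t" for t using mult_right_mono[OF B1 that] by simp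
    have mono: "s \<le> t \<Longrightarrow> B * s \<le> B * t" for s t using B1 by simp
    have By: "y \<le> B * y" "0 \<le> B * y" using up[OF y0] y0 by linarith+
    have "y \<in> vals (L False c1 \<union> L False c2 \<union> (L True d1 \<union> L True d2))" using hvals_mono[OF E] y by blast
    then consider "y \<in> vals (L False c1)" | "y \<in> vals (L False c2)" | "y \<in> vals (L True d1)" | "y \<in> vals (L True d2)"
      unfolding hvals_Un by blast
    then show ?thesis
    proof cases
      case 1
      have "x \<le> B * y" by (rule h1[OF x 1])
      also have "\<dots> \<le> B * (B * y)" by (rule mono[OF By(1)])
      also have "\<dots> \<le> B * (B * (B * y))" by (rule mono[OF mono[OF By(1)]])
      finally show ?thesis .
    next
      case 2
      have "x \<le> B * v13" by (rule h1[OF x v13(1)])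
      also have "\<dots> \<le> B * (B * v23)" by (rule mono[OF h3[OF v13(2) v23(2)]])
      also have "\<dots> \<le> B * (B * (B * y))" by (rule mono[OF mono[OF h2[OF v23(1) 2]]])
      finally show ?thesis .
    next
      case 3
      have "x \<le> B * v13" by (rule h1[OF x v13(1)])
      also have "\<dots> \<le> B * (B * y)" by (rule mono[OF h3[OF v13(2) 3]])
      also have "\<dots> \<le> B * (B * (B * y))" by (rule mono[OF mono[OF By(1)]])
      finally show ?thesis .
    next
      case 4
      have "x \<le> B * v14" by (rule h1[OF x v14(1)])
      also have "\<dots> \<le> B * (B * y)" by (rule mono[OF h4[OF v14(2) 4]])
      also have "\<dots> \<le> B * (B * (B * y))" by (rule mono[OF mono[OF By(1)]])
      finally show ?thesis .
    qed
  qed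
  have "x0 \<in> open_rect c1 c2 d1 d2" using c1 c2 d1 d2 by (simp add: mem_open_rect X_def Y_def)
  then obtain r where r: "0 < r" "ball x0 r \<subseteq> open_rect c1 c2 d1 d2" using open_rect_props(1) open_contains_ball by blast
  have R': "rect c1 c2 d1 d2 \<subseteq> \<Omega>" using sub R by (rule order_trans)
  have small: "\<exists>y\<in>vals ?E. y < e" if e: "0 < e" for e
  proof (rule ccontr)
    assume "\<not> ?thesis"
    then have bd: "\<And>y. y \<in> vals ?E \<Longrightarrow> e \<le> y" by (meson not_le)
    obtain i x where i: "Q i \<inter> ball x0 r \<noteq> {}" "x \<in> frontier (Q i)" "w x < e" using near[OF e r(1)] by blast
    have im: "i \<in> meeting Q (open_rect c1 c2 d1 d2)" using i(1) r(2) by (auto simp: meeting_def)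
    have "e \<le> w x" by (rule weak_min_principle[OF R' bd im i(2) e])
    then show False using i(3) by simp
  qed
  have zero: "x = 0" if x: "x \<in> vals (L False c1)" for x
  proof (rule ccontr)
    assume "x \<noteq> 0"
    then have x0: "0 < x" using vals_nonneg[OF x] by simp
    have B3: "0 < B * (B * B)" using B1 by simp
    then have "0 < x / (B * (B * B))" using x0 by simp
    then obtain y where y: "y \<in> vals ?E" "y < x / (B * (B * B))" using small by blast
    have "B * (B * B) * y < x" using y(2) B3 by (simp add: pos_less_divide_eq mult.commute)
    then show False using bound[OF x y(1)] by (simp add: mult.assoc)
  qed
  have "k \<in> meeting Q (L False c1)" using c1(1) by (simp add: mem_line_hits L_def)
  then have "zero_disk k" using zero vals_frontier by (simp add: zero_disk_def)
  then show ?thesis by blast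
qed

end

subsection \<open>Values of normalized functions\<close>

text \<open>\<open>u\<close> is the normalized version of \<open>g\<close>, but the two functions
  may differ on the carpet; the lemmas below recover enough agreement to transfer boundary
  values.\<close>

locale normalized_sobolev = sierpinski_carpet +
  fixes v :: modulus_version and g :: "complex \<Rightarrow> ereal" and u :: "complex \<Rightarrow> real"
  assumes g: "g \<in> sobolev_loc v \<Omega> Q" and u: "(\<lambda>x. ereal (u x)) \<in> sobolev_loc v \<Omega> Q"
    and u_eq: "x \<in> carpet \<Omega> Q \<Longrightarrow> ereal (u x) = normalized_version \<Omega> Q g x"
begin

definition gr :: "complex \<Rightarrow> real" where
  "gr x = real_of_ereal (g x)"

lemmas gr = sobolev_loc_real[OF g, folded gr_def]
lemmas ur = sobolev_loc_real[OF u, unfolded real_of_ereal.simps]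

lemma accessible_value_eq: "y \<in> accessible_points \<Omega> Q g \<Longrightarrow> accessible_value \<Omega> Q g y = ereal (u y)"
  using u_eq[of y] by (simp add: normalized_version_def accessible_points_def)

lemma accessible_eq:
  assumes "y \<in> accessible_points \<Omega> Q g"
  obtains \<gamma>0 \<gamma> where "\<gamma>0 \<in> good_paths \<Omega> Q g" "access_path \<Omega> Q y \<gamma>0 \<gamma>"
    "liminf_along Q (\<lambda>i. disk_max (Q i) g) y \<gamma> = ereal (u y)"
proof -
  let ?P = "\<lambda>\<gamma>. \<exists>\<gamma>0\<in>good_paths \<Omega> Q g. access_path \<Omega> Q y \<gamma>0 \<gamma>"
  have "\<exists>\<gamma>. ?P \<gamma>" using assms by (auto simp: accessible_points_def)
  then have "?P (SOME \<gamma>. ?P \<gamma>)" by (rule someI_ex)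
  then show ?thesis using that accessible_value_eq[OF assms] unfolding accessible_value_def by blast
qed

text \<open>Sierpinski's theorem: an interval is not a union of at least two and at most countably
  many disjoint nonempty closed sets. If every point were in a closed disk, the preimages of these
  disks would be such a partition, with \<open>{t}\<close> as one member.\<close>

lemma line_meets_carpet_interior:
  assumes t: "t < t'" and sub: "plane_line h c ` {t..t'} \<subseteq> \<Omega>" and fr: "plane_line h c t \<in> frontier (Q i)"
    and out: "\<And>s. s \<in> {t<..t'} \<Longrightarrow> plane_line h c s \<notin> closure (Q i)"
  obtains s where "s \<in> {t<..t'}" "plane_line h c s \<in> carpet_interior \<Omega> Q"
proof -
  define A where "A k = {s \<in> {t..t'}. plane_line h c s \<in> closure (Q k)}" for k
  define U where "U = range A - {{}}"
  have "\<exists>s\<in>{t<..t'}. plane_line h c s \<in> carpet_interior \<Omega> Q"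
  proof (rule ccontr)
    assume no: "\<not> ?thesis"
    have "s = t" if "s \<in> A i" for s
    proof (rule ccontr)
      assume "s \<noteq> t"
      then have "s \<in> {t<..t'}" using that by (simp add: A_def)
      then show False using out that by (simp add: A_def)
    qed
    moreover have "t \<in> A i" using frontier_Q_closure[OF fr] t by (simp add: A_def)
    ultimately have Ai: "A i = {t}" by blast
    have cov: "\<exists>k. s \<in> A k" if s: "s \<in> {t..t'}" for s
    proof (cases "s = t")
      case True
      then show ?thesis using Ai by blast
    next
      case False
      then have "plane_line h c s \<notin> carpet_interior \<Omega> Q" using no s by auto
      moreover have "plane_line h c s \<in> \<Omega>" using sub s by blast
      ultimately obtain k where "plane_line h c s \<in> closure (Q k)"
        using in_Q_closure frontier_Q_closure unfolding carpet_interior_def by (metis Diff_iff S_iff UN_E)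
      then show ?thesis using s by (auto simp: A_def)
    qed
    have "U = {{t..t'}}"
    proof (rule real_Sierpinski_lemma)
      show "t \<le> t'" using t by simp
      show "countable U" unfolding U_def by simp
      show "pairwise disjnt U"
      proof (rule pairwiseI)
        fix C D assume CD: "C \<in> U" "D \<in> U" "C \<noteq> D"
        then obtain k l where kl: "C = A k" "D = A l" unfolding U_def by blast
        have False if "s \<in> C" "s \<in> D" for s
        proof -
          have "plane_line h c s \<in> closure (Q k)" "plane_line h c s \<in> closure (Q l)" using that kl by (simp_all add: A_def)
          then have "k = l" by (rule Q_unique)
          then show False using CD(3) kl by simp
        qed
        then show "disjnt C D" unfolding disjnt_def by blast
      qed
      show "closed C \<and> C \<noteq> {}" if C: "C \<in> U" for C
      proof -
        obtain k where k: "C = A k" using C by (auto simp: U_def)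
        have "closed ({t..t'} \<inter> plane_line h c -` closure (Q k))"
          by (intro continuous_closed_preimage continuous_intros) auto
        moreover have "C = {t..t'} \<inter> plane_line h c -` closure (Q k)" unfolding k A_def by blast
        ultimately show ?thesis using C by (simp add: U_def)
      qed
      show "\<Union> U = {t..t'}"
      proof
        show "\<Union> U \<subseteq> {t..t'}" by (auto simp: U_def A_def)
        show "{t..t'} \<subseteq> \<Union> U"
        proof
          fix s assume "s \<in> {t..t'}"
          then obtain k where "s \<in> A k" using cov by blast
          then have "A k \<in> U" by (auto simp: U_def)
          then show "s \<in> \<Union> U" using \<open>s \<in> A k\<close> by blast
        qed
      qed
    qed
    moreover have "{t} \<in> U" using Ai by (auto simp: U_def)
    ultimately have "{t} = {t..t'}" by simp
    then have "t' \<in> {t}" using t by simp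
    then show False using t by simp
  qed
  then show ?thesis using that by blast
qed

text \<open>On a generic horizontal line both functions are controlled by their oscillation sums,
  and they coincide at the points of \<open>carpet_interior\<close> on it by
  \<open>accessible_value_on_line\<close>. Such points accumulate at the place where the line leaves
  \<open>Q i\<close> for the last time, so the functions agree there too.\<close>

lemma frontier_agree: "\<exists>p\<in>frontier (Q i). u p = gr p"
proof -
  obtain z0 where "z0 \<in> Q i" using Q_props(4) by blast
  then obtain \<delta> where \<delta>: "0 < \<delta>" "ball z0 \<delta> \<subseteq> Q i" using Q_props(1) open_contains_ball by blast
  define G where "G c \<longleftrightarrow>
     (\<forall>a b. a \<le> b \<longrightarrow> plane_line True c ` {a..b} \<subseteq> \<Omega> \<longrightarrow> curve_bound gr (osc gr) a b (plane_line True c)) \<and>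
     (\<forall>a b. a \<le> b \<longrightarrow> plane_line True c ` {a..b} \<subseteq> \<Omega> \<longrightarrow> curve_bound u (osc u) a b (plane_line True c)) \<and>
     (\<forall>a b. a \<le> b \<longrightarrow> plane_line True c ` {a..b} \<subseteq> \<Omega> \<longrightarrow> disk_sum (osc gr) (meeting Q (plane_line True c ` {a..b})) < \<infinity>) \<and>
     (\<forall>a b. a \<le> b \<longrightarrow> plane_line True c ` {a..b} \<subseteq> \<Omega> \<longrightarrow> disk_sum (osc u) (meeting Q (plane_line True c ` {a..b})) < \<infinity>) \<and>
     (\<forall>a b. a < b \<longrightarrow> plane_line True c ` {a..b} \<subseteq> \<Omega> \<longrightarrow> ({a..b}, plane_line True c) \<in> good_paths \<Omega> Q g)" for c
  have "AE c in lborel. G c"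
    unfolding G_def
    by (intro AE_conjI ae_curve_line[OF gr(6)] ae_curve_line[OF ur(6)] AE_line_good_path[OF g]
      ae_curve_line[OF ae_curve_finite_sum[OF gr(5), of v]] ae_curve_line[OF ae_curve_finite_sum[OF ur(5), of v]])
  moreover have "{Im z0<..<Im z0 + \<delta>} \<noteq> {}" using \<delta>(1) by simp
  ultimately obtain c where c: "c \<in> {Im z0<..<Im z0 + \<delta>}" "G c"
    using AE_lborel_open_ex[of G "{Im z0<..<Im z0 + \<delta>}"] open_greaterThanLessThan by blast
  have cb: "a \<le> b \<Longrightarrow> plane_line True c ` {a..b} \<subseteq> \<Omega> \<Longrightarrow> curve_bound gr (osc gr) a b (plane_line True c)"
    "a \<le> b \<Longrightarrow> plane_line True c ` {a..b} \<subseteq> \<Omega> \<Longrightarrow> curve_bound u (osc u) a b (plane_line True c)"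
    and fin: "a \<le> b \<Longrightarrow> plane_line True c ` {a..b} \<subseteq> \<Omega> \<Longrightarrow> disk_sum (osc gr) (meeting Q (plane_line True c ` {a..b})) < \<infinity>"
    "a \<le> b \<Longrightarrow> plane_line True c ` {a..b} \<subseteq> \<Omega> \<Longrightarrow> disk_sum (osc u) (meeting Q (plane_line True c ` {a..b})) < \<infinity>"
    and good: "a < b \<Longrightarrow> plane_line True c ` {a..b} \<subseteq> \<Omega> \<Longrightarrow> ({a..b}, plane_line True c) \<in> good_paths \<Omega> Q g" for a b
    using c(2) unfolding G_def by blast+
  let ?l = "plane_line True c"
  define T where "T = ?l -` closure (Q i)"
  have "closed T" unfolding T_def by (intro closed_vimage continuous_intros) simp
  moreover have "bounded T"
  proof -
    have "bounded (Re ` closure (Q i))"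
      using compact_closure_Q by (intro compact_imp_bounded compact_continuous_image) (auto intro: continuous_intros)
    moreover have "T \<subseteq> Re ` closure (Q i)"
    proof
      fix t assume "t \<in> T"
      then have "?l t \<in> closure (Q i)" by (simp add: T_def)
      then show "t \<in> Re ` closure (Q i)" by (intro image_eqI[of _ _ "?l t"]) (simp_all add: plane_line_def)
    qed
    ultimately show ?thesis by (rule bounded_subset)
  qed
  ultimately have "compact T" by (simp add: compact_eq_bounded_closed)
  moreover have "T \<noteq> {}"
  proof -
    have "dist z0 (?l (Re z0)) = \<bar>Im z0 - c\<bar>" by (simp add: plane_line_def dist_norm cmod_eq_Im)
    then have "?l (Re z0) \<in> ball z0 \<delta>" using c by simp
    then have "?l (Re z0) \<in> closure (Q i)" using \<delta>(2) in_Q_closure by blast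
    then show ?thesis by (auto simp: T_def)
  qed
  \<comment> \<open>The last time on the closed disk: to its right the line never returns to
    \<open>Q i\<close>, so the large oscillation of \<open>Q i\<close> does not enter the
    sums.\<close>
  ultimately obtain t2 where t2: "t2 \<in> T" "\<And>t. t \<in> T \<Longrightarrow> t \<le> t2" using compact_attains_sup[of T] by blast
  let ?p = "?l t2"
  have pcl: "?p \<in> closure (Q i)" using t2(1) by (simp add: T_def)
  have pfr: "?p \<in> frontier (Q i)"
  proof (rule ccontr)
    assume "?p \<notin> frontier (Q i)"
    then have "?p \<in> Q i" using pcl closure_Q(1) by blast
    then obtain d where d: "0 < d" "ball ?p d \<subseteq> Q i" using Q_props(1) open_contains_ball by blast
    have "?l (t2 + d/2) \<in> ball ?p d" using d(1) by simp
    then have "?l (t2 + d/2) \<in> closure (Q i)" using d(2) in_Q_closure by blast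
    then have "t2 + d/2 \<in> T" by (simp add: T_def)
    then show False using t2(2)[of "t2 + d/2"] d(1) by simp
  qed
  have p\<Omega>: "?p \<in> \<Omega>" using pcl Q_props(5) by blast
  then obtain \<eta> where \<eta>: "0 < \<eta>" "cball ?p \<eta> \<subseteq> \<Omega>" using open_Omega open_contains_cball by blast
  have seg: "?l ` {t2 - \<eta>..t2 + \<eta>} \<subseteq> \<Omega>" using \<eta> by (auto simp: abs_le_iff intro!: subsetD[OF \<eta>(2)])
  have seg': "?l ` {t2..t2 + \<eta>} \<subseteq> \<Omega>" using seg \<eta>(1) by (auto simp: image_subset_iff)
  have agree: "u (?l s) = gr (?l s)" if s: "s \<in> {t2<..<t2 + \<eta>}" "?l s \<in> carpet_interior \<Omega> Q" for s
  proof -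
    let ?y = "?l s"
    let ?\<gamma> = "({t2 - \<eta>..t2 + \<eta>}, ?l)"
    have gd: "?\<gamma> \<in> good_paths \<Omega> Q g" using good seg \<eta>(1) by simp
    have "?y \<in> path_trace ?\<gamma>" using s(1) \<eta>(1) by (auto simp: path_trace_def)
    then have "access_path \<Omega> Q ?y ?\<gamma> ?\<gamma>" using s(2) by (simp add: access_path_def)
    then have "?y \<in> accessible_points \<Omega> Q g" using gd s(2) by (auto simp: accessible_points_def carpet_interior_def)
    then obtain \<gamma>0 \<gamma> where *: "\<gamma>0 \<in> good_paths \<Omega> Q g" "access_path \<Omega> Q ?y \<gamma>0 \<gamma>"
      "liminf_along Q (\<lambda>i. disk_max (Q i) g) ?y \<gamma> = ereal (u ?y)" by (rule accessible_eq)
    have yc: "Im ?y = c" "Re ?y = s" by (simp_all add: plane_line_def)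
    show ?thesis
      by (rule accessible_value_on_line[OF s(2) g *, of "t2 - \<eta>" "t2 + \<eta>", folded gr_def, unfolded yc])
        (use s(1) \<eta>(1) seg cb(1) fin(1) in auto)
  qed
  have small: "\<bar>u ?p - gr ?p\<bar> < 2 * e" if e: "0 < e" for e
  proof -
    let ?J = "meeting Q (?l ` {t2..t2 + \<eta>})"
    have le: "t2 \<le> t2 + \<eta>" using \<eta>(1) by simp
    obtain n1 where n1: "disk_sum (osc gr) (?J - {..<n1}) < ennreal e"
      using disk_sum_tail[OF fin(1)[OF le seg'] e] by blast
    obtain n2 where n2: "disk_sum (osc u) (?J - {..<n2}) < ennreal e"
      using disk_sum_tail[OF fin(2)[OF le seg'] e] by blast
    define n where "n = max n1 n2"
    have off: "?p \<notin> closure (Q k)" if "k \<noteq> i" for k using pcl Q_unique that by blast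
    obtain r where r: "0 < r" "\<And>k. k < n \<Longrightarrow> k \<noteq> i \<Longrightarrow> Q k \<inter> cball ?p r = {}"
      by (rule interior_point_avoids[OF p\<Omega> off, of n i], assumption, rule that; assumption)
    define d where "d = min r (\<eta>/2)"
    have d: "0 < d" "d \<le> r" "d < \<eta>" using r(1) \<eta>(1) by (auto simp: d_def)
    \<comment> \<open>Between \<open>t2\<close> and \<open>s\<close> the line meets only disks of
      index at least \<open>n\<close>, whose oscillations have small sum for \<open>gr\<close> and
      for \<open>u\<close>.\<close>
    obtain s where s: "s \<in> {t2<..t2 + d}" "?l s \<in> carpet_interior \<Omega> Q"
    proof (rule line_meets_carpet_interior[of t2 "t2 + d" True c i])
      show "?l ` {t2..t2 + d} \<subseteq> \<Omega>" using seg' d(3) by (auto simp: image_subset_iff)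
      show "?l s \<notin> closure (Q i)" if "s \<in> {t2<..t2 + d}" for s using t2(2)[of s] that by (auto simp: T_def)
    qed (use d pfr in auto)
    have sub: "meeting Q (?l ` {t2..s}) \<subseteq> ?J - {..<n}"
    proof
      fix k assume k: "k \<in> meeting Q (?l ` {t2..s})"
      then obtain t where t: "t \<in> {t2..s}" "?l t \<in> Q k" unfolding meeting_def by blast
      have "k \<noteq> i"
      proof
        assume "k = i"
        then have "t \<in> T" using t(2) in_Q_closure by (simp add: T_def)
        then have "t = t2" using t2(2)[of t] t(1) by simp
        then show False using t(2) \<open>k = i\<close> pfr closure_Q(2) by blast
      qed
      moreover have "?l t \<in> cball ?p r" using t(1) s(1) d(2) by (simp add: abs_le_iff)
      ultimately have "\<not> k < n" using r(2) t(2) by blast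
      moreover have "k \<in> ?J" using k s(1) d(3) meeting_mono[of "?l ` {t2..s}" "?l ` {t2..t2 + \<eta>}" Q] by fastforce
      ultimately show "k \<in> ?J - {..<n}" by simp
    qed
    have S: "?p \<in> S" "?l s \<in> S" using pfr frontier_Q_subset s(2) by (auto simp: carpet_interior_def)
    have st: "t2 \<le> s" "s \<le> t2 + \<eta>" using s(1) d(3) by auto
    have "ennreal \<bar>gr ?p - gr (?l s)\<bar> \<le> disk_sum (osc gr) (meeting Q (?l ` {t2..s}))"
      using curve_boundD[OF cb(1)[OF le seg'] order_refl st S] .
    also have "\<dots> \<le> disk_sum (osc gr) (?J - {..<n1})" using sub by (intro disk_sum_subset) (auto simp: n_def)
    also note n1
    finally have 1: "\<bar>gr ?p - gr (?l s)\<bar> < e" by (simp add: ennreal_less_iff)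
    have "ennreal \<bar>u ?p - u (?l s)\<bar> \<le> disk_sum (osc u) (meeting Q (?l ` {t2..s}))"
      using curve_boundD[OF cb(2)[OF le seg'] order_refl st S] .
    also have "\<dots> \<le> disk_sum (osc u) (?J - {..<n2})" using sub by (intro disk_sum_subset) (auto simp: n_def)
    also note n2
    finally have 2: "\<bar>u ?p - u (?l s)\<bar> < e" by (simp add: ennreal_less_iff)
    have "u (?l s) = gr (?l s)" using agree[of s] s d(3) by auto
    then show ?thesis using 1 2 by linarith
  qed
  have "u ?p = gr ?p"
  proof (rule ccontr)
    assume "u ?p \<noteq> gr ?p"
    then have "\<bar>u ?p - gr ?p\<bar> < 2 * (\<bar>u ?p - gr ?p\<bar> / 2)" by (intro small) simp
    then show False by simp
  qed
  then show ?thesis using pfr by blast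
qed

text \<open>The access path meets disks near \<open>y\<close> whose suprema for \<open>gr\<close>
  are close to \<open>u y\<close> and whose oscillations are small. A boundary point at which
  \<open>u\<close> and \<open>gr\<close> agree then transfers the estimate to
  \<open>u\<close>.\<close>

lemma accessible_approx:
  assumes y: "y \<in> carpet_interior \<Omega> Q" "y \<in> accessible_points \<Omega> Q g" and e: "0 < e" "0 < r"
  shows "\<exists>i. Q i \<inter> ball y r \<noteq> {} \<and> (\<exists>p\<in>frontier (Q i). \<bar>u p - u y\<bar> < e)"
proof -
  obtain \<gamma>0 \<gamma> where *: "\<gamma>0 \<in> good_paths \<Omega> Q g" "access_path \<Omega> Q y \<gamma>0 \<gamma>"
    "liminf_along Q (\<lambda>i. disk_max (Q i) g) y \<gamma> = ereal (u y)" using y(2) by (rule accessible_eq)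
  obtain \<phi> :: "real \<Rightarrow> complex" and C :: "real set" where Cfin: "disk_sum (osc gr) (meeting Q (\<phi> ` C)) < \<infinity>"
    and near: "\<And>e. 0 < e \<Longrightarrow> \<exists>s\<in>C. \<exists>i. \<phi> s \<in> Q i \<and> Q i \<subseteq> ball y e \<and> \<bar>disk_sup gr i - u y\<bar> < e"
    by (rule access_segment[OF y(1) g *, folded gr_def]) blast
  have "0 < e/2" using e(1) by simp
  then obtain r1 where r1: "0 < r1" "disk_sum (osc gr) (meeting Q (\<phi> ` C) \<inter> meeting Q (cball y r1)) \<le> ennreal (e/2)"
    using small_sum_near[OF y(1) Cfin] by blast
  define d where "d = min (min r r1) (e/2)"
  have "0 < d" using e r1(1) by (simp add: d_def)
  then obtain s i where s: "s \<in> C" "\<phi> s \<in> Q i" "Q i \<subseteq> ball y d" "\<bar>disk_sup gr i - u y\<bar> < d" using near by blast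
  have sb: "\<phi> s \<in> ball y d" using s(2,3) by blast
  then have "i \<in> meeting Q (\<phi> ` C) \<inter> meeting Q (cball y r1)" using s(1,2) by (auto simp: meeting_def d_def)
  then have "ennreal (osc gr i) \<le> ennreal (e/2)" using r1(2) by (rule order_trans[OF disk_sum_upper])
  then have "osc gr i \<le> e/2" using e(1) by simp
  obtain p where p: "p \<in> frontier (Q i)" "u p = gr p" using frontier_agree by blast
  have "\<bar>disk_sup gr i - gr p\<bar> \<le> osc gr i" by (rule disk_sup_near[OF gr(2) p(1)])
  moreover have "d \<le> e/2" by (simp add: d_def)
  ultimately have "\<bar>u p - u y\<bar> < e" using \<open>osc gr i \<le> e/2\<close> s(4) p(2) by linarith
  moreover have "\<phi> s \<in> Q i \<inter> ball y r" using s(2) sb by (simp add: d_def)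
  ultimately show ?thesis using p(1) by blast
qed

text \<open>A non-accessible point takes its value as a lower limit over accessible points, so some
  accessible \<open>y\<close> is close in place and value. Either \<open>y\<close> is in
  \<open>carpet_interior\<close> and has been treated, or it lies on the boundary of a disk and is
  itself the required boundary point.\<close>

lemma interior_approx:
  assumes x: "x \<in> carpet_interior \<Omega> Q" and e: "0 < e" "0 < r"
  shows "\<exists>i. Q i \<inter> ball x r \<noteq> {} \<and> (\<exists>p\<in>frontier (Q i). \<bar>u p - u x\<bar> < e)"
proof (cases "x \<in> accessible_points \<Omega> Q g")
  case False
  let ?A = "accessible_points \<Omega> Q g"
  have lim: "Liminf (at x within ?A) (accessible_value \<Omega> Q g) = ereal (u x)"
    using u_eq[of x] x False by (simp add: normalized_version_def carpet_interior_def)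
  \<comment> \<open>Near \<open>x\<close> the values exceed \<open>u x - e/2\<close>; if none were
    within \<open>e/2\<close> of \<open>u x\<close>, all would be at least \<open>u x + e/2\<close>
    and so would the lower limit. This also excludes that \<open>x\<close> is isolated from the
    accessible points, where the lower limit would be \<infinity>.\<close>
  have "\<exists>y\<in>?A. y \<in> ball x (r/2) \<and> \<bar>u y - u x\<bar> < e/2"
  proof (rule ccontr)
    assume no: "\<not> ?thesis"
    have "ereal (u x - e/2) < Liminf (at x within ?A) (accessible_value \<Omega> Q g)" using e lim by simp
    then have "\<forall>\<^sub>F y in at x within ?A. ereal (u x - e/2) < accessible_value \<Omega> Q g y" by (rule less_LiminfD)
    moreover have "\<forall>\<^sub>F y in at x within ?A. y \<in> ?A \<and> y \<in> ball x (r/2)"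
      using e(2) by (auto simp: eventually_at dist_commute intro!: exI[of _ "r/2"])
    ultimately have "\<forall>\<^sub>F y in at x within ?A. ereal (u x + e/2) \<le> accessible_value \<Omega> Q g y"
    proof eventually_elim
      case (elim y)
      then have av: "accessible_value \<Omega> Q g y = ereal (u y)" using accessible_value_eq by blast
      have "u x - e/2 < u y" using elim(1) unfolding av by simp
      moreover have "e/2 \<le> \<bar>u y - u x\<bar>" using no elim(2) by force
      ultimately have "u x + e/2 \<le> u y" by linarith
      then show ?case unfolding av by simp
    qed
    then have "ereal (u x + e/2) \<le> Liminf (at x within ?A) (accessible_value \<Omega> Q g)" by (rule Liminf_bounded)
    then show False using lim e(1) by simp
  qed
  then obtain y where y: "y \<in> ?A" "y \<in> ball x (r/2)" "\<bar>u y - u x\<bar> < e/2" by blast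
  have yS: "y \<in> S" using y(1) by (simp add: accessible_points_def)
  have sub: "ball y (r/2) \<subseteq> ball x r"
  proof
    fix z assume "z \<in> ball y (r/2)"
    then show "z \<in> ball x r" using y(2) dist_triangle[of x z y] by simp
  qed
  show ?thesis
  proof (cases "y \<in> carpet_interior \<Omega> Q")
    case True
    have "0 < e/2" "0 < r/2" using e by auto
    then obtain i p where i: "Q i \<inter> ball y (r/2) \<noteq> {}" "p \<in> frontier (Q i)" "\<bar>u p - u y\<bar> < e/2"
      using accessible_approx[OF True y(1)] by blast
    have "\<bar>u p - u x\<bar> < e" using i(3) y(3) by linarith
    then show ?thesis using i(1,2) sub by blast
  next
    case False
    then obtain i where i: "y \<in> frontier (Q i)" using yS by (auto simp: carpet_interior_def)
    have "y \<in> closure (Q i) \<inter> ball x r" using frontier_Q_closure[OF i] y(2) e(2) by simp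
    then have "Q i \<inter> ball x r \<noteq> {}" using open_Int_closure_eq_empty[of "ball x r" "Q i"] by blast
    moreover have "\<bar>u y - u x\<bar> < e" using y(3) e(1) by linarith
    ultimately show ?thesis using i by blast
  qed
qed (use accessible_approx x e in blast)

end

theorem theorem2p83:
  fixes \<Omega> :: "complex set"
    and Q :: "nat \<Rightarrow> complex set"
    and v :: modulus_version
    and u :: "complex \<Rightarrow> real"
    and x0 :: complex
  assumes "relative_sierpinski_carpet \<Omega> Q"
    and "carpet_harmonic v \<Omega> Q (\<lambda>x. ereal (u x))"
    and "normalized v \<Omega> Q (\<lambda>x. ereal (u x))"
    and "x0 \<in> carpet \<Omega> Q"
    and "(\<forall>x\<in>carpet \<Omega> Q. u x \<le> u x0) \<or> (\<forall>x\<in>carpet \<Omega> Q. u x0 \<le> u x)"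
  shows "u constant_on carpet \<Omega> Q"
proof -
  interpret C: sierpinski_carpet \<Omega> Q using assms(1) by (rule sierpinski_carpet.intro)
  obtain g where g: "g \<in> sobolev_loc v \<Omega> Q" "\<And>x. x \<in> carpet \<Omega> Q \<Longrightarrow> ereal (u x) = normalized_version \<Omega> Q g x"
    using assms(3) by (auto simp: normalized_def)
  have u: "(\<lambda>x. ereal (u x)) \<in> sobolev_loc v \<Omega> Q" using assms(2) by (simp add: carpet_harmonic_def)
  interpret N: normalized_sobolev \<Omega> Q v g u
    by (intro normalized_sobolev.intro C.sierpinski_carpet_axioms normalized_sobolev_axioms.intro g u)
  \<comment> \<open>The sign \<sigma> is -1 for a maximum and 1 for a minimum.\<close>
  obtain \<sigma> :: real where \<sigma>: "\<sigma> * \<sigma> = 1" "\<bar>\<sigma>\<bar> = 1" "\<And>x. x \<in> carpet \<Omega> Q \<Longrightarrow> 0 \<le> \<sigma> * (u x - u x0)"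
    using assms(5)
  proof
    assume "\<forall>x\<in>carpet \<Omega> Q. u x \<le> u x0"
    then show ?thesis using that[of "-1"] by simp
  next
    assume "\<forall>x\<in>carpet \<Omega> Q. u x0 \<le> u x"
    then show ?thesis using that[of 1] by simp
  qed
  define w where "w x = \<sigma> * (u x - u x0)" for x
  have w_diff: "\<bar>w x - w y\<bar> = \<bar>u x - u y\<bar>" for x y
    unfolding w_def using \<sigma>(2) by (simp add: right_diff_distrib[symmetric] abs_mult)
  have osc_w: "C.osc w = C.osc u" by (rule ext) (simp add: C.osc_def w_diff)
  interpret W: nonneg_harmonic \<Omega> Q v w
  proof (intro nonneg_harmonic.intro C.sierpinski_carpet_axioms nonneg_harmonic_axioms.intro)
    show "0 \<le> w x" if "x \<in> carpet \<Omega> Q" for x using \<sigma>(3)[OF that] by (simp add: w_def)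
    have "bounded (w ` frontier (Q i))" for i
    proof -
      have "bounded (u ` frontier (Q i))" using N.ur(2) by (simp add: C.disk_bounded_def)
      then obtain B where "\<forall>x\<in>frontier (Q i). norm (u x) \<le> B" by (auto simp: bounded_iff)
      then have "norm (w x) \<le> B + \<bar>u x0\<bar>" if "x \<in> frontier (Q i)" for x
        using that \<sigma>(2) abs_triangle_ineq4[of "u x" "u x0"] by (fastforce simp: w_def abs_mult)
      then show ?thesis by (auto simp: bounded_iff)
    qed
    then show "C.disk_bounded w" by (simp add: C.disk_bounded_def)
    show "C.loc_sq (C.osc w)" unfolding osc_w by (rule N.ur(5))
    have "C.curve_bound w = C.curve_bound u" by (intro ext) (simp add: C.curve_bound_def w_diff)
    then show "C.ae_curve v (C.curve_bound w (C.osc w))" using N.ur(6) unfolding osc_w by simp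
    fix V \<zeta>
    assume V: "open V" "compactly_contained V \<Omega>" and \<zeta>: "C.test_function v V \<zeta>"
    have d: "\<bar>\<sigma> * \<zeta> x - \<sigma> * \<zeta> y\<bar> = \<bar>\<zeta> x - \<zeta> y\<bar>" for x y
      using \<sigma>(2) by (simp add: right_diff_distrib[symmetric] abs_mult)
    have "C.curve_bound (\<lambda>x. \<sigma> * \<zeta> x) = C.curve_bound \<zeta>" by (intro ext) (simp add: C.curve_bound_def d)
    then have "C.test_function v V (\<lambda>x. \<sigma> * \<zeta> x)" using \<zeta> \<sigma>(2) by (simp add: C.test_function_def d abs_mult)
    then have "disk_sum (\<lambda>i. (C.osc u i)\<^sup>2) (meeting Q V)
        \<le> disk_sum (\<lambda>i. (C.osc (\<lambda>x. u x + \<sigma> * \<zeta> x) i)\<^sup>2) (meeting Q V)"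
      by (rule C.harmonic_real[OF assms(2) V])
    \<comment> \<open>Since \<sigma> squares to 1, \<open>w + \<zeta>\<close> is \<sigma> times
      \<open>u + \<sigma> * \<zeta>\<close> up to an additive constant, and neither changes
      oscillations. So \<sigma> times \<zeta> is the competitor for \<open>u\<close>.\<close>
    moreover have "C.osc (\<lambda>x. u x + \<sigma> * \<zeta> x) = C.osc (\<lambda>x. w x + \<zeta> x)"
    proof -
      have "\<bar>(w x + \<zeta> x) - (w y + \<zeta> y)\<bar> = \<bar>(u x + \<sigma> * \<zeta> x) - (u y + \<sigma> * \<zeta> y)\<bar>" for x y
      proof -
        have "(w x + \<zeta> x) - (w y + \<zeta> y) = \<sigma> * (u x - u y) + (\<sigma> * \<sigma>) * (\<zeta> x - \<zeta> y)"
          unfolding \<sigma>(1) by (simp add: w_def algebra_simps)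
        also have "\<dots> = \<sigma> * ((u x + \<sigma> * \<zeta> x) - (u y + \<sigma> * \<zeta> y))" by (simp add: algebra_simps)
        finally show ?thesis using \<sigma>(2) by (simp add: abs_mult)
      qed
      then show ?thesis by (intro ext) (simp add: C.osc_def)
    qed
    ultimately show "disk_sum (\<lambda>i. (C.osc w i)\<^sup>2) (meeting Q V) \<le> disk_sum (\<lambda>i. (C.osc (\<lambda>x. w x + \<zeta> x) i)\<^sup>2) (meeting Q V)"
      unfolding osc_w by simp
  qed
  have w0: "w x = 0 \<longleftrightarrow> u x = u x0" for x using \<sigma>(1) by (auto simp: w_def)
  have w_abs: "w x \<le> \<bar>u x - u x0\<bar>" for x
    using \<sigma>(2) abs_ge_self[of "w x"] by (simp add: w_def abs_mult)
  have zero: "W.zero_disk j" for j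
  proof -
    have "\<exists>i. \<exists>x\<in>frontier (Q i). w x = 0"
    proof (cases "x0 \<in> carpet_interior \<Omega> Q")
      case True
      have "\<exists>i. W.zero_disk i"
      proof (rule W.near_zero_disk)
        show "x0 \<in> \<Omega>" using assms(4) by (simp add: C.S_iff)
        fix e r :: real assume "0 < e" "0 < r"
        then obtain i p where "Q i \<inter> ball x0 r \<noteq> {}" "p \<in> frontier (Q i)" "\<bar>u p - u x0\<bar> < e"
          using N.interior_approx[OF True] by blast
        moreover have "w p < e" using w_abs[of p] calculation(3) by linarith
        ultimately show "\<exists>i. Q i \<inter> ball x0 r \<noteq> {} \<and> (\<exists>x\<in>frontier (Q i). w x < e)" by blast
      qed
      then show ?thesis using C.frontier_Q_nonempty by (fastforce simp: W.zero_disk_def)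
    next
      case False
      then obtain i where "x0 \<in> frontier (Q i)" using assms(4) by (auto simp: carpet_interior_def)
      then show ?thesis using w0 by blast
    qed
    then show ?thesis using W.zero_disk_spread by blast
  qed
  \<comment> \<open>On boundaries of disks this is the vanishing of \<open>w\<close>. At other
    points \<open>u x\<close> is a limit of boundary values, which all equal
    \<open>u x0\<close>.\<close>
  have "u x = u x0" if x: "x \<in> carpet \<Omega> Q" for x
  proof (cases "x \<in> carpet_interior \<Omega> Q")
    case True
    show ?thesis
    proof (rule ccontr)
      assume "u x \<noteq> u x0"
      then obtain i p where "p \<in> frontier (Q i)" "\<bar>u p - u x\<bar> < \<bar>u x - u x0\<bar>"
        using N.interior_approx[OF True, of "\<bar>u x - u x0\<bar>" 1] by auto
      moreover have "u p = u x0" using zero[of i] calculation(1) w0 by (simp add: W.zero_disk_def)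
      ultimately show False by simp
    qed
  next
    case False
    then obtain i where "x \<in> frontier (Q i)" using x by (auto simp: carpet_interior_def)
    then show ?thesis using zero[of i] w0 by (simp add: W.zero_disk_def)
  qed
  then show ?thesis by (auto simp: constant_on_def)
qed

end
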